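(* Let $G$ be a countably infinite (discrete) amenable group, let $\pi:(X,G)\to(Y,G)$ be a factor map between two $G$-systems, and let $\widetilde{\pi}:(\mathcal{M}(X),G)\to(\mathcal{M}(Y),G)$ be the induced factor map. Then: (i) $\pi$ has zero relative topological entropy if and only if $\widetilde{\pi}$ has zero relative topological entropy, i.e. $\mathrm{h}_{\mathrm{top}}(\pi,G)=0\iff \mathrm{h}_{\mathrm{top}}(\widetilde{\pi},G)=0$. (ii) $\pi$ has positive relative topological entropy if and only if $\widetilde{\pi}$ has infinite relative mean dimension, i.e. $\mathrm{h}_{\mathrm{top}}(\pi,G)>0\iff \mathrm{mdim}(\widetilde{\pi},G)=+\infty$.
   Context: $\mathcal{F}(G)$ denotes the collection of nonempty finite subsets of $G$. A countable group $G$ is amenable if it has a F{\o}lner sequence, i.e. a sequence $\{G_n\}_{n\ge1}\subset\mathcal{F}(G)$ with $\lim_{n\to\infty}\frac{|(G_n\setminus gG_n)\cup(gG_n\setminus G_n)|}{|G_n|}=0$ for every $g\in G$. A $G$-system $(X,G)$ is a compact metrizable space $X$ together with a continuous action $G\times X\to X$, $(g,x)\mapsto gx$, of the discrete group $G$ by homeomorphisms. A factor map $\pi:(X,G)\to(Y,G)$ between $G$-systems is a continuous surjective map $\pi:X\to Y$ with $\pi(gx)=g\pi(x)$ for all $x\in X$, $g\in G$. $\mathcal{M}(X)$ is the space of Borel probability measures on $X$ with the weak$^*$-topology; it is a compact metrizable space. A $G$-system $(X,G)$ induces the $G$-system $(\mathcal{M}(X),G)$ given by $g\mu=\mu\circ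 g^{-1}$. A factor map $\pi:(X,G)\to(Y,G)$ induces the factor map $\widetilde{\pi}:(\mathcal{M}(X),G)\to(\mathcal{M}(Y),G)$, $\widetilde{\pi}(\mu)=\mu\circ\pi^{-1}$, called the induced factor map. For a compatible metric $d$ on $X$ and $H\in\mathcal{F}(G)$, put $d_H(x,x')=\max_{s\in H}d(sx,sx')$, which is again a compatible metric on $X$. Relative topological entropy: for a closed set $A\subset X$, $\varepsilon>0$ and $H\in\mathcal{F}(G)$, let $\sharp(A,\varepsilon,d_H)$ be the largest cardinality of a subset $S\subset A$ such that $d_H(x,y)>\varepsilon$ for all distinct $x,y\in S$. For a factor map $\pi:(X,G)\to(Y,G)$ and a F{\o}lner sequence $\{G_n\}$ of $G$, $$\mathrm{h}_{\mathrm{top}}(\pi,G)=\lim_{\varepsilon\to0}\limsup_{n\to\infty}\frac{\log\left(\sup_{y\in Y}\sharp(\pi^{-1}(y),\varepsilon,d_{G_n})\right)}{|G_n|}.$$ This is independent of the choice of the F{\o}lner sequence and of the compatible metric $d$. Relative mean dimension: for a compact metrizable space $Z$ with compatible metric $\rho$ and $\varepsilon>0$, a continuous map $f:Z\to P$ to a compact metrizable space $P$ is an $\varepsilon$-embedding with respect to $\rho$ if $f(z_1)=f(z_2)$ implies $\rho(z_1,z_2)<\varepsilon$. $\mathrm{Widim}_\varepsilon(Z,\rho)$ is the smallest integer $n$ such that there is an $n$-dimensional (finite) simplicial complex $P$ admitting an $\varepsilon$-embedding $f:Z\to P$ with respect to $\rho$. For a factor map $\pi:(X,G)\to(Y,G)$,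 a compatible metric $d$ on $X$ and a F{\o}lner sequence $\{G_n\}$ of $G$, $$\mathrm{mdim}(\pi,G)=\lim_{\varepsilon\to0}\lim_{n\to\infty}\frac{\sup_{y\in Y}\mathrm{Widim}_\varepsilon(\pi^{-1}(y),d_{G_n})}{|G_n|}\in[0,+\infty].$$ The limits exist, and the value is independent of the F{\o}lner sequence and of the compatible metric $d$. The quantities $\mathrm{h}_{\mathrm{top}}(\widetilde{\pi},G)$ and $\mathrm{mdim}(\widetilde{\pi},G)$ are obtained by applying these definitions to the factor map $\widetilde{\pi}:(\mathcal{M}(X),G)\to(\mathcal{M}(Y),G)$. *)

theory Defs
  imports
    "HOL-Probability.Probability"
    "HOL-Algebra.Coset"
    "HOL-Algebra.Group_Action"
begin

section \<open>Amenable groups\<close>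

definition finite_subsets :: "('g, 'm) monoid_scheme \<Rightarrow> 'g set set" where
  "finite_subsets G = {H. H \<subseteq> carrier G \<and> finite H \<and> H \<noteq> {}}"

definition folner_sequence :: "('g, 'm) monoid_scheme \<Rightarrow> (nat \<Rightarrow> 'g set) \<Rightarrow> bool" where
  "folner_sequence G F \<longleftrightarrow>
     (\<forall>n. F n \<in> finite_subsets G) \<and>
     (\<forall>g\<in>carrier G.
        (\<lambda>n. real (card ((F n - (g <#\<^bsub>G\<^esub> F n)) \<union> ((g <#\<^bsub>G\<^esub> F n) - F n))) / real (card (F n)))
          \<longlonglongrightarrow> 0)"

definition amenable :: "('g, 'm) monoid_scheme \<Rightarrow> bool" where
  "amenable G \<longleftrightarrow> (\<exists>F. folner_sequence G F)"


section \<open>Systems and factor maps\<close>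

locale G_system = group_action G "topspace X" act
  for G :: "('g, 'm) monoid_scheme" (structure) and X :: "'a topology" and act :: "'g \<Rightarrow> 'a \<Rightarrow> 'a" +
  assumes compact_X: "compact_space X"
    and metrizable_X: "metrizable_space X"
    and continuous_act:
      "continuous_map (prod_topology (discrete_topology (carrier G)) X) X (\<lambda>(g, x). act g x)"

locale factor_map =
  dom: G_system G X act + cod: G_system G Y act'
  for G :: "('g, 'm) monoid_scheme" (structure)
    and X :: "'a topology" and act :: "'g \<Rightarrow> 'a \<Rightarrow> 'a"
    and Y :: "'b topology" and act' :: "'g \<Rightarrow> 'b \<Rightarrow> 'b"
    and \<pi> :: "'a \<Rightarrow> 'b" +
  assumes continuous_factor: "continuous_map X Y \<pi>"
    and surj_factor: "\<pi> ` topspace X = topspace Y"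
    and equivariant: "\<And>g x. g \<in> carrier G \<Longrightarrow> x \<in> topspace X \<Longrightarrow> \<pi> (act g x) = act' g (\<pi> x)"

definition fibre :: "'a topology \<Rightarrow> ('a \<Rightarrow> 'b) \<Rightarrow> 'b \<Rightarrow> 'a set" where
  "fibre X \<pi> y = {x \<in> topspace X. \<pi> x = y}"

definition compatible_metric :: "'a topology \<Rightarrow> ('a \<Rightarrow> 'a \<Rightarrow> real) \<Rightarrow> bool" where
  "compatible_metric X d \<longleftrightarrow>
     Metric_space (topspace X) d \<and> Metric_space.mtopology (topspace X) d = X"

definition dyn_metric :: "('g \<Rightarrow> 'a \<Rightarrow> 'a) \<Rightarrow> ('a \<Rightarrow> 'a \<Rightarrow> real) \<Rightarrow> 'g set \<Rightarrow> 'a \<Rightarrow> 'a \<Rightarrow> real" where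
  "dyn_metric act d H x x' = Max ((\<lambda>s. d (act s x) (act s x')) ` H)"


section \<open>The induced system on Borel probability measures\<close>

definition borel_of :: "'a topology \<Rightarrow> 'a measure" where
  "borel_of X = sigma (topspace X) {U. openin X U}"

definition borel_probs :: "'a topology \<Rightarrow> 'a measure set" where
  "borel_probs X = {\<mu>. sets \<mu> = sets (borel_of X) \<and> prob_space \<mu>}"

text \<open>
  The weak-star topology: the coarsest one making \<open>\<mu> \<mapsto> \<integral>f d\<mu>\<close> continuous for every continuous
  real function on \<open>X\<close>.
\<close>

definition prob_topology :: "'a topology \<Rightarrow> 'a measure topology" where
  "prob_topology X = topology_generated_by
     {{\<mu> \<in> borel_probs X. integral\<^sup>L \<mu> f \<in> U} | f U. continuous_map X euclideanreal f \<and> open U}"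

lemma topspace_prob_topology [simp]: "topspace (prob_topology X) = borel_probs X"
proof -
  have "continuous_map X euclideanreal (\<lambda>_. 0)" by simp
  moreover have "borel_probs X = {\<mu> \<in> borel_probs X. integral\<^sup>L \<mu> (\<lambda>_. 0::real) \<in> UNIV}" by simp
  ultimately show ?thesis
    unfolding prob_topology_def topology_generated_by_topspace using open_UNIV by blast
qed

text \<open>
  \<^const>\<open>group_action\<close> asks each group element to act by a function that is
  \<^const>\<open>undefined\<close> off the underlying set, hence the restriction.
\<close>

definition induced_action :: "'a topology \<Rightarrow> ('g \<Rightarrow> 'a \<Rightarrow> 'a) \<Rightarrow> 'g \<Rightarrow> 'a measure \<Rightarrow> 'a measure" where
  "induced_action X act g = (\<lambda>\<mu>\<in>borel_probs X. distr \<mu> (borel_of X) (act g))"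

definition induced_map :: "'b topology \<Rightarrow> ('a \<Rightarrow> 'b) \<Rightarrow> 'a measure \<Rightarrow> 'b measure" where
  "induced_map Y \<pi> \<mu> = distr \<mu> (borel_of Y) \<pi>"


section \<open>Relative topological entropy\<close>

definition separated :: "('a \<Rightarrow> 'a \<Rightarrow> real) \<Rightarrow> real \<Rightarrow> 'a set \<Rightarrow> bool" where
  "separated \<rho> \<epsilon> S \<longleftrightarrow> (\<forall>x\<in>S. \<forall>y\<in>S. x \<noteq> y \<longrightarrow> \<rho> x y > \<epsilon>)"

definition sep_number :: "'a set \<Rightarrow> real \<Rightarrow> ('a \<Rightarrow> 'a \<Rightarrow> real) \<Rightarrow> nat" where
  "sep_number A \<epsilon> \<rho> = Max {card S | S. S \<subseteq> A \<and> finite S \<and> separated \<rho> \<epsilon> S}"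

text \<open>
  The suprema over \<open>y\<close> below are taken in \<^typ>\<open>nat\<close>. For a factor map they are suprema of bounded
  sets: by compactness \<open>\<sharp>(\<pi>\<^sup>-\<^sup>1(y), \<epsilon>, d\<^sub>H) \<le> \<sharp>(X, \<epsilon>, d\<^sub>H) < \<infinity>\<close>, and likewise for
  \<open>Widim\<^sub>\<epsilon>\<close>.
\<close>

definition rel_entropy ::
  "'a topology \<Rightarrow> ('g \<Rightarrow> 'a \<Rightarrow> 'a) \<Rightarrow> 'b topology \<Rightarrow> ('a \<Rightarrow> 'b) \<Rightarrow>
   ('a \<Rightarrow> 'a \<Rightarrow> real) \<Rightarrow> (nat \<Rightarrow> 'g set) \<Rightarrow> ereal" where
  "rel_entropy X act Y \<pi> d F =
     Lim (at_right 0) (\<lambda>\<epsilon>. limsup (\<lambda>n.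
       ereal (ln (real (SUP y\<in>topspace Y. sep_number (fibre X \<pi> y) \<epsilon> (dyn_metric act d (F n))))
              / real (card (F n)))))"


section \<open>Relative mean dimension\<close>

text \<open>
  Finite simplicial complexes are taken abstractly, with vertices in \<^typ>\<open>nat\<close>, so that their
  dimension is not bounded by a type. The realization consists of the barycentric coordinate
  functions, topologised coordinatewise.
\<close>

definition finite_complex :: "nat set set \<Rightarrow> bool" where
  "finite_complex K \<longleftrightarrow>
     finite K \<and> (\<forall>\<sigma>\<in>K. finite \<sigma> \<and> \<sigma> \<noteq> {}) \<and> (\<forall>\<sigma>\<in>K. \<forall>\<tau>. \<tau> \<subseteq> \<sigma> \<and> \<tau> \<noteq> {} \<longrightarrow> \<tau> \<in> K)"

definition has_dimension :: "nat set set \<Rightarrow> nat \<Rightarrow> bool" where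
  "has_dimension K n \<longleftrightarrow> (\<exists>\<sigma>\<in>K. card \<sigma> = n + 1) \<and> (\<forall>\<sigma>\<in>K. card \<sigma> \<le> n + 1)"

definition realization :: "nat set set \<Rightarrow> (nat \<Rightarrow> real) topology" where
  "realization K = subtopology (product_topology (\<lambda>_. euclideanreal) UNIV)
     {x. (\<forall>i. 0 \<le> x i) \<and> {i. x i \<noteq> 0} \<in> K \<and> (\<Sum>i\<in>{i. x i \<noteq> 0}. x i) = 1}"

definition eps_embedding ::
  "'a topology \<Rightarrow> ('a \<Rightarrow> 'a \<Rightarrow> real) \<Rightarrow> real \<Rightarrow> 'p topology \<Rightarrow> ('a \<Rightarrow> 'p) \<Rightarrow> bool" where
  "eps_embedding Z \<rho> \<epsilon> P f \<longleftrightarrow>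
     continuous_map Z P f \<and>
     (\<forall>z1\<in>topspace Z. \<forall>z2\<in>topspace Z. f z1 = f z2 \<longrightarrow> \<rho> z1 z2 < \<epsilon>)"

definition Widim :: "real \<Rightarrow> 'a topology \<Rightarrow> ('a \<Rightarrow> 'a \<Rightarrow> real) \<Rightarrow> nat" where
  "Widim \<epsilon> Z \<rho> = (LEAST n. \<exists>K. finite_complex K \<and> has_dimension K n \<and>
                            (\<exists>f. eps_embedding Z \<rho> \<epsilon> (realization K) f))"

definition rel_mdim ::
  "'a topology \<Rightarrow> ('g \<Rightarrow> 'a \<Rightarrow> 'a) \<Rightarrow> 'b topology \<Rightarrow> ('a \<Rightarrow> 'b) \<Rightarrow>
   ('a \<Rightarrow> 'a \<Rightarrow> real) \<Rightarrow> (nat \<Rightarrow> 'g set) \<Rightarrow> ereal" where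
  "rel_mdim X act Y \<pi> d F =
     Lim (at_right 0) (\<lambda>\<epsilon>. lim (\<lambda>n.
       ereal (real (SUP y\<in>topspace Y.
                Widim \<epsilon> (subtopology X (fibre X \<pi> y)) (dyn_metric act d (F n)))
              / real (card (F n)))))"

end

theory Submission
  imports Defs "HOL-Real_Asymp.Real_Asymp"
begin

text \<open>
  Everything passes through independence density: for some continuous \<open>g\<close> and \<open>a < b\<close>, every finite
  \<open>H \<subseteq> G\<close> has a subset \<open>W\<close> of proportion at least \<open>c > 0\<close> such that within a single fibre the values
  \<open>g (s z)\<close>, \<open>s \<in> W\<close>, can be prescribed to be \<open>\<le> a\<close> or \<open>\<ge> b\<close> independently. A combinatorial dichotomy shows
  that this is equivalent to positive relative entropy, for \<open>\<pi>\<close> and for the induced map alike.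

  Dirac measures transfer independence from \<open>\<pi>\<close> to the induced map. Conversely, measures over a common
  base measure are approximated by the empirical measures of boundedly many points; if the fibres of \<open>\<pi>\<close>
  had few separated orbits, there would be too few such samples to realise all patterns on \<open>W\<close>.

  Independence of \<open>\<pi>\<close> along disjoint blocks of \<open>L\<close> translates yields cubes of product measures of dimension
  \<open>2\<^sup>L - 1\<close> per block in a fibre of the induced map, so by Lebesgue's covering theorem its mean dimension
  exceeds a constant times \<open>(2\<^sup>L - 1) / L\<^sup>2\<close>. If the induced map has zero entropy, its coordinates
  \<open>g (s \<mu>)\<close> can be cut off at random thresholds so that few of them are not constant \<open>0\<close> or \<open>1\<close> at any
  point of a fibre, and its mean dimension is zero. The limit over the Folner sequence exists by the
  Ornstein--Weiss lemma.
\<close>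

section \<open>Counting subsets\<close>

text \<open>Independence density is stated for all finite sets \<open>H\<close> and not along a
  Folner sequence, which is why the entropy of \<open>\<pi>\<close> and the invariants of the
  induced map may be computed along different sequences.

  The dichotomy is a Sauer-Shelah argument with two separated values in place of membership: a fibre
  either is covered by few boxes, each of which excludes one of the two values at every coordinate,
  or shatters so many subsets of \<open>H\<close> that they cannot all be small. Finitely many
  choices of \<open>g\<close>, \<open>a\<close>, \<open>b\<close> separate all pairs of distant
  points, so few boxes for each of them would bound the number of separated orbits.

  The obstacle in descending from measures is that their common image on \<open>Y\<close> need not
  be a Dirac measure, so that they do not live on one fibre of \<open>\<pi>\<close>. Since they all
  have the same image, the sampled positions in \<open>Y\<close> can be fixed once for half of the
  patterns, and only the entropy inside the fibres enters, never that of \<open>Y\<close>.\<close>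

lemma card_small_subsets_le:
  fixes x r :: real
  assumes "finite A" "0 < x" "x \<le> 1"
  shows "real (card {W. W \<subseteq> A \<and> real (card W) \<le> r}) * x powr r \<le> (1 + x) ^ card A"
proof -
  let ?S = "{W. W \<subseteq> A \<and> real (card W) \<le> r}"
  have fin: "finite ?S" using assms(1) by simp
  \<comment> \<open>Chernoff-type weighting: give a subset \<open>W\<close> the weight
    \<open>x ^ card W\<close>. Small subsets have weight at least \<open>x powr r\<close> because
    \<open>x \<le> 1\<close>, and all weights together sum to
    \<open>(1 + x) ^ card A\<close>.\<close>
  have "real (card ?S) * x powr r = (\<Sum>W\<in>?S. x powr r)" by simp
  also have "\<dots> \<le> (\<Sum>W\<in>?S. x ^ card W)"
  proof (rule sum_mono)
    fix W assume "W \<in> ?S"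
    then have "x powr r \<le> x powr (real (card W))"
      using assms by (intro powr_mono') auto
    then show "x powr r \<le> x ^ card W" using assms by (simp add: powr_realpow)
  qed
  also have "\<dots> \<le> (\<Sum>W\<in>Pow A. x ^ card W)"
    using assms by (intro sum_mono2) auto
  also have "\<dots> = (\<Prod>a\<in>A. x + 1)"
    using prod_add[OF assms(1), of "\<lambda>_. x" "\<lambda>_. 1"] by simp
  finally show ?thesis by (simp add: add.commute)
qed

text \<open>The exponent \<open>\<beta>\<close> is split in half. The choice
  \<open>x \<le> \<beta> / 2\<close> bounds \<open>(1 + x) ^ n\<close> by
  \<open>exp (n * \<beta> / 2)\<close>, and \<open>c\<close> is so small that dividing by
  \<open>x powr (c * n)\<close> costs at most the same factor again.\<close>

lemma few_small_subsets:
  fixes \<beta> :: real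
  assumes "\<beta> > 0"
  obtains c where "c > 0"
    "\<forall>A::'a set. finite A \<longrightarrow>
       real (card {W. W \<subseteq> A \<and> real (card W) \<le> c * real (card A)}) \<le> exp (\<beta> * real (card A))"
proof -
  define x where "x = min 1 (\<beta> / 2)"
  have x: "0 < x" "x \<le> 1" "x \<le> \<beta> / 2" using assms by (auto simp: x_def)
  \<comment> \<open>The summand 1 keeps \<open>D\<close> positive when \<open>x = 1\<close>.\<close>
  define D where "D = 1 - ln x"
  define c where "c = \<beta> / 2 / D"
  have lnx: "ln x \<le> 0" using x by simp
  have c: "c > 0" using assms lnx by (simp add: c_def D_def)
  have cx: "- c * ln x \<le> \<beta> / 2"
  proof -
    have "D \<noteq> 0" using lnx by (simp add: D_def)
    then have "c * D = \<beta> / 2" by (simp add: c_def)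
    then show ?thesis using c by (simp add: D_def algebra_simps)
  qed
  have "real (card {W. W \<subseteq> A \<and> real (card W) \<le> c * real (card A)}) \<le> exp (\<beta> * real (card A))"
    if "finite A" for A :: "'a set"
  proof -
    let ?n = "real (card A)"
    have "real (card {W. W \<subseteq> A \<and> real (card W) \<le> c * ?n}) * x powr (c * ?n) \<le> (1 + x) ^ card A"
      by (rule card_small_subsets_le) (use that x in auto)
    also have "\<dots> \<le> exp x ^ card A" using x by (intro power_mono) auto
    also have "\<dots> = exp (?n * x)" by (simp add: exp_of_nat_mult)
    finally have "real (card {W. W \<subseteq> A \<and> real (card W) \<le> c * ?n}) \<le> exp (?n * x) / x powr (c * ?n)"
      using x by (simp add: pos_le_divide_eq)
    also have "\<dots> = exp (?n * x - c * ?n * ln x)" using x by (simp add: powr_def exp_diff)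
    also have "\<dots> \<le> exp (\<beta> * ?n)"
    proof -
      have "?n * (x - c * ln x) \<le> ?n * \<beta>" using cx x by (intro mult_left_mono) auto
      then show ?thesis by (simp add: algebra_simps)
    qed
    finally show ?thesis .
  qed
  with c show ?thesis by (intro that[of c]) auto
qed

section \<open>Independence sets from box coverings\<close>

text \<open>The boxes are the members of the join, over the coordinates \<open>s\<close>, of the
  two-set covers by the complements of \<open>P s\<close> and of \<open>Q s\<close>; a set
  \<open>\<sigma>\<close> records where the first complement is chosen.\<close>

definition box_cover :: "'s set \<Rightarrow> ('s \<Rightarrow> 'z \<Rightarrow> bool) \<Rightarrow> ('s \<Rightarrow> 'z \<Rightarrow> bool) \<Rightarrow> 'z set \<Rightarrow> 's set set \<Rightarrow> bool" where
  "box_cover Z P Q S C \<longleftrightarrow> C \<subseteq> Pow Z \<and>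
     (\<forall>z\<in>S. \<exists>\<sigma>\<in>C. (\<forall>s\<in>\<sigma>. \<not> P s z) \<and> (\<forall>s\<in>Z-\<sigma>. \<not> Q s z))"

text \<open>The subsets of \<open>Z\<close> shattered by \<open>S\<close> in the sense of Sauer and
  Shelah, with \<open>P s\<close> and \<open>Q s\<close> in place of membership and its
  negation.\<close>

definition indep_sets :: "'s set \<Rightarrow> ('s \<Rightarrow> 'z \<Rightarrow> bool) \<Rightarrow> ('s \<Rightarrow> 'z \<Rightarrow> bool) \<Rightarrow> 'z set \<Rightarrow> 's set set" where
  "indep_sets Z P Q S = {W. W \<subseteq> Z \<and> (\<forall>\<tau>\<subseteq>W. \<exists>z\<in>S. (\<forall>s\<in>\<tau>. P s z) \<and> (\<forall>s\<in>W-\<tau>. Q s z))}"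

lemma indep_sets_mono: "S \<subseteq> S' \<Longrightarrow> Z \<subseteq> Z' \<Longrightarrow> indep_sets Z P Q S \<subseteq> indep_sets Z' P Q S'"
  unfolding indep_sets_def by blast

lemma finite_indep_sets: "finite Z \<Longrightarrow> finite (indep_sets Z P Q S)"
  unfolding indep_sets_def by auto

text \<open>
  An independent set for both halves \<open>S1 \<subseteq> {P a}\<close> and \<open>S2 \<subseteq> {Q a}\<close> stays independent after adding
  \<open>a\<close>, so the independent sets of the halves are counted without loss.
\<close>

lemma card_indep_sets_add:
  assumes fin: "finite Z" and a: "a \<notin> Z"
  shows "card (indep_sets Z P Q {z\<in>S. P a z}) + card (indep_sets Z P Q {z\<in>S. Q a z})
       \<le> card (indep_sets (insert a Z) P Q S)"
proof -
  let ?I1 = "indep_sets Z P Q {z\<in>S. P a z}" and ?I2 = "indep_sets Z P Q {z\<in>S. Q a z}"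
  have fI: "finite ?I1" "finite ?I2" "finite (indep_sets (insert a Z) P Q S)"
    using fin by (auto intro: finite_indep_sets)
  have sub1: "?I1 \<union> ?I2 \<subseteq> indep_sets (insert a Z) P Q S"
    using indep_sets_mono[of "{z\<in>S. P a z}" S Z "insert a Z" P Q]
      indep_sets_mono[of "{z\<in>S. Q a z}" S Z "insert a Z" P Q] by blast
  have "insert a W \<in> indep_sets (insert a Z) P Q S" if W: "W \<in> ?I1 \<inter> ?I2" for W
    unfolding indep_sets_def
  proof (intro CollectI conjI allI impI)
    show "insert a W \<subseteq> insert a Z" using W by (auto simp: indep_sets_def)
    fix \<tau> assume \<tau>: "\<tau> \<subseteq> insert a W"
    have aW: "a \<notin> W" using W a by (auto simp: indep_sets_def)
    have "\<tau> - {a} \<subseteq> W" using \<tau> by blast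
    moreover have "\<forall>\<tau>\<subseteq>W. \<exists>z\<in>{z\<in>S. P a z}. (\<forall>s\<in>\<tau>. P s z) \<and> (\<forall>s\<in>W-\<tau>. Q s z)"
      and "\<forall>\<tau>\<subseteq>W. \<exists>z\<in>{z\<in>S. Q a z}. (\<forall>s\<in>\<tau>. P s z) \<and> (\<forall>s\<in>W-\<tau>. Q s z)"
      using W by (simp_all add: indep_sets_def)
    ultimately have "\<exists>z\<in>{z\<in>S. P a z}. (\<forall>s\<in>\<tau>-{a}. P s z) \<and> (\<forall>s\<in>W-(\<tau>-{a}). Q s z)"
      and "\<exists>z\<in>{z\<in>S. Q a z}. (\<forall>s\<in>\<tau>-{a}. P s z) \<and> (\<forall>s\<in>W-(\<tau>-{a}). Q s z)"
      by (metis (no_types, lifting))+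
    then obtain z1 z2 where z1: "z1 \<in> S" "P a z1" "\<forall>s\<in>\<tau>-{a}. P s z1" "\<forall>s\<in>W-(\<tau>-{a}). Q s z1"
      and z2: "z2 \<in> S" "Q a z2" "\<forall>s\<in>\<tau>-{a}. P s z2" "\<forall>s\<in>W-(\<tau>-{a}). Q s z2"
      by (auto simp del: Diff_iff)
    show "\<exists>z\<in>S. (\<forall>s\<in>\<tau>. P s z) \<and> (\<forall>s\<in>insert a W - \<tau>. Q s z)"
    proof (cases "a \<in> \<tau>")
      case True
      then show ?thesis using z1 aW by (intro bexI[of _ z1]) auto
    next
      case False
      then show ?thesis using z2 aW by (intro bexI[of _ z2]) auto
    qed
  qed
  then have sub2: "insert a ` (?I1 \<inter> ?I2) \<subseteq> indep_sets (insert a Z) P Q S" by blast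
  have aI: "a \<notin> W" if "W \<in> ?I1 \<or> W \<in> ?I2" for W
    using that a by (auto simp: indep_sets_def)
  have "inj_on (insert a) (?I1 \<inter> ?I2)"
    using aI by (intro inj_onI) (metis Int_iff insert_ident)
  then have "card (?I1 \<inter> ?I2) = card (insert a ` (?I1 \<inter> ?I2))"
    by (simp add: card_image)
  moreover have "(?I1 \<union> ?I2) \<inter> insert a ` (?I1 \<inter> ?I2) = {}"
    using aI by blast
  ultimately have "card (?I1 \<union> ?I2) + card (?I1 \<inter> ?I2)
      = card ((?I1 \<union> ?I2) \<union> insert a ` (?I1 \<inter> ?I2))"
    using fI by (subst card_Un_disjoint) auto
  also have "\<dots> \<le> card (indep_sets (insert a Z) P Q S)"
    using sub1 sub2 fI by (intro card_mono) auto
  finally show ?thesis using card_Un_Int[OF fI(1,2)] by linarith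
qed

text \<open>The new coordinate costs no extra boxes on either part: where \<open>P a\<close> holds,
  \<open>Q a\<close> fails and the old box may omit \<open>a\<close>; elsewhere \<open>a\<close> may
  be added to it.\<close>

lemma box_cover_union:
  assumes a: "a \<notin> Z" and PQ: "\<And>z. z \<in> S \<Longrightarrow> \<not> (P a z \<and> Q a z)"
    and C1: "box_cover Z P Q {z\<in>S. P a z} C1" and C2: "box_cover Z P Q {z\<in>S. \<not> P a z} C2"
  shows "box_cover (insert a Z) P Q S (C1 \<union> insert a ` C2)"
  unfolding box_cover_def
proof (intro conjI ballI)
  show "C1 \<union> insert a ` C2 \<subseteq> Pow (insert a Z)"
    using C1 C2 unfolding box_cover_def by blast
  fix z assume z: "z \<in> S"
  show "\<exists>\<sigma>\<in>C1 \<union> insert a ` C2. (\<forall>s\<in>\<sigma>. \<not> P s z) \<and> (\<forall>s\<in>insert a Z - \<sigma>. \<not> Q s z)"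
  proof (cases "P a z")
    case True
    then obtain \<sigma> where "\<sigma> \<in> C1" "(\<forall>s\<in>\<sigma>. \<not> P s z) \<and> (\<forall>s\<in>Z-\<sigma>. \<not> Q s z)"
      using C1 z unfolding box_cover_def by blast
    then show ?thesis using True PQ[OF z] by blast
  next
    case False
    then obtain \<sigma> where "\<sigma> \<in> C2" "(\<forall>s\<in>\<sigma>. \<not> P s z) \<and> (\<forall>s\<in>Z-\<sigma>. \<not> Q s z)"
      using C2 z unfolding box_cover_def by blast
    then show ?thesis using False by (intro bexI[of _ "insert a \<sigma>"]) auto
  qed
qed

lemma box_cover_union':
  assumes a: "a \<notin> Z" and PQ: "\<And>z. z \<in> S \<Longrightarrow> \<not> (P a z \<and> Q a z)"
    and C1: "box_cover Z P Q {z\<in>S. Q a z} C1" and C2: "box_cover Z P Q {z\<in>S. \<not> Q a z} C2"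
  shows "box_cover (insert a Z) P Q S (insert a ` C1 \<union> C2)"
  unfolding box_cover_def
proof (intro conjI ballI)
  show "insert a ` C1 \<union> C2 \<subseteq> Pow (insert a Z)"
    using C1 C2 unfolding box_cover_def by blast
  fix z assume z: "z \<in> S"
  show "\<exists>\<sigma>\<in>insert a ` C1 \<union> C2. (\<forall>s\<in>\<sigma>. \<not> P s z) \<and> (\<forall>s\<in>insert a Z - \<sigma>. \<not> Q s z)"
  proof (cases "Q a z")
    case True
    then obtain \<sigma> where "\<sigma> \<in> C1" "(\<forall>s\<in>\<sigma>. \<not> P s z) \<and> (\<forall>s\<in>Z-\<sigma>. \<not> Q s z)"
      using C1 z unfolding box_cover_def by blast
    then show ?thesis using True PQ[OF z] by (intro bexI[of _ "insert a \<sigma>"]) auto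
  next
    case False
    then obtain \<sigma> where "\<sigma> \<in> C2" "(\<forall>s\<in>\<sigma>. \<not> P s z) \<and> (\<forall>s\<in>Z-\<sigma>. \<not> Q s z)"
      using C2 z unfolding box_cover_def by blast
    then show ?thesis using False by blast
  qed
qed

text \<open>
  Induction over the coordinates. If one of the two values of a coordinate is taken on a part that
  needs at most a fraction \<open>\<eta> = (1/2)^m\<close> of the boxes, the coordinate is dropped at the price of a
  factor \<open>1 - \<eta>\<close>; otherwise both parts contribute and the number of independent sets doubles.
\<close>

lemma box_cover_le_indep_sets:
  fixes m :: nat
  defines "\<eta> \<equiv> (1/2::real) ^ m"
  assumes m: "m > 0" and "finite Z" and "finite S"
    and "\<And>s z. s \<in> Z \<Longrightarrow> z \<in> S \<Longrightarrow> \<not> (P s z \<and> Q s z)"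
  shows "\<exists>C. finite C \<and> box_cover Z P Q S C \<and>
           (1 - \<eta>) ^ card Z * real (card C) \<le> real (card (indep_sets Z P Q S)) ^ m"
  using assms(3-5)
proof (induction Z arbitrary: S rule: finite_induct)
  case empty
  show ?case
  proof (cases "S = {}")
    case True
    then show ?thesis by (intro exI[of _ "{}"]) (auto simp: box_cover_def)
  next
    case False
    then have "indep_sets {} P Q S = {{}}" by (auto simp: indep_sets_def)
    then show ?thesis by (intro exI[of _ "{{}}"]) (auto simp: box_cover_def)
  qed
next
  case (insert a Z)
  have \<eta>: "0 < \<eta>" "\<eta> \<le> 1/2" "\<eta> < 1"
  proof -
    show "0 < \<eta>" by (simp add: \<eta>_def)
    have "(1/2::real) ^ m \<le> (1/2) ^ 1" using m by (intro power_decreasing) auto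
    then show "\<eta> \<le> 1/2" by (simp add: \<eta>_def)
    then show "\<eta> < 1" by simp
  qed
  let ?H = "\<lambda>S. real (card (indep_sets Z P Q S))"
  let ?q = "(1 - \<eta>) ^ card Z"
  have q: "?q > 0" using \<eta> by simp
  have IH: "\<exists>C. finite C \<and> box_cover Z P Q S' C \<and> ?q * real (card C) \<le> ?H S' ^ m" if "S' \<subseteq> S" for S'
  proof (rule insert.IH)
    show "finite S'" using that insert.prems(1) by (rule finite_subset)
    show "\<And>s z. s \<in> Z \<Longrightarrow> z \<in> S' \<Longrightarrow> \<not> (P s z \<and> Q s z)" using insert.prems(2) that by blast
  qed
  have PQ: "\<And>z. z \<in> S \<Longrightarrow> \<not> (P a z \<and> Q a z)" using insert.prems by blast
  let ?S1 = "{z\<in>S. P a z}" and ?S1' = "{z\<in>S. \<not> P a z}"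
  let ?S2 = "{z\<in>S. Q a z}" and ?S2' = "{z\<in>S. \<not> Q a z}"
  obtain C1 where C1: "finite C1" "box_cover Z P Q ?S1 C1" "?q * real (card C1) \<le> ?H ?S1 ^ m"
    using IH[of ?S1] by auto
  obtain C1' where C1': "finite C1'" "box_cover Z P Q ?S1' C1'" "?q * real (card C1') \<le> ?H ?S1' ^ m"
    using IH[of ?S1'] by auto
  obtain C2 where C2: "finite C2" "box_cover Z P Q ?S2 C2" "?q * real (card C2) \<le> ?H ?S2 ^ m"
    using IH[of ?S2] by auto
  obtain C2' where C2': "finite C2'" "box_cover Z P Q ?S2' C2'" "?q * real (card C2') \<le> ?H ?S2' ^ m"
    using IH[of ?S2'] by auto
  let ?HH = "real (card (indep_sets (insert a Z) P Q S))"
  have Hmono: "?H S' \<le> ?HH" if "S' \<subseteq> S" for S'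
    using insert.hyps that by (intro of_nat_mono card_mono finite_indep_sets indep_sets_mono) auto
  define D where "D = C1 \<union> insert a ` C1'"
  define E where "E = insert a ` C2 \<union> C2'"
  have D: "finite D" "box_cover (insert a Z) P Q S D" and E: "finite E" "box_cover (insert a Z) P Q S E"
    using box_cover_union[OF insert.hyps(2) PQ C1(2) C1'(2)] box_cover_union'[OF insert.hyps(2) PQ C2(2) C2'(2)]
      C1 C1' C2 C2' unfolding D_def E_def by auto
  have cD: "real (card D) \<le> real (card C1) + real (card C1')"
  proof -
    have "card D \<le> card C1 + card C1'" unfolding D_def
      using card_Un_le[of C1 "insert a ` C1'"] card_image_le[OF C1'(1), of "insert a"] by linarith
    then show ?thesis by linarith
  qed
  have cE: "real (card E) \<le> real (card C2) + real (card C2')"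
  proof -
    have "card E \<le> card C2 + card C2'" unfolding E_def
      using card_Un_le[of "insert a ` C2" C2'] card_image_le[OF C2(1), of "insert a"] by linarith
    then show ?thesis by linarith
  qed
  have cZ: "(1 - \<eta>) ^ card (insert a Z) = ?q * (1 - \<eta>)"
    using insert.hyps by simp
  consider (P) "real (card C1) \<le> \<eta> * real (card D)" | (Q) "real (card C2) \<le> \<eta> * real (card E)"
    | (both) "real (card C1) > \<eta> * real (card D)" "real (card C2) > \<eta> * real (card E)" by linarith
  then show ?case
  proof cases
    case P
    have "?q * (1 - \<eta>) * real (card D) \<le> ?q * real (card C1')"
      using P cD q by (subst mult.assoc, intro mult_left_mono) (auto simp: algebra_simps)
    also have "\<dots> \<le> ?H ?S1' ^ m" by fact
    also have "\<dots> \<le> ?HH ^ m" by (intro power_mono Hmono) auto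
    finally show ?thesis using D cZ by auto
  next
    case Q
    have "?q * (1 - \<eta>) * real (card E) \<le> ?q * real (card C2')"
      using Q cE q by (subst mult.assoc, intro mult_left_mono) (auto simp: algebra_simps)
    also have "\<dots> \<le> ?H ?S2' ^ m" by fact
    also have "\<dots> \<le> ?HH ^ m" by (intro power_mono Hmono) auto
    finally show ?thesis using E cZ by auto
  next
    case both
    define F where "F = (if card D \<le> card E then D else E)"
    have F: "finite F" "box_cover (insert a Z) P Q S F" "card F \<le> card D" "card F \<le> card E"
      using D E by (auto simp: F_def)
    let ?h = "min (?H ?S1) (?H ?S2)"
    have "?q * \<eta> * real (card F) \<le> ?q * real (card C1)" "?q * \<eta> * real (card F) \<le> ?q * real (card C2)"
    proof -
      have "\<eta> * real (card F) \<le> \<eta> * real (card D)" "\<eta> * real (card F) \<le> \<eta> * real (card E)"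
        using F \<eta> by auto
      then show "?q * \<eta> * real (card F) \<le> ?q * real (card C1)" "?q * \<eta> * real (card F) \<le> ?q * real (card C2)"
        using both q by auto
    qed
    then have "?q * \<eta> * real (card F) \<le> ?H ?S1 ^ m" "?q * \<eta> * real (card F) \<le> ?H ?S2 ^ m"
      using C1(3) C2(3) by linarith+
    then have h: "?q * \<eta> * real (card F) \<le> ?h ^ m" by (simp add: min_def)
    have "?q * (1 - \<eta>) * real (card F) \<le> ?q * real (card F)"
      using q \<eta> by (simp add: mult_left_le mult_right_mono)
    also have "\<dots> = 2 ^ m * (?q * \<eta> * real (card F))"
      by (simp add: \<eta>_def power_divide)
    also have "\<dots> \<le> 2 ^ m * ?h ^ m" using h by simp
    also have "\<dots> = (2 * ?h) ^ m" by (simp add: power_mult_distrib)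
    also have "\<dots> \<le> (?H ?S1 + ?H ?S2) ^ m" by (intro power_mono) (auto simp: min_def)
    also have "\<dots> \<le> ?HH ^ m"
      using card_indep_sets_add[OF insert.hyps, of P Q S] by (intro power_mono) auto
    finally show ?thesis using F cZ by auto
  qed
qed

text \<open>For \<open>m\<close> with \<open>1 - (1/2) ^ m > exp (- \<beta> / 2)\<close>, a need for
  \<open>exp (\<beta> * n)\<close> boxes forces at least \<open>exp (\<beta> * n / (2 * m))\<close>
  independent sets, while only \<open>exp (\<beta> * n / (4 * m))\<close> subsets have at most
  \<open>c * n\<close> elements. The constant \<open>c\<close> depends on \<open>\<beta>\<close>
  alone, so one density serves all fibres and all finite sets.\<close>

lemma large_indep_set:
  fixes \<beta> :: real
  assumes "\<beta> > 0"
  shows "\<exists>c>0. \<forall>(Z::'s set) (S::'z set) P Q.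
    finite Z \<and> finite S \<and> Z \<noteq> {} \<and> (\<forall>s\<in>Z. \<forall>z\<in>S. \<not> (P s z \<and> Q s z)) \<and>
    (\<forall>C. finite C \<and> box_cover Z P Q S C \<longrightarrow> exp (\<beta> * real (card Z)) \<le> real (card C)) \<longrightarrow>
    (\<exists>W\<in>indep_sets Z P Q S. c * real (card Z) \<le> real (card W))"
proof -
  have "(\<lambda>m. 1 - (1/2::real) ^ m) \<longlonglongrightarrow> 1 - 0"
    by (intro tendsto_intros LIMSEQ_power_zero) auto
  moreover have "exp (- \<beta> / 2) < 1 - 0" using assms by simp
  ultimately have "eventually (\<lambda>m. exp (- \<beta> / 2) < 1 - (1/2::real) ^ m) sequentially"
    by (rule order_tendstoD)
  then have "eventually (\<lambda>m. exp (- \<beta> / 2) < 1 - (1/2::real) ^ m \<and> m > 0) sequentially"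
    using eventually_gt_at_top[of "0::nat"] by eventually_elim auto
  from eventually_happens'[OF sequentially_bot this] obtain m where m: "exp (- \<beta> / 2) < 1 - (1/2::real) ^ m" "m > 0"
    by blast
  have pos: "\<beta> / (4 * m) > 0" using assms m by simp
  obtain c where c: "c > 0"
    "\<forall>A::'s set. finite A \<longrightarrow>
       real (card {W. W \<subseteq> A \<and> real (card W) \<le> c * real (card A)}) \<le> exp (\<beta> / (4 * m) * real (card A))"
    by (rule few_small_subsets[OF pos, where 'a = 's]) blast
  have main: "\<exists>W\<in>indep_sets Z P Q S. c * real (card Z) \<le> real (card W)"
    if hyp: "finite Z \<and> finite S \<and> Z \<noteq> {} \<and> (\<forall>s\<in>Z. \<forall>z\<in>S. \<not> (P s z \<and> Q s z)) \<and>
      (\<forall>C. finite C \<and> box_cover Z P Q S C \<longrightarrow> exp (\<beta> * real (card Z)) \<le> real (card C))"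
    for Z :: "'s set" and S :: "'z set" and P Q
  proof (rule ccontr)
    have Z: "finite Z" "Z \<noteq> {}" and S: "finite S" and PQ: "\<And>s z. s \<in> Z \<Longrightarrow> z \<in> S \<Longrightarrow> \<not> (P s z \<and> Q s z)"
      and cov: "\<And>C. finite C \<Longrightarrow> box_cover Z P Q S C \<Longrightarrow> exp (\<beta> * real (card Z)) \<le> real (card C)"
      using hyp by simp_all
    assume "\<not> ?thesis"
    then have "real (card W) \<le> c * real (card Z)" if "W \<in> indep_sets Z P Q S" for W
      using that by (meson linear)
    then have "indep_sets Z P Q S \<subseteq> {W. W \<subseteq> Z \<and> real (card W) \<le> c * real (card Z)}"
    proof (intro subsetI CollectI conjI)
      fix W assume "W \<in> indep_sets Z P Q S"
      then show "real (card W) \<le> c * real (card Z)" by fact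
    qed (simp add: indep_sets_def subset_iff)
    then have "card (indep_sets Z P Q S) \<le> card {W. W \<subseteq> Z \<and> real (card W) \<le> c * real (card Z)}"
      using Z by (intro card_mono) auto
    also have "real \<dots> \<le> exp (\<beta> / (4 * m) * real (card Z))" using c(2) Z by blast
    finally have H: "real (card (indep_sets Z P Q S)) \<le> exp (\<beta> / (4 * m) * real (card Z))" by simp
    obtain C where C: "finite C" "box_cover Z P Q S C"
      "(1 - (1/2) ^ m) ^ card Z * real (card C) \<le> real (card (indep_sets Z P Q S)) ^ m"
      using box_cover_le_indep_sets[of m Z S P Q] m Z S PQ by blast
    have "exp (\<beta> / 2 * real (card Z)) = exp (- \<beta> / 2) ^ card Z * exp (\<beta> * real (card Z))"
      by (simp add: exp_of_nat_mult[symmetric] exp_add[symmetric] field_simps)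
    also have "\<dots> \<le> (1 - (1/2) ^ m) ^ card Z * exp (\<beta> * real (card Z))"
      using m by (intro mult_right_mono power_mono) auto
    also have "\<dots> \<le> (1 - (1/2) ^ m) ^ card Z * real (card C)"
    proof (rule mult_left_mono[OF cov[OF C(1,2)]])
      have "(0::real) \<le> 1 - (1/2) ^ m" using m(1) exp_gt_zero[of "- \<beta> / 2"] by linarith
      then show "(0::real) \<le> (1 - (1/2) ^ m) ^ card Z" by simp
    qed
    also have "\<dots> \<le> real (card (indep_sets Z P Q S)) ^ m" by fact
    also have "\<dots> \<le> exp (\<beta> / (4 * m) * real (card Z)) ^ m" using H by (intro power_mono) auto
    also have "\<dots> = exp (\<beta> / 4 * real (card Z))"
      using m by (simp add: exp_of_nat_mult[symmetric] field_simps)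
    finally have "\<beta> / 2 * real (card Z) \<le> \<beta> / 4 * real (card Z)" by simp
    then show False using assms Z by (simp add: card_gt_0_iff)
  qed
  show ?thesis
    by (intro exI[of _ c] conjI allI impI) (rule c(1), rule main, assumption)
qed

section \<open>Sampling\<close>

definition tuples :: "'e set \<Rightarrow> nat \<Rightarrow> 'e list set" where
  "tuples E L = {xs. set xs \<subseteq> E \<and> length xs = L}"

lemma finite_tuples: "finite E \<Longrightarrow> finite (tuples E L)"
  unfolding tuples_def by (rule finite_lists_length_eq)

lemma tuples_0 [simp]: "tuples E 0 = {[]}"
  by (auto simp: tuples_def)

lemma tuples_Suc: "tuples E (Suc L) = (\<lambda>p. fst p # snd p) ` (E \<times> tuples E L)"
  unfolding tuples_def by (force simp: length_Suc_conv image_iff)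

lemma sum_tuples_Suc:
  "(\<Sum>xs\<in>tuples E (Suc L). f xs) = (\<Sum>e\<in>E. \<Sum>xs\<in>tuples E L. f (e # xs))"
proof -
  have "inj_on (\<lambda>p. fst p # snd p) (E \<times> tuples E L)" by (auto simp: inj_on_def prod_eq_iff)
  then show ?thesis
    unfolding tuples_Suc by (simp add: sum.reindex sum.cartesian_product case_prod_beta)
qed

text \<open>Density of the product measure on tuples, that is, of independent samples with law
  \<open>q\<close>.\<close>

definition weight :: "('e \<Rightarrow> real) \<Rightarrow> 'e list \<Rightarrow> real" where
  "weight q xs = prod_list (map q xs)"

lemma weight_simps [simp]: "weight q [] = 1" "weight q (e # xs) = q e * weight q xs"
  by (simp_all add: weight_def)

lemma weight_nonneg: "(\<And>e. e \<in> E \<Longrightarrow> 0 \<le> q e) \<Longrightarrow> xs \<in> tuples E L \<Longrightarrow> 0 \<le> weight q xs"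
  unfolding weight_def tuples_def by (intro prod_list_nonneg) auto

lemma sum_weight: "(\<Sum>e\<in>E. q e) = 1 \<Longrightarrow> (\<Sum>xs\<in>tuples E L. weight q xs) = 1"
proof (induction L)
  case (Suc L)
  have "(\<Sum>xs\<in>tuples E (Suc L). weight q xs) = (\<Sum>e\<in>E. q e) * (\<Sum>xs\<in>tuples E L. weight q xs)"
    by (simp only: sum_tuples_Suc weight_simps sum_distrib_left[symmetric] sum_distrib_right[symmetric])
  then show ?case using Suc by simp
qed simp

lemma sum_weight_linear:
  assumes "(\<Sum>e\<in>E. q e) = 1" "(\<Sum>e\<in>E. q e * \<phi> e) = 0"
  shows "(\<Sum>xs\<in>tuples E L. weight q xs * (\<Sum>x\<leftarrow>xs. \<phi> x)) = (0::real)"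
proof (induction L)
  case (Suc L)
  have "(\<Sum>xs\<in>tuples E (Suc L). weight q xs * (\<Sum>x\<leftarrow>xs. \<phi> x))
      = (\<Sum>e\<in>E. \<Sum>xs\<in>tuples E L. q e * \<phi> e * weight q xs + q e * (weight q xs * (\<Sum>x\<leftarrow>xs. \<phi> x)))"
    unfolding sum_tuples_Suc by (intro sum.cong refl) (simp add: algebra_simps)
  also have "\<dots> = (\<Sum>e\<in>E. q e * \<phi> e) * (\<Sum>xs\<in>tuples E L. weight q xs)
      + (\<Sum>e\<in>E. q e) * (\<Sum>xs\<in>tuples E L. weight q xs * (\<Sum>x\<leftarrow>xs. \<phi> x))"
    unfolding sum.distrib sum_distrib_left[symmetric] sum_distrib_right[symmetric] ..
  finally show ?case using Suc assms by simp
qed simp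

text \<open>Additivity of the variance: the mixed terms vanish since the samples are independent and
  \<open>\<phi>\<close> is centred.\<close>

lemma sum_weight_square:
  assumes "(\<Sum>e\<in>E. q e) = 1" "(\<Sum>e\<in>E. q e * \<phi> e) = 0"
  shows "(\<Sum>xs\<in>tuples E L. weight q xs * (\<Sum>x\<leftarrow>xs. \<phi> x)\<^sup>2) = real L * (\<Sum>e\<in>E. q e * (\<phi> e)\<^sup>2)"
proof (induction L)
  case (Suc L)
  have "(\<Sum>xs\<in>tuples E (Suc L). weight q xs * (\<Sum>x\<leftarrow>xs. \<phi> x)\<^sup>2)
      = (\<Sum>e\<in>E. \<Sum>xs\<in>tuples E L. q e * (\<phi> e)\<^sup>2 * weight q xs
          + (2 * (q e * \<phi> e)) * (weight q xs * (\<Sum>x\<leftarrow>xs. \<phi> x))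
          + q e * (weight q xs * (\<Sum>x\<leftarrow>xs. \<phi> x)\<^sup>2))"
    unfolding sum_tuples_Suc
    by (intro sum.cong refl) (simp add: algebra_simps power2_eq_square)
  also have "\<dots> = (\<Sum>e\<in>E. q e * (\<phi> e)\<^sup>2) * (\<Sum>xs\<in>tuples E L. weight q xs)
      + (\<Sum>e\<in>E. 2 * (q e * \<phi> e)) * (\<Sum>xs\<in>tuples E L. weight q xs * (\<Sum>x\<leftarrow>xs. \<phi> x))
      + (\<Sum>e\<in>E. q e) * (\<Sum>xs\<in>tuples E L. weight q xs * (\<Sum>x\<leftarrow>xs. \<phi> x)\<^sup>2)"
    unfolding sum.distrib sum_distrib_left[symmetric] sum_distrib_right[symmetric] ..
  finally show ?case using Suc assms sum_weight[OF assms(1), of L] sum_weight_linear[OF assms, of L]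
    by (simp add: algebra_simps)
qed simp

text \<open>The keys of an independent sample form an independent sample of the marginal
  \<open>\<nu>\<close>. The right-hand side depends on \<open>q\<close> only through
  \<open>\<nu>\<close>, and this lets different laws share one tuple of keys.\<close>

lemma sum_weight_map:
  assumes "finite E" and \<nu>: "\<And>k. (\<Sum>e\<in>{e\<in>E. key e = k}. q e) = \<nu> k"
  shows "(\<Sum>xs\<in>{xs\<in>tuples E (length ks). map key xs = ks}. weight q xs) = weight \<nu> ks"
proof (induction ks)
  case Nil
  have "{xs\<in>tuples E 0. map key xs = []} = {[]}" by auto
  then show ?case by simp
next
  case (Cons k ks)
  let ?A = "{e\<in>E. key e = k}" and ?B = "{xs\<in>tuples E (length ks). map key xs = ks}"
  have "{xs\<in>tuples E (length (k # ks)). map key xs = k # ks} = (\<lambda>p. fst p # snd p) ` (?A \<times> ?B)"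
    by (auto simp: tuples_Suc image_iff)
  moreover have "inj_on (\<lambda>p. fst p # snd p) (?A \<times> ?B)" by (auto simp: inj_on_def prod_eq_iff)
  ultimately have "(\<Sum>xs\<in>{xs\<in>tuples E (length (k # ks)). map key xs = k # ks}. weight q xs)
      = (\<Sum>e\<in>?A. \<Sum>xs\<in>?B. q e * weight q xs)"
    by (simp add: sum.reindex sum.cartesian_product case_prod_beta)
  also have "\<dots> = (\<Sum>e\<in>?A. q e) * (\<Sum>xs\<in>?B. weight q xs)"
    by (simp only: sum_distrib_left[symmetric] sum_distrib_right[symmetric])
  finally show ?case using Cons \<nu> by simp
qed

lemma card_tuples_map_le:
  assumes "finite E" and m: "\<And>k. card {e\<in>E. key e = k} \<le> m"
  shows "card {xs\<in>tuples E (length ks). map key xs = ks} \<le> m ^ length ks"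
proof (induction ks)
  case Nil
  have "{xs\<in>tuples E 0. map key xs = []} = {[]}" by auto
  then show ?case by simp
next
  case (Cons k ks)
  let ?A = "{e\<in>E. key e = k}" and ?B = "{xs\<in>tuples E (length ks). map key xs = ks}"
  have "{xs\<in>tuples E (length (k # ks)). map key xs = k # ks} = (\<lambda>p. fst p # snd p) ` (?A \<times> ?B)"
    by (auto simp: tuples_Suc image_iff)
  moreover have "finite (?A \<times> ?B)" using assms(1) finite_tuples[OF assms(1)] by simp
  ultimately have "card {xs\<in>tuples E (length (k # ks)). map key xs = k # ks} \<le> card (?A \<times> ?B)"
    by (simp only: card_image_le)
  also have "\<dots> \<le> m * m ^ length ks"
    unfolding card_cartesian_product using m Cons by (intro mult_mono) auto
  finally show ?case by simp
qed

definition sample_error :: "'s set \<Rightarrow> ('s \<Rightarrow> 'e \<Rightarrow> real) \<Rightarrow> ('s \<Rightarrow> real) \<Rightarrow> 'e list \<Rightarrow> real" where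
  "sample_error W h v xs = (\<Sum>s\<in>W. ((\<Sum>x\<leftarrow>xs. h s x) / real (length xs) - v s)\<^sup>2)"

lemma sum_list_minus_const: "(\<Sum>x\<leftarrow>xs. f x - (c::real)) = (\<Sum>x\<leftarrow>xs. f x) - real (length xs) * c"
  by (induction xs) (simp_all add: algebra_simps)

text \<open>Chebyshev's argument summed over \<open>W\<close>: values in \<open>[0, 1]\<close> have
  variance at most 1, so each empirical mean has mean square error at most \<open>1 / L\<close> and
  the expected total error is at most \<open>card W / L\<close>. Markov's inequality at twice this
  value leaves mass one half.\<close>

lemma good_samples_weight:
  assumes E: "finite E" and W: "finite W" and L: "L > 0"
    and q: "\<And>e. e \<in> E \<Longrightarrow> 0 \<le> q e" "(\<Sum>e\<in>E. q e) = (1::real)"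
    and h: "\<And>s e. s \<in> W \<Longrightarrow> e \<in> E \<Longrightarrow> 0 \<le> h s e \<and> h s e \<le> 1"
  shows "1 / 2 \<le> (\<Sum>xs\<in>{xs\<in>tuples E L. sample_error W h (\<lambda>s. \<Sum>e\<in>E. q e * h s e) xs \<le> 2 * card W / L}.
                    weight q xs)"
proof -
  define v where "v s = (\<Sum>e\<in>E. q e * h s e)" for s
  let ?err = "sample_error W h v"
  let ?G = "{xs\<in>tuples E L. ?err xs \<le> 2 * card W / L}"
  have v: "0 \<le> v s \<and> v s \<le> 1" if "s \<in> W" for s
  proof
    show "0 \<le> v s" unfolding v_def using q h that by (intro sum_nonneg) auto
    have "v s \<le> (\<Sum>e\<in>E. q e)" unfolding v_def
      using q h that by (intro sum_mono) (auto simp: mult_left_le)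
    then show "v s \<le> 1" using q by simp
  qed
  have "(\<Sum>xs\<in>tuples E L. weight q xs * ?err xs)
      = (\<Sum>s\<in>W. (\<Sum>xs\<in>tuples E L. weight q xs * (\<Sum>x\<leftarrow>xs. h s x - v s)\<^sup>2) / (real L)\<^sup>2)"
  proof -
    have "weight q xs * ?err xs = (\<Sum>s\<in>W. weight q xs * (\<Sum>x\<leftarrow>xs. h s x - v s)\<^sup>2 / (real L)\<^sup>2)"
      if "xs \<in> tuples E L" for xs
    proof -
      have len: "length xs = L" using that by (simp add: tuples_def)
      have "((\<Sum>x\<leftarrow>xs. h s x) / real L - v s)\<^sup>2 = (\<Sum>x\<leftarrow>xs. h s x - v s)\<^sup>2 / (real L)\<^sup>2" for s
      proof -
        have "(\<Sum>x\<leftarrow>xs. h s x) / real L - v s = (\<Sum>x\<leftarrow>xs. h s x - v s) / real L"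
          using L by (simp add: sum_list_minus_const len field_simps)
        then show ?thesis by (simp add: power_divide)
      qed
      then have "?err xs = (\<Sum>s\<in>W. (\<Sum>x\<leftarrow>xs. h s x - v s)\<^sup>2 / (real L)\<^sup>2)"
        unfolding sample_error_def len by (intro sum.cong refl)
      then show ?thesis by (simp only: sum_distrib_left times_divide_eq_right)
    qed
    then have "(\<Sum>xs\<in>tuples E L. weight q xs * ?err xs)
        = (\<Sum>xs\<in>tuples E L. \<Sum>s\<in>W. weight q xs * (\<Sum>x\<leftarrow>xs. h s x - v s)\<^sup>2 / (real L)\<^sup>2)"
      by (intro sum.cong refl)
    also have "\<dots> = (\<Sum>s\<in>W. \<Sum>xs\<in>tuples E L. weight q xs * (\<Sum>x\<leftarrow>xs. h s x - v s)\<^sup>2 / (real L)\<^sup>2)"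
      by (rule sum.swap)
    finally show ?thesis by (simp only: sum_divide_distrib)
  qed
  also have "\<dots> \<le> (\<Sum>s\<in>W. 1 / real L)"
  proof (rule sum_mono)
    fix s assume s: "s \<in> W"
    have 0: "(\<Sum>e\<in>E. q e * (h s e - v s)) = 0"
    proof -
      have "(\<Sum>e\<in>E. q e * (h s e - v s)) = (\<Sum>e\<in>E. q e * h s e) - (\<Sum>e\<in>E. q e) * v s"
        by (simp add: right_diff_distrib sum_subtractf sum_distrib_right)
      then show ?thesis using q by (simp add: v_def)
    qed
    have "(\<Sum>e\<in>E. q e * (h s e - v s)\<^sup>2) \<le> (\<Sum>e\<in>E. q e)"
    proof (rule sum_mono)
      fix e assume e: "e \<in> E"
      have "\<bar>h s e - v s\<bar> \<le> 1" using h[OF s e] v[OF s] by auto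
      then have "(h s e - v s)\<^sup>2 \<le> 1" by (simp add: abs_square_le_1)
      then show "q e * (h s e - v s)\<^sup>2 \<le> q e" using q e by (simp add: mult_left_le)
    qed
    then have "real L * (\<Sum>e\<in>E. q e * (h s e - v s)\<^sup>2) \<le> real L" using q by (simp add: mult_left_le)
    then show "(\<Sum>xs\<in>tuples E L. weight q xs * (\<Sum>x\<leftarrow>xs. h s x - v s)\<^sup>2) / (real L)\<^sup>2 \<le> 1 / real L"
      unfolding sum_weight_square[OF q(2) 0] using L by (simp add: field_simps power2_eq_square)
  qed
  finally have tot: "(\<Sum>xs\<in>tuples E L. weight q xs * ?err xs) \<le> real (card W) / L" by simp
  have split: "(\<Sum>xs\<in>tuples E L. weight q xs) = (\<Sum>xs\<in>?G. weight q xs) + (\<Sum>xs\<in>tuples E L - ?G. weight q xs)"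
    using finite_tuples[OF E] by (subst sum.subset_diff[of ?G]) auto
  \<comment> \<open>Markov's inequality divides by \<open>2 * card W / L\<close>; for empty
    \<open>W\<close> every sample is good.\<close>
  have bad: "(\<Sum>xs\<in>tuples E L - ?G. weight q xs) \<le> 1 / 2"
  proof (cases "W = {}")
    case True
    then have "tuples E L - ?G = {}" by (auto simp: sample_error_def)
    then show ?thesis by (simp only: sum.empty)
  next
    case False
    then have cW: "real (card W) > 0" using W by (simp add: card_gt_0_iff)
    have "(\<Sum>xs\<in>tuples E L - ?G. weight q xs) * (2 * card W / L)
        = (\<Sum>xs\<in>tuples E L - ?G. weight q xs * (2 * card W / L))" by (rule sum_distrib_right)
    also have "\<dots> \<le> (\<Sum>xs\<in>tuples E L - ?G. weight q xs * ?err xs)"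
      by (intro sum_mono mult_left_mono) (auto intro: weight_nonneg[where E = E] q)
    also have "\<dots> \<le> (\<Sum>xs\<in>tuples E L. weight q xs * ?err xs)"
    proof (rule sum_mono2)
      fix xs assume "xs \<in> tuples E L - (tuples E L - ?G)"
      then show "0 \<le> weight q xs * ?err xs"
        by (intro mult_nonneg_nonneg weight_nonneg[where E = E and L = L] q)
           (auto simp: sample_error_def intro!: sum_nonneg)
    qed (use finite_tuples[OF E] in auto)
    finally have le: "(\<Sum>xs\<in>tuples E L - ?G. weight q xs) * (2 * card W / L) \<le> real (card W) / L"
      using tot by linarith
    have "b \<le> 1 / 2" if "b * (2 * card W / L) \<le> real (card W) / L" for b :: real
      using that cW L by (simp add: field_simps)
    from this[OF le] show ?thesis .
  qed
  have "1 / 2 \<le> (\<Sum>xs\<in>?G. weight q xs)" using split bad sum_weight[OF q(2), of L] by linarith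
  then show ?thesis unfolding v_def .
qed

text \<open>
  The weight of a tuple of keys is the same for all \<open>\<tau>\<close>, so one tuple of keys serves at least half of
  the \<open>\<tau>\<close>; over that tuple only \<open>m ^ L\<close> samples exist.
\<close>

lemma few_samples_suffice:
  fixes q :: "'t \<Rightarrow> 'e \<Rightarrow> real" and h :: "'s \<Rightarrow> 'e \<Rightarrow> real"
  assumes E: "finite E" and \<Theta>: "finite \<Theta>" and W: "finite W" and L: "L > 0"
    and q: "\<And>\<tau> e. \<tau> \<in> \<Theta> \<Longrightarrow> e \<in> E \<Longrightarrow> 0 \<le> q \<tau> e" "\<And>\<tau>. \<tau> \<in> \<Theta> \<Longrightarrow> (\<Sum>e\<in>E. q \<tau> e) = 1"
    and \<nu>: "\<And>\<tau> k. \<tau> \<in> \<Theta> \<Longrightarrow> (\<Sum>e\<in>{e\<in>E. key e = k}. q \<tau> e) = \<nu> k"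
    and m: "\<And>k. card {e\<in>E. key e = k} \<le> m"
    and h: "\<And>s e. s \<in> W \<Longrightarrow> e \<in> E \<Longrightarrow> 0 \<le> h s e \<and> h s e \<le> 1"
  shows "\<exists>V \<subseteq> tuples E L. card V \<le> m ^ L \<and>
    card \<Theta> \<le> 2 * card {\<tau>\<in>\<Theta>. \<exists>xs\<in>V. sample_error W h (\<lambda>s. \<Sum>e\<in>E. q \<tau> e * h s e) xs \<le> 2 * card W / L}"
proof (cases "\<Theta> = {}")
  case True
  then show ?thesis by (intro exI[of _ "{}"]) auto
next
  case False
  then obtain \<tau>0 where \<tau>0: "\<tau>0 \<in> \<Theta>" by blast
  define good where "good \<tau> xs \<longleftrightarrow> sample_error W h (\<lambda>s. \<Sum>e\<in>E. q \<tau> e * h s e) xs \<le> 2 * card W / L" for \<tau> xs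
  define V where "V ks = {xs\<in>tuples E L. map key xs = ks}" for ks
  define K where "K = tuples (key ` E) L"
  define g where "g ks = {\<tau>\<in>\<Theta>. \<exists>xs\<in>V ks. good \<tau> xs}" for ks
  have finK: "finite K" unfolding K_def using E by (intro finite_tuples) auto
  have mapK: "map key xs \<in> K" if "xs \<in> tuples E L" for xs
    using that unfolding K_def tuples_def by auto
  have wV: "(\<Sum>xs\<in>V ks. weight (q \<tau>) xs) = weight \<nu> ks" if "\<tau> \<in> \<Theta>" "ks \<in> K" for \<tau> ks
  proof -
    have "length ks = L" using that by (simp add: K_def tuples_def)
    then show ?thesis unfolding V_def using sum_weight_map[OF E \<nu>[OF that(1)], of ks] by simp
  qed
  have \<nu>0: "weight \<nu> ks \<ge> 0" if "ks \<in> K" for ks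
    unfolding wV[OF \<tau>0 that, symmetric] V_def
    by (intro sum_nonneg weight_nonneg[where E = E and L = L] q) (auto simp: \<tau>0)
  have group: "(\<Sum>xs\<in>tuples E L. f xs) = (\<Sum>ks\<in>K. \<Sum>xs\<in>V ks. f xs)" for f :: "'e list \<Rightarrow> real"
    unfolding V_def using sum.group[of "tuples E L" K "map key" f] finite_tuples[OF E] finK mapK
    by (auto simp: image_subset_iff)
  have \<nu>1: "(\<Sum>ks\<in>K. weight \<nu> ks) = 1"
    using group[of "weight (q \<tau>0)"] wV[OF \<tau>0] sum_weight[OF q(2)[OF \<tau>0], of L] by simp
  have half: "1 / 2 \<le> (\<Sum>ks\<in>K. weight \<nu> ks * (if \<tau> \<in> g ks then 1 else 0))" if \<tau>: "\<tau> \<in> \<Theta>" for \<tau>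
  proof -
    have "1 / 2 \<le> (\<Sum>xs\<in>{xs\<in>tuples E L. good \<tau> xs}. weight (q \<tau>) xs)"
      unfolding good_def using good_samples_weight[OF E W L q(1)[OF \<tau>] q(2)[OF \<tau>] h] .
    also have "\<dots> = (\<Sum>xs\<in>tuples E L. if good \<tau> xs then weight (q \<tau>) xs else 0)"
      using finite_tuples[OF E] by (simp add: sum.inter_filter)
    also have "\<dots> = (\<Sum>ks\<in>K. \<Sum>xs\<in>V ks. if good \<tau> xs then weight (q \<tau>) xs else 0)"
      by (rule group)
    also have "\<dots> \<le> (\<Sum>ks\<in>K. weight \<nu> ks * (if \<tau> \<in> g ks then 1 else 0))"
    proof (rule sum_mono)
      fix ks assume ks: "ks \<in> K"
      show "(\<Sum>xs\<in>V ks. if good \<tau> xs then weight (q \<tau>) xs else 0)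
          \<le> weight \<nu> ks * (if \<tau> \<in> g ks then 1 else 0)"
      proof (cases "\<tau> \<in> g ks")
        case True
        have "(\<Sum>xs\<in>V ks. if good \<tau> xs then weight (q \<tau>) xs else 0) \<le> (\<Sum>xs\<in>V ks. weight (q \<tau>) xs)"
          by (intro sum_mono) (auto simp: V_def intro: weight_nonneg[where E = E] q \<tau>)
        then show ?thesis using True wV[OF \<tau> ks] by simp
      next
        case False
        then have "(\<Sum>xs\<in>V ks. if good \<tau> xs then weight (q \<tau>) xs else 0) = 0"
          using \<tau> by (intro sum.neutral) (auto simp: g_def)
        then show ?thesis using False by simp
      qed
    qed
    finally show ?thesis .
  qed
  have "\<exists>ks\<in>K. card \<Theta> \<le> 2 * card (g ks)"
  proof (rule ccontr)
    assume "\<not> ?thesis"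
    \<comment> \<open>Integrality turns the strict inequality into a gap of 1, so averaging over
      \<open>K\<close> contradicts \<open>half\<close> even though some tuples of keys may have
      weight 0.\<close>
    then have neg: "2 * real (card (g ks)) \<le> real (card \<Theta>) - 1" if "ks \<in> K" for ks
      using that by fastforce
    have gsub: "g ks \<subseteq> \<Theta>" for ks by (auto simp: g_def)
    have "real (card \<Theta>) / 2 = (\<Sum>\<tau>\<in>\<Theta>. 1 / 2)" by simp
    also have "\<dots> \<le> (\<Sum>\<tau>\<in>\<Theta>. \<Sum>ks\<in>K. weight \<nu> ks * (if \<tau> \<in> g ks then 1 else 0))"
      using half by (rule sum_mono)
    also have "\<dots> = (\<Sum>ks\<in>K. weight \<nu> ks * (\<Sum>\<tau>\<in>\<Theta>. if \<tau> \<in> g ks then 1 else 0))"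
      by (subst sum.swap) (simp only: sum_distrib_left)
    also have "\<dots> = (\<Sum>ks\<in>K. weight \<nu> ks * real (card (g ks)))"
      using \<Theta> gsub by (intro sum.cong refl) (simp add: sum.If_cases Int_absorb1)
    also have "\<dots> \<le> (\<Sum>ks\<in>K. weight \<nu> ks * ((real (card \<Theta>) - 1) / 2))"
    proof (intro sum_mono mult_left_mono)
      fix ks assume "ks \<in> K"
      then show "real (card (g ks)) \<le> (real (card \<Theta>) - 1) / 2" "0 \<le> weight \<nu> ks"
        using neg[of ks] \<nu>0[of ks] by auto
    qed
    also have "\<dots> = (real (card \<Theta>) - 1) / 2"
      by (simp only: sum_distrib_right[symmetric] \<nu>1 mult_1)
    finally show False by simp
  qed
  then obtain ks where ks: "ks \<in> K" "card \<Theta> \<le> 2 * card (g ks)" by blast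
  have "card (V ks) \<le> m ^ L"
    using card_tuples_map_le[OF E m, of ks] ks(1) unfolding V_def K_def tuples_def by simp
  moreover have "V ks \<subseteq> tuples E L" by (auto simp: V_def)
  ultimately show ?thesis using ks(2) unfolding g_def good_def by blast
qed

section \<open>The Ornstein--Weiss lemma\<close>

context group begin

text \<open>The boundary of \<open>A\<close> with respect to left multiplication by
  \<open>K\<close>. If \<open>c\<close> is in \<open>A\<close> but not bad for \<open>T\<close>,
  then \<open>A\<close> contains the whole translate \<open>rtrans T c\<close>; this is why tiles
  are right translates while Folner sets are invariant on the left.\<close>

definition bad_points :: "'a set \<Rightarrow> 'a set \<Rightarrow> 'a set" where
  "bad_points K A = {a\<in>A. \<exists>k\<in>K. k \<otimes> a \<notin> A}"

definition rtrans :: "'a set \<Rightarrow> 'a \<Rightarrow> 'a set" where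
  "rtrans A c = (\<lambda>a. a \<otimes> c) ` A"

lemma finite_rtrans: "finite A \<Longrightarrow> finite (rtrans A c)"
  by (simp add: rtrans_def)

lemma rtrans_closed: "A \<subseteq> carrier G \<Longrightarrow> c \<in> carrier G \<Longrightarrow> rtrans A c \<subseteq> carrier G"
  by (auto simp: rtrans_def)

lemma card_rtrans: "A \<subseteq> carrier G \<Longrightarrow> c \<in> carrier G \<Longrightarrow> card (rtrans A c) = card A"
  unfolding rtrans_def by (intro card_image inj_onI) (auto simp: subset_iff)

lemma card_bad_points_le:
  assumes "finite K"
  shows "card (bad_points K A) \<le> (\<Sum>k\<in>K. card {a\<in>A. k \<otimes> a \<notin> A})"
proof -
  have "bad_points K A = (\<Union>k\<in>K. {a\<in>A. k \<otimes> a \<notin> A})" by (auto simp: bad_points_def)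
  then show ?thesis using card_UN_le[OF assms] by simp
qed

section \<open>Almost invariance of Folner sets\<close>

lemma folner_finite_subsets: "folner_sequence G F \<Longrightarrow> F n \<subseteq> carrier G \<and> finite (F n) \<and> F n \<noteq> {}"
  by (auto simp: folner_sequence_def finite_subsets_def)

lemma folner_translate:
  assumes F: "folner_sequence G F" and k: "k \<in> carrier G" and \<kappa>: "\<kappa> > 0"
  shows "\<forall>\<^sub>F n in sequentially. real (card {a\<in>F n. k \<otimes> a \<notin> F n}) \<le> \<kappa> * real (card (F n))"
proof -
  have "(\<lambda>n. real (card ((F n - (k <#\<^bsub>G\<^esub> F n)) \<union> ((k <#\<^bsub>G\<^esub> F n) - F n))) / real (card (F n))) \<longlonglongrightarrow> 0"
    using F k by (simp add: folner_sequence_def)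
  then have "\<forall>\<^sub>F n in sequentially.
      real (card ((F n - (k <#\<^bsub>G\<^esub> F n)) \<union> ((k <#\<^bsub>G\<^esub> F n) - F n))) / real (card (F n)) < \<kappa>"
    using \<kappa> by (rule order_tendstoD)
  then show ?thesis
  proof eventually_elim
    case (elim n)
    have Fn: "F n \<subseteq> carrier G" "finite (F n)" "card (F n) > 0"
      using folner_finite_subsets[OF F, of n] by (auto simp: card_gt_0_iff)
    have sub: "(\<lambda>a. k \<otimes> a) ` {a\<in>F n. k \<otimes> a \<notin> F n} \<subseteq> (k <#\<^bsub>G\<^esub> F n) - F n"
      by (auto simp: l_coset_def)
    have fin: "finite (k <#\<^bsub>G\<^esub> F n)" using Fn by (simp add: l_coset_def)
    have "inj_on (\<lambda>a. k \<otimes> a) {a\<in>F n. k \<otimes> a \<notin> F n}"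
      using Fn k by (intro inj_onI) (auto simp: subset_iff)
    then have "card {a\<in>F n. k \<otimes> a \<notin> F n} = card ((\<lambda>a. k \<otimes> a) ` {a\<in>F n. k \<otimes> a \<notin> F n})"
      by (simp add: card_image)
    also have "\<dots> \<le> card ((F n - (k <#\<^bsub>G\<^esub> F n)) \<union> ((k <#\<^bsub>G\<^esub> F n) - F n))"
      using sub fin Fn by (intro card_mono) auto
    finally have "real (card {a\<in>F n. k \<otimes> a \<notin> F n})
        \<le> real (card ((F n - (k <#\<^bsub>G\<^esub> F n)) \<union> ((k <#\<^bsub>G\<^esub> F n) - F n)))" by simp
    also have "\<dots> \<le> \<kappa> * real (card (F n))" using elim Fn by (simp add: divide_less_eq)
    finally show ?case .
  qed
qed

lemma folner_bad_points:
  assumes F: "folner_sequence G F" and K: "K \<subseteq> carrier G" "finite K" and \<kappa>: "\<kappa> > 0"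
  shows "\<forall>\<^sub>F n in sequentially. real (card (bad_points K (F n))) \<le> \<kappa> * real (card (F n))"
proof -
  have "\<kappa> / (real (card K) + 1) > 0" using \<kappa> by simp
  then have "\<forall>\<^sub>F n in sequentially. \<forall>k\<in>K.
      real (card {a\<in>F n. k \<otimes> a \<notin> F n}) \<le> \<kappa> / (real (card K) + 1) * real (card (F n))"
    using folner_translate[OF F _ \<open>\<kappa> / (real (card K) + 1) > 0\<close>] K by (intro eventually_ball_finite) auto
  then show ?thesis
  proof eventually_elim
    case (elim n)
    have "real (card (bad_points K (F n))) \<le> (\<Sum>k\<in>K. real (card {a\<in>F n. k \<otimes> a \<notin> F n}))"
      using card_bad_points_le[OF K(2), of "F n"] by (simp flip: of_nat_sum)
    also have "\<dots> \<le> (\<Sum>k\<in>K. \<kappa> / (real (card K) + 1) * real (card (F n)))"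
      using elim by (intro sum_mono) auto
    also have "\<dots> = (real (card K) / (real (card K) + 1)) * (\<kappa> * real (card (F n)))" by simp
    also have "\<dots> \<le> 1 * (\<kappa> * real (card (F n)))" using \<kappa> by (intro mult_right_mono) auto
    finally show ?case by simp
  qed
qed

text \<open>A point \<open>a\<close> that is not bad for an \<open>N\<close>-element set
  \<open>K\<close> carries a full translate \<open>rtrans K a\<close> inside
  \<open>F n\<close>.\<close>

lemma folner_card_at_top:
  assumes F: "folner_sequence G F" and inf: "infinite (carrier G)"
  shows "\<forall>\<^sub>F n in sequentially. N \<le> card (F n)"
proof -
  obtain K where K: "K \<subseteq> carrier G" "finite K" "card K = N"
    using infinite_arbitrarily_large[OF inf] by blast
  show ?thesis
    using folner_bad_points[OF F K(1,2), of "1/2", simplified]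
  proof eventually_elim
    case (elim n)
    have Fn: "F n \<subseteq> carrier G" "finite (F n)" "card (F n) > 0"
      using folner_finite_subsets[OF F, of n] by (auto simp: card_gt_0_iff)
    have "bad_points K (F n) \<noteq> F n"
    proof
      assume "bad_points K (F n) = F n"
      then show False using elim Fn by simp
    qed
    then obtain a where a: "a \<in> F n" "\<forall>k\<in>K. k \<otimes> a \<in> F n" by (auto simp: bad_points_def)
    then have "rtrans K a \<subseteq> F n" by (auto simp: rtrans_def)
    then have "card (rtrans K a) \<le> card (F n)" using Fn by (intro card_mono) auto
    moreover have "a \<in> carrier G" using a Fn by blast
    ultimately show ?case using card_rtrans[of K a] K by simp
  qed
qed

text \<open>Double counting: for fixed \<open>k\<close>, every \<open>w\<close> in \<open>W\<close>
  is of the form \<open>k \<otimes> a\<close> with \<open>a\<close> in \<open>A\<close>, up to the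
  few points that \<open>inv k\<close> moves out of \<open>A\<close>. Used to find translates of
  \<open>T\<close> that meet \<open>W\<close> in a definite proportion.\<close>

lemma sum_hits_ge:
  assumes A: "A \<subseteq> carrier G" "finite A" and T: "T \<subseteq> carrier G" "finite T" and W: "W \<subseteq> A"
    and inv: "\<And>k. k \<in> T \<Longrightarrow> real (card {a\<in>A. inv k \<otimes> a \<notin> A}) \<le> \<kappa> * real (card A)"
    and c: "c * real (card A) \<le> real (card W)"
  shows "(c - \<kappa>) * real (card A) * real (card T) \<le> (\<Sum>a\<in>A. real (card {k\<in>T. k \<otimes> a \<in> W}))"
proof -
  have finW: "finite W" using W A(2) by (rule finite_subset)
  have each: "(c - \<kappa>) * real (card A) \<le> real (card {a\<in>A. k \<otimes> a \<in> W})" if k: "k \<in> T" for k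
  proof -
    have kG: "k \<in> carrier G" using k T by blast
    have "W \<subseteq> (\<lambda>a. k \<otimes> a) ` {a\<in>A. k \<otimes> a \<in> W} \<union> {a\<in>A. inv k \<otimes> a \<notin> A}"
    proof
      fix w assume w: "w \<in> W"
      then have wA: "w \<in> A" "w \<in> carrier G" using W A by auto
      have "w = k \<otimes> (inv k \<otimes> w)" using kG wA by (simp add: m_assoc[symmetric])
      then show "w \<in> (\<lambda>a. k \<otimes> a) ` {a\<in>A. k \<otimes> a \<in> W} \<union> {a\<in>A. inv k \<otimes> a \<notin> A}"
        using w wA by (cases "inv k \<otimes> w \<in> A") auto
    qed
    then have "card W \<le> card ((\<lambda>a. k \<otimes> a) ` {a\<in>A. k \<otimes> a \<in> W} \<union> {a\<in>A. inv k \<otimes> a \<notin> A})"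
      using A by (intro card_mono) auto
    also have "\<dots> \<le> card ((\<lambda>a. k \<otimes> a) ` {a\<in>A. k \<otimes> a \<in> W}) + card {a\<in>A. inv k \<otimes> a \<notin> A}"
      by (rule card_Un_le)
    also have "card ((\<lambda>a. k \<otimes> a) ` {a\<in>A. k \<otimes> a \<in> W}) \<le> card {a\<in>A. k \<otimes> a \<in> W}"
      using A by (intro card_image_le) auto
    finally have "real (card W) \<le> real (card {a\<in>A. k \<otimes> a \<in> W}) + \<kappa> * real (card A)"
      using inv[OF k] by linarith
    then show ?thesis using c by (simp add: algebra_simps)
  qed
  have "(c - \<kappa>) * real (card A) * real (card T) = (\<Sum>k\<in>T. (c - \<kappa>) * real (card A))" by simp
  also have "\<dots> \<le> (\<Sum>k\<in>T. real (card {a\<in>A. k \<otimes> a \<in> W}))" using each by (rule sum_mono)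
  also have "\<dots> = (\<Sum>k\<in>T. \<Sum>a\<in>A. if k \<otimes> a \<in> W then 1 else 0)"
    using A by (intro sum.cong refl) (simp add: sum.If_cases Int_def)
  also have "\<dots> = (\<Sum>a\<in>A. \<Sum>k\<in>T. if k \<otimes> a \<in> W then 1 else 0)" by (rule sum.swap)
  also have "\<dots> = (\<Sum>a\<in>A. real (card {k\<in>T. k \<otimes> a \<in> W}))"
    using T by (intro sum.cong refl) (simp add: sum.If_cases Int_def)
  finally show ?thesis .
qed

text \<open>
  A maximal family of almost disjoint translates of \<open>T\<close> inside \<open>A\<close>: every further translate meets the
  union in more than \<open>\<epsilon> |T|\<close> points, and each point of the union is counted at most \<open>|T|\<close> times.
\<close>

lemma almost_disjoint_translates:
  assumes A: "A \<subseteq> carrier G" "finite A" and T: "T \<subseteq> carrier G" "finite T" "T \<noteq> {}"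
    and \<epsilon>: "0 < \<epsilon>" "\<epsilon> < 1"
    and inv: "real (card (bad_points T A)) \<le> real (card A) / 2"
  obtains C where "C \<subseteq> A" "\<And>c. c \<in> C \<Longrightarrow> rtrans T c \<subseteq> A"
    "real (card C) * real (card T) * (1 - \<epsilon>) \<le> real (card (\<Union>c\<in>C. rtrans T c))"
    "\<epsilon> / 2 * real (card A) \<le> real (card (\<Union>c\<in>C. rtrans T c))"
proof -
  let ?I = "A - bad_points T A"
  let ?U = "\<lambda>C. \<Union>c\<in>C. rtrans T c"
  define \<F> where "\<F> = {C. C \<subseteq> ?I \<and> real (card C) * real (card T) * (1 - \<epsilon>) \<le> real (card (?U C))}"
  have "{} \<in> \<F>" by (simp add: \<F>_def)
  moreover have fin\<F>: "finite \<F>" using A by (intro finite_subset[of \<F> "Pow A"]) (auto simp: \<F>_def)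
  ultimately obtain C where C: "C \<in> \<F>" "\<forall>C'\<in>\<F>. C \<subseteq> C' \<longrightarrow> C = C'"
    using finite_has_maximal2[OF fin\<F>, of "{}"] by auto
  have finC: "finite C" using C(1) A by (auto simp: \<F>_def intro: finite_subset)
  have finU: "finite (?U C)" using finC T by (intro finite_UN_I finite_rtrans) auto
  have CI: "C \<subseteq> ?I" using C(1) by (simp add: \<F>_def)
  have hit: "\<epsilon> * real (card T) \<le> real (card (rtrans T c \<inter> ?U C))" if c: "c \<in> ?I" for c
  proof (cases "c \<in> C")
    case True
    then have "rtrans T c \<inter> ?U C = rtrans T c" by blast
    moreover have "c \<in> carrier G" using c A by blast
    ultimately show ?thesis using card_rtrans[OF T(1)] \<epsilon> by (simp add: mult_left_le_one_le)
  next
    case False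
    show ?thesis
    proof (rule ccontr)
      assume neg: "\<not> ?thesis"
      have cG: "c \<in> carrier G" using c A by blast
      have "card (rtrans T c) = card (rtrans T c \<inter> ?U C) + card (rtrans T c - ?U C)"
        using T finU by (subst card_Un_disjoint[symmetric]) (auto intro: finite_rtrans arg_cong[where f = card])
      then have "(1 - \<epsilon>) * real (card T) \<le> real (card (rtrans T c - ?U C))"
        using neg card_rtrans[OF T(1) cG] by (simp add: algebra_simps)
      moreover have "card (?U (insert c C)) = card (?U C) + card (rtrans T c - ?U C)"
        using finU T by (subst card_Un_disjoint[symmetric]) (auto intro: finite_rtrans arg_cong[where f = card])
      ultimately have "insert c C \<in> \<F>"
        using C(1) c False finC by (simp add: \<F>_def algebra_simps)
      then show False using C(2) False by blast
    qed
  qed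
  have "\<epsilon> * real (card T) * real (card ?I) \<le> (\<Sum>c\<in>?I. real (card (rtrans T c \<inter> ?U C)))"
    using sum_mono[of ?I "\<lambda>_. \<epsilon> * real (card T)", OF hit] by (simp add: mult.commute)
  also have "\<dots> = real (card (SIGMA c:?I. rtrans T c \<inter> ?U C))"
    using A T by (subst card_SigmaI) (auto intro: finite_rtrans)
  also have "card (SIGMA c:?I. rtrans T c \<inter> ?U C) \<le> card (T \<times> ?U C)"
  proof (rule card_inj_on_le[of "\<lambda>(c, u). (u \<otimes> inv c, u)"])
    show "inj_on (\<lambda>(c, u). (u \<otimes> inv c, u)) (SIGMA c:?I. rtrans T c \<inter> ?U C)"
    proof (rule inj_onI, clarsimp)
      fix c u c'
      assume u: "u \<in> rtrans T c" "u \<in> rtrans T c'" and c: "c \<in> A" "c' \<in> A" and eq: "u \<otimes> inv c = u \<otimes> inv c'"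
      have "c \<in> carrier G" "c' \<in> carrier G" using c A by auto
      moreover have "u \<in> carrier G" using u(1) calculation(1) T by (auto simp: rtrans_def)
      ultimately show "c = c'" using eq by (simp add: inv_eq_1_iff) (metis inv_inv)
    qed
    show "(\<lambda>(c, u). (u \<otimes> inv c, u)) ` (SIGMA c:?I. rtrans T c \<inter> ?U C) \<subseteq> T \<times> ?U C"
    proof clarsimp
      fix c u c' assume c: "c \<in> A" and u: "u \<in> rtrans T c" "c' \<in> C" "u \<in> rtrans T c'"
      have cG: "c \<in> carrier G" using c A by auto
      obtain t where t: "t \<in> T" "u = t \<otimes> c" using u by (auto simp: rtrans_def)
      then have "u \<otimes> inv c = t" using cG T by (simp add: m_assoc subset_iff)
      then show "u \<otimes> inv c \<in> T \<and> (\<exists>x\<in>C. u \<in> rtrans T x)" using t u by auto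
    qed
  qed (use T finU in auto)
  finally have "\<epsilon> * real (card T) * real (card ?I) \<le> real (card T) * real (card (?U C))"
    by (simp add: card_cartesian_product)
  moreover have "real (card T) > 0" using T by (simp add: card_gt_0_iff)
  ultimately have "\<epsilon> * real (card ?I) \<le> real (card (?U C))" by (simp add: algebra_simps)
  moreover have half: "real (card A) / 2 \<le> real (card ?I)"
  proof -
    have "bad_points T A \<subseteq> A" by (auto simp: bad_points_def)
    then have "card ?I = card A - card (bad_points T A)" "card (bad_points T A) \<le> card A"
      using A by (auto intro: card_Diff_subset card_mono finite_subset)
    then show ?thesis using inv by linarith
  qed
  moreover have "\<epsilon> / 2 * real (card A) = \<epsilon> * (real (card A) / 2)" by simp
  moreover have "\<epsilon> * (real (card A) / 2) \<le> \<epsilon> * real (card ?I)"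
    using half \<epsilon> by (intro mult_left_mono) auto
  ultimately have "\<epsilon> / 2 * real (card A) \<le> real (card (?U C))" by linarith
  moreover have "rtrans T c \<subseteq> A" if "c \<in> C" for c
    using that CI by (auto simp: rtrans_def bad_points_def)
  ultimately show ?thesis using C(1) CI by (intro that[of C]) (auto simp: \<F>_def)
qed

text \<open>A point \<open>a\<close> that becomes bad by removing the translates satisfies
  \<open>k \<otimes> a = t \<otimes> c\<close> for some tile. As \<open>a\<close> itself is not in
  that tile, \<open>inv k \<otimes> t\<close> is not in \<open>T\<close>, so \<open>t\<close> is a
  boundary point of \<open>T\<close>; and \<open>a\<close> is determined by \<open>c\<close>,
  \<open>k\<close> and \<open>t\<close>.\<close>

lemma bad_points_Diff_translates:
  assumes K: "K \<subseteq> carrier G" "finite K" and T: "T \<subseteq> carrier G" "finite T"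
    and C: "C \<subseteq> carrier G" "finite C" and A: "finite A" "A \<subseteq> carrier G"
  shows "card (bad_points K (A - (\<Union>c\<in>C. rtrans T c)))
    \<le> card (bad_points K A) + card C * (card K * card (bad_points ((\<lambda>k. inv k) ` K) T))"
proof -
  let ?U = "\<Union>c\<in>C. rtrans T c"
  let ?B = "bad_points ((\<lambda>k. inv k) ` K) T"
  have finB: "finite ?B" using T by (auto simp: bad_points_def)
  let ?f = "\<lambda>(c, k, t). inv k \<otimes> (t \<otimes> c)"
  have "bad_points K (A - ?U) \<subseteq> bad_points K A \<union> ?f ` (C \<times> K \<times> ?B)"
  proof
    fix a assume a: "a \<in> bad_points K (A - ?U)"
    then obtain k where k: "k \<in> K" "k \<otimes> a \<notin> A - ?U" and aA: "a \<in> A" "a \<notin> ?U"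
      by (auto simp: bad_points_def)
    have G: "a \<in> carrier G" "k \<in> carrier G" using aA A k K by auto
    show "a \<in> bad_points K A \<union> ?f ` (C \<times> K \<times> ?B)"
    proof (cases "k \<otimes> a \<in> A")
      case False
      then show ?thesis using k aA by (auto simp: bad_points_def)
    next
      case True
      then obtain c where c: "c \<in> C" "k \<otimes> a \<in> rtrans T c" using k by blast
      then obtain t where t: "t \<in> T" "k \<otimes> a = t \<otimes> c" by (auto simp: rtrans_def)
      have G': "c \<in> carrier G" "t \<in> carrier G" using c t C T by auto
      have ea: "a = inv k \<otimes> (t \<otimes> c)" using t(2) G by (metis inv_solve_left m_closed G')
      have "inv k \<otimes> t \<notin> T"
      proof
        assume "inv k \<otimes> t \<in> T"
        then have "a \<in> rtrans T c" using ea G G' by (force simp: rtrans_def m_assoc)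
        then show False using aA c by blast
      qed
      then have "t \<in> ?B" using t k by (auto simp: bad_points_def)
      then have "?f (c, k, t) \<in> ?f ` (C \<times> K \<times> ?B)" using c(1) k(1) by (intro imageI) auto
      then show ?thesis using ea by simp
    qed
  qed
  then have "card (bad_points K (A - ?U)) \<le> card (bad_points K A \<union> ?f ` (C \<times> K \<times> ?B))"
    using A K C finB by (intro card_mono) (auto simp: bad_points_def)
  also have "\<dots> \<le> card (bad_points K A) + card (?f ` (C \<times> K \<times> ?B))" by (rule card_Un_le)
  also have "card (?f ` (C \<times> K \<times> ?B)) \<le> card (C \<times> K \<times> ?B)"
    using K C finB by (intro card_image_le) auto
  finally show ?thesis by (simp add: card_cartesian_product)
qed

lemma subadditive_translates_le:
  fixes f :: "'a set \<Rightarrow> real"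
  assumes empty: "f {} = 0"
    and subadd: "\<And>A B. \<lbrakk>A \<subseteq> carrier G; finite A; B \<subseteq> carrier G; finite B\<rbrakk> \<Longrightarrow> f (A \<union> B) \<le> f A + f B"
    and inv: "\<And>A c. \<lbrakk>A \<subseteq> carrier G; finite A; c \<in> carrier G\<rbrakk> \<Longrightarrow> f (rtrans A c) = f A"
    and T: "T \<subseteq> carrier G" "finite T" and "finite C" "C \<subseteq> carrier G"
  shows "f (\<Union>c\<in>C. rtrans T c) \<le> real (card C) * f T"
  using assms(6,7)
proof (induction C rule: finite_induct)
  case (insert c C)
  have "f (\<Union>c\<in>insert c C. rtrans T c) \<le> f (rtrans T c) + f (\<Union>c\<in>C. rtrans T c)"
    unfolding UN_insert
  proof (rule subadd)
    show "rtrans T c \<subseteq> carrier G" "(\<Union>c\<in>C. rtrans T c) \<subseteq> carrier G"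
      using insert T rtrans_closed by blast+
  qed (use insert T finite_rtrans in auto)
  then show ?case using insert inv[OF T] by (simp add: algebra_simps)
qed (simp add: empty)

text \<open>The tiles do not appear. Of a quasi-tiling only its effect is kept, namely the bound for
  \<open>f\<close> on the tiled part \<open>A - B\<close>, so that a further tile can be placed
  before an existing tiling in an induction.\<close>

definition tileable :: "('a set \<Rightarrow> real) \<Rightarrow> real \<Rightarrow> real \<Rightarrow> bool" where
  "tileable f q \<eta> \<longleftrightarrow> (\<exists>K \<kappa>. K \<subseteq> carrier G \<and> finite K \<and> \<kappa> > 0 \<and>
     (\<forall>A. A \<subseteq> carrier G \<and> finite A \<and> real (card (bad_points K A)) \<le> \<kappa> * real (card A) \<longrightarrow>
       (\<exists>B\<subseteq>A. real (card B) \<le> \<eta> * real (card A) \<and> f (A - B) \<le> q * real (card (A - B)))))"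

lemma tileableE:
  assumes "tileable f q \<eta>"
  obtains K \<kappa> where "K \<subseteq> carrier G" "finite K" "\<kappa> > 0"
    "\<And>A. \<lbrakk>A \<subseteq> carrier G; finite A; real (card (bad_points K A)) \<le> \<kappa> * real (card A)\<rbrakk> \<Longrightarrow>
       \<exists>B\<subseteq>A. real (card B) \<le> \<eta> * real (card A) \<and> f (A - B) \<le> q * real (card (A - B))"
  using assms unfolding tileable_def by (elim exE conjE) (rule that, auto)

text \<open>
  Tiling first by a large tile \<open>T\<close> and then the remainder by the previous tiles reduces the untiled part by
  the factor \<open>1 - \<epsilon> / 2\<close>; the remainder stays almost invariant because \<open>T\<close> is.
\<close>

lemma tileable_step:
  fixes f :: "'a set \<Rightarrow> real"
  assumes F: "folner_sequence G F"
    and empty: "f {} = 0"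
    and subadd: "\<And>A B. \<lbrakk>A \<subseteq> carrier G; finite A; B \<subseteq> carrier G; finite B\<rbrakk> \<Longrightarrow> f (A \<union> B) \<le> f A + f B"
    and inv: "\<And>A c. \<lbrakk>A \<subseteq> carrier G; finite A; c \<in> carrier G\<rbrakk> \<Longrightarrow> f (rtrans A c) = f A"
    and freq: "\<exists>\<^sub>F n in sequentially. f (F n) \<le> p * real (card (F n))"
    and \<epsilon>: "0 < \<epsilon>" "\<epsilon> < 1" and p: "p \<ge> 0" and \<eta>: "\<eta> > 0"
    and tile: "tileable f (p / (1 - \<epsilon>)) \<eta>"
  shows "tileable f (p / (1 - \<epsilon>)) (\<eta> * (1 - \<epsilon> / 2))"
proof -
  define q where "q = p / (1 - \<epsilon>)"
  define \<theta> where "\<theta> = \<eta> * (1 - \<epsilon> / 2)"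
  have \<theta>: "\<theta> > 0" using \<epsilon> \<eta> by (simp add: \<theta>_def)
  obtain K \<kappa> where K: "K \<subseteq> carrier G" "finite K" "\<kappa> > 0"
    and til: "\<And>A. \<lbrakk>A \<subseteq> carrier G; finite A; real (card (bad_points K A)) \<le> \<kappa> * real (card A)\<rbrakk> \<Longrightarrow>
       \<exists>B\<subseteq>A. real (card B) \<le> \<eta> * real (card A) \<and> f (A - B) \<le> q * real (card (A - B))"
    using tile unfolding q_def[symmetric] by (elim tileableE) blast
  \<comment> \<open>Invariance demanded of the tile \<open>T\<close> under the inverses of
    \<open>K\<close>. Of the \<open>\<kappa> * \<theta> * card A\<close> bad points that the
    remainder may have, one half is reserved for those of \<open>A\<close> and the other half for
    those created by removing the translates of \<open>T\<close>.\<close>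
  define \<kappa>2 where "\<kappa>2 = \<kappa> * \<theta> * (1 - \<epsilon>) / (2 * (real (card K) + 1))"
  have \<kappa>2: "\<kappa>2 > 0" using K \<theta> \<epsilon> by (simp add: \<kappa>2_def)
  have K\<kappa>2: "real (card K) * \<kappa>2 \<le> \<kappa> * \<theta> * (1 - \<epsilon>) / 2"
  proof -
    have "real (card K) * \<kappa>2 = (real (card K) / (real (card K) + 1)) * (\<kappa> * \<theta> * (1 - \<epsilon>) / 2)"
      by (simp add: \<kappa>2_def field_simps)
    also have "\<dots> \<le> 1 * (\<kappa> * \<theta> * (1 - \<epsilon>) / 2)" using K \<theta> \<epsilon> by (intro mult_right_mono) auto
    finally show ?thesis by simp
  qed
  have "\<forall>\<^sub>F n in sequentially. real (card (bad_points ((\<lambda>k. inv k) ` K) (F n))) \<le> \<kappa>2 * real (card (F n))"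
    using K \<kappa>2 by (intro folner_bad_points[OF F]) auto
  with freq have "\<exists>\<^sub>F n in sequentially. f (F n) \<le> p * real (card (F n)) \<and>
      real (card (bad_points ((\<lambda>k. inv k) ` K) (F n))) \<le> \<kappa>2 * real (card (F n))"
    by (rule frequently_eventually_frequently)
  then obtain n where n: "f (F n) \<le> p * real (card (F n))"
      "real (card (bad_points ((\<lambda>k. inv k) ` K) (F n))) \<le> \<kappa>2 * real (card (F n))"
    by (auto dest!: frequently_ex)
  define T where "T = F n"
  have T: "T \<subseteq> carrier G" "finite T" "T \<noteq> {}" using folner_finite_subsets[OF F, of n] by (auto simp: T_def)
  define \<kappa>' where "\<kappa>' = min (1/2) (\<kappa> * \<theta> / 2)"
  have \<kappa>': "\<kappa>' > 0" "\<kappa>' \<le> 1/2" "\<kappa>' \<le> \<kappa> * \<theta> / 2" using K \<theta> by (auto simp: \<kappa>'_def)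
  have "\<exists>B\<subseteq>A. real (card B) \<le> \<theta> * real (card A) \<and> f (A - B) \<le> q * real (card (A - B))"
    if A: "A \<subseteq> carrier G" "finite A" and bad: "real (card (bad_points (K \<union> T) A)) \<le> \<kappa>' * real (card A)" for A
  proof -
    have badT: "card (bad_points T A) \<le> card (bad_points (K \<union> T) A)"
      and badK: "card (bad_points K A) \<le> card (bad_points (K \<union> T) A)"
      using A by (auto intro!: card_mono simp: bad_points_def)
    have \<kappa>A: "\<kappa>' * real (card A) \<le> 1/2 * real (card A)" "\<kappa>' * real (card A) \<le> \<kappa> * \<theta> / 2 * real (card A)"
      using \<kappa>' by (intro mult_right_mono; simp)+
    have "real (card (bad_points T A)) \<le> real (card A) / 2" using badT bad \<kappa>A by linarith
    then obtain C where C: "C \<subseteq> A" "\<And>c. c \<in> C \<Longrightarrow> rtrans T c \<subseteq> A"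
      "real (card C) * real (card T) * (1 - \<epsilon>) \<le> real (card (\<Union>c\<in>C. rtrans T c))"
      "\<epsilon> / 2 * real (card A) \<le> real (card (\<Union>c\<in>C. rtrans T c))"
      using almost_disjoint_translates[OF A T \<epsilon>] by blast
    define U where "U = (\<Union>c\<in>C. rtrans T c)"
    have finC: "finite C" and CG: "C \<subseteq> carrier G" using C(1) A finite_subset by auto
    have U: "U \<subseteq> A" "finite U" using C(2) A(2) by (auto simp: U_def intro: finite_subset)
    have cA: "real (card A) = real (card U) + real (card (A - U))"
      using U A by (simp add: card_Diff_subset card_mono)
    have fU: "f U \<le> q * real (card U)"
    proof -
      have "f U \<le> real (card C) * f T"
        unfolding U_def using empty subadd inv T(1,2) finC CG by (rule subadditive_translates_le)
      also have "\<dots> \<le> real (card C) * (p * real (card T))" using n by (intro mult_left_mono) (auto simp: T_def)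
      also have "\<dots> = q * (real (card C) * real (card T) * (1 - \<epsilon>))" using \<epsilon> by (simp add: q_def)
      also have "\<dots> \<le> q * real (card U)" using C(3) p \<epsilon> unfolding U_def by (intro mult_left_mono) (auto simp: q_def)
      finally show ?thesis .
    qed
    \<comment> \<open>Either the remainder is already below the target proportion
      \<open>\<theta>\<close> and becomes the exceptional set, or it has more than
      \<open>\<theta> * card A\<close> points, so that a bound on bad points relative to
      \<open>A\<close> is one relative to the remainder.\<close>
    show ?thesis
    proof (cases "real (card (A - U)) \<le> \<theta> * real (card A)")
      case True
      have "A - (A - U) = U" using U by blast
      then show ?thesis using True fU by (intro exI[of _ "A - U"]) auto
    next
      case False
      have "real (card (bad_points K (A - U)))
          \<le> real (card (bad_points K A)) + real (card C) * (real (card K) * real (card (bad_points ((\<lambda>k. inv k) ` K) T)))"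
        using bad_points_Diff_translates[OF K(1,2) T(1,2) CG finC A(2,1)]
        unfolding U_def of_nat_mult[symmetric] of_nat_add[symmetric] of_nat_le_iff .
      also have "\<dots> \<le> \<kappa> * \<theta> / 2 * real (card A) + real (card C) * (real (card K) * (\<kappa>2 * real (card T)))"
        using badK bad \<kappa>A n by (intro add_mono mult_left_mono) (auto simp: T_def)
      also have "real (card C) * (real (card K) * (\<kappa>2 * real (card T)))
          = (real (card K) * \<kappa>2) * (real (card C) * real (card T))" by simp
      also have "\<dots> \<le> (\<kappa> * \<theta> * (1 - \<epsilon>) / 2) * (real (card C) * real (card T))"
        using K\<kappa>2 by (intro mult_right_mono) auto
      also have "\<dots> = \<kappa> * \<theta> / 2 * (real (card C) * real (card T) * (1 - \<epsilon>))" by simp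
      also have "\<dots> \<le> \<kappa> * \<theta> / 2 * real (card A)"
        using C(3) cA K \<theta> unfolding U_def by (intro mult_left_mono) auto
      finally have "real (card (bad_points K (A - U))) \<le> \<kappa> * (\<theta> * real (card A))" by simp
      also have "\<dots> \<le> \<kappa> * real (card (A - U))" using False K by (intro mult_left_mono) auto
      finally obtain B where B: "B \<subseteq> A - U" "real (card B) \<le> \<eta> * real (card (A - U))"
          "f (A - U - B) \<le> q * real (card (A - U - B))"
        using til[of "A - U"] A by auto
      have "real (card B) \<le> \<theta> * real (card A)"
      proof -
        have "real (card (A - U)) \<le> (1 - \<epsilon> / 2) * real (card A)"
          using C(4) cA unfolding U_def[symmetric] by (simp add: algebra_simps)
        then have "\<eta> * real (card (A - U)) \<le> \<eta> * ((1 - \<epsilon> / 2) * real (card A))"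
          using \<eta> by (intro mult_left_mono) auto
        then show ?thesis using B(2) by (simp add: \<theta>_def)
      qed
      moreover have "f (A - B) \<le> q * real (card (A - B))"
      proof -
        have eq: "A - B = U \<union> (A - U - B)" using B(1) U by blast
        have "f (A - B) \<le> f U + f (A - U - B)"
          unfolding eq using A U by (intro subadd) auto
        also have "\<dots> \<le> q * real (card U) + q * real (card (A - U - B))" using fU B(3) by linarith
        also have "\<dots> = q * real (card (A - B))"
          unfolding eq using A U by (subst card_Un_disjoint) (auto simp: algebra_simps)
        finally show ?thesis .
      qed
      ultimately show ?thesis using B(1) by blast
    qed
  qed
  then show ?thesis
    unfolding tileable_def q_def[symmetric] \<theta>_def[symmetric]
    using K(1,2) T(1,2) \<kappa>'(1) by (intro exI[of _ "K \<union> T"] exI[of _ \<kappa>']) auto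
qed

text \<open>Folner sets whose quotient is close to the lower limit \<open>l\<close> occur
  arbitrarily far out and serve as tiles. After \<open>k\<close> rounds a late \<open>F n\<close> is
  tiled up to the proportion \<open>(1 - \<epsilon> / 2) ^ k\<close>, where the trivial bound
  \<open>f B \<le> M * card B\<close> suffices; hence the upper limit is at most
  \<open>l\<close>.\<close>

theorem ornstein_weiss:
  fixes f :: "'a set \<Rightarrow> real"
  assumes F: "folner_sequence G F"
    and empty: "f {} = 0" and nonneg: "\<And>A. \<lbrakk>A \<subseteq> carrier G; finite A\<rbrakk> \<Longrightarrow> 0 \<le> f A"
    and subadd: "\<And>A B. \<lbrakk>A \<subseteq> carrier G; finite A; B \<subseteq> carrier G; finite B\<rbrakk> \<Longrightarrow> f (A \<union> B) \<le> f A + f B"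
    and inv: "\<And>A c. \<lbrakk>A \<subseteq> carrier G; finite A; c \<in> carrier G\<rbrakk> \<Longrightarrow> f (rtrans A c) = f A"
  shows "convergent (\<lambda>n. f (F n) / real (card (F n)))"
proof -
  define g where "g n = f (F n) / real (card (F n))" for n
  define M where "M = f {\<one>}"
  have M: "M \<ge> 0" using nonneg by (simp add: M_def)
  have Fn: "F n \<subseteq> carrier G" "finite (F n)" "card (F n) > 0" for n
    using folner_finite_subsets[OF F, of n] by (auto simp: card_gt_0_iff)
  have fM: "f B \<le> M * real (card B)" if "B \<subseteq> carrier G" "finite B" for B
  proof -
    have "f (\<Union>c\<in>B. rtrans {\<one>} c) \<le> real (card B) * f {\<one>}"
      using empty subadd inv _ _ that(2,1) by (rule subadditive_translates_le) auto
    moreover have "(\<Union>c\<in>B. rtrans {\<one>} c) = B" using that by (auto simp: rtrans_def subset_iff)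
    ultimately show ?thesis by (simp add: M_def mult.commute)
  qed
  have g: "0 \<le> g n" "g n \<le> M" for n
    using nonneg[OF Fn(1,2)] fM[OF Fn(1,2)] Fn(3)[of n] by (auto simp: g_def pos_divide_le_eq)
  have "0 \<le> liminf (\<lambda>n. ereal (g n))" "liminf (\<lambda>n. ereal (g n)) \<le> ereal M"
    using g by (auto intro!: Liminf_bounded Liminf_le simp: eventually_sequentially)
  then obtain l where l: "liminf (\<lambda>n. ereal (g n)) = ereal l" "l \<ge> 0"
    by (cases "liminf (\<lambda>n. ereal (g n))") auto
  have up: "\<forall>\<^sub>F n in sequentially. g n \<le> l + \<xi>" if \<xi>: "\<xi> > 0" for \<xi>
  proof -
    \<comment> \<open>Overlaps raise the cost per point from \<open>p\<close> to
      \<open>p / (1 - \<epsilon>)\<close>. The choice keeps this below \<open>l + \<xi> / 2\<close>,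
      and the other \<open>\<xi> / 2\<close> pays for the untiled part.\<close>
    define \<epsilon> where "\<epsilon> = min (1/2) (\<xi> / (4 * (l + \<xi>)))"
    define p where "p = l + \<xi> / 4"
    have \<epsilon>: "0 < \<epsilon>" "\<epsilon> < 1" using \<xi> l by (auto simp: \<epsilon>_def)
    have p: "p \<ge> 0" using \<xi> l by (simp add: p_def)
    have q: "p / (1 - \<epsilon>) \<le> l + \<xi> / 2"
    proof -
      have "\<epsilon> * (l + \<xi>) \<le> \<xi> / (4 * (l + \<xi>)) * (l + \<xi>)"
        using \<xi> l by (intro mult_right_mono) (auto simp: \<epsilon>_def)
      also have "\<dots> = \<xi> / 4" using \<xi> l by (simp add: field_simps)
      finally have "\<epsilon> * (l + \<xi>) \<le> \<xi> / 4" .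
      moreover have "\<epsilon> * (l + \<xi> / 2) \<le> \<epsilon> * (l + \<xi>)" using \<epsilon> \<xi> by (intro mult_left_mono) auto
      ultimately have "p \<le> (l + \<xi> / 2) * (1 - \<epsilon>)" by (simp add: p_def algebra_simps)
      then show ?thesis using \<epsilon> by (simp add: pos_divide_le_eq)
    qed
    have freq: "\<exists>\<^sub>F n in sequentially. f (F n) \<le> p * real (card (F n))"
    proof (rule ccontr)
      assume "\<not> ?thesis"
      then have "\<forall>\<^sub>F n in sequentially. ereal p \<le> ereal (g n)"
        unfolding not_frequently
      proof eventually_elim
        case (elim n)
        then show ?case using Fn(3)[of n] by (simp add: g_def pos_le_divide_eq)
      qed
      then have "ereal p \<le> ereal l" unfolding l(1)[symmetric] by (rule Liminf_bounded)
      then show False using \<xi> by (simp add: p_def)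
    qed
    have til: "tileable f (p / (1 - \<epsilon>)) ((1 - \<epsilon> / 2) ^ k)" for k
    proof (induction k)
      case 0
      show ?case unfolding tileable_def
        by (intro exI[of _ "{}"] exI[of _ 1]) (auto simp: empty intro!: exI[where P = "\<lambda>B. B \<subseteq> _ \<and> _ B"])
    next
      case (Suc k)
      have "(1 - \<epsilon> / 2) ^ k > 0" using \<epsilon> by simp
      from tileable_step[OF F empty subadd inv freq \<epsilon> p this Suc] show ?case by (simp add: mult.commute)
    qed
    have "(\<lambda>k. M * (1 - \<epsilon> / 2) ^ k) \<longlonglongrightarrow> M * 0"
      using \<epsilon> by (intro tendsto_intros LIMSEQ_power_zero) auto
    then have "\<forall>\<^sub>F k in sequentially. M * (1 - \<epsilon> / 2) ^ k < \<xi> / 2"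
      using \<xi> by (intro order_tendstoD) auto
    from eventually_happens'[OF sequentially_bot this] obtain k where k: "M * (1 - \<epsilon> / 2) ^ k < \<xi> / 2" by blast
    obtain K \<kappa> where K: "K \<subseteq> carrier G" "finite K" "\<kappa> > 0"
      and B: "\<And>A. \<lbrakk>A \<subseteq> carrier G; finite A; real (card (bad_points K A)) \<le> \<kappa> * real (card A)\<rbrakk> \<Longrightarrow>
         \<exists>B\<subseteq>A. real (card B) \<le> (1 - \<epsilon> / 2) ^ k * real (card A) \<and> f (A - B) \<le> p / (1 - \<epsilon>) * real (card (A - B))"
      using til[of k] by (elim tileableE) blast
    show ?thesis using folner_bad_points[OF F K]
    proof eventually_elim
      case (elim n)
      obtain B where B: "B \<subseteq> F n" "real (card B) \<le> (1 - \<epsilon> / 2) ^ k * real (card (F n))"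
        "f (F n - B) \<le> p / (1 - \<epsilon>) * real (card (F n - B))" using B[OF Fn(1,2) elim] by blast
      have finB: "finite B" "B \<subseteq> carrier G"
        using B(1) Fn(1,2)[of n] by (auto intro: finite_subset)
      have "F n = (F n - B) \<union> B" using B by blast
      then have "f (F n) \<le> f (F n - B) + f B" using subadd[of "F n - B" B] Fn finB by auto
      also have "\<dots> \<le> p / (1 - \<epsilon>) * real (card (F n - B)) + M * real (card B)"
        using B(3) fM[of B] finB by linarith
      also have "\<dots> \<le> (l + \<xi> / 2) * real (card (F n)) + M * ((1 - \<epsilon> / 2) ^ k * real (card (F n)))"
        using q B(2) M l \<xi> Fn p \<epsilon> by (intro add_mono mult_mono mult_left_mono) (auto intro!: card_mono)
      also have "M * ((1 - \<epsilon> / 2) ^ k * real (card (F n))) \<le> \<xi> / 2 * real (card (F n))"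
        using k by (simp only: mult.assoc[symmetric]) (intro mult_right_mono, auto)
      finally have "f (F n) \<le> (l + \<xi>) * real (card (F n))" by (simp add: algebra_simps)
      then show ?case using Fn(3)[of n] by (simp add: g_def pos_divide_le_eq)
    qed
  qed
  have "limsup (\<lambda>n. ereal (g n)) \<le> ereal l"
  proof (rule ereal_le_epsilon2)
    fix \<xi> :: real assume "\<xi> > 0"
    from up[OF this] show "limsup (\<lambda>n. ereal (g n)) \<le> ereal l + ereal \<xi>"
      by (intro Limsup_bounded) (auto elim: eventually_mono)
  qed
  then have "g \<longlonglongrightarrow> l"
    using l(1) by (intro limsup_le_liminf_real) simp_all
  then show ?thesis unfolding g_def convergent_def by auto
qed

end

section \<open>Width dimension through level sets\<close>

text \<open>
  Encodes a map into a complex of dimension \<open>D\<close>: the standard triangulation of the cube \<open>[0,1]\<^sup>N\<close> has a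
  point in the interior of a simplex whose dimension is the number of distinct coordinates in \<open>(0,1)\<close>.
\<close>

definition small_width :: "'a topology \<Rightarrow> ('a \<Rightarrow> 'a \<Rightarrow> real) \<Rightarrow> real \<Rightarrow> nat \<Rightarrow> bool" where
  "small_width Z \<rho> \<epsilon> D \<longleftrightarrow> (\<exists>(N::nat) u.
     (\<forall>c<N. continuous_map Z euclideanreal (u c)) \<and>
     (\<forall>z\<in>topspace Z. \<forall>c<N. 0 \<le> u c z \<and> u c z \<le> 1) \<and>
     (\<forall>z\<in>topspace Z. card ((\<lambda>c. u c z) ` {..<N} \<inter> {0<..<1}) \<le> D) \<and>
     (\<forall>z\<in>topspace Z. \<forall>z'\<in>topspace Z. (\<forall>c<N. u c z = u c z') \<longrightarrow> \<rho> z z' < \<epsilon>))"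

lemma small_widthI:
  fixes u :: "'c \<Rightarrow> 'a \<Rightarrow> real"
  assumes I: "finite I"
    and cont: "\<And>c. c \<in> I \<Longrightarrow> continuous_map Z euclideanreal (u c)"
    and range: "\<And>c z. c \<in> I \<Longrightarrow> z \<in> topspace Z \<Longrightarrow> 0 \<le> u c z \<and> u c z \<le> 1"
    and card: "\<And>z. z \<in> topspace Z \<Longrightarrow> card ((\<lambda>c. u c z) ` I \<inter> {0<..<1}) \<le> D"
    and sep: "\<And>z z'. \<lbrakk>z \<in> topspace Z; z' \<in> topspace Z; \<And>c. c \<in> I \<Longrightarrow> u c z = u c z'\<rbrakk> \<Longrightarrow> \<rho> z z' < \<epsilon>"
  shows "small_width Z \<rho> \<epsilon> D"
proof -
  obtain h where h: "bij_betw h {..<card I} I"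
    using ex_bij_betw_nat_finite[OF I] by (auto simp: atLeast0LessThan)
  have hI: "h ` {..<card I} = I" using h by (simp add: bij_betw_def)
  have hin: "h c \<in> I" if "c < card I" for c
  proof -
    have "h c \<in> h ` {..<card I}" using that by simp
    then show ?thesis unfolding hI .
  qed
  have img: "(\<lambda>c. u (h c) z) ` {..<card I} = (\<lambda>c. u c z) ` I" for z
    using image_image[of "\<lambda>c. u c z" h "{..<card I}"] unfolding hI by (rule sym)
  show ?thesis
    unfolding small_width_def
  proof (rule exI[of _ "card I"], rule exI[of _ "\<lambda>c. u (h c)"], intro conjI)
    show "\<forall>z\<in>topspace Z. \<forall>z'\<in>topspace Z. (\<forall>c<card I. u (h c) z = u (h c) z') \<longrightarrow> \<rho> z z' < \<epsilon>"
    proof (intro ballI impI)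
      fix z z' assume z: "z \<in> topspace Z" "z' \<in> topspace Z" and eq: "\<forall>c<card I. u (h c) z = u (h c) z'"
      have "u c z = u c z'" if "c \<in> I" for c
      proof -
        have "c \<in> h ` {..<card I}" by (simp add: hI that)
        then obtain k where "k < card I" "c = h k" by auto
        then show ?thesis using eq by simp
      qed
      then show "\<rho> z z' < \<epsilon>" by (rule sep[OF z])
    qed
    show "\<forall>c<card I. continuous_map Z euclideanreal (u (h c))"
      using cont hin by blast
    show "\<forall>z\<in>topspace Z. \<forall>c<card I. 0 \<le> u (h c) z \<and> u (h c) z \<le> 1"
      using range hin by blast
    show "\<forall>z\<in>topspace Z. card ((\<lambda>c. u (h c) z) ` {..<card I} \<inter> {0<..<1}) \<le> D"
      unfolding img using card by blast
  qed
qed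

lemma small_width_mono:
  assumes "small_width Z \<rho> \<epsilon> D" "D \<le> D'"
  shows "small_width Z \<rho> \<epsilon> D'"
proof -
  obtain N :: nat and u where u: "\<forall>c<N. continuous_map Z euclideanreal (u c)"
     "\<forall>z\<in>topspace Z. \<forall>c<N. 0 \<le> u c z \<and> u c z \<le> 1"
     "\<forall>z\<in>topspace Z. card ((\<lambda>c. u c z) ` {..<N} \<inter> {0<..<1}) \<le> D"
     "\<forall>z\<in>topspace Z. \<forall>z'\<in>topspace Z. (\<forall>c<N. u c z = u c z') \<longrightarrow> \<rho> z z' < \<epsilon>"
    using assms(1) unfolding small_width_def by (elim exE conjE)
  have "\<forall>z\<in>topspace Z. card ((\<lambda>c. u c z) ` {..<N} \<inter> {0<..<1}) \<le> D'"
    using u(3) assms(2) order_trans by blast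
  with u(1,2,4) show ?thesis unfolding small_width_def by (intro exI conjI)
qed

text \<open>Partial sums of the barycentric coordinates. They jump only at the at most
  \<open>n + 1\<close> vertices of the support and equal 1 from the last of them on, so at most
  \<open>n\<close> values lie strictly between 0 and 1; consecutive differences recover the
  coordinates.\<close>

lemma eps_embedding_imp_small_width:
  assumes K: "finite_complex K" "has_dimension K n" and emb: "eps_embedding Z \<rho> \<epsilon> (realization K) f"
  shows "small_width Z \<rho> \<epsilon> n"
proof -
  have finV: "finite (\<Union>K)" using K(1) by (auto simp: finite_complex_def)
  then obtain N where N: "\<Union>K \<subseteq> {..<N}"
    using finite_nat_bounded by blast
  have fc: "continuous_map Z (realization K) f" using emb by (simp add: eps_embedding_def)
  then have f: "f z \<in> topspace (realization K)" if "z \<in> topspace Z" for z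
    using that by (auto simp: continuous_map_def Pi_iff)
  have fc': "continuous_map Z euclideanreal (\<lambda>z. f z i)" for i
    using fc unfolding realization_def continuous_map_in_subtopology
    by (simp add: continuous_map_componentwise_UNIV)
  define supp where "supp z = {i. f z i \<noteq> 0}" for z
  have props: "\<And>i. 0 \<le> f z i" "supp z \<in> K" "(\<Sum>i\<in>supp z. f z i) = 1" if "z \<in> topspace Z" for z
    using f[OF that] unfolding realization_def supp_def topspace_subtopology by simp_all
  have supp: "finite (supp z)" "supp z \<subseteq> {..<N}" "supp z \<noteq> {}" "card (supp z) \<le> n + 1"
    if "z \<in> topspace Z" for z
  proof -
    note inK = props(2)[OF that]
    show "finite (supp z)" "supp z \<noteq> {}" using K(1) inK by (auto simp: finite_complex_def)
    show "supp z \<subseteq> {..<N}" using N inK by blast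
    show "card (supp z) \<le> n + 1" using K(2) inK by (simp add: has_dimension_def)
  qed
  define u where "u c z = (\<Sum>j\<le>c. f z j)" for c z
  have usupp: "u c z = (\<Sum>j\<in>{j\<in>supp z. j \<le> c}. f z j)" if "z \<in> topspace Z" for c z
    unfolding u_def by (rule sum.mono_neutral_cong_right) (auto simp: supp_def)
  show ?thesis
  proof (rule small_widthI[of "{..<N}" Z u])
    show "continuous_map Z euclideanreal (u c)" for c
      unfolding u_def by (intro continuous_map_sum fc') auto
    show "0 \<le> u c z \<and> u c z \<le> 1" if z: "z \<in> topspace Z" for c z
    proof
      show "0 \<le> u c z" unfolding u_def by (intro sum_nonneg props z)
      show "u c z \<le> 1"
        unfolding usupp[OF z] props(3)[OF z, symmetric]
        using supp[OF z] props(1)[OF z] by (intro sum_mono2) auto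
    qed
    show "card ((\<lambda>c. u c z) ` {..<N} \<inter> {0<..<1}) \<le> n" if z: "z \<in> topspace Z" for z
    proof -
      let ?m = "Max (supp z)"
      have "(\<lambda>c. u c z) ` {..<N} \<inter> {0<..<1} \<subseteq> (\<lambda>c. u c z) ` (supp z - {?m})"
      proof
        fix x assume "x \<in> (\<lambda>c. u c z) ` {..<N} \<inter> {0<..<1}"
        then obtain c where c: "x = u c z" "0 < u c z" "u c z < 1" by auto
        let ?S = "{j\<in>supp z. j \<le> c}"
        have ne: "?S \<noteq> {}"
        proof
          assume "?S = {}"
          then have "u c z = 0" unfolding usupp[OF z] by (simp only: sum.empty)
          then show False using c by simp
        qed
        have finS: "finite ?S" using supp(1)[OF z] by simp
        define k where "k = Max ?S"
        have k: "k \<in> ?S" "\<And>j. j \<in> ?S \<Longrightarrow> j \<le> k" using Max_in[OF finS ne] finS by (auto simp: k_def)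
        then have "{j\<in>supp z. j \<le> c} = {j\<in>supp z. j \<le> k}" by fastforce
        then have uk: "u c z = u k z" unfolding usupp[OF z] by (simp only:)
        have "k \<noteq> ?m"
        proof
          assume "k = ?m"
          then have "{j\<in>supp z. j \<le> k} = supp z" using supp(1)[OF z] by auto
          then have "u k z = 1" unfolding usupp[OF z] using props(3)[OF z] by (simp only:)
          then show False using uk c by simp
        qed
        then show "x \<in> (\<lambda>c. u c z) ` (supp z - {?m})" using c(1) uk k(1) by auto
      qed
      then have "card ((\<lambda>c. u c z) ` {..<N} \<inter> {0<..<1}) \<le> card ((\<lambda>c. u c z) ` (supp z - {?m}))"
        using supp(1)[OF z] by (intro card_mono) auto
      also have "\<dots> \<le> card (supp z - {?m})" using supp(1)[OF z] by (intro card_image_le) auto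
      also have "\<dots> \<le> n" using supp[OF z] by simp
      finally show ?thesis .
    qed
    show "\<rho> z z' < \<epsilon>" if z: "z \<in> topspace Z" "z' \<in> topspace Z"
      and eq: "\<And>c. c \<in> {..<N} \<Longrightarrow> u c z = u c z'" for z z'
    proof -
      have "f z j = f z' j" for j
      proof (cases "j < N")
        case True
        show ?thesis
        proof (cases j)
          case 0
          then show ?thesis using eq[of 0] True by (simp add: u_def)
        next
          case (Suc i)
          then show ?thesis using eq[of j] eq[of i] True by (simp add: u_def)
        qed
      next
        case False
        then have "j \<notin> supp z" "j \<notin> supp z'" using supp(2) z by auto
        then show ?thesis by (simp add: supp_def)
      qed
      then have "f z = f z'" by blast
      then show ?thesis using emb z by (simp add: eps_embedding_def)
    qed
  qed auto
qed

section \<open>From level coordinates back to simplicial complexes\<close>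

lemma continuous_map_Min:
  fixes u :: "'c \<Rightarrow> 'a \<Rightarrow> real"
  assumes "finite S" "\<And>c. c \<in> S \<Longrightarrow> continuous_map Z euclideanreal (u c)"
  shows "continuous_map Z euclideanreal (\<lambda>z. Min (insert b ((\<lambda>c. u c z) ` S)))"
  using assms
proof (induction S rule: finite_induct)
  case (insert c S)
  have "(\<lambda>z. Min (insert b ((\<lambda>c. u c z) ` insert c S)))
      = (\<lambda>z. min (u c z) (Min (insert b ((\<lambda>c. u c z) ` S))))"
  proof
    fix z
    have "Min (insert (u c z) (insert b ((\<lambda>c. u c z) ` S))) = min (u c z) (Min (insert b ((\<lambda>c. u c z) ` S)))"
      using insert.hyps by (intro Min_insert) auto
    then show "Min (insert b ((\<lambda>c. u c z) ` insert c S)) = min (u c z) (Min (insert b ((\<lambda>c. u c z) ` S)))"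
      by (simp only: image_insert insert_commute)
  qed
  then show ?case using insert by (simp add: continuous_map_real_min)
qed simp

lemma continuous_map_Max:
  fixes u :: "'c \<Rightarrow> 'a \<Rightarrow> real"
  assumes "finite S" "\<And>c. c \<in> S \<Longrightarrow> continuous_map Z euclideanreal (u c)"
  shows "continuous_map Z euclideanreal (\<lambda>z. Max (insert b ((\<lambda>c. u c z) ` S)))"
  using assms
proof (induction S rule: finite_induct)
  case (insert c S)
  have "(\<lambda>z. Max (insert b ((\<lambda>c. u c z) ` insert c S)))
      = (\<lambda>z. max (u c z) (Max (insert b ((\<lambda>c. u c z) ` S))))"
  proof
    fix z
    have "Max (insert (u c z) (insert b ((\<lambda>c. u c z) ` S))) = max (u c z) (Max (insert b ((\<lambda>c. u c z) ` S)))"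
      using insert.hyps by (intro Max_insert) auto
    then show "Max (insert b ((\<lambda>c. u c z) ` insert c S)) = max (u c z) (Max (insert b ((\<lambda>c. u c z) ` S)))"
      by (simp only: image_insert insert_commute)
  qed
  then show ?case using insert by (simp add: continuous_map_real_max)
qed simp

text \<open>
  The barycentric coordinate of a point \<open>v\<close> of the cube \<open>[0,1]\<^sup>I\<close> at the vertex \<open>S \<subseteq> I\<close> in the standard
  triangulation of the cube: the measure of the levels \<open>t \<in> (0,1]\<close> with \<open>{c. v c \<ge> t} = S\<close>.
\<close>

definition lev :: "'c set \<Rightarrow> ('c \<Rightarrow> real) \<Rightarrow> 'c set \<Rightarrow> real" where
  "lev I v S = max 0 (Min (insert 1 (v ` S)) - Max (insert 0 (v ` (I - S))))"

definition levset :: "'c set \<Rightarrow> ('c \<Rightarrow> real) \<Rightarrow> 'c set \<Rightarrow> real set" where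
  "levset I v S = {t. 0 < t \<and> t \<le> 1 \<and> {c\<in>I. t \<le> v c} = S}"

lemma levset_eq:
  assumes "finite I" "S \<subseteq> I"
  shows "levset I v S = {Max (insert 0 (v ` (I - S)))<..Min (insert 1 (v ` S))}"
proof -
  have fin: "finite S" "finite (I - S)" using assms finite_subset by auto
  have "t \<in> levset I v S \<longleftrightarrow> t \<in> {Max (insert 0 (v ` (I - S)))<..Min (insert 1 (v ` S))}" for t
  proof -
    have "{c\<in>I. t \<le> v c} = S \<longleftrightarrow> (\<forall>c\<in>S. t \<le> v c) \<and> (\<forall>c\<in>I - S. v c < t)"
      using assms(2) by (auto simp: not_le[symmetric])
    then show ?thesis using fin by (auto simp: levset_def)
  qed
  then show ?thesis by blast
qed

lemma measure_levset:
  assumes "finite I" "S \<subseteq> I"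
  shows "measure lborel (levset I v S) = lev I v S"
  unfolding levset_eq[OF assms] lev_def
  by (cases "Max (insert 0 (v ` (I - S))) \<le> Min (insert 1 (v ` S))") (auto simp: max_def)

lemma sum_lev:
  assumes I: "finite I" and A: "\<A> \<subseteq> Pow I"
  shows "(\<Sum>S\<in>\<A>. lev I v S) = measure lborel {t. 0 < t \<and> t \<le> 1 \<and> {c\<in>I. t \<le> v c} \<in> \<A>}"
proof -
  have fin: "finite \<A>" using A I by (metis finite_Pow_iff finite_subset)
  have sub: "levset I v S \<subseteq> {0..1}" for S by (auto simp: levset_def)
  have ems: "emeasure lborel (levset I v S) \<noteq> \<infinity>" if "S \<in> \<A>" for S
  proof -
    have "emeasure lborel (levset I v S) \<le> emeasure lborel {0..1::real}"
      by (rule emeasure_mono[OF sub]) simp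
    then show ?thesis by (auto simp: top_unique)
  qed
  have "(\<Sum>S\<in>\<A>. lev I v S) = (\<Sum>S\<in>\<A>. measure lborel (levset I v S))"
    using A I by (intro sum.cong refl) (auto simp: measure_levset)
  also have "\<dots> = measure lborel (\<Union>S\<in>\<A>. levset I v S)"
  proof (rule measure_finite_Union[symmetric])
    show "levset I v ` \<A> \<subseteq> sets lborel"
      using A I by (auto simp: levset_eq subset_iff)
    show "disjoint_family_on (levset I v) \<A>"
      by (auto simp: disjoint_family_on_def levset_def)
  qed (use fin ems in auto)
  also have "(\<Union>S\<in>\<A>. levset I v S) = {t. 0 < t \<and> t \<le> 1 \<and> {c\<in>I. t \<le> v c} \<in> \<A>}"
    by (auto simp: levset_def)
  finally show ?thesis .
qed

lemma sum_lev_Pow: "finite I \<Longrightarrow> (\<Sum>S\<in>Pow I. lev I v S) = 1"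
proof -
  assume I: "finite I"
  have "{t::real. 0 < t \<and> t \<le> 1 \<and> {c\<in>I. t \<le> v c} \<in> Pow I} = {0<..1}" by auto
  then show ?thesis unfolding sum_lev[OF I subset_refl] by (simp only:) simp
qed

text \<open>Layer-cake formula; it shows that \<open>lev\<close> determines the point
  \<open>v\<close>.\<close>

lemma sum_lev_member:
  assumes I: "finite I" and c: "c \<in> I" "0 \<le> v c" "v c \<le> 1"
  shows "(\<Sum>S\<in>{S\<in>Pow I. c \<in> S}. lev I v S) = v c"
proof -
  have "{t::real. 0 < t \<and> t \<le> 1 \<and> {c\<in>I. t \<le> v c} \<in> {S\<in>Pow I. c \<in> S}} = {0<..v c}" using c by auto
  moreover have "{S\<in>Pow I. c \<in> S} \<subseteq> Pow I" by blast
  ultimately show ?thesis using sum_lev[OF I, of "{S\<in>Pow I. c \<in> S}" v] c by (simp only:) simp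
qed

text \<open>A vertex \<open>S\<close> of positive weight is the superlevel set at its own minimum
  \<open>?b S\<close>, hence determined by it, and this minimum is either 1 or one of the values in
  \<open>(0, 1)\<close>.\<close>

lemma card_lev_pos:
  assumes I: "finite I" and v: "\<And>c. c \<in> I \<Longrightarrow> 0 \<le> v c \<and> v c \<le> 1"
  shows "card {S\<in>Pow I. lev I v S \<noteq> 0} \<le> card (v ` I \<inter> {0<..<1}) + 1"
proof -
  let ?b = "\<lambda>S. Min (insert 1 (v ` S))" and ?a = "\<lambda>S. Max (insert 0 (v ` (I - S)))"
  let ?P = "{S\<in>Pow I. lev I v S \<noteq> 0}"
  have ab: "?a S < ?b S" "S \<subseteq> I" if "S \<in> ?P" for S using that by (auto simp: lev_def max_def split: if_splits)
  have fin: "finite S" "finite (I - S)" if "S \<in> ?P" for S using that I finite_subset by auto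
  have eq: "S = {c\<in>I. ?b S \<le> v c}" if S: "S \<in> ?P" for S
  proof -
    have "?b S \<le> v c" if "c \<in> S" for c using that fin(1)[OF S] by (intro Min_le) auto
    moreover have "v c < ?b S" if "c \<in> I - S" for c
    proof -
      have "v c \<le> ?a S" using that fin(2)[OF S] by (intro Max_ge) auto
      then show ?thesis using ab(1)[OF S] by linarith
    qed
    ultimately show ?thesis using ab(2)[OF S] by fastforce
  qed
  have "inj_on ?b ?P"
  proof (rule inj_onI)
    fix S S' assume S: "S \<in> ?P" "S' \<in> ?P" and b: "?b S = ?b S'"
    have "S = {c\<in>I. ?b S \<le> v c}" by (rule eq[OF S(1)])
    also have "\<dots> = S'" unfolding b by (rule eq[OF S(2), symmetric])
    finally show "S = S'" .
  qed
  then have "card ?P = card (?b ` ?P)" by (simp add: card_image)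
  also have "\<dots> \<le> card (insert 1 (v ` I \<inter> {0<..<1}))"
  proof (rule card_mono)
    show "?b ` ?P \<subseteq> insert 1 (v ` I \<inter> {0<..<1})"
    proof
      fix x assume "x \<in> ?b ` ?P"
      then obtain S where S: "S \<in> ?P" "x = ?b S" by blast
      have "0 \<le> ?a S" using fin(2)[OF S(1)] by (intro Max_ge) auto
      then have pos: "0 < x" using ab(1)[OF S(1)] S(2) by linarith
      have "?b S \<in> insert 1 (v ` S)" using fin(1)[OF S(1)] by (intro Min_in) auto
      moreover have "?b S \<le> 1" using fin(1)[OF S(1)] by (intro Min_le) auto
      ultimately show "x \<in> insert 1 (v ` I \<inter> {0<..<1})" using pos S ab(2)[OF S(1)] by force
    qed
  qed (use I in auto)
  also have "\<dots> \<le> card (v ` I \<inter> {0<..<1}) + 1" using I by (simp add: card_insert_if)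
  finally show ?thesis .
qed

lemma small_width_imp_eps_embedding:
  assumes "small_width Z \<rho> \<epsilon> D"
  shows "\<exists>K. finite_complex K \<and> has_dimension K D \<and> (\<exists>f. eps_embedding Z \<rho> \<epsilon> (realization K) f)"
proof -
  obtain N :: nat and u where cont: "\<forall>c<N. continuous_map Z euclideanreal (u c)"
    and range: "\<forall>z\<in>topspace Z. \<forall>c<N. 0 \<le> u c z \<and> u c z \<le> 1"
    and card: "\<forall>z\<in>topspace Z. card ((\<lambda>c. u c z) ` {..<N} \<inter> {0<..<1}) \<le> D"
    and sep: "\<forall>z\<in>topspace Z. \<forall>z'\<in>topspace Z. (\<forall>c<N. u c z = u c z') \<longrightarrow> \<rho> z z' < \<epsilon>"
    using assms unfolding small_width_def by blast
  let ?I = "{..<N}"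
  let ?v = "\<lambda>z c. u c z"
  obtain dec where dec: "bij_betw dec {..<2^N :: nat} (Pow ?I)"
    using ex_bij_betw_nat_finite[of "Pow ?I"] by (simp add: atLeast0LessThan card_Pow) blast
  have decI: "dec i \<subseteq> ?I" if "i < 2^N" for i using that dec by (auto simp: bij_betw_def)
  \<comment> \<open>The complex is the full \<open>D\<close>-skeleton of a simplex, so only the
    number of nonzero coordinates has to be bounded. The term \<open>D + 1\<close> makes its
    dimension exactly \<open>D\<close> even if \<open>2 ^ N\<close> is small.\<close>
  define M where "M = max (2^N) (D + 1)"
  define K where "K = {\<sigma>. \<sigma> \<subseteq> {..<M} \<and> \<sigma> \<noteq> {} \<and> card \<sigma> \<le> D + 1}"
  have "K \<subseteq> Pow {..<M}" by (auto simp: K_def)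
  then have K: "finite_complex K"
    unfolding finite_complex_def
  proof (intro conjI ballI allI impI)
    fix \<sigma> \<tau> assume "\<sigma> \<in> K" "\<tau> \<subseteq> \<sigma> \<and> \<tau> \<noteq> {}"
    moreover from this have "finite \<sigma>" using finite_subset[of \<sigma> "{..<M}"] by (simp add: K_def)
    ultimately show "\<tau> \<in> K" using card_mono[of \<sigma> \<tau>] unfolding K_def by auto
  next
    show "finite K" using \<open>K \<subseteq> Pow {..<M}\<close> by (rule finite_subset) simp
    show "finite \<sigma>" if "\<sigma> \<in> K" for \<sigma> using that finite_subset[of \<sigma> "{..<M}"] by (simp add: K_def)
    show "\<sigma> \<noteq> {}" if "\<sigma> \<in> K" for \<sigma> using that by (simp add: K_def)
  qed
  have dim: "has_dimension K D"
    unfolding has_dimension_def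
  proof
    show "\<exists>\<sigma>\<in>K. card \<sigma> = D + 1"
      by (intro bexI[of _ "{..<D+1}"]) (auto simp: K_def M_def)
  qed (auto simp: K_def)
  define f where "f z i = (if i < 2^N then lev ?I (?v z) (dec i) else 0)" for z i
  have fcont: "continuous_map Z euclideanreal (\<lambda>z. f z i)" for i
  proof (cases "i < 2^N")
    case True
    then have "finite (dec i)" "finite (?I - dec i)" using decI finite_subset by blast+
    then have "continuous_map Z euclideanreal (\<lambda>z. lev ?I (?v z) (dec i))"
      unfolding lev_def using decI[OF True] cont
      by (intro continuous_map_real_max continuous_map_diff continuous_map_Min continuous_map_Max) auto
    then show ?thesis using True by (simp add: f_def)
  qed (simp add: f_def)
  have sumf: "(\<Sum>i<2^N. if P (dec i) then f z i else 0) = (\<Sum>S\<in>{S\<in>Pow ?I. P S}. lev ?I (?v z) S)" for z P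
  proof -
    have "(\<Sum>i<2^N. if P (dec i) then f z i else 0) = (\<Sum>i<2^N. if P (dec i) then lev ?I (?v z) (dec i) else 0)"
      by (intro sum.cong) (auto simp: f_def)
    also have "\<dots> = (\<Sum>S\<in>Pow ?I. if P S then lev ?I (?v z) S else 0)"
      by (rule sum.reindex_bij_betw[OF dec])
    also have "\<dots> = (\<Sum>S\<in>{S\<in>Pow ?I. P S}. lev ?I (?v z) S)"
      by (rule sum.inter_filter[symmetric]) simp
    finally show ?thesis .
  qed
  have top: "f z \<in> topspace (realization K)" if z: "z \<in> topspace Z" for z
  proof -
    let ?S = "{i. f z i \<noteq> 0}"
    have sub: "?S \<subseteq> {..<2^N}" by (auto simp: f_def split: if_splits)
    have fin: "finite ?S" using finite_subset[OF sub] by simp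
    have one: "(\<Sum>i\<in>?S. f z i) = 1"
    proof -
      have "(\<Sum>i\<in>?S. f z i) = (\<Sum>i<2^N. f z i)"
        using sub by (intro sum.mono_neutral_left) auto
      also have "\<dots> = 1" using sumf[of "\<lambda>_. True" z] sum_lev_Pow[of ?I "?v z"] by (simp add: Pow_def)
      finally show ?thesis .
    qed
    have "dec ` ?S \<subseteq> {S\<in>Pow ?I. lev ?I (?v z) S \<noteq> 0}"
      using decI by (auto simp: f_def split: if_splits)
    then have "card (dec ` ?S) \<le> card {S\<in>Pow ?I. lev ?I (?v z) S \<noteq> 0}"
      by (intro card_mono) auto
    moreover have "card (dec ` ?S) = card ?S"
      using dec sub by (intro card_image) (auto simp: bij_betw_def intro: inj_on_subset)
    moreover have "card {S\<in>Pow ?I. lev ?I (?v z) S \<noteq> 0} \<le> D + 1"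
      using card_lev_pos[of ?I "?v z"] range card z by fastforce
    ultimately have "card ?S \<le> D + 1" by linarith
    moreover have "?S \<noteq> {}" using one by (metis sum.empty zero_neq_one)
    moreover have "?S \<subseteq> {..<M}" using sub by (auto simp: M_def)
    ultimately have "?S \<in> K" by (simp add: K_def)
    moreover have "0 \<le> f z i" for i by (simp add: f_def lev_def)
    ultimately show ?thesis using one by (simp add: realization_def)
  qed
  have "eps_embedding Z \<rho> \<epsilon> (realization K) f"
    unfolding eps_embedding_def
  proof (intro conjI ballI impI)
    show "continuous_map Z (realization K) f"
      unfolding realization_def continuous_map_in_subtopology
    proof
      show "continuous_map Z (product_topology (\<lambda>_. euclideanreal) UNIV) f"
        using fcont by (simp add: continuous_map_componentwise_UNIV)
      show "f \<in> topspace Z \<rightarrow> {x. (\<forall>i. 0 \<le> x i) \<and> {i. x i \<noteq> 0} \<in> K \<and> (\<Sum>i\<in>{i. x i \<noteq> 0}. x i) = 1}"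
        using top by (auto simp: realization_def)
    qed
    fix z z' assume z: "z \<in> topspace Z" "z' \<in> topspace Z" and eq: "f z = f z'"
    have "u c z = u c z'" if c: "c < N" for c
    proof -
      have "u c x = (\<Sum>i<2^N. if c \<in> dec i then f x i else 0)" if "x \<in> topspace Z" for x
        unfolding sumf using sum_lev_member[of ?I c "?v x"] c range that by simp
      from this[OF z(1)] this[OF z(2)] show ?thesis unfolding eq by (rule trans[OF _ sym])
    qed
    then show "\<rho> z z' < \<epsilon>" using sep z by blast
  qed
  with K dim show ?thesis by blast
qed

lemma Widim_le: "small_width Z \<rho> \<epsilon> D \<Longrightarrow> Widim \<epsilon> Z \<rho> \<le> D"
  unfolding Widim_def by (rule Least_le) (rule small_width_imp_eps_embedding)

text \<open>The hypothesis ensures that the \<open>LEAST\<close> in \<open>Widim\<close> is taken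
  over a nonempty set and hence attained.\<close>

lemma small_width_Widim:
  assumes "small_width Z \<rho> \<epsilon> D"
  shows "small_width Z \<rho> \<epsilon> (Widim \<epsilon> Z \<rho>)"
  using LeastI[of "\<lambda>n. \<exists>K. finite_complex K \<and> has_dimension K n \<and> (\<exists>f. eps_embedding Z \<rho> \<epsilon> (realization K) f)",
      OF small_width_imp_eps_embedding[OF assms]] eps_embedding_imp_small_width
  unfolding Widim_def by blast

section \<open>The Lebesgue covering theorem for cubes\<close>

text \<open>The \<open>n\<close>-cube inside the sequences, with all later coordinates 0, so that
  its dimension is a number and not a type.\<close>

definition cube :: "nat \<Rightarrow> (nat \<Rightarrow> real) set" where
  "cube n = {\<theta>. \<forall>i. 0 \<le> \<theta> i \<and> \<theta> i \<le> (if i < n then 1 else 0)}"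

lemma compact_cube: "compact (cube n)"
proof -
  have "compactin (product_topology (\<lambda>_. euclideanreal) UNIV) (PiE UNIV (\<lambda>i. {0..if i < n then 1 else 0::real}))"
    by (subst compactin_PiE) auto
  moreover have "PiE UNIV (\<lambda>i. {0..if i < n then 1 else 0::real}) = cube n"
    by (auto simp: cube_def PiE_def Pi_def)
  ultimately show ?thesis by (simp add: euclidean_product_topology)
qed

lemma continuous_on_coord: "continuous_on S (\<lambda>x::nat \<Rightarrow> real. x i)"
  by (rule continuous_on_subset[OF continuous_on_product_coordinates]) simp

lemma cube_uniformly_continuous:
  fixes v :: "(nat \<Rightarrow> real) \<Rightarrow> real"
  assumes cont: "continuous_on (cube n) v" and e: "e > 0"
  shows "\<exists>p0. \<forall>p\<ge>p0. \<forall>x\<in>cube n. \<forall>y\<in>cube n. (\<forall>i. \<bar>x i - y i\<bar> \<le> 1 / real p) \<longrightarrow> \<bar>v x - v y\<bar> < e"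
proof -
  have "uniformly_continuous_on (cube n) v"
    using cont compact_cube by (rule compact_uniformly_continuous)
  then obtain \<delta> where \<delta>: "\<delta> > 0" "\<And>x y. \<lbrakk>x \<in> cube n; y \<in> cube n; dist y x < \<delta>\<rbrakk> \<Longrightarrow> dist (v y) (v x) < e"
    using e unfolding uniformly_continuous_on_def by metis
  obtain N where N: "(1/2::real) ^ N < \<delta> / 2"
    using real_arch_pow_inv[of "\<delta> / 2" "1/2"] \<delta> by auto
  obtain p0 :: nat where p0: "4 / \<delta> < real p0" using reals_Archimedean2 by blast
  show ?thesis
  proof (intro exI[of _ p0] allI impI ballI)
    fix p x y assume p: "p0 \<le> p" and xy: "x \<in> cube n" "y \<in> cube n" and close: "\<forall>i. \<bar>x i - y i\<bar> \<le> 1 / real p"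
    have "4 / \<delta> < real p" using p0 p by linarith
    moreover from this have "0 < real p" using \<delta>(1) by (smt (verit) divide_pos_pos)
    ultimately have p': "1 / real p < \<delta> / 4" using \<delta>(1) by (simp add: field_simps)
    have "dist x y \<le> 2 * Max {dist (x (from_nat n)) (y (from_nat n)) |n. n \<le> N} + (1/2) ^ N"
      by (rule dist_fun_le_dist_first_terms)
    also have "Max {dist (x (from_nat n)) (y (from_nat n)) |n. n \<le> N} \<le> 1 / real p"
      using close by (intro Max.boundedI) (auto simp: dist_real_def)
    finally have "dist x y < \<delta>" using N p' by simp
    then show "\<bar>v x - v y\<bar> < e" using \<delta>(2)[OF xy(2,1)] by (simp add: dist_real_def)
  qed
qed

definition clip :: "real \<Rightarrow> real" where
  "clip x = max 0 (min 1 x)"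

lemma clip_bounds [simp]: "0 \<le> clip x" "clip x \<le> 1"
  by (auto simp: clip_def)

lemma continuous_on_clip: "continuous_on S f \<Longrightarrow> continuous_on S (\<lambda>x. clip (f x))"
  unfolding clip_def by (intro continuous_intros)

text \<open>Pigeonhole: fewer than \<open>n\<close> values cannot meet all of the \<open>n\<close>
  disjoint open intervals of length \<open>1 / n\<close>.\<close>

lemma level_free_interval:
  fixes V :: "real set"
  assumes "finite V" "card (V \<inter> {0<..<1}) < n"
  shows "\<exists>j<n. \<forall>x\<in>V. x \<le> real j / n \<or> real (j + 1) / n \<le> x"
proof (rule ccontr)
  assume neg: "\<not> ?thesis"
  have n: "n > 0" using assms by linarith
  have "\<exists>x\<in>V. real j / n < x \<and> x < real (j + 1) / n" if "j < n" for j
    using neg that by (meson not_le)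
  then obtain x where x: "\<And>j. j < n \<Longrightarrow> x j \<in> V" "\<And>j. j < n \<Longrightarrow> real j / n < x j"
      "\<And>j. j < n \<Longrightarrow> x j < real (j + 1) / n"
    by metis
  have fl: "nat \<lfloor>n * x j\<rfloor> = j" if "j < n" for j
  proof -
    have "real j < n * x j" "n * x j < real j + 1"
      using x(2,3)[OF that] n by (simp_all add: field_simps)
    then have "\<lfloor>n * x j\<rfloor> = int j" by (intro floor_unique) auto
    then show ?thesis by simp
  qed
  have "inj_on x {..<n}" by (intro inj_onI) (metis fl lessThan_iff)
  then have "n = card (x ` {..<n})" by (simp add: card_image)
  also have "\<dots> \<le> card (V \<inter> {0<..<1})"
  proof (rule card_mono)
    show "x ` {..<n} \<subseteq> V \<inter> {0<..<1}"
    proof (intro image_subsetI IntI)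
      fix j assume j: "j \<in> {..<n}"
      then show "x j \<in> V" using x by simp
      have "0 \<le> real j / n" "real (j + 1) / n \<le> 1" using n j by (auto simp: field_simps)
      moreover have "real j / n < x j" "x j < real (j + 1) / n" using x(2,3)[of j] j by auto
      ultimately show "x j \<in> {0<..<1}" unfolding greaterThanLessThan_iff by linarith
    qed
  qed (use assms in simp)
  finally show False using assms(2) by simp
qed

text \<open>
  Colour a point by a level interval avoided by all \<open>v k\<close>. A colour class falls into clopen pieces according
  to the set of \<open>k\<close> whose value lies above the interval, and no piece of colour \<open>j\<close> joins the two faces in
  direction \<open>j\<close>; Kuhn's lemma excludes such a colouring with \<open>n\<close> colours.
\<close>

lemma no_small_pieces_colouring:
  fixes v :: "'k \<Rightarrow> (nat \<Rightarrow> real) \<Rightarrow> real"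
  assumes fin: "finite K" and n: "n > 0"
    and cont: "\<And>k. k \<in> K \<Longrightarrow> continuous_on (cube n) (v k)"
    and card: "\<And>\<theta>. \<theta> \<in> cube n \<Longrightarrow> card ((\<lambda>k. v k \<theta>) ` K \<inter> {0<..<1}) < n"
    and faces: "\<And>\<theta> \<theta>' i h. \<lbrakk>\<theta> \<in> cube n; \<theta>' \<in> cube n; i < n; \<theta> i = 0; \<theta>' i = 1; 0 < h; h < 1\<rbrakk> \<Longrightarrow>
       {k\<in>K. h \<le> v k \<theta>} \<noteq> {k\<in>K. h \<le> v k \<theta>'}"
  shows False
proof -
  define w where "w = 1 / real n"
  have w: "w > 0" using n by (simp add: w_def)
  have "\<exists>p0. \<forall>k\<in>K. \<forall>p\<ge>p0. \<forall>x\<in>cube n. \<forall>y\<in>cube n. (\<forall>i. \<bar>x i - y i\<bar> \<le> 1 / real p) \<longrightarrow> \<bar>v k x - v k y\<bar> < w / 3"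
  proof -
    have "\<forall>k\<in>K. \<exists>p0. \<forall>p\<ge>p0. \<forall>x\<in>cube n. \<forall>y\<in>cube n. (\<forall>i. \<bar>x i - y i\<bar> \<le> 1 / real p) \<longrightarrow> \<bar>v k x - v k y\<bar> < w / 3"
      using cube_uniformly_continuous[OF cont, of _ "w / 3"] w by simp
    then obtain P where P: "\<forall>k\<in>K. \<forall>p\<ge>P k. \<forall>x\<in>cube n. \<forall>y\<in>cube n. (\<forall>i. \<bar>x i - y i\<bar> \<le> 1 / real p) \<longrightarrow> \<bar>v k x - v k y\<bar> < w / 3"
      by (metis (no_types, lifting))
    have "P k \<le> (\<Sum>k\<in>K. P k)" if "k \<in> K" for k using member_le_sum[of k K P] that fin by simp
    then show ?thesis using P by (intro exI[of _ "\<Sum>k\<in>K. P k"]) (meson le_trans)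
  qed
  then obtain p0 where p0: "\<And>k p x y. \<lbrakk>k \<in> K; p0 \<le> p; x \<in> cube n; y \<in> cube n; \<forall>i. \<bar>x i - y i\<bar> \<le> 1 / real p\<rbrakk>
      \<Longrightarrow> \<bar>v k x - v k y\<bar> < w / 3" by blast
  define p where "p = max 1 p0"
  have p: "p > 0" "p0 \<le> p" by (auto simp: p_def)
  define emb :: "(nat \<Rightarrow> nat) \<Rightarrow> nat \<Rightarrow> real" where "emb x i = (if i < n then real (x i) / p else 0)" for x i
  have emb: "emb x \<in> cube n" if "\<forall>i<n. x i \<le> p" for x
    using that p by (auto simp: cube_def emb_def)
  \<comment> \<open>Midpoint of the \<open>j\<close>-th level interval. A grid step changes each
    \<open>v k\<close> by less than \<open>w / 3\<close>, so a value outside the interval cannot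
    cross \<open>h j\<close>.\<close>
  define h where "h j = (real j + 1 / 2) * w" for j :: nat
  have h: "0 < h j" "h j < 1" if "j < n" for j
  proof -
    show "0 < h j" using w by (simp add: h_def)
    have "(real j + 1 / 2) * w < real n * w" using that w by (intro mult_strict_right_mono) auto
    then show "h j < 1" using n by (simp add: h_def w_def)
  qed
  define side where "side j \<theta> = {k\<in>K. h j \<le> v k \<theta>}" for j \<theta>
  \<comment> \<open>Pieces are not taken to be connected: all points with the same
    \<open>side\<close> are identified, and \<open>low\<close> asks whether this side occurs on the
    lower face. The hypothesis \<open>faces\<close> then keeps it off the upper face.\<close>
  define low where "low j \<theta> \<longleftrightarrow> (\<exists>\<theta>0\<in>cube n. \<theta>0 j = 0 \<and> side j \<theta>0 = side j \<theta>)" for j \<theta>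
  define label :: "(nat \<Rightarrow> nat) \<Rightarrow> nat \<Rightarrow> nat" where "label x j = (if low j (emb x) then 0 else 1)" for x j
  obtain q where q: "\<forall>i<n. q i < p"
    and rs: "\<forall>i<n. \<exists>r s. (\<forall>j<n. q j \<le> r j \<and> r j \<le> q j + 1) \<and> (\<forall>j<n. q j \<le> s j \<and> s j \<le> q j + 1) \<and> label r i \<noteq> label s i"
  proof (rule kuhn_lemma[of p n label])
    show "\<forall>x. (\<forall>i<n. x i \<le> p) \<longrightarrow> (\<forall>i<n. x i = 0 \<longrightarrow> label x i = 0)"
    proof (intro allI impI)
      fix x i assume x: "\<forall>i<n. x i \<le> p" "i < n" "x i = 0"
      then have "emb x i = 0" by (simp add: emb_def)
      then show "label x i = 0" using emb[OF x(1)] by (auto simp: label_def low_def)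
    qed
    show "\<forall>x. (\<forall>i<n. x i \<le> p) \<longrightarrow> (\<forall>i<n. x i = p \<longrightarrow> label x i = 1)"
    proof (intro allI impI)
      fix x i assume x: "\<forall>i<n. x i \<le> p" "i < n" "x i = p"
      then have 1: "emb x i = 1" using p by (simp add: emb_def)
      have "\<not> low i (emb x)"
        unfolding low_def side_def using faces[OF _ emb[OF x(1)] x(2) _ 1 h[OF x(2)]] by blast
      then show "label x i = 1" by (simp add: label_def)
    qed
  qed (use p in \<open>auto simp: label_def\<close>)
  have qc: "emb q \<in> cube n" using q by (intro emb) (auto intro: less_imp_le)
  obtain j where j: "j < n" and free: "\<And>y. y \<in> (\<lambda>k. v k (emb q)) ` K \<Longrightarrow> y \<le> real j / n \<or> real (j + 1) / n \<le> y"
    using level_free_interval[of "(\<lambda>k. v k (emb q)) ` K" n] card[OF qc] fin by (meson finite_imageI)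
  have same: "side j (emb r) = side j (emb q)" if r: "\<forall>j<n. q j \<le> r j \<and> r j \<le> q j + 1" for r
  proof -
    have rc: "emb r \<in> cube n"
    proof (intro emb allI impI)
      fix i assume "i < n"
      then have "r i \<le> q i + 1" "q i < p" using r q by auto
      then show "r i \<le> p" by simp
    qed
    have "\<bar>emb r i - emb q i\<bar> \<le> 1 / real p" for i
    proof (cases "i < n")
      case True
      then have "q i \<le> r i" "r i \<le> q i + 1" using r by auto
      then have "\<bar>real (r i) - real (q i)\<bar> \<le> 1" by linarith
      then have "\<bar>real (r i) - real (q i)\<bar> / p \<le> 1 / p" using p by (intro divide_right_mono) auto
      then show ?thesis using True p by (simp add: emb_def flip: diff_divide_distrib)
    qed (simp add: emb_def)
    then have close: "\<bar>v k (emb r) - v k (emb q)\<bar> < w / 3" if "k \<in> K" for k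
      using p0[OF that p(2) rc qc] by blast
    have "h j \<le> v k (emb r) \<longleftrightarrow> h j \<le> v k (emb q)" if k: "k \<in> K" for k
    proof -
      have "v k (emb q) \<le> real j * w \<or> (real j + 1) * w \<le> v k (emb q)"
        using free[of "v k (emb q)"] k by (auto simp: w_def add_divide_distrib algebra_simps)
      moreover have "h j = real j * w + w / 2" "(real j + 1) * w = real j * w + w"
        by (simp_all add: h_def algebra_simps)
      ultimately show ?thesis using close[OF k] w by linarith
    qed
    then show ?thesis by (auto simp: side_def)
  qed
  obtain r s where "\<forall>j<n. q j \<le> r j \<and> r j \<le> q j + 1" "\<forall>j<n. q j \<le> s j \<and> s j \<le> q j + 1" "label r j \<noteq> label s j"
    using rs j by blast
  then show False using same[of r] same[of s] by (simp add: label_def low_def)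
qed

text \<open>If opposite faces never had equal values, compactness would give a gap
  \<open>\<eta>\<close> between them. Each \<open>u c\<close> is cut into \<open>r\<close> pieces
  \<open>clip (r * u c - i)\<close>. At any point at most one piece of each coordinate lies in
  \<open>(0, 1)\<close>, with value \<open>frac (r * u c)\<close>, so the number of such values does
  not grow; but the superlevel sets of the pieces now determine \<open>u c\<close> up to
  \<open>2 / r\<close>. For large \<open>r\<close> this turns the gap into the hypothesis on faces
  of \<open>no_small_pieces_colouring\<close>.\<close>

lemma cube_not_small_width:
  fixes u :: "'c \<Rightarrow> (nat \<Rightarrow> real) \<Rightarrow> real"
  assumes I: "finite I" and D: "D < n"
    and cont: "\<And>c. c \<in> I \<Longrightarrow> continuous_on (cube n) (u c)"
    and range: "\<And>c \<theta>. c \<in> I \<Longrightarrow> \<theta> \<in> cube n \<Longrightarrow> 0 \<le> u c \<theta> \<and> u c \<theta> \<le> 1"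
    and card: "\<And>\<theta>. \<theta> \<in> cube n \<Longrightarrow> card ((\<lambda>c. u c \<theta>) ` I \<inter> {0<..<1}) \<le> D"
  shows "\<exists>\<theta>\<in>cube n. \<exists>\<theta>'\<in>cube n. \<exists>i<n. \<theta> i = 0 \<and> \<theta>' i = 1 \<and> (\<forall>c\<in>I. u c \<theta> = u c \<theta>')"
proof (rule ccontr)
  assume neg: "\<not> ?thesis"
  let ?P = "\<lambda>i. (cube n \<inter> {\<theta>. \<theta> i = 0}) \<times> (cube n \<inter> {\<theta>. \<theta> i = 1})"
  let ?g = "\<lambda>(\<theta>, \<theta>'). \<Sum>c\<in>I. \<bar>u c \<theta> - u c \<theta>'\<bar>"
  have "\<exists>e>0. \<forall>x\<in>?P i. e \<le> ?g x" if i: "i < n" for i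
  proof (cases "?P i = {}")
    case True
    then show ?thesis by (intro exI[of _ 1]) auto
  next
    case False
    have cl: "closed {\<theta>::nat \<Rightarrow> real. \<theta> i = t}" for t
      by (intro closed_Collect_eq continuous_on_coord continuous_on_const)
    have "compact (?P i)"
      by (intro compact_Times compact_Int_closed compact_cube cl)
    moreover have "continuous_on (?P i) ?g"
    proof -
      have "continuous_on (?P i) (\<lambda>x. u c (fst x))" "continuous_on (?P i) (\<lambda>x. u c (snd x))" if "c \<in> I" for c
        by (rule continuous_on_compose2[OF cont[OF that]]; auto intro: continuous_on_fst continuous_on_snd continuous_on_id)+
      then show ?thesis unfolding case_prod_beta by (intro continuous_on_sum continuous_on_rabs continuous_on_diff) auto
    qed
    ultimately obtain x where x: "x \<in> ?P i" "\<And>y. y \<in> ?P i \<Longrightarrow> ?g x \<le> ?g y"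
      using continuous_attains_inf[of "?P i" ?g] False by blast
    obtain c where "c \<in> I" "u c (fst x) \<noteq> u c (snd x)"
    proof -
      have "fst x \<in> cube n" "snd x \<in> cube n" "fst x i = 0" "snd x i = 1" using x(1) by auto
      then have "\<not> (\<forall>c\<in>I. u c (fst x) = u c (snd x))" using neg i by blast
      then show ?thesis using that by blast
    qed
    then have "0 < (\<Sum>c\<in>I. \<bar>u c (fst x) - u c (snd x)\<bar>)"
      using I by (intro sum_pos2[of I c]) auto
    then have "0 < ?g x" by (simp add: case_prod_beta)
    then show ?thesis using x(2) by blast
  qed
  then have "\<forall>i\<in>{..<n}. \<exists>e>0. \<forall>x\<in>?P i. e \<le> ?g x" by simp
  from bchoice[OF this] obtain e where e': "\<forall>i\<in>{..<n}. e i > 0 \<and> (\<forall>x\<in>?P i. e i \<le> ?g x)" by (elim exE)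
  have e: "\<And>i. i < n \<Longrightarrow> e i > 0" using e' by simp
  have e2: "\<And>i x. i < n \<Longrightarrow> x \<in> ?P i \<Longrightarrow> e i \<le> ?g x" using e' by blast
  define \<eta> where "\<eta> = Min (e ` {..<n})"
  have n: "n > 0" using D by simp
  have \<eta>: "\<eta> > 0" unfolding \<eta>_def using e n by (subst Min_gr_iff) auto
  have \<eta>g: "\<eta> \<le> (\<Sum>c\<in>I. \<bar>u c \<theta> - u c \<theta>'\<bar>)"
    if "\<theta> \<in> cube n" "\<theta>' \<in> cube n" "i < n" "\<theta> i = 0" "\<theta>' i = 1" for \<theta> \<theta>' i
  proof -
    have "\<eta> \<le> e i" unfolding \<eta>_def using that by (intro Min_le) auto
    then show ?thesis using e2[of i "(\<theta>, \<theta>')"] that by simp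
  qed
  obtain r :: nat where r: "2 * card I / \<eta> < r" using reals_Archimedean2 by blast
  have "0 \<le> 2 * real (card I) / \<eta>" using \<eta> by simp
  then have r0: "0 < real r" using r by linarith
  have r\<eta>: "real (card I) * (2 / r) < \<eta>" using r r0 \<eta> by (simp add: field_simps)
  define v where "v k \<theta> = clip (r * u (fst k) \<theta> - real (snd k))" for k \<theta>
  show False
  proof (rule no_small_pieces_colouring[of "I \<times> {..<r}" n v])
    show "continuous_on (cube n) (v k)" if "k \<in> I \<times> {..<r}" for k
      unfolding v_def using that cont
      by (intro continuous_on_clip continuous_on_diff continuous_on_mult continuous_on_const) auto
    show "card ((\<lambda>k. v k \<theta>) ` (I \<times> {..<r}) \<inter> {0<..<1}) < n" if \<theta>: "\<theta> \<in> cube n" for \<theta>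
    proof -
      have "(\<lambda>k. v k \<theta>) ` (I \<times> {..<r}) \<inter> {0<..<1} \<subseteq> (\<lambda>x. frac (r * x)) ` ((\<lambda>c. u c \<theta>) ` I \<inter> {0<..<1})"
      proof
        fix y assume "y \<in> (\<lambda>k. v k \<theta>) ` (I \<times> {..<r}) \<inter> {0<..<1}"
        then obtain c i where ci: "c \<in> I" "i < r" "y = clip (r * u c \<theta> - real i)" "0 < y" "y < 1"
          by (auto simp: v_def)
        then have y: "y = r * u c \<theta> - real i" by (auto simp: clip_def max_def min_def split: if_splits)
        then have lt: "real i < r * u c \<theta>" "r * u c \<theta> < real i + 1" using ci by auto
        then have "\<lfloor>r * u c \<theta>\<rfloor> = int i" by (intro floor_unique) auto
        then have "y = frac (r * u c \<theta>)" using y by (simp add: frac_def)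
        moreover have "0 < r * u c \<theta>" using lt by linarith
        then have "0 < u c \<theta>" using r0 by (simp add: zero_less_mult_iff)
        moreover have "r * u c \<theta> < real r * 1" using lt(2) ci(2) by linarith
        then have "u c \<theta> < 1" by (simp only: mult_less_cancel_left_pos[OF r0])
        ultimately show "y \<in> (\<lambda>x. frac (r * x)) ` ((\<lambda>c. u c \<theta>) ` I \<inter> {0<..<1})" using ci(1) by auto
      qed
      then have "card ((\<lambda>k. v k \<theta>) ` (I \<times> {..<r}) \<inter> {0<..<1}) \<le> card ((\<lambda>x. frac (r * x)) ` ((\<lambda>c. u c \<theta>) ` I \<inter> {0<..<1}))"
        using I by (intro card_mono) auto
      also have "\<dots> \<le> card ((\<lambda>c. u c \<theta>) ` I \<inter> {0<..<1})" using I by (intro card_image_le) auto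
      finally show ?thesis using card[OF \<theta>] D by linarith
    qed
    show "{k\<in>I \<times> {..<r}. h \<le> v k \<theta>} \<noteq> {k\<in>I \<times> {..<r}. h \<le> v k \<theta>'}"
      if \<theta>: "\<theta> \<in> cube n" "\<theta>' \<in> cube n" "i < n" "\<theta> i = 0" "\<theta>' i = 1" and h: "0 < h" "h < 1" for \<theta> \<theta>' i h
    proof
      assume eq: "{k\<in>I \<times> {..<r}. h \<le> v k \<theta>} = {k\<in>I \<times> {..<r}. h \<le> v k \<theta>'}"
      have gap: "r * u c y - r * u c x \<le> 2"
        if c: "c \<in> I" and x: "x \<in> cube n" and y: "y \<in> cube n"
          and imp: "\<And>k. k \<in> I \<times> {..<r} \<Longrightarrow> h \<le> v k y \<Longrightarrow> h \<le> v k x" for c x y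
      proof (rule ccontr)
        assume far: "\<not> ?thesis"
        have ux: "0 \<le> r * u c x" and uy: "r * u c y \<le> r"
          using range[OF c x] range[OF c y] r0 by (auto simp: mult_left_le)
        \<comment> \<open>The piece with index just above \<open>r * u c x\<close> vanishes at
          \<open>x\<close> and equals 1 at \<open>y\<close> once the two scaled values differ by
          more than 2.\<close>
        define i where "i = nat \<lfloor>r * u c x\<rfloor> + 1"
        have "real (nat \<lfloor>r * u c x\<rfloor>) = of_int \<lfloor>r * u c x\<rfloor>" using ux by simp
        then have i: "r * u c x \<le> real i" "real i \<le> r * u c x + 1"
          unfolding i_def using floor_correct[of "r * u c x"] by linarith+
        have "real i + 1 < r" using i far uy by linarith
        then have k: "(c, i) \<in> I \<times> {..<r}" using c by auto
        have "v (c, i) x = 0" using i by (simp add: v_def clip_def)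
        moreover have "v (c, i) y = 1" using i far by (simp add: v_def clip_def)
        ultimately show False using imp[OF k] h by simp
      qed
      have "\<bar>u c \<theta> - u c \<theta>'\<bar> \<le> 2 / r" if c: "c \<in> I" for c
      proof -
        have "r * u c \<theta>' - r * u c \<theta> \<le> 2" by (rule gap[OF c \<theta>(1,2)]) (use eq in blast)
        moreover have "r * u c \<theta> - r * u c \<theta>' \<le> 2" by (rule gap[OF c \<theta>(2,1)]) (use eq in blast)
        ultimately have "r * \<bar>u c \<theta> - u c \<theta>'\<bar> \<le> 2"
          by (simp add: abs_if right_diff_distrib)
        then show ?thesis using r0 by (simp add: pos_le_divide_eq mult.commute)
      qed
      then have "(\<Sum>c\<in>I. \<bar>u c \<theta> - u c \<theta>'\<bar>) \<le> real (card I) * (2 / r)"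
        using sum_bounded_above[of I "\<lambda>c. \<bar>u c \<theta> - u c \<theta>'\<bar>" "2 / r"] by simp
      then show False using \<eta>g[OF \<theta>] r\<eta> by linarith
    qed
  qed (use I n in auto)
qed

section \<open>Compact metric spaces\<close>

locale compact_metric =
  fixes Z :: "'a topology" and \<rho> :: "'a \<Rightarrow> 'a \<Rightarrow> real"
  assumes compact_Z: "compact_space Z" and compatible: "compatible_metric Z \<rho>"
begin

sublocale Metric_space "topspace Z" \<rho>
  using compatible by (simp add: compatible_metric_def)

lemma mtopology_eq: "mtopology = Z"
  using compatible by (simp add: compatible_metric_def)

lemma compactin_Z: "compactin mtopology (topspace Z)"
  using compact_Z by (simp add: mtopology_eq compact_space_def)

lemma finite_net:
  assumes "\<epsilon> > 0"
  shows "\<exists>N. finite N \<and> N \<subseteq> topspace Z \<and> (\<forall>z\<in>topspace Z. \<exists>x\<in>N. \<rho> x z < \<epsilon>)"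
proof -
  obtain N where N: "finite N" "N \<subseteq> topspace Z" "topspace Z \<subseteq> (\<Union>x\<in>N. mball x \<epsilon>)"
    using compactin_imp_mtotally_bounded[OF compactin_Z] assms unfolding mtotally_bounded_def by metis
  have "\<exists>x\<in>N. \<rho> x z < \<epsilon>" if "z \<in> topspace Z" for z 
  proof -
    obtain x where "x \<in> N" "z \<in> mball x \<epsilon>" using N(3) \<open>z \<in> topspace Z\<close> by blast
    then show ?thesis by (intro bexI[of _ x]) simp_all
  qed
  with N show ?thesis by blast
qed

lemma continuous_real_iff:
  "continuous_map Z euclideanreal f \<longleftrightarrow>
    (\<forall>a\<in>topspace Z. \<forall>\<epsilon>>0. \<exists>\<delta>>0. \<forall>x\<in>topspace Z. \<rho> a x < \<delta> \<longrightarrow> \<bar>f a - f x\<bar> < \<epsilon>)"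
  using metric_continuous_map[OF Met_TC.Metric_space_axioms, of f]
  by (simp add: mtopology_eq mtopology_is_euclidean dist_real_def) meson

lemma continuous_dist_point:
  assumes "x \<in> topspace Z"
  shows "continuous_map Z euclideanreal (\<rho> x)"
  unfolding continuous_real_iff
proof (intro ballI allI impI)
  fix a \<epsilon> :: real and b assume "b \<in> topspace Z" "(0::real) < \<epsilon>"
  moreover have "\<bar>\<rho> x b - \<rho> x y\<bar> \<le> \<rho> b y" if "y \<in> topspace Z" for y
    using triangle[of x b y] triangle[of x y b] commute[of b y] assms that calculation by auto
  ultimately show "\<exists>\<delta>>0. \<forall>y\<in>topspace Z. \<rho> b y < \<delta> \<longrightarrow> \<bar>\<rho> x b - \<rho> x y\<bar> < \<epsilon>"
    by (intro exI[of _ \<epsilon>]) (auto intro: le_less_trans)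
qed

lemma uniformly_continuous:
  assumes f: "continuous_map Z euclideanreal f" and \<epsilon>: "\<epsilon> > 0"
  shows "\<exists>\<delta>>0. \<forall>x\<in>topspace Z. \<forall>y\<in>topspace Z. \<rho> x y < \<delta> \<longrightarrow> \<bar>f x - f y\<bar> < \<epsilon>"
proof -
  let ?U = "\<lambda>a. {x\<in>topspace Z. f x \<in> ball (f a) (\<epsilon> / 2)}"
  have "\<exists>\<delta>>0. \<forall>x\<in>topspace Z. \<exists>U\<in>?U ` topspace Z. mball x \<delta> \<subseteq> U"
  proof (rule lebesgue_number[OF compactin_Z])
    show "topspace Z \<subseteq> \<Union> (?U ` topspace Z)" using \<epsilon> by auto
    show "openin mtopology U" if "U \<in> ?U ` topspace Z" for U
    proof -
      from that obtain a where "U = ?U a" by blast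
      then show ?thesis unfolding mtopology_eq
        by (simp only:) (rule openin_continuous_map_preimage[OF f], simp)
    qed
  qed
  then obtain \<delta> where \<delta>: "\<delta> > 0" "\<And>x. x \<in> topspace Z \<Longrightarrow> \<exists>a\<in>topspace Z. mball x \<delta> \<subseteq> ?U a" by auto
  have "\<bar>f x - f y\<bar> < \<epsilon>" if xy: "x \<in> topspace Z" "y \<in> topspace Z" "\<rho> x y < \<delta>" for x y
  proof -
    obtain a where a: "mball x \<delta> \<subseteq> ?U a" using \<delta>(2)[OF xy(1)] by blast
    have "x \<in> mball x \<delta>" "y \<in> mball x \<delta>" using xy \<delta>(1) by auto
    then have "f x \<in> ball (f a) (\<epsilon> / 2)" "f y \<in> ball (f a) (\<epsilon> / 2)" using a by blast+
    then have "\<bar>f a - f x\<bar> < \<epsilon> / 2" "\<bar>f a - f y\<bar> < \<epsilon> / 2" by (simp_all add: dist_real_def)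
    then show ?thesis by linarith
  qed
  with \<delta>(1) show ?thesis by blast
qed

lemma uniformly_continuous_finite:
  assumes "finite \<F>" "\<And>f. f \<in> \<F> \<Longrightarrow> continuous_map Z euclideanreal f" and "\<epsilon> > 0"
  shows "\<exists>\<delta>>0. \<forall>f\<in>\<F>. \<forall>x\<in>topspace Z. \<forall>y\<in>topspace Z. \<rho> x y < \<delta> \<longrightarrow> \<bar>f x - f y\<bar> < \<epsilon>"
  using assms(1,2)
proof (induction \<F> rule: finite_induct)
  case empty
  then show ?case by (intro exI[of _ 1]) auto
next
  case (insert f \<F>)
  obtain \<delta>1 where \<delta>1: "\<delta>1 > 0" "\<forall>f\<in>\<F>. \<forall>x\<in>topspace Z. \<forall>y\<in>topspace Z. \<rho> x y < \<delta>1 \<longrightarrow> \<bar>f x - f y\<bar> < \<epsilon>"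
    using insert by auto
  obtain \<delta>2 where \<delta>2: "\<delta>2 > 0" "\<forall>x\<in>topspace Z. \<forall>y\<in>topspace Z. \<rho> x y < \<delta>2 \<longrightarrow> \<bar>f x - f y\<bar> < \<epsilon>"
    using uniformly_continuous[OF insert.prems(1)[OF insertI1] assms(3)] by blast
  show ?case using \<delta>1 \<delta>2 by (intro exI[of _ "min \<delta>1 \<delta>2"]) auto
qed

lemma bounded_continuous:
  assumes f: "continuous_map Z euclideanreal f"
  shows "\<exists>B>0. \<forall>x\<in>topspace Z. \<bar>f x\<bar> \<le> B"
proof -
  have "compact (f ` topspace Z)"
    using image_compactin[OF _ f] compact_Z by (simp add: compact_space_def)
  then obtain B where "\<forall>y\<in>f ` topspace Z. norm y \<le> B"
    using compact_imp_bounded bounded_iff by metis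
  then show ?thesis by (intro exI[of _ "max B 1"]) (auto simp: le_max_iff_disj)
qed

lemma continuous_dist:
  "continuous_map (prod_topology Z Z) euclideanreal (\<lambda>(x, y). \<rho> x y)"
proof -
  show ?thesis
    unfolding mtopology_is_euclidean[symmetric] Met_TC.continuous_map_to_metric
  proof (intro ballI allI impI)
    fix p :: "'a \<times> 'a" and \<epsilon> :: real assume p: "p \<in> topspace (prod_topology Z Z)" and \<epsilon>: "\<epsilon> > 0"
    obtain x y where xy: "p = (x, y)" by force
    have xyZ: "x \<in> topspace Z" "y \<in> topspace Z" using p xy by auto
    let ?U = "mball x (\<epsilon> / 2) \<times> mball y (\<epsilon> / 2)"
    have "openin Z (mball x r)" for x r using openin_mball[of x r] by (simp add: mtopology_eq)
    then have "openin (prod_topology Z Z) ?U" by (simp add: openin_prod_Times_iff)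
    moreover have "p \<in> ?U" using xy xyZ \<epsilon> by auto
    moreover have "(\<lambda>(x, y). \<rho> x y) q \<in> Met_TC.mball ((\<lambda>(x, y). \<rho> x y) p) \<epsilon>" if "q \<in> ?U" for q
    proof -
      obtain a b where q: "q = (a, b)" by force
      have ab: "a \<in> topspace Z" "b \<in> topspace Z" "\<rho> x a < \<epsilon> / 2" "\<rho> y b < \<epsilon> / 2" using that q by auto
      have "\<rho> x y \<le> \<rho> x a + (\<rho> a b + \<rho> b y)" "\<rho> a b \<le> \<rho> a x + (\<rho> x y + \<rho> y b)"
        using triangle[of x a y] triangle[of a b y] triangle[of a x b] triangle[of x y b] xyZ ab by auto
      then show ?thesis using ab commute[of b y] commute[of a x] by (simp add: q xy dist_real_def)
    qed
    ultimately show "\<exists>U. openin (prod_topology Z Z) U \<and> p \<in> U \<and>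
        (\<forall>q\<in>U. (\<lambda>(x, y). \<rho> x y) q \<in> Met_TC.mball ((\<lambda>(x, y). \<rho> x y) p) \<epsilon>)" by blast
  qed
qed

text \<open>Compactness of the set of pairs at distance at least \<open>\<epsilon>\<close>. The
  strict inequalities define open sets, and a pair with \<open>g x \<noteq> g y\<close> is caught by
  the numbers that divide the interval between the two values into thirds.\<close>

lemma separating_triples:
  assumes cont: "\<And>g. g \<in> \<G> \<Longrightarrow> continuous_map Z euclideanreal g"
    and sep: "\<And>x y. \<lbrakk>x \<in> topspace Z; y \<in> topspace Z; x \<noteq> y\<rbrakk> \<Longrightarrow> \<exists>g\<in>\<G>. g x \<noteq> g y"
    and \<epsilon>: "\<epsilon> > 0"
  shows "\<exists>Q. finite Q \<and> (\<forall>(g, a, b)\<in>Q. g \<in> \<G> \<and> a < (b::real)) \<and>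
    (\<forall>x\<in>topspace Z. \<forall>y\<in>topspace Z. \<epsilon> \<le> \<rho> x y \<longrightarrow>
      (\<exists>(g, a, b)\<in>Q. (g x \<le> a \<and> b \<le> g y) \<or> (g y \<le> a \<and> b \<le> g x)))"
proof -
  let ?T = "{(g, a, b) | g a b. g \<in> \<G> \<and> a < (b::real)}"
  let ?O = "\<lambda>(g, a, b). {p\<in>topspace (prod_topology Z Z). (g (fst p) < a \<and> b < g (snd p)) \<or> (g (snd p) < a \<and> b < g (fst p))}"
  let ?E = "{p\<in>topspace (prod_topology Z Z). (\<lambda>(x, y). \<rho> x y) p \<in> {\<epsilon>..}}"
  have "closedin (prod_topology Z Z) ?E"
    using continuous_dist by (rule closedin_continuous_map_preimage) simp
  moreover have "compact_space (prod_topology Z Z)"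
    using compact_Z by (simp add: compact_space_prod_topology)
  ultimately have E: "compactin (prod_topology Z Z) ?E" by (intro closedin_compact_space)
  have O: "openin (prod_topology Z Z) (?O t)" if t': "t \<in> ?T" for t
  proof -
    obtain g a b where t: "t = (g, a, b)" "g \<in> \<G>" using t' by blast
    have g: "continuous_map (prod_topology Z Z) euclideanreal (\<lambda>p. g (fst p))"
      "continuous_map (prod_topology Z Z) euclideanreal (\<lambda>p. g (snd p))"
      using continuous_map_compose[OF continuous_map_fst cont[OF t(2)]]
        continuous_map_compose[OF continuous_map_snd cont[OF t(2)]] by (simp_all add: o_def)
    let ?P = "prod_topology Z Z"
    have eq: "?O t = ({p\<in>topspace ?P. g (fst p) \<in> {..<a}} \<inter> {p\<in>topspace ?P. g (snd p) \<in> {b<..}})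
        \<union> ({p\<in>topspace ?P. g (snd p) \<in> {..<a}} \<inter> {p\<in>topspace ?P. g (fst p) \<in> {b<..}})"
      unfolding t by auto
    show ?thesis unfolding eq
      by (intro openin_Un openin_Int openin_continuous_map_preimage[OF g(1)] openin_continuous_map_preimage[OF g(2)]) auto
  qed
  have cover: "?E \<subseteq> \<Union> (?O ` ?T)"
  proof
    fix p assume p: "p \<in> ?E"
    obtain x y where xy: "p = (x, y)" by force
    have xyZ: "x \<in> topspace Z" "y \<in> topspace Z" "\<epsilon> \<le> \<rho> x y" using p xy by auto
    then have "x \<noteq> y" using \<epsilon> by auto
    then obtain g where g: "g \<in> \<G>" "g x \<noteq> g y" using sep xyZ by blast
    define l where "l = min (g x) (g y)"
    define u where "u = max (g x) (g y)"
    have lu: "l < u" using g(2) by (auto simp: l_def u_def)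
    let ?t = "(g, (2 * l + u) / 3, (l + 2 * u) / 3)"
    have "p \<in> ?O ?t"
      using p xy lu g(2) by (auto simp: l_def u_def min_def max_def split: if_splits)
    moreover have "?t \<in> ?T"
      using g(1) lu by (intro CollectI exI[of _ g] exI[of _ "(2 * l + u) / 3"] exI[of _ "(l + 2 * u) / 3"]) auto
    ultimately show "p \<in> \<Union> (?O ` ?T)" by blast
  qed
  obtain \<F> where \<F>: "finite \<F>" "\<F> \<subseteq> ?O ` ?T" "?E \<subseteq> \<Union>\<F>"
  proof -
    have "openin (prod_topology Z Z) U" if U: "U \<in> ?O ` ?T" for U
    proof -
      from U obtain t where "t \<in> ?T" "U = ?O t" by (rule imageE)
      then show ?thesis using O by (simp only:)
    qed
    then have "\<exists>\<F>. finite \<F> \<and> \<F> \<subseteq> ?O ` ?T \<and> ?E \<subseteq> \<Union>\<F>" by (rule compactinD[OF E _ cover])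
    with that show ?thesis by (elim exE conjE)
  qed
  obtain Q where Q: "Q \<subseteq> ?T" "finite Q" "\<F> = ?O ` Q"
    using finite_subset_image[OF \<F>(1,2)] by blast
  show ?thesis
  proof (intro exI[of _ Q] conjI ballI impI)
    show "finite Q" by fact
    show "case t of (g, a, b) \<Rightarrow> g \<in> \<G> \<and> a < b" if "t \<in> Q" for t
    proof -
      have "t \<in> ?T" using that Q(1) by (rule subsetD[rotated])
      then show ?thesis by blast
    qed
    fix x y assume xy: "x \<in> topspace Z" "y \<in> topspace Z" "\<epsilon> \<le> \<rho> x y"
    then have "(x, y) \<in> ?E" by auto
    then obtain t where t: "t \<in> Q" "(x, y) \<in> ?O t" using \<F>(3) Q(3) by blast
    obtain g a b where gab: "t = (g, a, b)" by (cases t)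
    have "(g x < a \<and> b < g y) \<or> (g y < a \<and> b < g x)" using t(2) unfolding gab by simp
    then have "(g x \<le> a \<and> b \<le> g y) \<or> (g y \<le> a \<and> b \<le> g x)" by linarith
    then show "\<exists>(g, a, b)\<in>Q. (g x \<le> a \<and> b \<le> g y) \<or> (g y \<le> a \<and> b \<le> g x)"
      using t(1) unfolding gab by (intro bexI[of _ "(g, a, b)"]) simp_all
  qed
qed

end

section \<open>Borel probability measures on a compact metrizable space\<close>

lemma space_borel_of [simp]: "space (borel_of X) = topspace X"
  unfolding borel_of_def by (rule space_measure_of) (auto dest: openin_subset)

lemma sets_borel_of: "sets (borel_of X) = sigma_sets (topspace X) {U. openin X U}"
  unfolding borel_of_def by (rule sets_measure_of) (auto dest: openin_subset)

lemma openin_borel_of: "openin X U \<Longrightarrow> U \<in> sets (borel_of X)"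
  by (simp add: sets_borel_of)

lemma measurable_borel_ofI:
  assumes "f \<in> space M \<rightarrow> topspace X" "\<And>U. openin X U \<Longrightarrow> f -` U \<inter> space M \<in> sets M"
  shows "f \<in> measurable M (borel_of X)"
  unfolding borel_of_def using assms by (intro measurable_measure_of) (auto dest: openin_subset)

lemma continuous_map_measurable:
  assumes "continuous_map X Y f"
  shows "f \<in> measurable (borel_of X) (borel_of Y)"
proof (rule measurable_borel_ofI)
  show "f \<in> space (borel_of X) \<rightarrow> topspace Y" using assms by (auto simp: continuous_map_def)
  fix U assume "openin Y U"
  then have "openin X {x\<in>topspace X. f x \<in> U}" by (rule openin_continuous_map_preimage[OF assms])
  moreover have "{x\<in>topspace X. f x \<in> U} = f -` U \<inter> space (borel_of X)" by auto
  ultimately show "f -` U \<inter> space (borel_of X) \<in> sets (borel_of X)" using openin_borel_of by metis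
qed

lemma continuous_map_borel_measurable:
  assumes "continuous_map X euclideanreal f"
  shows "f \<in> borel_measurable (borel_of X)"
proof (rule borel_measurableI)
  fix S :: "real set" assume "open S"
  then have "openin X {x\<in>topspace X. f x \<in> S}" by (intro openin_continuous_map_preimage[OF assms]) simp
  moreover have "{x\<in>topspace X. f x \<in> S} = f -` S \<inter> space (borel_of X)" by auto
  ultimately show "f -` S \<inter> space (borel_of X) \<in> sets (borel_of X)" using openin_borel_of by metis
qed

lemma borel_probsD:
  assumes "\<mu> \<in> borel_probs X"
  shows "prob_space \<mu>" "sets \<mu> = sets (borel_of X)" "space \<mu> = topspace X"
proof -
  show "prob_space \<mu>" and s: "sets \<mu> = sets (borel_of X)" using assms by (auto simp: borel_probs_def)
  show "space \<mu> = topspace X" using sets_eq_imp_space_eq[OF s] by simp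
qed

lemma borel_probs_measurable:
  assumes "\<mu> \<in> borel_probs X"
  shows "measurable \<mu> N = measurable (borel_of X) N"
  using borel_probsD(2)[OF assms] by (rule measurable_cong_sets) simp

lemma distr_borel_probs:
  assumes "prob_space M" "f \<in> measurable M (borel_of Y)"
  shows "distr M (borel_of Y) f \<in> borel_probs Y"
  using prob_space.prob_space_distr[OF assms] by (simp add: borel_probs_def)

lemma continuous_integral:
  assumes "continuous_map X euclideanreal f"
  shows "continuous_map (prob_topology X) euclideanreal (\<lambda>\<mu>. integral\<^sup>L \<mu> f)"
proof -
  have "openin (prob_topology X) {\<mu>\<in>borel_probs X. integral\<^sup>L \<mu> f \<in> U}" if "open U" for U
    unfolding prob_topology_def using assms that by (intro topology_generated_by_Basis) blast
  then show ?thesis by (auto simp: continuous_map_def)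
qed

lemma continuous_map_into_prob_topology:
  assumes "h \<in> topspace T \<rightarrow> borel_probs X"
    and "\<And>f. continuous_map X euclideanreal f \<Longrightarrow> continuous_map T euclideanreal (\<lambda>t. integral\<^sup>L (h t) f)"
  shows "continuous_map T (prob_topology X) h"
  unfolding prob_topology_def
proof (rule continuous_on_generated_topo)
  let ?S = "{{\<mu> \<in> borel_probs X. integral\<^sup>L \<mu> f \<in> U} | f U. continuous_map X euclideanreal f \<and> open U}"
  have "\<Union> ?S = borel_probs X"
    using topspace_prob_topology[of X] unfolding prob_topology_def topology_generated_by_topspace .
  then show "h ` topspace T \<subseteq> \<Union> ?S" using assms(1) by auto
  fix V assume "V \<in> ?S"
  then obtain f U where V: "V = {\<mu> \<in> borel_probs X. integral\<^sup>L \<mu> f \<in> U}"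
    and f: "continuous_map X euclideanreal f" and U: "open U" by blast
  have "h -` V \<inter> topspace T = {t\<in>topspace T. integral\<^sup>L (h t) f \<in> U}" using assms(1) V by auto
  then show "openin T (h -` V \<inter> topspace T)"
    using openin_continuous_map_preimage[OF assms(2)[OF f], of U] U by simp
qed

lemma limitin_prob_topology:
  assumes \<mu>: "\<mu> \<in> borel_probs X" and \<sigma>: "\<And>n. \<sigma> n \<in> borel_probs X"
    and lim: "\<And>f. continuous_map X euclideanreal f \<Longrightarrow> (\<lambda>n::nat. integral\<^sup>L (\<sigma> n) f) \<longlonglongrightarrow> integral\<^sup>L \<mu> f"
  shows "limitin (prob_topology X) \<sigma> \<mu> sequentially"
proof -
  let ?S = "{{\<mu> \<in> borel_probs X. integral\<^sup>L \<mu> f \<in> U} | f U. continuous_map X euclideanreal f \<and> open U}"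
  have "\<mu> \<in> U \<longrightarrow> (\<forall>\<^sub>F n in sequentially. \<sigma> n \<in> U)" if "generate_topology_on ?S U" for U
    using that
  proof (induction rule: generate_topology_on.induct)
    case (Int a b)
    then show ?case by (auto intro: eventually_conj)
  next
    case (UN K)
    show ?case
    proof
      assume "\<mu> \<in> \<Union> K"
      then obtain k where k: "k \<in> K" "\<mu> \<in> k" by blast
      then have "\<forall>\<^sub>F n in sequentially. \<sigma> n \<in> k" using UN by blast
      then show "\<forall>\<^sub>F n in sequentially. \<sigma> n \<in> \<Union> K" using k(1) by (auto elim: eventually_mono)
    qed
  next
    case (Basis s)
    then obtain f U where s: "s = {\<mu> \<in> borel_probs X. integral\<^sup>L \<mu> f \<in> U}"
      and f: "continuous_map X euclideanreal f" and U: "open U" by blast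
    show ?case
    proof
      assume "\<mu> \<in> s"
      then have "\<forall>\<^sub>F n in sequentially. integral\<^sup>L (\<sigma> n) f \<in> U"
        using topological_tendstoD[OF lim[OF f] U] s by simp
      then show "\<forall>\<^sub>F n in sequentially. \<sigma> n \<in> s" using \<sigma> by (simp add: s)
    qed
  qed simp
  then show ?thesis
    using \<mu> unfolding limitin_def topspace_prob_topology
    by (auto simp: prob_topology_def openin_topology_generated_by_iff)
qed

text \<open>If all integrals agreed, the constant sequence \<open>\<mu>\<close> would converge to
  both measures. The Hausdorff property replaces an argument through regularity of measures.\<close>

lemma integrals_separate:
  assumes "Hausdorff_space (prob_topology X)" "\<mu> \<in> borel_probs X" "\<nu> \<in> borel_probs X" "\<mu> \<noteq> \<nu>"
  shows "\<exists>f. continuous_map X euclideanreal f \<and> integral\<^sup>L \<mu> f \<noteq> integral\<^sup>L \<nu> f"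
proof (rule ccontr)
  assume "\<not> ?thesis"
  then have "limitin (prob_topology X) (\<lambda>n. \<mu>) \<nu> sequentially"
    using assms by (intro limitin_prob_topology) auto
  moreover have "limitin (prob_topology X) (\<lambda>n. \<mu>) \<mu> sequentially"
    using assms by (intro limitin_prob_topology) auto
  ultimately have "\<mu> = \<nu>" using limitin_Hausdorff_unique assms(1) trivial_limit_sequentially by metis
  then show False using assms by simp
qed

lemma integral_distr_continuous:
  assumes \<mu>: "\<mu> \<in> borel_probs X" and h: "h \<in> measurable (borel_of X) (borel_of Y)"
    and f: "continuous_map Y euclideanreal f"
  shows "integral\<^sup>L (distr \<mu> (borel_of Y) h) f = integral\<^sup>L \<mu> (\<lambda>x. f (h x))"
  using h continuous_map_borel_measurable[OF f] borel_probs_measurable[OF \<mu>] by (intro integral_distr) auto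

section \<open>Sequential compactness of the space of probability measures\<close>

context compact_metric begin

lemma integrable_continuous:
  assumes \<mu>: "\<mu> \<in> borel_probs Z" and f: "continuous_map Z euclideanreal f"
  shows "integrable \<mu> f"
proof -
  interpret prob_space \<mu> using borel_probsD[OF \<mu>] by simp
  obtain B where B: "\<forall>x\<in>topspace Z. \<bar>f x\<bar> \<le> B" using bounded_continuous[OF f] by blast
  show ?thesis
    using B borel_probsD(3)[OF \<mu>] continuous_map_borel_measurable[OF f] borel_probs_measurable[OF \<mu>]
    by (intro integrable_const_bound[of f B]) auto
qed

text \<open>
  The points of \<open>Z\<close> are coded by the digits \<open>0, 1\<close> of an expansion in base \<open>3\<close> that record which sets of a
  countable family of small balls contain them.
\<close>

lemma small_balls:
  assumes "topspace Z \<noteq> {}"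
  obtains c :: "nat \<Rightarrow> 'a" and r :: "nat \<Rightarrow> real"
  where "\<And>i. c i \<in> topspace Z" "\<And>i. r i > 0"
    "\<And>\<epsilon>. \<epsilon> > 0 \<Longrightarrow> \<exists>N. \<forall>z\<in>topspace Z. \<exists>i<N. r i < \<epsilon> \<and> z \<in> mball (c i) (r i)"
proof -
  have "\<forall>n. \<exists>N. finite N \<and> N \<subseteq> topspace Z \<and> (\<forall>z\<in>topspace Z. \<exists>x\<in>N. \<rho> x z < 1 / real (Suc n))"
    by (intro allI finite_net) simp
  from choice[OF this] obtain N where N': "\<forall>n. finite (N n) \<and> N n \<subseteq> topspace Z \<and>
      (\<forall>z\<in>topspace Z. \<exists>x\<in>N n. \<rho> x z < 1 / real (Suc n))" by (elim exE)
  have N: "\<And>n. finite (N n)" "\<And>n. N n \<subseteq> topspace Z"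
      "\<And>n. \<forall>z\<in>topspace Z. \<exists>x\<in>N n. \<rho> x z < 1 / real (Suc n)"
    using N' by simp_all
  define C where "C = (SIGMA n:UNIV. N n)"
  have ne: "N n \<noteq> {}" for n using N(3)[of n] assms by auto
  have C: "C \<noteq> {}" "countable C" unfolding C_def using ne N(1) by (auto intro: countable_finite)
  define e where "e = from_nat_into C"
  have eC: "e i \<in> C" for i unfolding e_def using C(1) by (rule from_nat_into)
  define c where "c i = snd (e i)" for i
  define r where "r i = 1 / real (Suc (fst (e i)))" for i
  have "\<exists>M. \<forall>z\<in>topspace Z. \<exists>i<M. r i < \<epsilon> \<and> z \<in> mball (c i) (r i)" if \<epsilon>: "\<epsilon> > 0" for \<epsilon>
  proof -
    obtain n where n: "1 / real (Suc n) < \<epsilon>" using nat_approx_posE[OF \<epsilon>] by blast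
    have "\<exists>M. \<forall>x\<in>N n. \<exists>i<M. e i = (n, x)"
    proof -
      have "\<forall>x\<in>N n. \<exists>i. e i = (n, x)"
      proof
        fix x assume "x \<in> N n"
        then have "(n, x) \<in> C" by (simp add: C_def)
        then show "\<exists>i. e i = (n, x)" unfolding e_def using from_nat_into_surj[OF C(2)] by blast
      qed
      then obtain j where j: "\<forall>x\<in>N n. e (j x) = (n, x)" by metis
      have "j x < Suc (\<Sum>x\<in>N n. j x)" if "x \<in> N n" for x
        using member_le_sum[OF that, of j] N(1) by (simp add: le_imp_less_Suc)
      then show ?thesis using j by blast
    qed
    then obtain M where M: "\<forall>x\<in>N n. \<exists>i<M. e i = (n, x)" by blast
    have "\<exists>i<M. r i < \<epsilon> \<and> z \<in> mball (c i) (r i)" if z: "z \<in> topspace Z" for z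
    proof -
      obtain x where x: "x \<in> N n" "\<rho> x z < 1 / real (Suc n)" using N(3) z by blast
      obtain i where i: "i < M" "e i = (n, x)" using M x(1) by blast
      have "x \<in> topspace Z" using x(1) N(2) by blast
      then show ?thesis using x i n z by (intro exI[of _ i]) (auto simp: r_def c_def)
    qed
    then show ?thesis by blast
  qed
  moreover have "c i \<in> topspace Z" for i using eC[of i] by (auto simp: C_def c_def dest: subsetD[OF N(2)])
  moreover have "r i > 0" for i by (simp add: r_def)
  ultimately show ?thesis using that by blast
qed

end

text \<open>Base 3 with digits 0 and 1 gives a Cantor set: all digits after the first difference
  together contribute at most half of that digit, so close codes have equal initial digits. Base 2
  would allow equal sums of different expansions.\<close>

definition code :: "(nat \<Rightarrow> bool) \<Rightarrow> real" where
  "code a = (\<Sum>i. of_bool (a i) * (1/3) ^ i)"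

lemma summable_code: "summable (\<lambda>i. of_bool (a i) * (1/3::real) ^ i)"
  by (rule summable_comparison_test'[of "\<lambda>i. (1/3::real) ^ i" 0]) (auto simp: summable_geometric)

lemma code_bounds: "0 \<le> code a" "code a \<le> 3/2"
proof -
  show "0 \<le> code a" unfolding code_def by (intro suminf_nonneg summable_code) auto
  have "code a \<le> (\<Sum>i. (1/3::real) ^ i)"
    unfolding code_def by (intro suminf_le summable_code summable_geometric) auto
  then show "code a \<le> 3/2" by (simp add: suminf_geometric)
qed

lemma code_diff:
  assumes eq: "\<And>i. i < k \<Longrightarrow> a i = b i" and k: "a k" "\<not> b k"
  shows "(1/3) ^ k / 2 \<le> code a - code b"
proof -
  let ?t = "\<lambda>i. (of_bool (a i) - of_bool (b i)) * (1/3::real) ^ i"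
  have sum: "summable ?t"
    using summable_diff[OF summable_code[of a] summable_code[of b]] by (simp add: left_diff_distrib)
  have "code a - code b = (\<Sum>i. ?t i)"
    unfolding code_def using suminf_diff[OF summable_code[of a] summable_code[of b]] by (simp add: left_diff_distrib)
  also have "\<dots> = (\<Sum>i. ?t (i + Suc k)) + (\<Sum>i<Suc k. ?t i)"
    by (rule suminf_split_initial_segment[OF sum])
  also have "(\<Sum>i<Suc k. ?t i) = (1/3) ^ k" using eq k by simp
  also have "(\<Sum>i. ?t (i + Suc k)) \<ge> (\<Sum>i. - ((1/3) ^ Suc k * (1/3::real) ^ i))"
  proof (intro suminf_le)
    show "summable (\<lambda>i. - ((1/3) ^ Suc k * (1/3::real) ^ i))"
      by (intro summable_minus summable_mult summable_geometric) simp
    show "summable (\<lambda>i. ?t (i + Suc k))" using sum by (subst summable_iff_shift)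
    show "- ((1/3) ^ Suc k * (1/3) ^ i) \<le> ?t (i + Suc k)" for i
      by (auto simp: power_add of_bool_def)
  qed
  moreover have "(\<Sum>i. - ((1/3) ^ Suc k * (1/3::real) ^ i)) = - ((1/3) ^ k / 2)"
    using sums_unique[OF sums_minus[OF sums_mult[OF geometric_sums[of "1/3 :: real"], of "(1/3) ^ Suc k"]]] by simp
  ultimately show ?thesis by linarith
qed

lemma code_close:
  assumes "\<bar>code a - code b\<bar> < (1/3) ^ n / 2" "i < n"
  shows "a i = b i"
proof (rule ccontr)
  assume "a i \<noteq> b i"
  define k where "k = (LEAST k. a k \<noteq> b k)"
  have k: "a k \<noteq> b k" unfolding k_def using \<open>a i \<noteq> b i\<close> by (rule LeastI)
  have lt: "a j = b j" if "j < k" for j using not_less_Least[of j "\<lambda>k. a k \<noteq> b k"] that unfolding k_def by blast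
  have "k \<le> i" unfolding k_def using \<open>a i \<noteq> b i\<close> by (rule Least_le)
  then have "(1/3::real) ^ n \<le> (1/3) ^ k" using assms(2) by (intro power_decreasing) auto
  moreover have "(1/3) ^ k / 2 \<le> \<bar>code a - code b\<bar>"
  proof (cases "a k")
    case True
    have "(1/3) ^ k / 2 \<le> code a - code b" by (rule code_diff) (use lt k True in auto)
    then show ?thesis by linarith
  next
    case False
    have "(1/3) ^ k / 2 \<le> code b - code a" by (rule code_diff) (use lt k False in auto)
    then show ?thesis by linarith
  qed
  ultimately show False using assms(1) by linarith
qed

context compact_metric begin

text \<open>
  The code \<open>s\<close> transports a sequence of measures to the line, where Helly's theorem applies; continuous
  functions on \<open>Z\<close> extend to the closure of the range of \<open>s\<close>, and the limit measure is pulled back along a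
  limit \<open>\<phi>\<close> of the decoding map.
\<close>

theorem prob_sequentially_compact:
  assumes \<sigma>: "\<And>n::nat. \<sigma> n \<in> borel_probs Z"
  shows "\<exists>\<mu> r. \<mu> \<in> borel_probs Z \<and> strict_mono r \<and> limitin (prob_topology Z) (\<sigma> \<circ> r) \<mu> sequentially"
proof -
  interpret \<sigma>: prob_space "\<sigma> n" for n using borel_probsD[OF \<sigma>] by simp
  have Zne: "topspace Z \<noteq> {}" using \<sigma>.not_empty[of 0] borel_probsD(3)[OF \<sigma>[of 0]] by simp
  obtain c r where cr: "\<And>i::nat. c i \<in> topspace Z" "\<And>i. r i > 0"
    "\<And>\<epsilon>. \<epsilon> > 0 \<Longrightarrow> \<exists>N. \<forall>z\<in>topspace Z. \<exists>i<N. r i < \<epsilon> \<and> z \<in> mball (c i) (r i)"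
    using small_balls[OF Zne] by metis
  define s where "s z = code (\<lambda>i. z \<in> mball (c i) (r i))" for z
  \<comment> \<open>Only the inverse of \<open>s\<close> is uniformly continuous; \<open>s\<close>
    itself may jump at the boundaries of the balls and is merely Borel.\<close>
  have s_close: "\<exists>\<delta>>0. \<forall>x\<in>topspace Z. \<forall>y\<in>topspace Z. \<bar>s x - s y\<bar> < \<delta> \<longrightarrow> \<rho> x y < \<epsilon>" if \<epsilon>: "\<epsilon> > 0" for \<epsilon>
  proof -
    obtain N where N: "\<forall>z\<in>topspace Z. \<exists>i<N. r i < \<epsilon> / 2 \<and> z \<in> mball (c i) (r i)" using cr(3)[of "\<epsilon> / 2"] \<epsilon> by auto
    have "\<rho> x y < \<epsilon>" if xy: "x \<in> topspace Z" "y \<in> topspace Z" "\<bar>s x - s y\<bar> < (1/3) ^ N / 2" for x y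
    proof -
      obtain i where i: "i < N" "r i < \<epsilon> / 2" "x \<in> mball (c i) (r i)" using N xy(1) by blast
      have "x \<in> mball (c i) (r i) \<longleftrightarrow> y \<in> mball (c i) (r i)"
        using code_close[OF xy(3)[unfolded s_def] i(1)] .
      then have "\<rho> (c i) x < r i" "\<rho> (c i) y < r i" using i(3) by auto
      then show ?thesis using triangle[of x "c i" y] commute[of x "c i"] xy cr(1)[of i] i(2) by linarith
    qed
    then show ?thesis by (intro exI[of _ "(1/3) ^ N / 2"]) auto
  qed
  have s_meas: "s \<in> borel_measurable (borel_of Z)"
  proof -
    have ball: "mball (c i) (r i) \<in> sets (borel_of Z)" for i
      using openin_borel_of[of Z] openin_mball by (simp add: mtopology_eq)
    have "(\<lambda>z. of_bool (z \<in> mball (c i) (r i)) * (1/3) ^ i :: real) \<in> borel_measurable (borel_of Z)" for i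
    proof -
      have "(\<lambda>z. of_bool (z \<in> mball (c i) (r i)) * (1/3) ^ i :: real)
          = (\<lambda>z. indicator (mball (c i) (r i)) z * (1/3) ^ i)" by (auto simp: indicator_def)
      then show ?thesis using ball by simp
    qed
    then show ?thesis unfolding s_def code_def by (intro borel_measurable_suminf) auto
  qed
  have s_bounds: "0 \<le> s z" "s z \<le> 3/2" for z unfolding s_def by (rule code_bounds)+
  define S where "S = s ` topspace Z"
  define \<nu> where "\<nu> n = distr (\<sigma> n) borel s" for n
  have s_meas': "s \<in> borel_measurable (\<sigma> n)" for n using s_meas borel_probs_measurable[OF \<sigma>] by blast
  have \<nu>: "real_distribution (\<nu> n)" for n
    unfolding \<nu>_def real_distribution_def real_distribution_axioms_def
    using \<sigma>.prob_space_distr[OF s_meas'] by simp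
  have "tight \<nu>"
    unfolding tight_def
  proof (intro conjI allI impI \<nu>)
    fix \<epsilon> :: real assume "\<epsilon> > 0"
    have "measure (\<nu> n) {-1<..2} = 1" for n
    proof -
      have "s -` {-1<..2} \<inter> space (\<sigma> n) = space (\<sigma> n)"
      proof -
        have "s z \<in> {-1<..2}" for z using s_bounds[of z] by simp
        then show ?thesis by blast
      qed
      then show ?thesis unfolding \<nu>_def using s_meas' by (simp add: measure_distr \<sigma>.prob_space)
    qed
    then show "\<exists>a b::real. a < b \<and> (\<forall>n. 1 - \<epsilon> < measure (\<nu> n) {a<..b})"
      using \<open>\<epsilon> > 0\<close> by (intro exI[of _ "-1"] exI[of _ 2]) auto
  qed
  from tight_imp_convergent_subsubsequence[OF this strict_mono_id]
  obtain q M where q: "strict_mono (q :: nat \<Rightarrow> nat)" and M: "real_distribution M"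
    and weak: "weak_conv_m (\<nu> \<circ> id \<circ> q) M" by blast
  interpret M: real_distribution M by fact
  have conv: "(\<lambda>n. integral\<^sup>L (\<sigma> (q n)) (\<lambda>z. g (s z))) \<longlonglongrightarrow> integral\<^sup>L M g"
    if g: "continuous_on UNIV g" "\<And>x. \<bar>g x\<bar> \<le> B" for g :: "real \<Rightarrow> real" and B
  proof -
    have "(\<lambda>n. integral\<^sup>L ((\<nu> \<circ> id \<circ> q) n) g) \<longlonglongrightarrow> integral\<^sup>L M g"
    proof (rule weak_conv_imp_integral_bdd_continuous_conv[OF _ M weak])
      show "real_distribution ((\<nu> \<circ> id \<circ> q) n)" for n using \<nu> by simp
      show "isCont g x" for x using g(1) by (simp add: continuous_on_eq_continuous_at)
      show "norm (g x) \<le> B" for x using g(2) by simp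
    qed
    moreover have "integral\<^sup>L ((\<nu> \<circ> id \<circ> q) n) g = integral\<^sup>L (\<sigma> (q n)) (\<lambda>z. g (s z))" for n
      unfolding \<nu>_def comp_def id_def using g(1) s_meas'
      by (intro integral_distr) (auto intro: borel_measurable_continuous_onI)
    ultimately show ?thesis by simp
  qed
  \<comment> \<open>By \<open>s_close\<close> the function \<open>f\<close> read through the code is
    uniformly continuous on \<open>S\<close>; it extends to \<open>closure S\<close> and, by Tietze,
    to a bounded function on the line.\<close>
  have ext: "\<exists>g B. continuous_on UNIV g \<and> (\<forall>x. \<bar>g x\<bar> \<le> B) \<and> (\<forall>z\<in>topspace Z. g (s z) = f z)"
    if f: "continuous_map Z euclideanreal f" for f
  proof -
    have inj: "x = y" if "x \<in> topspace Z" "y \<in> topspace Z" "s x = s y" for x y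
    proof (rule ccontr)
      assume "x \<noteq> y"
      then have "\<rho> x y > 0" using that by simp
      from s_close[OF this] obtain \<delta> where "\<delta> > 0"
        "\<forall>a\<in>topspace Z. \<forall>b\<in>topspace Z. \<bar>s a - s b\<bar> < \<delta> \<longrightarrow> \<rho> a b < \<rho> x y" by blast
      with that(1,2) have "\<bar>s x - s y\<bar> < \<delta> \<longrightarrow> \<rho> x y < \<rho> x y" by blast
      with \<open>\<delta> > 0\<close> that(3) show False by simp
    qed
    define h where "h = (\<lambda>t. f (SOME z. z \<in> topspace Z \<and> s z = t))"
    have h: "h (s z) = f z" if "z \<in> topspace Z" for z
    proof -
      have "(SOME w. w \<in> topspace Z \<and> s w = s z) = z" using that inj by (intro some_equality) auto
      then show ?thesis by (simp add: h_def)
    qed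
    have "uniformly_continuous_on S h"
      unfolding uniformly_continuous_on_def
    proof (intro allI impI)
      fix \<epsilon> :: real assume "\<epsilon> > 0"
      then obtain \<delta> where \<delta>: "\<delta> > 0" "\<forall>x\<in>topspace Z. \<forall>y\<in>topspace Z. \<rho> x y < \<delta> \<longrightarrow> \<bar>f x - f y\<bar> < \<epsilon>"
        using uniformly_continuous[OF f] by blast
      obtain \<eta> where \<eta>: "\<eta> > 0" "\<forall>x\<in>topspace Z. \<forall>y\<in>topspace Z. \<bar>s x - s y\<bar> < \<eta> \<longrightarrow> \<rho> x y < \<delta>"
        using s_close[OF \<delta>(1)] by blast
      show "\<exists>d>0. \<forall>x\<in>S. \<forall>x'\<in>S. dist x' x < d \<longrightarrow> dist (h x') (h x) < \<epsilon>"
        using \<delta> \<eta> by (intro exI[of _ \<eta>]) (auto simp: S_def h dist_real_def)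
    qed
    then obtain g0 where g0: "uniformly_continuous_on (closure S) g0" "\<And>x. x \<in> S \<Longrightarrow> h x = g0 x"
      using uniformly_continuous_on_extension_on_closure[of S h] by metis
    obtain B where B: "B > 0" "\<forall>x\<in>topspace Z. \<bar>f x\<bar> \<le> B" using bounded_continuous[OF f] by blast
    have c0: "continuous_on (closure S) g0" using g0(1) by (rule uniformly_continuous_imp_continuous)
    have bd: "norm (g0 x) \<le> B" if "x \<in> closure S" for x
    proof -
      have "closure S \<subseteq> closure S \<inter> g0 -` cball 0 B"
      proof (rule closure_minimal)
        show "S \<subseteq> closure S \<inter> g0 -` cball 0 B"
          using closure_subset[of S] B(2) by (auto simp: S_def g0(2)[symmetric] h)
        show "closed (closure S \<inter> g0 -` cball 0 B)"
          by (intro continuous_closed_preimage c0) auto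
      qed
      then show ?thesis using that by auto
    qed
    obtain g where g: "continuous_on UNIV g" "\<And>x. x \<in> closure S \<Longrightarrow> g x = g0 x" "\<And>x. norm (g x) \<le> B"
      using Tietze[OF c0, of UNIV B] bd B(1) by (auto simp: less_imp_le)
    have "g (s z) = f z" if "z \<in> topspace Z" for z
    proof -
      have "s z \<in> S" using that by (simp add: S_def)
      moreover from this have "s z \<in> closure S" using closure_subset by blast
      ultimately show ?thesis using g(2) g0(2)[of "s z"] h[OF that] by simp
    qed
    then show ?thesis using g(1,3) by auto
  qed
  \<comment> \<open>A point of \<open>closure S\<close> need not be a code. If codes tend to
    \<open>y\<close>, a subsequence of the coded points converges in \<open>Z\<close>, and its limit
    decodes \<open>y\<close> simultaneously for all \<open>g\<close> for which
    \<open>g (s z)\<close> is continuous in \<open>z\<close>.\<close>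
  have "\<exists>x. x \<in> topspace Z \<and> (y \<in> closure S \<longrightarrow> (\<forall>g. continuous_on UNIV g \<and>
      continuous_map Z euclideanreal (\<lambda>z. g (s z)) \<longrightarrow> g y = g (s x)))" for y
  proof (cases "y \<in> closure S")
    case True
    then obtain t where t: "\<And>n. t n \<in> S" "t \<longlonglongrightarrow> y" unfolding closure_sequential by blast
    have "\<forall>n. \<exists>z. z \<in> topspace Z \<and> s z = t n"
    proof
      fix n
      have "t n \<in> s ` topspace Z" using t(1)[of n] by (simp add: S_def)
      then show "\<exists>z. z \<in> topspace Z \<and> s z = t n" by (elim imageE) auto
    qed
    then obtain z where z: "\<And>n. z n \<in> topspace Z" "\<And>n. s (z n) = t n" by metis
    have "range z \<subseteq> topspace Z" using z(1) by auto
    then obtain x p where x: "x \<in> topspace Z" and p: "strict_mono (p :: nat \<Rightarrow> nat)"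
      and lim: "limitin mtopology (z \<circ> p) x sequentially"
      using compact_space_sequentially compact_Z mtopology_eq by metis
    have "g y = g (s x)" if g: "continuous_on UNIV g" "continuous_map Z euclideanreal (\<lambda>z. g (s z))"
      for g :: "real \<Rightarrow> real"
    proof -
      have "limitin euclideanreal ((\<lambda>z. g (s z)) \<circ> (z \<circ> p)) (g (s x)) sequentially"
        using continuous_map_limit[OF g(2)] lim by (simp add: mtopology_eq)
      then have "(\<lambda>n. g (t (p n))) \<longlonglongrightarrow> g (s x)" by (simp add: o_def z(2))
      moreover have "(\<lambda>n. g (t (p n))) \<longlonglongrightarrow> g y"
      proof -
        have "(\<lambda>n. t (p n)) \<longlonglongrightarrow> y" using LIMSEQ_subseq_LIMSEQ[OF t(2) p] by (simp add: o_def)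
        then show ?thesis using g(1) by (intro isCont_tendsto_compose[of y g]) (simp_all add: continuous_on_eq_continuous_at)
      qed
      ultimately show ?thesis using LIMSEQ_unique by blast
    qed
    then show ?thesis using x by blast
  next
    case False
    then show ?thesis using Zne by blast
  qed
  then obtain \<phi> where \<phi>: "\<And>y. \<phi> y \<in> topspace Z" "\<And>y g. \<lbrakk>y \<in> closure S; continuous_on UNIV g;
      continuous_map Z euclideanreal (\<lambda>z. g (s z))\<rbrakk> \<Longrightarrow> g y = g (s (\<phi> y))" by metis
  \<comment> \<open>The value off \<open>closure S\<close> is arbitrary; that set turns out to be a
    null set of \<open>M\<close>.\<close>
  define \<psi> where "\<psi> y = (if y \<in> closure S then \<phi> y else c 0)" for y
  have \<psi>: "\<psi> y \<in> topspace Z" for y using \<phi>(1) cr(1) by (simp add: \<psi>_def)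
  have val: "f (\<psi> y) = g y" if f: "continuous_map Z euclideanreal f" and g: "continuous_on UNIV g"
    and gs: "\<And>z. z \<in> topspace Z \<Longrightarrow> g (s z) = f z" and y: "y \<in> closure S" for f g y
  proof -
    have "continuous_map Z euclideanreal (\<lambda>z. g (s z))" by (rule continuous_map_eq[OF f]) (simp add: gs)
    from \<phi>(2)[OF y g this] gs[OF \<phi>(1)] y show ?thesis by (simp add: \<psi>_def)
  qed
  \<comment> \<open>On \<open>closure S\<close> the distance from \<open>a\<close> to
    \<open>\<psi> y\<close> is a continuous function of \<open>y\<close>, although
    \<open>\<phi>\<close> was obtained by choice.\<close>
  have ball_meas: "{y. \<psi> y \<in> mball a e} \<in> sets borel" if a: "a \<in> topspace Z" for a e
  proof -
    obtain g where g: "continuous_on UNIV g" "\<forall>z\<in>topspace Z. g (s z) = \<rho> a z"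
      using ext[OF continuous_dist_point[OF a]] by blast
    have "\<rho> a (\<psi> y) = g y" if "y \<in> closure S" for y
      using val[OF continuous_dist_point[OF a] g(1) _ that] g(2) by blast
    then have eq: "{y. \<psi> y \<in> mball a e} = ({y. g y < e} \<inter> closure S) \<union> (if c 0 \<in> mball a e then - closure S else {})"
      using a \<psi> cr(1) by (auto simp: \<psi>_def split: if_splits)
    have "open {y. g y < e}" using g(1) by (intro open_Collect_less continuous_on_const)
    then have "{y. g y < e} \<in> sets borel" by (rule borel_open)
    moreover have "closure S \<in> sets borel" by (rule borel_closed) simp
    moreover have "- closure S \<in> sets borel" by (intro borel_open open_Compl) simp
    ultimately show ?thesis unfolding eq by auto
  qed
  have \<psi>_meas: "\<psi> \<in> measurable borel (borel_of Z)"
  proof (rule measurable_borel_ofI)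
    show "\<psi> \<in> space borel \<rightarrow> topspace Z" using \<psi> by auto
    fix U assume U: "openin Z U"
    let ?I = "{i. mball (c i) (r i) \<subseteq> U}"
    have U_eq: "U = (\<Union>i\<in>?I. mball (c i) (r i))"
    proof
      show "U \<subseteq> (\<Union>i\<in>?I. mball (c i) (r i))"
      proof
        fix x assume x: "x \<in> U"
        have "openin mtopology U" using U by (simp add: mtopology_eq)
        then obtain e where e: "e > 0" "mball x e \<subseteq> U" using x unfolding openin_mtopology by blast
        have xZ: "x \<in> topspace Z" using x U openin_subset by blast
        obtain N where "\<forall>z\<in>topspace Z. \<exists>i<N. r i < e / 2 \<and> z \<in> mball (c i) (r i)" using cr(3)[of "e / 2"] e by auto
        then obtain i where i: "r i < e / 2" "x \<in> mball (c i) (r i)" using xZ by blast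
        have "mball (c i) (r i) \<subseteq> mball x e"
        proof
          fix y assume y: "y \<in> mball (c i) (r i)"
          then show "y \<in> mball x e"
            using i triangle[of x "c i" y] commute[of x "c i"] by auto
        qed
        then show "x \<in> (\<Union>i\<in>?I. mball (c i) (r i))" using i e(2) by blast
      qed
    qed blast
    have "\<psi> -` U \<inter> space borel = \<psi> -` (\<Union>i\<in>?I. mball (c i) (r i))"
      using arg_cong[OF U_eq, of "\<lambda>V. \<psi> -` V"] by simp
    also have "\<dots> = (\<Union>i\<in>?I. {y. \<psi> y \<in> mball (c i) (r i)})"
    proof (intro subset_antisym subsetI)
      fix x assume "x \<in> \<psi> -` (\<Union>i\<in>?I. mball (c i) (r i))"
      then have "\<psi> x \<in> (\<Union>i\<in>?I. mball (c i) (r i))" by (rule vimageD)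
      then obtain i where i: "i \<in> ?I" "\<psi> x \<in> mball (c i) (r i)" by (rule UN_E)
      from i(1) show "x \<in> (\<Union>i\<in>?I. {y. \<psi> y \<in> mball (c i) (r i)})"
        by (rule UN_I) (rule CollectI, rule i(2))
    next
      fix x assume "x \<in> (\<Union>i\<in>?I. {y. \<psi> y \<in> mball (c i) (r i)})"
      then obtain i where i: "i \<in> ?I" "x \<in> {y. \<psi> y \<in> mball (c i) (r i)}" by (rule UN_E)
      from i(2) have "\<psi> x \<in> mball (c i) (r i)" by (rule CollectD)
      with i(1) have "\<psi> x \<in> (\<Union>i\<in>?I. mball (c i) (r i))" by (rule UN_I)
      then show "x \<in> \<psi> -` (\<Union>i\<in>?I. mball (c i) (r i))" by (rule vimageI2)
    qed
    also have "\<dots> \<in> sets borel" by (rule sets.countable_UN'[OF countableI_type]) (rule image_subsetI, rule ball_meas, rule cr(1))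
    finally show "\<psi> -` U \<inter> space borel \<in> sets borel" .
  qed
  define \<mu> where "\<mu> = distr M (borel_of Z) \<psi>"
  have M_measurable: "borel_measurable M = borel_measurable borel"
    by (rule measurable_cong_sets) simp_all
  have M_meas: "\<psi> \<in> measurable M (borel_of Z)"
    using \<psi>_meas measurable_cong_sets[OF M.events_eq_borel refl] by blast
  have \<mu>: "\<mu> \<in> borel_probs Z"
    unfolding \<mu>_def using M.prob_space_axioms M_meas by (rule distr_borel_probs)
  \<comment> \<open>The truncated distance to \<open>closure S\<close> vanishes on all codes, so its
    integrals along the subsequence are 0 and so is their limit.\<close>
  have AE: "AE y in M. y \<in> closure S"
  proof -
    let ?g = "\<lambda>y. min 1 (infdist y (closure S))"
    have gc: "continuous_on UNIV ?g" by (intro continuous_intros)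
    have "(\<lambda>n. integral\<^sup>L (\<sigma> (q n)) (\<lambda>z. ?g (s z))) \<longlonglongrightarrow> integral\<^sup>L M ?g"
      by (rule conv[OF gc, of 1]) (auto simp: infdist_nonneg)
    moreover have "integral\<^sup>L (\<sigma> (q n)) (\<lambda>z. ?g (s z)) = 0" for n
    proof -
      have "?g (s z) = 0" if "z \<in> space (\<sigma> (q n))" for z
      proof -
        have "s z \<in> closure S" using that borel_probsD(3)[OF \<sigma>] closure_subset[of S] by (auto simp: S_def)
        then show ?thesis by simp
      qed
      then have "integral\<^sup>L (\<sigma> (q n)) (\<lambda>z. ?g (s z)) = integral\<^sup>L (\<sigma> (q n)) (\<lambda>z. 0)"
        by (intro Bochner_Integration.integral_cong refl)
      then show ?thesis by simp
    qed
    ultimately have "(\<lambda>n::nat. 0) \<longlonglongrightarrow> integral\<^sup>L M ?g" by simp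
    then have "integral\<^sup>L M ?g = 0" using LIMSEQ_unique[OF _ tendsto_const] by metis
    moreover have "integrable M ?g"
    proof (rule M.integrable_const_bound[of _ 1])
      show "?g \<in> borel_measurable M"
        unfolding M_measurable by (rule borel_measurable_continuous_onI[OF gc])
    qed (simp add: infdist_nonneg)
    ultimately have "AE y in M. ?g y = 0"
      by (subst (asm) integral_nonneg_eq_0_iff_AE) (auto simp: infdist_nonneg)
    then show ?thesis
    proof eventually_elim
      case (elim y)
      have "S \<noteq> {}" using Zne by (simp add: S_def)
      moreover have "infdist y (closure S) = 0" using elim by (auto simp: min_def split: if_splits)
      ultimately show ?case using in_closed_iff_infdist_zero[of "closure S" y] by auto
    qed
  qed
  have "limitin (prob_topology Z) (\<sigma> \<circ> q) \<mu> sequentially"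
  proof (rule limitin_prob_topology[OF \<mu>])
    show "(\<sigma> \<circ> q) n \<in> borel_probs Z" for n using \<sigma> by simp
    fix f assume f: "continuous_map Z euclideanreal f"
    obtain g B where g: "continuous_on UNIV g" "\<forall>x. \<bar>g x\<bar> \<le> B" "\<forall>z\<in>topspace Z. g (s z) = f z"
      using ext[OF f] by blast
    have "integral\<^sup>L (\<sigma> (q n)) (\<lambda>z. g (s z)) = integral\<^sup>L (\<sigma> (q n)) f" for n
      using g(3) borel_probsD(3)[OF \<sigma>] by (intro Bochner_Integration.integral_cong refl) auto
    moreover have "integral\<^sup>L \<mu> f = integral\<^sup>L M g"
    proof -
      have "integral\<^sup>L \<mu> f = integral\<^sup>L M (\<lambda>y. f (\<psi> y))"
        unfolding \<mu>_def using M_meas continuous_map_borel_measurable[OF f] by (rule integral_distr)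
      also have "\<dots> = integral\<^sup>L M g"
      proof (rule integral_cong_AE)
        show "(\<lambda>y. f (\<psi> y)) \<in> borel_measurable M"
          using measurable_compose[OF M_meas continuous_map_borel_measurable[OF f]] .
        show "g \<in> borel_measurable M"
          unfolding M_measurable by (rule borel_measurable_continuous_onI[OF g(1)])
        show "AE y in M. f (\<psi> y) = g y"
          using AE by eventually_elim (use val[OF f g(1)] g(3) in blast)
      qed
      finally show ?thesis .
    qed
    ultimately show "(\<lambda>n. integral\<^sup>L ((\<sigma> \<circ> q) n) f) \<longlonglongrightarrow> integral\<^sup>L \<mu> f"
      using conv[OF g(1), of B] g(2) by (simp add: o_def)
  qed
  then show ?thesis using \<mu> q by blast
qed

text \<open>The compatible metric \<open>\<delta>\<close> upgrades sequential compactness to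
  compactness.\<close>

theorem compact_prob_topology:
  assumes "compatible_metric (prob_topology Z) \<delta>"
  shows "compact_space (prob_topology Z)"
proof -
  have ms: "Metric_space (borel_probs Z) \<delta>" and eq: "Metric_space.mtopology (borel_probs Z) \<delta> = prob_topology Z"
    using assms by (auto simp: compatible_metric_def)
  show ?thesis
    unfolding eq[symmetric] Metric_space.compact_space_sequentially[OF ms]
  proof (intro allI impI)
    fix \<sigma> :: "nat \<Rightarrow> 'a measure" assume "range \<sigma> \<subseteq> borel_probs Z"
    then have "\<And>n. \<sigma> n \<in> borel_probs Z" by auto
    from prob_sequentially_compact[OF this]
    show "\<exists>l r. l \<in> borel_probs Z \<and> strict_mono r \<and>
        limitin (Metric_space.mtopology (borel_probs Z) \<delta>) (\<sigma> \<circ> r) l sequentially"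
      unfolding eq .
  qed
qed

end

section \<open>Entropy and independence density\<close>

text \<open>Common setting of \<open>\<pi>\<close> and of the induced map, so that one treatment of
  separation, independence and width serves both. The rules are equations at points of the spaces,
  which both systems satisfy.\<close>

locale fibred_system = group G + compact_metric Z \<rho>
  for G :: "('g, 'm) monoid_scheme" (structure) and Z :: "'a topology" and \<rho> :: "'a \<Rightarrow> 'a \<Rightarrow> real" +
  fixes act :: "'g \<Rightarrow> 'a \<Rightarrow> 'a" and Y :: "'b topology" and act' :: "'g \<Rightarrow> 'b \<Rightarrow> 'b" and \<pi> :: "'a \<Rightarrow> 'b"
  assumes act_continuous: "\<And>g. g \<in> carrier G \<Longrightarrow> continuous_map Z Z (act g)"
    and act_mult: "\<And>g h z. \<lbrakk>g \<in> carrier G; h \<in> carrier G; z \<in> topspace Z\<rbrakk> \<Longrightarrow> act (g \<otimes> h) z = act g (act h z)"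
    and act'_closed: "\<And>g y. \<lbrakk>g \<in> carrier G; y \<in> topspace Y\<rbrakk> \<Longrightarrow> act' g y \<in> topspace Y"
    and equivariant: "\<And>g z. \<lbrakk>g \<in> carrier G; z \<in> topspace Z\<rbrakk> \<Longrightarrow> \<pi> (act g z) = act' g (\<pi> z)"
begin

abbreviation fib :: "'b \<Rightarrow> 'a set" where "fib \<equiv> fibre Z \<pi>"

abbreviation dyn :: "'g set \<Rightarrow> 'a \<Rightarrow> 'a \<Rightarrow> real" where "dyn \<equiv> dyn_metric act \<rho>"

lemma fib_subset: "fib y \<subseteq> topspace Z"
  by (auto simp: fibre_def)

lemma act_closed: "g \<in> carrier G \<Longrightarrow> z \<in> topspace Z \<Longrightarrow> act g z \<in> topspace Z"
  using act_continuous by (auto simp: continuous_map_def)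

lemma act_fib: "g \<in> carrier G \<Longrightarrow> z \<in> fib y \<Longrightarrow> act g z \<in> fib (act' g y)"
  using act_closed equivariant by (auto simp: fibre_def)

lemma dyn_less_iff:
  assumes "H \<in> finite_subsets G"
  shows "dyn H x y < e \<longleftrightarrow> (\<forall>s\<in>H. \<rho> (act s x) (act s y) < e)"
  using assms unfolding dyn_metric_def finite_subsets_def by (subst Max_less_iff) auto

lemma dyn_le_iff:
  assumes "H \<in> finite_subsets G"
  shows "dyn H x y \<le> e \<longleftrightarrow> (\<forall>s\<in>H. \<rho> (act s x) (act s y) \<le> e)"
  using assms unfolding dyn_metric_def finite_subsets_def by (subst Max_le_iff) auto

text \<open>Two points whose orbits along \<open>H\<close> are rounded to the same points of an
  \<open>e / 2\<close>-net are at distance at most \<open>e\<close>. This makes the maximum in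
  \<open>sep_number\<close> and the supremum over the fibres meaningful.\<close>

lemma separated_card_bounded:
  assumes H: "H \<in> finite_subsets G" and e: "e > 0"
  shows "\<exists>N. \<forall>S. S \<subseteq> topspace Z \<and> finite S \<and> separated (dyn H) e S \<longrightarrow> card S \<le> N"
proof -
  obtain N where N: "finite N" "N \<subseteq> topspace Z" "\<forall>z\<in>topspace Z. \<exists>x\<in>N. \<rho> x z < e / 2"
    using finite_net[of "e / 2"] e by auto
  define p where "p z = (SOME x. x \<in> N \<and> \<rho> x z < e / 2)" for z
  have p: "p z \<in> N \<and> \<rho> (p z) z < e / 2" if "z \<in> topspace Z" for z
    unfolding p_def by (rule someI_ex) (use N(3) that in blast)
  have HG: "H \<subseteq> carrier G" "finite H" using H by (auto simp: finite_subsets_def)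
  have "card S \<le> card (PiE H (\<lambda>_. N))" if S: "S \<subseteq> topspace Z" "finite S" "separated (dyn H) e S" for S
  proof (rule card_inj_on_le[of "\<lambda>z. \<lambda>s\<in>H. p (act s z)"])
    show "inj_on (\<lambda>z. \<lambda>s\<in>H. p (act s z)) S"
    proof (rule inj_onI, rule ccontr)
      fix x y assume xy: "x \<in> S" "y \<in> S" and eq: "(\<lambda>s\<in>H. p (act s x)) = (\<lambda>s\<in>H. p (act s y))" and ne: "x \<noteq> y"
      have "\<rho> (act s x) (act s y) \<le> e" if s: "s \<in> H" for s
      proof -
        have Z: "act s x \<in> topspace Z" "act s y \<in> topspace Z" using s HG xy S(1) act_closed by blast+
        have pe: "p (act s x) = p (act s y)" using fun_cong[OF eq, of s] s by simp
        have pN: "p (act s x) \<in> topspace Z" using p[OF Z(1)] N(2) by blast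
        have "\<rho> (act s x) (act s y) \<le> \<rho> (act s x) (p (act s x)) + \<rho> (p (act s x)) (act s y)"
          using triangle Z pN by blast
        moreover have "\<rho> (p (act s x)) (act s y) < e / 2" using p[OF Z(2)] unfolding pe by simp
        ultimately show ?thesis using p[OF Z(1)] commute[of "act s x" "p (act s x)"] by linarith
      qed
      then have "dyn H x y \<le> e" using dyn_le_iff[OF H] by blast
      then show False using S(3) xy ne unfolding separated_def by fastforce
    qed
    show "(\<lambda>z. \<lambda>s\<in>H. p (act s z)) ` S \<subseteq> PiE H (\<lambda>_. N)"
    proof (intro image_subsetI PiE_I)
      fix z s assume "z \<in> S" "s \<in> H"
      then have "act s z \<in> topspace Z" using HG S(1) act_closed by blast
      then show "(\<lambda>s\<in>H. p (act s z)) s \<in> N" using p \<open>s \<in> H\<close> by simp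
    qed auto
    show "finite (PiE H (\<lambda>_. N))" using HG N by (intro finite_PiE) auto
  qed
  then show ?thesis by blast
qed

lemma sep_number_props:
  assumes H: "H \<in> finite_subsets G" and e: "e > 0" and A: "A \<subseteq> topspace Z"
  shows "\<And>S. \<lbrakk>S \<subseteq> A; finite S; separated (dyn H) e S\<rbrakk> \<Longrightarrow> card S \<le> sep_number A e (dyn H)"
    and "\<exists>S. S \<subseteq> A \<and> finite S \<and> separated (dyn H) e S \<and> card S = sep_number A e (dyn H)"
proof -
  let ?C = "{card S | S. S \<subseteq> A \<and> finite S \<and> separated (dyn H) e S}"
  obtain N where N: "\<forall>S. S \<subseteq> topspace Z \<and> finite S \<and> separated (dyn H) e S \<longrightarrow> card S \<le> N"
    using separated_card_bounded[OF H e] by blast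
  have "?C \<subseteq> {..N}"
  proof
    fix k assume "k \<in> ?C"
    then obtain S where S: "k = card S" "S \<subseteq> A" "finite S" "separated (dyn H) e S" by blast
    then have "S \<subseteq> topspace Z" using A by blast
    then show "k \<in> {..N}" using N S by simp
  qed
  then have fin: "finite ?C" by (rule finite_subset) simp
  have "separated (dyn H) e {}" by (simp add: separated_def)
  then have ne: "?C \<noteq> {}" by blast
  show "card S \<le> sep_number A e (dyn H)" if "S \<subseteq> A" "finite S" "separated (dyn H) e S" for S
    unfolding sep_number_def using that by (intro Max_ge fin) blast
  show "\<exists>S. S \<subseteq> A \<and> finite S \<and> separated (dyn H) e S \<and> card S = sep_number A e (dyn H)"
  proof -
    have "sep_number A e (dyn H) \<in> ?C" using Max_in[OF fin ne] unfolding sep_number_def .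
    then obtain S where "sep_number A e (dyn H) = card S \<and> S \<subseteq> A \<and> finite S \<and> separated (dyn H) e S" by blast
    then show ?thesis by (intro exI[of _ S]) simp
  qed
qed

section \<open>Fibrewise separation numbers and entropy\<close>

definition Sep :: "real \<Rightarrow> 'g set \<Rightarrow> nat" where
  "Sep e H = (SUP y\<in>topspace Y. sep_number (fib y) e (dyn H))"

lemma Sep_bdd:
  assumes H: "H \<in> finite_subsets G" and e: "e > 0"
  shows "bdd_above ((\<lambda>y. sep_number (fib y) e (dyn H)) ` topspace Y)"
proof -
  obtain N where N: "\<forall>S. S \<subseteq> topspace Z \<and> finite S \<and> separated (dyn H) e S \<longrightarrow> card S \<le> N"
    using separated_card_bounded[OF H e] by blast
  have "sep_number (fib y) e (dyn H) \<le> N" for y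
    using sep_number_props(2)[OF H e fib_subset, of y] N fib_subset[of y] by (metis order_trans)
  then show ?thesis by (intro bdd_aboveI[of _ N]) auto
qed

lemma card_le_Sep:
  assumes H: "H \<in> finite_subsets G" and e: "e > 0" and y: "y \<in> topspace Y"
    and S: "S \<subseteq> fib y" "finite S" "separated (dyn H) e S"
  shows "card S \<le> Sep e H"
  using sep_number_props(1)[OF H e fib_subset S] cSUP_upper[OF y Sep_bdd[OF H e]]
  unfolding Sep_def by linarith

lemma Sep_attained:
  assumes H: "H \<in> finite_subsets G" and e: "e > 0" and pos: "Sep e H > 0"
  shows "\<exists>y\<in>topspace Y. \<exists>S. S \<subseteq> fib y \<and> finite S \<and> separated (dyn H) e S \<and> card S = Sep e H"
proof -
  let ?V = "(\<lambda>y. sep_number (fib y) e (dyn H)) ` topspace Y"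
  have "?V \<noteq> {}" using pos by (auto simp: Sep_def)
  moreover have "finite ?V" using Sep_bdd[OF H e] by (simp add: bdd_above_nat)
  ultimately have "Sep e H \<in> ?V" unfolding Sep_def using Max_in cSup_eq_Max by metis
  then obtain y where y: "y \<in> topspace Y" "Sep e H = sep_number (fib y) e (dyn H)" by blast
  then show ?thesis using sep_number_props(2)[OF H e fib_subset, of y] by metis
qed

lemma Sep_antimono:
  assumes H: "H \<in> finite_subsets G" and e: "0 < e" "e \<le> e'"
  shows "Sep e' H \<le> Sep e H"
proof (cases "Sep e' H > 0")
  case True
  then obtain y S where S: "y \<in> topspace Y" "S \<subseteq> fib y" "finite S" "separated (dyn H) e' S" "card S = Sep e' H"
    using Sep_attained[OF H, of e'] e by auto
  have "separated (dyn H) e S" using S(4) e unfolding separated_def by (meson le_less_trans)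
  then show ?thesis using card_le_Sep[OF H e(1) S(1-3)] S(5) by simp
qed simp

definition Ent :: "(nat \<Rightarrow> 'g set) \<Rightarrow> real \<Rightarrow> ereal" where
  "Ent F e = limsup (\<lambda>n. ereal (ln (real (Sep e (F n))) / real (card (F n))))"

text \<open>The case \<open>n = 0\<close>, with \<open>ln 0 = 0\<close>, is included because
  \<open>Sep\<close> may be 0, for instance when \<open>Y\<close> is empty.\<close>

lemma ln_nat_nonneg: "0 \<le> ln (real n)"
  by (cases "n = 0") auto

lemma Ent_nonneg: "0 \<le> Ent F e"
proof -
  have "(0::ereal) = limsup (\<lambda>n::nat. 0)" by (simp add: Limsup_const)
  also have "\<dots> \<le> Ent F e" unfolding Ent_def
    by (intro Limsup_mono always_eventually allI) (simp add: ln_nat_nonneg)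
  finally show ?thesis .
qed

lemma Ent_antimono:
  assumes F: "\<And>n. F n \<in> finite_subsets G" and e: "0 < e" "e \<le> e'"
  shows "Ent F e' \<le> Ent F e"
  unfolding Ent_def
proof (intro Limsup_mono always_eventually allI)
  fix n
  have "ln (real (Sep e' (F n))) \<le> ln (real (Sep e (F n)))"
  proof (cases "Sep e' (F n) = 0")
    case True
    then show ?thesis by (simp add: ln_nat_nonneg)
  next
    case False
    then show ?thesis using Sep_antimono[OF F e, of n] by (subst ln_le_cancel_iff) auto
  qed
  then show "ereal (ln (real (Sep e' (F n))) / real (card (F n))) \<le> ereal (ln (real (Sep e (F n))) / real (card (F n)))"
    by (simp add: divide_right_mono)
qed

text \<open>Monotonicity in the scale turns the limit at 0 into a supremum, so positivity is visible
  at a single scale.\<close>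

lemma rel_entropy_eq:
  assumes F: "\<And>n. F n \<in> finite_subsets G"
  shows "rel_entropy Z act Y \<pi> \<rho> F = (SUP e\<in>{0<..}. Ent F e)"
proof -
  have "((\<lambda>e. Ent F e) \<longlongrightarrow> (SUP e\<in>{0<..}. Ent F e)) (at_right 0)"
  proof (rule order_tendstoI)
    fix a assume "a < (SUP e\<in>{0<..}. Ent F e)"
    then obtain e where e: "e > 0" "a < Ent F e" by (auto simp: less_SUP_iff)
    have "eventually (\<lambda>e'. e' \<in> {0<..<e}) (at_right 0)" using e(1) by (rule eventually_at_right_real)
    then show "\<forall>\<^sub>F e in at_right 0. a < Ent F e"
    proof eventually_elim
      case (elim e')
      then have "Ent F e \<le> Ent F e'" by (intro Ent_antimono F) auto
      then show ?case using e(2) by (rule less_le_trans[rotated])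
    qed
  next
    fix a assume a: "(SUP e\<in>{0<..}. Ent F e) < a"
    have "eventually (\<lambda>e'. e' \<in> {0<..<1::real}) (at_right 0)" by (rule eventually_at_right_real) simp
    then show "\<forall>\<^sub>F e in at_right 0. Ent F e < a"
    proof eventually_elim
      case (elim e')
      then have "Ent F e' \<le> (SUP e\<in>{0<..}. Ent F e)" by (intro SUP_upper) auto
      then show ?case using a by (rule le_less_trans)
    qed
  qed
  then show ?thesis
    unfolding rel_entropy_def Ent_def Sep_def by (intro tendsto_Lim) simp_all
qed

lemma rel_entropy_pos_iff:
  assumes "\<And>n. F n \<in> finite_subsets G"
  shows "0 < rel_entropy Z act Y \<pi> \<rho> F \<longleftrightarrow> (\<exists>e>0. 0 < Ent F e)"
  unfolding rel_entropy_eq[OF assms] by (auto simp: less_SUP_iff)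

lemma rel_entropy_nonneg:
  assumes "\<And>n. F n \<in> finite_subsets G"
  shows "0 \<le> rel_entropy Z act Y \<pi> \<rho> F"
  unfolding rel_entropy_eq[OF assms] by (rule SUP_upper2[of 1]) (auto simp: Ent_nonneg)

section \<open>Independence density\<close>

definition indep :: "('a \<Rightarrow> real) \<Rightarrow> real \<Rightarrow> real \<Rightarrow> 'b \<Rightarrow> 'g set set" where
  "indep g a b y = indep_sets (carrier G) (\<lambda>s z. g (act s z) \<le> a) (\<lambda>s z. b \<le> g (act s z)) (fib y)"

definition ind_density :: "('a \<Rightarrow> real) \<Rightarrow> real \<Rightarrow> real \<Rightarrow> real \<Rightarrow> bool" where
  "ind_density g a b c \<longleftrightarrow>
     (\<forall>T\<in>finite_subsets G. \<exists>y\<in>topspace Y. \<exists>W\<in>indep g a b y. W \<subseteq> T \<and> c * real (card T) \<le> real (card W))"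

text \<open>By \<open>act k (act c z) = act (k \<otimes> c) z\<close>, the points that realise the
  patterns on \<open>W\<close> are moved by \<open>c\<close> to points that realise them on
  \<open>V\<close>, all in the fibre over \<open>act' c y\<close>.\<close>

lemma indep_translate:
  assumes W: "W \<in> indep g a b y" and c: "c \<in> carrier G" and V: "V \<subseteq> carrier G" "\<And>k. k \<in> V \<Longrightarrow> k \<otimes> c \<in> W"
  shows "V \<in> indep g a b (act' c y)"
  unfolding indep_def indep_sets_def
proof (intro CollectI conjI allI impI V(1))
  fix \<tau> assume \<tau>: "\<tau> \<subseteq> V"
  define \<tau>' where "\<tau>' = {k \<otimes> c | k. k \<in> \<tau>}"
  have "\<tau>' \<subseteq> W" using \<tau> V(2) by (auto simp: \<tau>'_def)
  then obtain z where z: "z \<in> fib y" "\<forall>s\<in>\<tau>'. g (act s z) \<le> a" "\<forall>s\<in>W-\<tau>'. b \<le> g (act s z)"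
    using W unfolding indep_def indep_sets_def by blast
  have zZ: "z \<in> topspace Z" using z(1) fib_subset by blast
  have act: "act k (act c z) = act (k \<otimes> c) z" if "k \<in> V" for k
    using act_mult[OF _ c zZ] that V(1) by auto
  have "k \<otimes> c \<in> W - \<tau>'" if k: "k \<in> V - \<tau>" for k
  proof -
    have "k \<otimes> c \<noteq> k' \<otimes> c" if "k' \<in> \<tau>" for k'
    proof
      assume "k \<otimes> c = k' \<otimes> c"
      then have "k = k'" using k that \<tau> V(1) c by (auto simp: subset_iff)
      then show False using k that by blast
    qed
    then show ?thesis using k V(2) by (auto simp: \<tau>'_def)
  qed
  then have "\<forall>k\<in>V-\<tau>. b \<le> g (act k (act c z))" using z(3) act by simp
  moreover have "\<forall>k\<in>\<tau>. g (act k (act c z)) \<le> a"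
  proof
    fix k assume "k \<in> \<tau>"
    then have "k \<in> V" "k \<otimes> c \<in> \<tau>'" using \<tau> by (auto simp: \<tau>'_def)
    then show "g (act k (act c z)) \<le> a" using z(2) act by simp
  qed
  ultimately show "\<exists>z\<in>fib (act' c y). (\<forall>s\<in>\<tau>. g (act s z) \<le> a) \<and> (\<forall>s\<in>V-\<tau>. b \<le> g (act s z))"
    using act_fib[OF c z(1)] by blast
qed

text \<open>An arbitrary \<open>T\<close> is moved into a Folner set that is almost invariant under
  the inverses of \<open>T\<close>. On average over \<open>x\<close> in \<open>F n\<close> at least
  \<open>c / 2 * card T\<close> of the products \<open>k \<otimes> x\<close> lie in
  \<open>W\<close>, so some \<open>x\<close> does as well, and \<open>indep_translate\<close>
  carries its hits back into \<open>T\<close>. The invariance error takes the other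
  \<open>c / 2\<close>.\<close>

lemma ind_density_of_folner:
  assumes F: "folner_sequence G F" and c: "c > 0"
    and freq: "\<exists>\<^sub>F n in sequentially. \<exists>y\<in>topspace Y. \<exists>W\<in>indep g a b y. W \<subseteq> F n \<and> c * real (card (F n)) \<le> real (card W)"
  shows "ind_density g a b (c / 2)"
  unfolding ind_density_def
proof
  fix T assume "T \<in> finite_subsets G"
  then have T: "T \<subseteq> carrier G" "finite T" "T \<noteq> {}" by (auto simp: finite_subsets_def)
  have "\<forall>\<^sub>F n in sequentially. \<forall>k\<in>T. real (card {a\<in>F n. inv k \<otimes> a \<notin> F n}) \<le> c / 2 * real (card (F n))"
    using T c by (intro eventually_ball_finite ballI folner_translate[OF F]) auto
  with freq have "\<exists>\<^sub>F n in sequentially. (\<exists>y\<in>topspace Y. \<exists>W\<in>indep g a b y. W \<subseteq> F n \<and> c * real (card (F n)) \<le> real (card W))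
      \<and> (\<forall>k\<in>T. real (card {a\<in>F n. inv k \<otimes> a \<notin> F n}) \<le> c / 2 * real (card (F n)))"
    by (rule frequently_eventually_frequently)
  then obtain n y W where y: "y \<in> topspace Y" and W: "W \<in> indep g a b y" "W \<subseteq> F n" "c * real (card (F n)) \<le> real (card W)"
    and k: "\<And>k. k \<in> T \<Longrightarrow> real (card {a\<in>F n. inv k \<otimes> a \<notin> F n}) \<le> c / 2 * real (card (F n))"
    by (auto dest!: frequently_ex)
  have Fn: "F n \<subseteq> carrier G" "finite (F n)" "F n \<noteq> {}" using folner_finite_subsets[OF F, of n] by auto
  have sum: "(c - c / 2) * real (card (F n)) * real (card T) \<le> (\<Sum>x\<in>F n. real (card {k\<in>T. k \<otimes> x \<in> W}))"
    using Fn(1,2) T(1,2) W(2) k W(3) by (rule sum_hits_ge)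
  have "\<exists>x\<in>F n. c / 2 * real (card T) \<le> real (card {k\<in>T. k \<otimes> x \<in> W})"
  proof (rule ccontr)
    assume "\<not> ?thesis"
    then have "(\<Sum>x\<in>F n. real (card {k\<in>T. k \<otimes> x \<in> W})) < (\<Sum>x\<in>F n. c / 2 * real (card T))"
      using Fn by (intro sum_strict_mono) (auto simp: not_le)
    then show False using sum by (simp add: mult_ac)
  qed
  then obtain x where x: "x \<in> F n" "c / 2 * real (card T) \<le> real (card {k\<in>T. k \<otimes> x \<in> W})" by blast
  have xG: "x \<in> carrier G" using x Fn by blast
  have "{k\<in>T. k \<otimes> x \<in> W} \<in> indep g a b (act' x y)"
    using T(1) by (intro indep_translate[OF W(1) xG]) auto
  then show "\<exists>y\<in>topspace Y. \<exists>W\<in>indep g a b y. W \<subseteq> T \<and> c / 2 * real (card T) \<le> real (card W)"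
    using x(2) act'_closed[OF xG y] by (intro bexI[of _ "act' x y"] bexI[of _ "{k\<in>T. k \<otimes> x \<in> W}"]) auto
qed

text \<open>Points realising different patterns on \<open>W\<close> differ under \<open>g\<close> by
  at least \<open>b - a\<close> at some time in \<open>H\<close>. The scale \<open>e\<close> comes
  from uniform continuity of \<open>g\<close> and hence does not depend on \<open>H\<close>.\<close>

lemma ind_density_imp_Sep_ge:
  assumes g: "continuous_map Z euclideanreal g" and ab: "a < b" and ind: "ind_density g a b c"
  obtains e where "e > 0" "\<And>H. H \<in> finite_subsets G \<Longrightarrow> 2 powr (c * real (card H)) \<le> real (Sep e H)"
proof -
  obtain \<delta> where \<delta>: "\<delta> > 0" "\<forall>x\<in>topspace Z. \<forall>y\<in>topspace Z. \<rho> x y < \<delta> \<longrightarrow> \<bar>g x - g y\<bar> < b - a"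
    using uniformly_continuous[OF g, of "b - a"] ab by auto
  have "2 powr (c * real (card H)) \<le> real (Sep (\<delta> / 2) H)" if H: "H \<in> finite_subsets G" for H
  proof -
    obtain y W where y: "y \<in> topspace Y" and W: "W \<in> indep g a b y" "W \<subseteq> H" "c * real (card H) \<le> real (card W)"
      using ind H unfolding ind_density_def by blast
    have H': "H \<subseteq> carrier G" "finite H" using H by (auto simp: finite_subsets_def)
    have finW: "finite W" using W(2) H'(2) by (rule finite_subset)
    have "\<forall>\<tau>\<in>Pow W. \<exists>z. z \<in> fib y \<and> (\<forall>s\<in>\<tau>. g (act s z) \<le> a) \<and> (\<forall>s\<in>W-\<tau>. b \<le> g (act s z))"
      using W(1) unfolding indep_def indep_sets_def by blast
    from bchoice[OF this] obtain z where z: "\<forall>\<tau>\<in>Pow W. z \<tau> \<in> fib y \<and> (\<forall>s\<in>\<tau>. g (act s (z \<tau>)) \<le> a) \<and> (\<forall>s\<in>W-\<tau>. b \<le> g (act s (z \<tau>)))"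
      by (elim exE)
    have zZ: "z \<tau> \<in> topspace Z" if "\<tau> \<subseteq> W" for \<tau> using z that fib_subset by blast
    have far: "\<delta> / 2 < dyn H (z \<tau>) (z \<tau>')" if t: "\<tau> \<subseteq> W" "\<tau>' \<subseteq> W" "\<tau> \<noteq> \<tau>'" for \<tau> \<tau>'
    proof -
      obtain s where s: "s \<in> W" "b - a \<le> \<bar>g (act s (z \<tau>)) - g (act s (z \<tau>'))\<bar>"
      proof -
        consider s where "s \<in> \<tau>" "s \<notin> \<tau>'" | s where "s \<in> \<tau>'" "s \<notin> \<tau>" using t(3) by blast
        then show ?thesis
        proof cases
          case 1
          then have "g (act s (z \<tau>)) \<le> a" "b \<le> g (act s (z \<tau>'))" using z t by auto
          then show ?thesis using 1 t(1) by (intro that[of s]) auto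
        next
          case 2
          then have "g (act s (z \<tau>')) \<le> a" "b \<le> g (act s (z \<tau>))" using z t by auto
          then show ?thesis using 2 t(2) by (intro that[of s]) auto
        qed
      qed
      have sH: "s \<in> H" "s \<in> carrier G" using s(1) W(2) H'(1) by auto
      have "\<not> \<rho> (act s (z \<tau>)) (act s (z \<tau>')) < \<delta>"
        using \<delta>(2) s(2) act_closed[OF sH(2) zZ[OF t(1)]] act_closed[OF sH(2) zZ[OF t(2)]] by fastforce
      then have "\<not> dyn H (z \<tau>) (z \<tau>') < \<delta>" using sH dyn_less_iff[OF H] by blast
      then show ?thesis using \<delta>(1) by linarith
    qed
    have inj: "inj_on z (Pow W)"
    proof (rule inj_onI, rule ccontr)
      fix \<tau> \<tau>' assume t: "\<tau> \<in> Pow W" "\<tau>' \<in> Pow W" "z \<tau> = z \<tau>'" "\<tau> \<noteq> \<tau>'"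
      have "dyn H (z \<tau>) (z \<tau>) \<le> 0"
        unfolding dyn_le_iff[OF H] using act_closed[OF _ zZ[of \<tau>]] H'(1) t(1) by auto
      moreover have "\<delta> / 2 < dyn H (z \<tau>) (z \<tau>)" using far[of \<tau> \<tau>'] t by simp
      ultimately show False using \<delta>(1) by linarith
    qed
    have "card (z ` Pow W) \<le> Sep (\<delta> / 2) H"
    proof (rule card_le_Sep[OF H _ y])
      show "separated (dyn H) (\<delta> / 2) (z ` Pow W)" unfolding separated_def using far by blast
    qed (use \<delta> z finW in auto)
    then have "2 ^ card W \<le> Sep (\<delta> / 2) H" using finW by (simp add: card_image[OF inj] card_Pow)
    then have "2 ^ card W \<le> real (Sep (\<delta> / 2) H)" by (metis of_nat_le_iff of_nat_numeral of_nat_power)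
    moreover have "2 powr (c * real (card H)) \<le> 2 powr real (card W)" using W(3) by (intro powr_mono) auto
    moreover have "2 powr real (card W) = (2::real) ^ card W" by (simp add: powr_realpow)
    ultimately show ?thesis by linarith
  qed
  then show ?thesis using \<delta>(1) by (intro that[of "\<delta> / 2"]) auto
qed

lemma Ent_pos_of_exponential:
  assumes F: "\<And>n. F n \<in> finite_subsets G" and c: "c > 0"
    and ge: "\<forall>\<^sub>F n in sequentially. 2 powr (c * real (card (F n))) \<le> real (Sep e (F n))"
  shows "0 < Ent F e"
proof -
  have "ereal (c * ln 2) \<le> Ent F e"
  proof -
    have "ereal (c * ln 2) = limsup (\<lambda>n::nat. ereal (c * ln 2))" by (simp add: Limsup_const)
    also have "\<dots> \<le> Ent F e"
      unfolding Ent_def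
    proof (rule Limsup_mono, use ge in eventually_elim)
      case (elim n)
      have "0 < card (F n)" using F[of n] by (auto simp: finite_subsets_def card_gt_0_iff)
      moreover have "ln (2 powr (c * real (card (F n)))) \<le> ln (real (Sep e (F n)))"
        using elim by (intro ln_mono) auto
      ultimately show ?case by (simp add: pos_le_divide_eq mult_ac)
    qed
    finally show ?thesis .
  qed
  moreover have "0 < ereal (c * ln 2)" using c by simp
  ultimately show ?thesis by (rule less_le_trans[rotated])
qed

text \<open>Send a point to one box containing it for each triple of \<open>Q\<close>. This is
  injective on \<open>S\<close>: two separated points are told apart by some triple at some time
  \<open>s\<close>, but a common box excludes at \<open>s\<close> the same one of the two values for
  both of them.\<close>

lemma positive_entropy_box_covers:
  assumes H: "H \<in> finite_subsets G" and fin: "finite Q"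
    and Q: "\<And>x y. \<lbrakk>x \<in> topspace Z; y \<in> topspace Z; e \<le> \<rho> x y\<rbrakk> \<Longrightarrow>
      \<exists>(g, a, b)\<in>Q. (g x \<le> a \<and> b \<le> g y) \<or> (g y \<le> a \<and> b \<le> g x)"
    and S: "S \<subseteq> topspace Z" "finite S" "separated (dyn H) e S"
    and C: "\<And>g a b. (g, a, b) \<in> Q \<Longrightarrow> finite (C (g, a, b)) \<and>
      box_cover H (\<lambda>s z. g (act s z) \<le> a) (\<lambda>s z. b \<le> g (act s z)) S (C (g, a, b))"
  shows "card S \<le> (\<Prod>t\<in>Q. card (C t))"
proof -
  have HG: "H \<subseteq> carrier G" using H by (auto simp: finite_subsets_def)
  have C': "finite (C t) \<and> box_cover H (\<lambda>s z. fst t (act s z) \<le> fst (snd t)) (\<lambda>s z. snd (snd t) \<le> fst t (act s z)) S (C t)"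
    if "t \<in> Q" for t using C[of "fst t" "fst (snd t)" "snd (snd t)"] that by simp
  define box where "box t z = (SOME \<sigma>. \<sigma> \<in> C t \<and> (\<forall>s\<in>\<sigma>. \<not> fst t (act s z) \<le> fst (snd t)) \<and>
      (\<forall>s\<in>H-\<sigma>. \<not> snd (snd t) \<le> fst t (act s z)))" for t z
  have box: "box t z \<in> C t \<and> (\<forall>s\<in>box t z. \<not> fst t (act s z) \<le> fst (snd t)) \<and>
      (\<forall>s\<in>H-box t z. \<not> snd (snd t) \<le> fst t (act s z))" if "t \<in> Q" "z \<in> S" for t z
    unfolding box_def
  proof (rule someI_ex)
    show "\<exists>\<sigma>. \<sigma> \<in> C t \<and> (\<forall>s\<in>\<sigma>. \<not> fst t (act s z) \<le> fst (snd t)) \<and> (\<forall>s\<in>H-\<sigma>. \<not> snd (snd t) \<le> fst t (act s z))"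
      using C'[OF that(1)] that(2) unfolding box_cover_def by blast
  qed
  have "card S \<le> card (PiE Q C)"
  proof (rule card_inj_on_le[of "\<lambda>z. \<lambda>t\<in>Q. box t z"])
    show "inj_on (\<lambda>z. \<lambda>t\<in>Q. box t z) S"
    proof (rule inj_onI, rule ccontr)
      fix x y assume xy: "x \<in> S" "y \<in> S" "x \<noteq> y" and eq: "(\<lambda>t\<in>Q. box t x) = (\<lambda>t\<in>Q. box t y)"
      have "e < dyn H x y" using S(3) xy unfolding separated_def by blast
      then have "\<not> dyn H x y \<le> e" by simp
      then obtain s where s: "s \<in> H" "e < \<rho> (act s x) (act s y)" unfolding dyn_le_iff[OF H] by auto
      have "act s x \<in> topspace Z" "act s y \<in> topspace Z" using s(1) HG xy S(1) act_closed by blast+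
      from Q[OF this] s(2) obtain t where t: "t \<in> Q"
        "(fst t (act s x) \<le> fst (snd t) \<and> snd (snd t) \<le> fst t (act s y)) \<or>
         (fst t (act s y) \<le> fst (snd t) \<and> snd (snd t) \<le> fst t (act s x))"
        by (auto simp: case_prod_beta)
      have "box t x = box t y" using fun_cong[OF eq, of t] t(1) by simp
      then show False using box[OF t(1) xy(1)] box[OF t(1) xy(2)] t(2) s(1) by (cases "s \<in> box t x") auto
    qed
    show "(\<lambda>z. \<lambda>t\<in>Q. box t z) ` S \<subseteq> PiE Q C" using box by auto
    show "finite (PiE Q C)" using fin C' by (intro finite_PiE) auto
  qed
  then show ?thesis using fin by (simp add: card_PiE)
qed

text \<open>If every triple needed fewer than \<open>exp (\<beta>' * n)\<close> boxes, their product
  would bound a maximal separated set by \<open>exp (\<beta> * n)\<close>, against the entropy. So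
  infinitely often some triple needs many boxes, which gives a large independent set, and by
  finiteness of \<open>Q\<close> the same triple occurs infinitely often. The 1 in the denominator
  of \<open>\<beta>'\<close> allows for empty \<open>Q\<close>.\<close>

theorem positive_entropy_imp_ind_density:
  assumes F: "folner_sequence G F"
    and cont: "\<And>g. g \<in> \<G> \<Longrightarrow> continuous_map Z euclideanreal g"
    and sep: "\<And>x y. \<lbrakk>x \<in> topspace Z; y \<in> topspace Z; x \<noteq> y\<rbrakk> \<Longrightarrow> \<exists>g\<in>\<G>. g x \<noteq> g y"
    and e: "e > 0" and pos: "0 < Ent F e"
  shows "\<exists>g\<in>\<G>. \<exists>a b c. a < b \<and> c > 0 \<and> ind_density g a b c"
proof -
  have Fn: "F n \<in> finite_subsets G" for n using F by (simp add: folner_sequence_def)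
  have Fn': "F n \<subseteq> carrier G" "finite (F n)" "F n \<noteq> {}" for n using folner_finite_subsets[OF F, of n] by auto
  obtain Q where fin: "finite Q" and Qt: "\<forall>(g, a, b)\<in>Q. g \<in> \<G> \<and> a < b"
    and Qs: "\<forall>x\<in>topspace Z. \<forall>y\<in>topspace Z. e \<le> \<rho> x y \<longrightarrow>
      (\<exists>(g, a, b)\<in>Q. (g x \<le> a \<and> b \<le> g y) \<or> (g y \<le> a \<and> b \<le> g x))"
    using separating_triples[OF cont sep e] by blast
  obtain \<beta> where \<beta>: "0 < ereal \<beta>" "ereal \<beta> < Ent F e" using ereal_dense2[OF pos] by blast
  have freq: "\<exists>\<^sub>F n in sequentially. exp (\<beta> * real (card (F n))) < real (Sep e (F n))"
  proof (rule ccontr)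
    assume "\<not> ?thesis"
    then have "\<forall>\<^sub>F n in sequentially. ereal (ln (real (Sep e (F n))) / real (card (F n))) \<le> ereal \<beta>"
      unfolding not_frequently
    proof eventually_elim
      case (elim n)
      have pos: "0 < card (F n)" using Fn'[of n] by (simp add: card_gt_0_iff)
      have "ln (real (Sep e (F n))) \<le> \<beta> * real (card (F n))"
      proof (cases "Sep e (F n) = 0")
        case True
        then show ?thesis using \<beta>(1) by simp
      next
        case False
        then have "ln (real (Sep e (F n))) \<le> ln (exp (\<beta> * real (card (F n))))"
          using elim by (intro ln_mono) auto
        then show ?thesis by simp
      qed
      then show ?case using pos by (simp add: pos_divide_le_eq)
    qed
    then have "Ent F e \<le> ereal \<beta>" unfolding Ent_def by (rule Limsup_bounded)
    then show False using \<beta>(2) by simp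
  qed
  define \<beta>' where "\<beta>' = \<beta> / (real (card Q) + 1)"
  have \<beta>': "\<beta>' > 0" using \<beta>(1) by (simp add: \<beta>'_def)
  obtain c where c: "c > 0" and large: "\<forall>(H::'g set) (S::'a set) P R.
    finite H \<and> finite S \<and> H \<noteq> {} \<and> (\<forall>s\<in>H. \<forall>z\<in>S. \<not> (P s z \<and> R s z)) \<and>
    (\<forall>C. finite C \<and> box_cover H P R S C \<longrightarrow> exp (\<beta>' * real (card H)) \<le> real (card C)) \<longrightarrow>
    (\<exists>W\<in>indep_sets H P R S. c * real (card H) \<le> real (card W))"
    using large_indep_set[OF \<beta>'] by (elim exE conjE)
  let ?good = "\<lambda>t n. \<exists>y\<in>topspace Y. \<exists>W\<in>indep (fst t) (fst (snd t)) (snd (snd t)) y.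
      W \<subseteq> F n \<and> c * real (card (F n)) \<le> real (card W)"
  have "\<exists>\<^sub>F n in sequentially. \<exists>t\<in>Q. ?good t n"
    using freq
  proof (rule frequently_elim1)
    fix n assume big: "exp (\<beta> * real (card (F n))) < real (Sep e (F n))"
    have "0 < real (Sep e (F n))" using big exp_gt_zero[of "\<beta> * real (card (F n))"] by linarith
    then obtain y S where y: "y \<in> topspace Y" and S: "S \<subseteq> fib y" "finite S" "separated (dyn (F n)) e S" "card S = Sep e (F n)"
      using Sep_attained[OF Fn e, of n] by auto
    have SZ: "S \<subseteq> topspace Z" using S(1) fib_subset by blast
    let ?P = "\<lambda>t s z. fst t (act s z) \<le> fst (snd t)" and ?R = "\<lambda>t s z. snd (snd t) \<le> fst t (act s z)"
    show "\<exists>t\<in>Q. ?good t n"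
    proof (cases "\<exists>t\<in>Q. \<forall>C. finite C \<and> box_cover (F n) (?P t) (?R t) S C \<longrightarrow> exp (\<beta>' * real (card (F n))) \<le> real (card C)")
      case True
      then obtain t where t: "t \<in> Q"
        "\<forall>C. finite C \<and> box_cover (F n) (?P t) (?R t) S C \<longrightarrow> exp (\<beta>' * real (card (F n))) \<le> real (card C)" by blast
      have "fst (snd t) < snd (snd t)" using Qt t(1) by (auto simp: case_prod_beta)
      then have dis: "\<forall>s\<in>F n. \<forall>z\<in>S. \<not> (?P t s z \<and> ?R t s z)" by auto
      have "\<exists>W\<in>indep_sets (F n) (?P t) (?R t) S. c * real (card (F n)) \<le> real (card W)"
        by (rule large[rule_format]) (intro conjI Fn' S(2) dis t(2))
      then obtain W where W: "W \<in> indep_sets (F n) (?P t) (?R t) S" "c * real (card (F n)) \<le> real (card W)" by blast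
      have "W \<in> indep (fst t) (fst (snd t)) (snd (snd t)) y"
        unfolding indep_def using indep_sets_mono[OF S(1) Fn'(1)] W(1) by blast
      moreover have "W \<subseteq> F n" using W(1) by (simp add: indep_sets_def)
      ultimately show ?thesis using t(1) y W(2) by blast
    next
      case False
      then have "\<forall>t\<in>Q. \<exists>C. finite C \<and> box_cover (F n) (?P t) (?R t) S C \<and> real (card C) < exp (\<beta>' * real (card (F n)))"
        by (meson not_le)
      from bchoice[OF this] obtain C where C: "\<forall>t\<in>Q. finite (C t) \<and> box_cover (F n) (?P t) (?R t) S (C t)
          \<and> real (card (C t)) < exp (\<beta>' * real (card (F n)))" by (elim exE)
      have "card S \<le> (\<Prod>t\<in>Q. card (C t))"
      proof (rule positive_entropy_box_covers[OF Fn fin _ SZ S(2,3)])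
        show "\<exists>(g, a, b)\<in>Q. (g x \<le> a \<and> b \<le> g y) \<or> (g y \<le> a \<and> b \<le> g x)"
          if "x \<in> topspace Z" "y \<in> topspace Z" "e \<le> \<rho> x y" for x y using Qs that by blast
        show "finite (C (g, a, b)) \<and> box_cover (F n) (\<lambda>s z. g (act s z) \<le> a) (\<lambda>s z. b \<le> g (act s z)) S (C (g, a, b))"
          if "(g, a, b) \<in> Q" for g a b using C that by fastforce
      qed
      then have "real (card S) \<le> (\<Prod>t\<in>Q. real (card (C t)))" by (simp flip: of_nat_prod)
      also have "\<dots> \<le> (\<Prod>t\<in>Q. exp (\<beta>' * real (card (F n))))"
        using C by (intro prod_mono) (auto intro: less_imp_le)
      also have "\<dots> = exp (real (card Q) * (\<beta>' * real (card (F n))))" by (simp add: exp_of_nat_mult)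
      also have "\<dots> \<le> exp (\<beta> * real (card (F n)))"
      proof -
        have "real (card Q) * \<beta>' \<le> \<beta>" using \<beta>(1) by (simp add: \<beta>'_def field_simps)
        then have "real (card Q) * \<beta>' * real (card (F n)) \<le> \<beta> * real (card (F n))" by (rule mult_right_mono) simp
        then show ?thesis by (simp add: mult.assoc)
      qed
      finally show ?thesis using big S(4) by simp
    qed
  qed
  then have "\<exists>t\<in>Q. \<exists>\<^sub>F n in sequentially. ?good t n"
    by (rule frequently_bex_finite[OF fin])
  then obtain t where t: "t \<in> Q" "\<exists>\<^sub>F n in sequentially. ?good t n" by blast
  have "ind_density (fst t) (fst (snd t)) (snd (snd t)) (c / 2)"
    by (rule ind_density_of_folner[OF F c t(2)])
  moreover have "fst t \<in> \<G>" "fst (snd t) < snd (snd t)" using Qt t(1) by (auto simp: case_prod_beta)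
  ultimately show ?thesis using c half_gt_zero by blast
qed

end

section \<open>Relative mean dimension\<close>

text \<open>
  \<open>t c / p\<close> is a threshold for the coordinate \<open>c\<close>; it is bad for the value \<open>v\<close> if \<open>p v - t c\<close> lies within
  \<open>1/2\<close> of the transition interval \<open>[0, 1]\<close>.
\<close>

lemma card_bad_thresholds: "card {k. k < p \<and> - (1/2) < x - real k \<and> x - real k < 3/2} \<le> 2"
proof -
  have "{k. k < p \<and> - (1/2) < x - real k \<and> x - real k < 3/2} \<subseteq> {nat \<lceil>x - 3/2\<rceil>, nat \<lceil>x - 3/2\<rceil> + 1}"
  proof
    fix k assume "k \<in> {k. k < p \<and> - (1/2) < x - real k \<and> x - real k < 3/2}"
    then have k: "x - 3/2 < real k" "real k < x + 1/2" by auto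
    have "int k = \<lceil>x - 3/2\<rceil> \<or> int k = \<lceil>x - 3/2\<rceil> + 1"
      using k ceiling_correct[of "x - 3/2"] by linarith
    then show "k \<in> {nat \<lceil>x - 3/2\<rceil>, nat \<lceil>x - 3/2\<rceil> + 1}" by auto
  qed
  then have "card {k. k < p \<and> - (1/2) < x - real k \<and> x - real k < 3/2} \<le> card {nat \<lceil>x - 3/2\<rceil>, nat \<lceil>x - 3/2\<rceil> + 1}"
    by (rule card_mono[rotated]) simp
  then show ?thesis by simp
qed

text \<open>Union bound in place of probability: for one \<open>j\<close> and one set of
  \<open>D + 1\<close> coordinates, the proportion of thresholds that are bad on all of them is at
  most \<open>(2 / p) ^ (D + 1)\<close>. There are \<open>card J\<close> points and at most
  \<open>2 ^ card C\<close> such sets, so \<open>small\<close> leaves a good choice.\<close>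

lemma threshold_choice:
  fixes v :: "'j \<Rightarrow> 'c \<Rightarrow> real"
  assumes J: "finite J" and C: "finite C" and p: "p > 0"
    and small: "real (card J) * 2 ^ card C * 2 ^ (D + 1) < real p ^ (D + 1)"
  shows "\<exists>t. (\<forall>c\<in>C. t c < p) \<and>
    (\<forall>j\<in>J. card {c\<in>C. - (1/2) < p * v j c - real (t c) \<and> p * v j c - real (t c) < 3/2} \<le> D)"
proof (cases "D + 1 \<le> card C")
  case False
  show ?thesis
  proof (intro exI[of _ "\<lambda>_. 0"] conjI ballI)
    fix j
    have "card {c\<in>C. - (1/2) < p * v j c - real 0 \<and> p * v j c - real 0 < 3/2} \<le> card C"
      using C by (intro card_mono) auto
    then show "card {c\<in>C. - (1/2) < p * v j c - real 0 \<and> p * v j c - real 0 < 3/2} \<le> D" using False by linarith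
  qed (use p in simp)
next
  case True
  let ?near = "\<lambda>j c k. - (1/2) < p * v j c - real k \<and> p * v j c - real k < 3/2"
  let ?T = "PiE C (\<lambda>_. {..<p})"
  define X where "X j B = PiE C (\<lambda>c. if c \<in> B then {k. k < p \<and> ?near j c k} else {..<p})" for j B
  define \<B> where "\<B> = {B. B \<subseteq> C \<and> card B = D + 1}"
  have fin\<B>: "finite \<B>" "card \<B> \<le> 2 ^ card C"
  proof -
    have "\<B> \<subseteq> Pow C" by (auto simp: \<B>_def)
    then show "finite \<B>" "card \<B> \<le> 2 ^ card C"
      using C card_mono[of "Pow C" \<B>] by (auto intro: finite_subset simp: card_Pow)
  qed
  have cX: "card (X j B) \<le> 2 ^ (D + 1) * p ^ (card C - (D + 1))" if B: "B \<in> \<B>" for j B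
  proof -
    have BC: "B \<subseteq> C" "card B = D + 1" using B by (auto simp: \<B>_def)
    have "card (X j B) = (\<Prod>c\<in>C. card (if c \<in> B then {k. k < p \<and> ?near j c k} else {..<p}))"
      unfolding X_def using C by (rule card_PiE)
    also have "\<dots> \<le> (\<Prod>c\<in>C. if c \<in> B then 2 else p)"
      using card_bad_thresholds[of p] by (intro prod_mono) auto
    also have "\<dots> = 2 ^ card B * p ^ card (C - B)"
      using C BC by (simp add: prod.If_cases Int_absorb1 Diff_eq)
    also have "card (C - B) = card C - (D + 1)" using BC C by (simp add: card_Diff_subset finite_subset)
    finally show ?thesis using BC by simp
  qed
  have finX: "finite (X j B)" for j B unfolding X_def using C by (intro finite_PiE) auto
  have "card (\<Union>j\<in>J. \<Union>B\<in>\<B>. X j B) \<le> (\<Sum>j\<in>J. card (\<Union>B\<in>\<B>. X j B))" using J by (rule card_UN_le)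
  also have "\<dots> \<le> (\<Sum>j\<in>J. \<Sum>B\<in>\<B>. card (X j B))" using fin\<B> by (intro sum_mono card_UN_le)
  also have "\<dots> \<le> (\<Sum>j\<in>J. \<Sum>B\<in>\<B>. 2 ^ (D + 1) * p ^ (card C - (D + 1)))" using cX by (intro sum_mono)
  also have "\<dots> = card J * card \<B> * (2 ^ (D + 1) * p ^ (card C - (D + 1)))" by simp
  also have "\<dots> \<le> card J * 2 ^ card C * (2 ^ (D + 1) * p ^ (card C - (D + 1)))"
    using fin\<B> by (intro mult_right_mono mult_left_mono) auto
  finally have "real (card (\<Union>j\<in>J. \<Union>B\<in>\<B>. X j B)) \<le> real (card J * 2 ^ card C * (2 ^ (D + 1) * p ^ (card C - (D + 1))))"
    by (rule of_nat_mono)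
  also have "\<dots> = (real (card J) * 2 ^ card C * 2 ^ (D + 1)) * real p ^ (card C - (D + 1))" by simp
  also have "\<dots> < real p ^ (D + 1) * real p ^ (card C - (D + 1))"
    using small p by (intro mult_strict_right_mono) auto
  also have "\<dots> = real p ^ card C" by (simp only: power_add[symmetric] le_add_diff_inverse[OF True])
  also have "\<dots> = real (card ?T)" using C by (simp add: card_PiE)
  finally have lt: "card (\<Union>j\<in>J. \<Union>B\<in>\<B>. X j B) < card ?T" by simp
  have "\<not> ?T \<subseteq> (\<Union>j\<in>J. \<Union>B\<in>\<B>. X j B)"
  proof
    assume "?T \<subseteq> (\<Union>j\<in>J. \<Union>B\<in>\<B>. X j B)"
    then have "card ?T \<le> card (\<Union>j\<in>J. \<Union>B\<in>\<B>. X j B)"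
      using J fin\<B> finX by (intro card_mono) auto
    then show False using lt by simp
  qed
  then obtain t where t: "t \<in> ?T" "\<And>j B. j \<in> J \<Longrightarrow> B \<in> \<B> \<Longrightarrow> t \<notin> X j B" by blast
  have "card {c\<in>C. ?near j c (t c)} \<le> D" if j: "j \<in> J" for j
  proof (rule ccontr)
    assume "\<not> ?thesis"
    then have "D + 1 \<le> card {c\<in>C. ?near j c (t c)}" by simp
    then obtain B where B: "B \<subseteq> {c\<in>C. ?near j c (t c)}" "card B = D + 1" "finite B"
      by (rule obtain_subset_with_card_n)
    have "B \<in> \<B>" using B by (auto simp: \<B>_def)
    moreover have "t \<in> X j B" unfolding X_def using t(1) B(1) by (auto simp: PiE_iff)
    ultimately show False using t(2)[OF j] by blast
  qed
  moreover have "t c < p" if "c \<in> C" for c using t(1) that by (auto simp: PiE_iff)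
  ultimately show ?thesis by blast
qed

lemma continuous_map_clip:
  "continuous_map Z euclideanreal f \<Longrightarrow> continuous_map Z euclideanreal (\<lambda>x. clip (f x))"
  unfolding clip_def by (intro continuous_map_real_max continuous_map_real_min) auto

lemma clip_diff_le: "\<bar>clip x - clip y\<bar> \<le> \<bar>x - y\<bar>"
  by (auto simp: clip_def max_def min_def)

section \<open>Separating bump functions\<close>

context compact_metric begin

text \<open>Equal to 0 up to distance \<open>e / 4\<close> from \<open>x\<close> and to 1 from
  distance \<open>e / 2\<close> on, with Lipschitz constant \<open>4 / e\<close>. Centres from an
  \<open>e / 4\<close>-net therefore separate points at distance at least \<open>e\<close> with the
  exact values 0 and 1.\<close>

definition bump :: "real \<Rightarrow> 'a \<Rightarrow> 'a \<Rightarrow> real" where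
  "bump e x z = clip (4 / e * \<rho> x z - 1)"

lemma bump_bounds: "0 \<le> bump e x z" "bump e x z \<le> 1"
  by (simp_all add: bump_def)

lemma continuous_bump: "x \<in> topspace Z \<Longrightarrow> continuous_map Z euclideanreal (bump e x)"
  unfolding bump_def by (intro continuous_map_clip continuous_map_diff continuous_map_real_mult_left continuous_dist_point) auto

lemma bump_diff_le:
  assumes "e > 0" "x \<in> topspace Z" "z \<in> topspace Z" "z' \<in> topspace Z"
  shows "\<bar>bump e x z - bump e x z'\<bar> \<le> 4 / e * \<rho> z z'"
proof -
  have "\<bar>bump e x z - bump e x z'\<bar> \<le> \<bar>4 / e * (\<rho> x z - \<rho> x z')\<bar>"
    using clip_diff_le[of "4 / e * \<rho> x z - 1" "4 / e * \<rho> x z' - 1"] by (simp add: bump_def right_diff_distrib)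
  also have "\<dots> = 4 / e * \<bar>\<rho> x z - \<rho> x z'\<bar>"
    unfolding abs_mult using assms(1) by (subst abs_of_pos[of "4 / e"]) auto
  also have "\<dots> \<le> 4 / e * \<rho> z z'"
  proof (rule mult_left_mono)
    show "\<bar>\<rho> x z - \<rho> x z'\<bar> \<le> \<rho> z z'"
      using triangle[of x z z'] triangle[of x z' z] commute[of z z'] assms by auto
  qed (use assms in simp)
  finally show ?thesis .
qed

lemma bump_separates:
  assumes e: "e > 0"
  shows "\<exists>N. finite N \<and> N \<subseteq> topspace Z \<and>
    (\<forall>z\<in>topspace Z. \<forall>z'\<in>topspace Z. e \<le> \<rho> z z' \<longrightarrow> (\<exists>x\<in>N. bump e x z = 0 \<and> bump e x z' = 1))"
proof -
  obtain N where N: "finite N" "N \<subseteq> topspace Z" "\<forall>z\<in>topspace Z. \<exists>x\<in>N. \<rho> x z < e / 4"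
    using finite_net[of "e / 4"] e by auto
  have "\<exists>x\<in>N. bump e x z = 0 \<and> bump e x z' = 1" if z: "z \<in> topspace Z" "z' \<in> topspace Z" "e \<le> \<rho> z z'" for z z'
  proof -
    obtain x where x: "x \<in> N" "\<rho> x z < e / 4" using N(3) z(1) by blast
    have "\<rho> z z' \<le> \<rho> x z + \<rho> x z'" using triangle[of z x z'] commute[of z x] z x(1) N(2) by auto
    then have "e / 2 \<le> \<rho> x z'" using x(2) z(3) e by linarith
    then have "2 \<le> 4 / e * \<rho> x z'" using e by (simp add: field_simps)
    moreover have "4 / e * \<rho> x z \<le> 1" using e x(2) by (simp add: field_simps)
    ultimately show ?thesis using x(1) by (intro bexI[of _ x]) (auto simp: bump_def clip_def)
  qed
  with N(1,2) show ?thesis by blast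
qed

end

section \<open>Fibrewise width: subadditivity and invariance\<close>

context fibred_system begin

lemma continuous_bump_act:
  "x \<in> topspace Z \<Longrightarrow> s \<in> carrier G \<Longrightarrow> continuous_map (subtopology Z A) euclideanreal (\<lambda>z. bump e x (act s z))"
  using continuous_map_compose[OF continuous_map_from_subtopology[OF act_continuous] continuous_bump, of s x A e]
  by (simp add: o_def)

text \<open>The bound is uniform in \<open>A\<close>, so the supremum of the widths of all fibres is
  one of a bounded set.\<close>

lemma small_width_exists:
  assumes H: "H \<in> finite_subsets G" and e: "e > 0"
  shows "\<exists>D. \<forall>A. small_width (subtopology Z A) (dyn H) e D"
proof -
  obtain N where N: "finite N" "N \<subseteq> topspace Z"
    "\<forall>z\<in>topspace Z. \<forall>z'\<in>topspace Z. e \<le> \<rho> z z' \<longrightarrow> (\<exists>x\<in>N. bump e x z = 0 \<and> bump e x z' = 1)"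
    using bump_separates[OF e] by (elim exE conjE)
  have HG: "H \<subseteq> carrier G" "finite H" using H by (auto simp: finite_subsets_def)
  have "small_width (subtopology Z A) (dyn H) e (card (N \<times> H))" for A
  proof (rule small_widthI[of "N \<times> H" _ "\<lambda>c z. bump e (fst c) (act (snd c) z)"])
    show "continuous_map (subtopology Z A) euclideanreal (\<lambda>z. bump e (fst c) (act (snd c) z))" if "c \<in> N \<times> H" for c
      using that N(2) HG(1) by (intro continuous_bump_act) auto
    show "card ((\<lambda>c. bump e (fst c) (act (snd c) z)) ` (N \<times> H) \<inter> {0<..<1}) \<le> card (N \<times> H)" for z
    proof -
      have fin: "finite (N \<times> H)" using N(1) HG(2) by simp
      have "card ((\<lambda>c. bump e (fst c) (act (snd c) z)) ` (N \<times> H) \<inter> {0<..<1})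
          \<le> card ((\<lambda>c. bump e (fst c) (act (snd c) z)) ` (N \<times> H))"
        using fin by (intro card_mono) auto
      also have "\<dots> \<le> card (N \<times> H)" using fin by (rule card_image_le)
      finally show ?thesis .
    qed
    show "dyn H z z' < e" if z: "z \<in> topspace (subtopology Z A)" "z' \<in> topspace (subtopology Z A)"
      and eq: "\<And>c. c \<in> N \<times> H \<Longrightarrow> bump e (fst c) (act (snd c) z) = bump e (fst c) (act (snd c) z')" for z z'
      unfolding dyn_less_iff[OF H]
    proof (rule ballI, rule ccontr)
      fix s assume s: "s \<in> H" "\<not> \<rho> (act s z) (act s z') < e"
      have "act s z \<in> topspace Z" "act s z' \<in> topspace Z" using s(1) HG(1) z act_closed by auto
      then obtain x where "x \<in> N" "bump e x (act s z) = 0" "bump e x (act s z') = 1" using N(3) s(2) by fastforce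
      then show False using eq[of "(x, s)"] s(1) by simp
    qed
  qed (use N(1) HG(2) bump_bounds in auto)
  then show ?thesis by blast
qed

text \<open>The value at \<open>{}\<close> is fixed separately, since \<open>dyn_metric\<close>
  takes a maximum over \<open>H\<close> and the Ornstein-Weiss lemma needs a function that vanishes
  at the empty set.\<close>

definition Wd :: "real \<Rightarrow> 'g set \<Rightarrow> nat" where
  "Wd e H = (if H = {} then 0 else SUP y\<in>topspace Y. Widim e (subtopology Z (fib y)) (dyn H))"

lemma Widim_le_Wd:
  assumes H: "H \<in> finite_subsets G" and e: "e > 0" and y: "y \<in> topspace Y"
  shows "Widim e (subtopology Z (fib y)) (dyn H) \<le> Wd e H"
proof -
  obtain D where D: "\<forall>A. small_width (subtopology Z A) (dyn H) e D" using small_width_exists[OF H e] by blast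
  have "bdd_above ((\<lambda>y. Widim e (subtopology Z (fib y)) (dyn H)) ` topspace Y)"
    using D Widim_le by (intro bdd_aboveI[of _ D]) blast
  moreover have "H \<noteq> {}" using H by (auto simp: finite_subsets_def)
  ultimately show ?thesis unfolding Wd_def using cSUP_upper[OF y] by simp
qed

lemma small_width_Wd:
  assumes H: "H \<in> finite_subsets G" and e: "e > 0" and y: "y \<in> topspace Y"
  shows "\<exists>D \<le> Wd e H. small_width (subtopology Z (fib y)) (dyn H) e D"
proof -
  obtain D where "\<forall>A. small_width (subtopology Z A) (dyn H) e D" using small_width_exists[OF H e] by blast
  then have "small_width (subtopology Z (fib y)) (dyn H) e (Widim e (subtopology Z (fib y)) (dyn H))"
    using small_width_Widim by blast
  then show ?thesis using Widim_le_Wd[OF H e y] by blast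
qed

lemma Wd_leI:
  assumes "\<And>y. y \<in> topspace Y \<Longrightarrow> small_width (subtopology Z (fib y)) (dyn H) e D"
  shows "Wd e H \<le> D"
proof (cases "topspace Y = {}")
  case True
  show ?thesis by (simp only: Wd_def True image_empty Sup_nat_empty) simp
next
  case False
  then have "(SUP y\<in>topspace Y. Widim e (subtopology Z (fib y)) (dyn H)) \<le> D"
    using assms Widim_le by (intro cSUP_least) blast+
  then show ?thesis unfolding Wd_def by simp
qed

text \<open>Juxtaposing two families of coordinates at most adds the numbers of values in
  \<open>(0, 1)\<close>. In terms of complexes this would require triangulating a product.\<close>

lemma small_width_Un:
  assumes H: "H1 \<in> finite_subsets G" "H2 \<in> finite_subsets G"
    and w: "small_width A (dyn H1) e D1" "small_width A (dyn H2) e D2"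
  shows "small_width A (dyn (H1 \<union> H2)) e (D1 + D2)"
proof -
  have H12: "H1 \<union> H2 \<in> finite_subsets G" using H by (auto simp: finite_subsets_def)
  obtain N1 :: nat and u1 where 1: "\<forall>c<N1. continuous_map A euclideanreal (u1 c)"
     "\<forall>z\<in>topspace A. \<forall>c<N1. 0 \<le> u1 c z \<and> u1 c z \<le> 1"
     "\<forall>z\<in>topspace A. card ((\<lambda>c. u1 c z) ` {..<N1} \<inter> {0<..<1}) \<le> D1"
     "\<forall>z\<in>topspace A. \<forall>z'\<in>topspace A. (\<forall>c<N1. u1 c z = u1 c z') \<longrightarrow> dyn H1 z z' < e"
    using w(1) unfolding small_width_def by (elim exE conjE)
  obtain N2 :: nat and u2 where 2: "\<forall>c<N2. continuous_map A euclideanreal (u2 c)"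
     "\<forall>z\<in>topspace A. \<forall>c<N2. 0 \<le> u2 c z \<and> u2 c z \<le> 1"
     "\<forall>z\<in>topspace A. card ((\<lambda>c. u2 c z) ` {..<N2} \<inter> {0<..<1}) \<le> D2"
     "\<forall>z\<in>topspace A. \<forall>z'\<in>topspace A. (\<forall>c<N2. u2 c z = u2 c z') \<longrightarrow> dyn H2 z z' < e"
    using w(2) unfolding small_width_def by (elim exE conjE)
  let ?u = "\<lambda>c z. case c of Inl c \<Rightarrow> u1 c z | Inr c \<Rightarrow> u2 c z"
  show ?thesis
  proof (rule small_widthI[of "{..<N1} <+> {..<N2}" _ ?u])
    show "card ((\<lambda>c. ?u c z) ` ({..<N1} <+> {..<N2}) \<inter> {0<..<1}) \<le> D1 + D2" if z: "z \<in> topspace A" for z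
    proof -
      have "(\<lambda>c. ?u c z) ` ({..<N1} <+> {..<N2}) \<inter> {0<..<1}
          \<subseteq> ((\<lambda>c. u1 c z) ` {..<N1} \<inter> {0<..<1}) \<union> ((\<lambda>c. u2 c z) ` {..<N2} \<inter> {0<..<1})" by auto
      then have "card ((\<lambda>c. ?u c z) ` ({..<N1} <+> {..<N2}) \<inter> {0<..<1})
          \<le> card (((\<lambda>c. u1 c z) ` {..<N1} \<inter> {0<..<1}) \<union> ((\<lambda>c. u2 c z) ` {..<N2} \<inter> {0<..<1}))"
        by (intro card_mono) auto
      also have "\<dots> \<le> card ((\<lambda>c. u1 c z) ` {..<N1} \<inter> {0<..<1}) + card ((\<lambda>c. u2 c z) ` {..<N2} \<inter> {0<..<1})"
        by (rule card_Un_le)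
      finally show ?thesis using 1(3) 2(3) z by fastforce
    qed
    show "dyn (H1 \<union> H2) z z' < e" if z: "z \<in> topspace A" "z' \<in> topspace A"
      and eq: "\<And>c. c \<in> {..<N1} <+> {..<N2} \<Longrightarrow> ?u c z = ?u c z'" for z z'
    proof -
      have "u1 c z = u1 c z'" if "c < N1" for c
        using eq[OF InlI[of c "{..<N1}"]] that by simp
      then have a: "dyn H1 z z' < e" using 1(4) z by blast
      have "u2 c z = u2 c z'" if "c < N2" for c
        using eq[OF InrI[of c "{..<N2}"]] that by simp
      then have b: "dyn H2 z z' < e" using 2(4) z by blast
      show ?thesis using a b unfolding dyn_less_iff[OF H12] dyn_less_iff[OF H(1)] dyn_less_iff[OF H(2)] by blast
    qed
  qed (use 1(1,2) 2(1,2) in \<open>auto simp: Plus_def split: sum.splits\<close>)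
qed

lemma Wd_subadditive:
  assumes H: "H1 \<subseteq> carrier G" "finite H1" "H2 \<subseteq> carrier G" "finite H2" and e: "e > 0"
  shows "Wd e (H1 \<union> H2) \<le> Wd e H1 + Wd e H2"
proof (cases "H1 = {} \<or> H2 = {}")
  case True
  then show ?thesis by auto
next
  case False
  then have F: "H1 \<in> finite_subsets G" "H2 \<in> finite_subsets G" using H by (auto simp: finite_subsets_def)
  show ?thesis
  proof (rule Wd_leI)
    fix y assume y: "y \<in> topspace Y"
    obtain D1 D2 where D: "D1 \<le> Wd e H1" "small_width (subtopology Z (fib y)) (dyn H1) e D1"
      "D2 \<le> Wd e H2" "small_width (subtopology Z (fib y)) (dyn H2) e D2"
      using small_width_Wd[OF F(1) e y] small_width_Wd[OF F(2) e y] by blast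
    have "small_width (subtopology Z (fib y)) (dyn (H1 \<union> H2)) e (D1 + D2)"
      using F D(2,4) by (rule small_width_Un)
    then show "small_width (subtopology Z (fib y)) (dyn (H1 \<union> H2)) e (Wd e H1 + Wd e H2)"
      by (rule small_width_mono) (use D(1,3) in simp)
  qed
qed

text \<open>The map \<open>act g\<close> carries the fibre over \<open>y\<close> into the one over
  \<open>act' g y\<close> and pulls \<open>dyn H\<close> back to
  \<open>dyn (rtrans H g)\<close>.\<close>

lemma Wd_rtrans_le:
  assumes H: "H \<in> finite_subsets G" and g: "g \<in> carrier G" and e: "e > 0"
  shows "Wd e (rtrans H g) \<le> Wd e H"
proof (rule Wd_leI)
  fix y assume y: "y \<in> topspace Y"
  have HG: "H \<subseteq> carrier G" "finite H" "H \<noteq> {}" using H by (auto simp: finite_subsets_def)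
  have Hg: "rtrans H g \<in> finite_subsets G"
    using HG rtrans_closed[OF HG(1) g] finite_rtrans[OF HG(2)] by (auto simp: finite_subsets_def rtrans_def)
  obtain D where D: "D \<le> Wd e H" "small_width (subtopology Z (fib (act' g y))) (dyn H) e D"
    using small_width_Wd[OF H e act'_closed[OF g y]] by blast
  obtain N :: nat and u where u: "\<forall>c<N. continuous_map (subtopology Z (fib (act' g y))) euclideanreal (u c)"
     "\<forall>z\<in>topspace (subtopology Z (fib (act' g y))). \<forall>c<N. 0 \<le> u c z \<and> u c z \<le> 1"
     "\<forall>z\<in>topspace (subtopology Z (fib (act' g y))). card ((\<lambda>c. u c z) ` {..<N} \<inter> {0<..<1}) \<le> D"
     "\<forall>z\<in>topspace (subtopology Z (fib (act' g y))). \<forall>z'\<in>topspace (subtopology Z (fib (act' g y))).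
        (\<forall>c<N. u c z = u c z') \<longrightarrow> dyn H z z' < e"
    using D(2) unfolding small_width_def by (elim exE conjE)
  have top: "act g z \<in> topspace (subtopology Z (fib (act' g y)))" if "z \<in> topspace (subtopology Z (fib y))" for z
    using that act_closed[OF g] act_fib[OF g] by auto
  have cont: "continuous_map (subtopology Z (fib y)) (subtopology Z (fib (act' g y))) (act g)"
    unfolding continuous_map_in_subtopology
    using continuous_map_from_subtopology[OF act_continuous[OF g]] act_fib[OF g] by auto
  show "small_width (subtopology Z (fib y)) (dyn (rtrans H g)) e (Wd e H)"
  proof (rule small_widthI[of "{..<N}" _ "\<lambda>c z. u c (act g z)"])
    show "continuous_map (subtopology Z (fib y)) euclideanreal (\<lambda>z. u c (act g z))" if "c \<in> {..<N}" for c
      using continuous_map_compose[OF cont, of euclideanreal "u c"] u(1) that by (simp add: o_def)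
    show "card ((\<lambda>c. u c (act g z)) ` {..<N} \<inter> {0<..<1}) \<le> Wd e H" if "z \<in> topspace (subtopology Z (fib y))" for z
      using u(3) top[OF that] D(1) by (meson order_trans)
    show "dyn (rtrans H g) z z' < e" if z: "z \<in> topspace (subtopology Z (fib y))" "z' \<in> topspace (subtopology Z (fib y))"
      and eq: "\<And>c. c \<in> {..<N} \<Longrightarrow> u c (act g z) = u c (act g z')" for z z'
    proof -
      have "dyn H (act g z) (act g z') < e" using u(4) top z eq by blast
      then have "\<forall>s\<in>H. \<rho> (act s (act g z)) (act s (act g z')) < e" unfolding dyn_less_iff[OF H] .
      moreover have "act (s \<otimes> g) x = act s (act g x)" if "s \<in> H" "x \<in> topspace (subtopology Z (fib y))" for s x
        using act_mult[OF _ g] that HG(1) by auto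
      ultimately show ?thesis unfolding dyn_less_iff[OF Hg] using z by (auto simp: rtrans_def)
    qed
  qed (use u(2) top in auto)
qed

lemma Wd_rtrans:
  assumes H: "H \<subseteq> carrier G" "finite H" and g: "g \<in> carrier G" and e: "e > 0"
  shows "Wd e (rtrans H g) = Wd e H"
proof (cases "H = {}")
  case True
  then show ?thesis by (simp add: rtrans_def)
next
  case False
  then have H1: "H \<in> finite_subsets G" using H by (simp add: finite_subsets_def)
  have H2: "rtrans H g \<in> finite_subsets G"
    using False rtrans_closed[OF H(1) g] finite_rtrans[OF H(2)] by (auto simp: finite_subsets_def rtrans_def)
  have "rtrans (rtrans H g) (inv g) = H"
    using H(1) g by (auto simp: rtrans_def image_image m_assoc subset_iff)
  then have "Wd e H \<le> Wd e (rtrans H g)" using Wd_rtrans_le[OF H2 inv_closed[OF g] e] by simp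
  then show ?thesis using Wd_rtrans_le[OF H1 g e] by simp
qed

lemma Wd_convergent:
  assumes F: "folner_sequence G F" and e: "e > 0"
  shows "convergent (\<lambda>n. real (Wd e (F n)) / real (card (F n)))"
proof (rule ornstein_weiss[OF F, of "\<lambda>H. real (Wd e H)"])
  show "real (Wd e (A \<union> B)) \<le> real (Wd e A) + real (Wd e B)"
    if "A \<subseteq> carrier G" "finite A" "B \<subseteq> carrier G" "finite B" for A B
    using Wd_subadditive[OF that e] by linarith
  show "real (Wd e (rtrans A c)) = real (Wd e A)" if "A \<subseteq> carrier G" "finite A" "c \<in> carrier G" for A c
    using Wd_rtrans[OF that e] by simp
qed (simp_all add: Wd_def)

lemma rel_mdim_eq:
  assumes F: "folner_sequence G F"
  shows "rel_mdim Z act Y \<pi> \<rho> F = Lim (at_right 0) (\<lambda>e. lim (\<lambda>n. ereal (real (Wd e (F n)) / real (card (F n)))))"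
  using folner_finite_subsets[OF F] unfolding rel_mdim_def Wd_def by simp

lemma rel_mdim_infinite:
  assumes F: "folner_sequence G F"
    and big: "\<And>R. \<exists>e0>0. \<forall>e. 0 < e \<and> e < e0 \<longrightarrow>
      (\<forall>\<^sub>F n in sequentially. R * real (card (F n)) \<le> real (Wd e (F n)))"
  shows "rel_mdim Z act Y \<pi> \<rho> F = \<infinity>"
proof -
  let ?L = "\<lambda>e. lim (\<lambda>n. ereal (real (Wd e (F n)) / real (card (F n))))"
  have "(?L \<longlongrightarrow> \<infinity>) (at_right 0)"
    unfolding tendsto_PInfty
  proof
    fix R :: real
    \<comment> \<open>The bound is requested for \<open>R + 1\<close> because a limit keeps only the
      weak inequality.\<close>
    obtain e0 where e0: "e0 > 0" "\<And>e. 0 < e \<Longrightarrow> e < e0 \<Longrightarrow>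
      \<forall>\<^sub>F n in sequentially. (R + 1) * real (card (F n)) \<le> real (Wd e (F n))" using big[of "R + 1"] by blast
    have "eventually (\<lambda>e. e \<in> {0<..<e0}) (at_right 0)" using e0(1) by (rule eventually_at_right_real)
    then show "\<forall>\<^sub>F e in at_right 0. ereal R < ?L e"
    proof eventually_elim
      case (elim e)
      then have e: "0 < e" "e < e0" by auto
      obtain l where l: "(\<lambda>n. real (Wd e (F n)) / real (card (F n))) \<longlonglongrightarrow> l"
        using Wd_convergent[OF F e(1)] unfolding convergent_def by blast
      have "\<forall>\<^sub>F n in sequentially. R + 1 \<le> real (Wd e (F n)) / real (card (F n))"
        using e0(2)[OF e]
      proof eventually_elim
        case (elim n)
        have "0 < card (F n)" using folner_finite_subsets[OF F, of n] by (simp add: card_gt_0_iff)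
        then show ?case using elim by (simp add: pos_le_divide_eq)
      qed
      then have "R + 1 \<le> l" using tendsto_lowerbound[OF l] by simp
      moreover have "?L e = ereal l" using l by (intro limI) simp
      ultimately show ?case by simp
    qed
  qed
  then show ?thesis unfolding rel_mdim_eq[OF F] by (intro tendsto_Lim) simp_all
qed

lemma rel_mdim_zero:
  assumes F: "folner_sequence G F"
    and small: "\<And>e. e > 0 \<Longrightarrow> (\<lambda>n. real (Wd e (F n)) / real (card (F n))) \<longlonglongrightarrow> 0"
  shows "rel_mdim Z act Y \<pi> \<rho> F = 0"
proof -
  let ?L = "\<lambda>e. lim (\<lambda>n. ereal (real (Wd e (F n)) / real (card (F n))))"
  have "eventually (\<lambda>e. e \<in> {0<..<1::real}) (at_right 0)" by (rule eventually_at_right_real) simp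
  then have "eventually (\<lambda>e. ?L e = 0) (at_right 0)"
  proof eventually_elim
    case (elim e)
    then have "(\<lambda>n. ereal (real (Wd e (F n)) / real (card (F n)))) \<longlonglongrightarrow> ereal 0" using small[of e] by simp
    then show ?case by (simp add: limI zero_ereal_def)
  qed
  then have "(?L \<longlongrightarrow> 0) (at_right 0)" by (rule tendsto_eventually)
  then show ?thesis unfolding rel_mdim_eq[OF F] by (intro tendsto_Lim) simp_all
qed

section \<open>Zero entropy and zero mean dimension\<close>

lemma spanning_set:
  assumes H: "H \<in> finite_subsets G" and r: "r > 0" and y: "y \<in> topspace Y"
  shows "\<exists>S. S \<subseteq> fib y \<and> finite S \<and> card S \<le> Sep r H \<and> (\<forall>z\<in>fib y. \<exists>x\<in>S. dyn H x z \<le> r)"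
proof -
  have HG: "H \<subseteq> carrier G" using H by (auto simp: finite_subsets_def)
  obtain S where S: "S \<subseteq> fib y" "finite S" "separated (dyn H) r S" "card S = sep_number (fib y) r (dyn H)"
    using sep_number_props(2)[OF H r fib_subset] by blast
  have "\<exists>x\<in>S. dyn H x z \<le> r" if z: "z \<in> fib y" for z
  proof (rule ccontr)
    assume neg: "\<not> ?thesis"
    have sym: "dyn H z x = dyn H x z" for x unfolding dyn_metric_def by (simp add: commute)
    have "dyn H z z \<le> 0"
      unfolding dyn_le_iff[OF H] using HG z fib_subset act_closed by (auto simp: subset_iff)
    then have "z \<notin> S" using neg r by force
    moreover have "separated (dyn H) r (insert z S)"
      unfolding separated_def
    proof (intro ballI impI)
      fix a b assume ab: "a \<in> insert z S" "b \<in> insert z S" "a \<noteq> b"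
      have far: "r < dyn H x z" if "x \<in> S" for x using neg that by (simp add: not_le)
      consider "a \<in> S" "b \<in> S" | "a = z" "b \<in> S" | "a \<in> S" "b = z" using ab by blast
      then show "r < dyn H a b"
      proof cases
        case 1
        then show ?thesis using S(3) ab(3) unfolding separated_def by blast
      qed (use far sym in simp_all)
    qed
    ultimately have "card (insert z S) \<le> sep_number (fib y) r (dyn H)"
      using S z by (intro sep_number_props(1)[OF H r fib_subset]) auto
    then show False using S(2,4) \<open>z \<notin> S\<close> by simp
  qed
  moreover have "card S \<le> Sep r H" using card_le_Sep[OF H r y S(1-3)] .
  ultimately show ?thesis using S(1,2) by blast
qed

text \<open>Thresholds are chosen only for the points of a spanning set. The scale
  \<open>e / (8 * p)\<close> makes the scaled coordinates of any \<open>z\<close> differ by at most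
  \<open>1/2\<close> from those of a nearby spanning point, so a coordinate in \<open>(0, 1)\<close>
  at \<open>z\<close> is bad for that point. Cutting loses no separation: since
  \<open>t c < p\<close>, the value 0 is sent to 0 and the value 1 to 1.\<close>

lemma Wd_le_of_Sep:
  assumes e: "e > 0" and N: "finite N" "N \<subseteq> topspace Z"
    "\<forall>z\<in>topspace Z. \<forall>z'\<in>topspace Z. e \<le> \<rho> z z' \<longrightarrow> (\<exists>x\<in>N. bump e x z = 0 \<and> bump e x z' = 1)"
    and p: "p > 0" and H: "H \<in> finite_subsets G"
    and small: "real (Sep (e / (8 * real p)) H) * 2 ^ (card N * card H) * 2 ^ (D + 1) < real p ^ (D + 1)"
  shows "Wd e H \<le> D"
proof (rule Wd_leI)
  fix y assume y: "y \<in> topspace Y"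
  have HG: "H \<subseteq> carrier G" "finite H" using H by (auto simp: finite_subsets_def)
  define r where "r = e / (8 * real p)"
  have r: "r > 0" using e p by (simp add: r_def)
  obtain S where S: "S \<subseteq> fib y" "finite S" and cS: "card S \<le> Sep r H"
    and span: "\<And>z. z \<in> fib y \<Longrightarrow> \<exists>x\<in>S. dyn H x z \<le> r"
    using spanning_set[OF H r y] by blast
  let ?C = "N \<times> H"
  define v where "v z c = bump e (fst c) (act (snd c) z)" for z c
  have "real (card S) * 2 ^ card ?C * 2 ^ (D + 1) < real p ^ (D + 1)"
  proof -
    have "real (card S) * 2 ^ card ?C * 2 ^ (D + 1) \<le> real (Sep r H) * 2 ^ (card N * card H) * 2 ^ (D + 1)"
      using cS by (intro mult_right_mono) (auto simp: card_cartesian_product)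
    then show ?thesis using small unfolding r_def by (rule le_less_trans)
  qed
  then obtain t where t: "\<forall>c\<in>?C. t c < p" and
    near: "\<forall>x\<in>S. card {c\<in>?C. - (1/2) < p * v x c - real (t c) \<and> p * v x c - real (t c) < 3/2} \<le> D"
    using threshold_choice[OF S(2) _ p, of ?C D v] N(1) HG(2) by auto
  define u where "u c z = clip (p * v z c - real (t c))" for c z
  show "small_width (subtopology Z (fib y)) (dyn H) e D"
  proof (rule small_widthI[of ?C _ u])
    show "continuous_map (subtopology Z (fib y)) euclideanreal (u c)" if "c \<in> ?C" for c
      unfolding u_def v_def using that N(2) HG(1)
      by (intro continuous_map_clip continuous_map_diff continuous_map_real_mult_left continuous_bump_act) auto
    show "card ((\<lambda>c. u c z) ` ?C \<inter> {0<..<1}) \<le> D" if z: "z \<in> topspace (subtopology Z (fib y))" for z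
    proof -
      have zf: "z \<in> fib y" "z \<in> topspace Z" using z by auto
      obtain x where x: "x \<in> S" "dyn H x z \<le> r" using span[OF zf(1)] by blast
      have xZ: "x \<in> topspace Z" using x(1) S(1) fib_subset by blast
      let ?B = "{c\<in>?C. - (1/2) < p * v x c - real (t c) \<and> p * v x c - real (t c) < 3/2}"
      have "(\<lambda>c. u c z) ` ?C \<inter> {0<..<1} \<subseteq> (\<lambda>c. u c z) ` ?B"
      proof
        fix w assume "w \<in> (\<lambda>c. u c z) ` ?C \<inter> {0<..<1}"
        then obtain c where c: "c \<in> ?C" "w = u c z" "0 < u c z" "u c z < 1" by auto
        have "0 < p * v z c - real (t c)" "p * v z c - real (t c) < 1"
          using c(3,4) by (auto simp: u_def clip_def max_def min_def split: if_splits)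
        moreover have "\<bar>p * v z c - p * v x c\<bar> \<le> 1 / 2"
        proof -
          have cc: "fst c \<in> topspace Z" "snd c \<in> H" "snd c \<in> carrier G" using c(1) N(2) HG(1) by auto
          have "\<bar>v x c - v z c\<bar> \<le> 4 / e * \<rho> (act (snd c) x) (act (snd c) z)"
            unfolding v_def using cc zf(2) xZ act_closed by (intro bump_diff_le e) auto
          also have "\<dots> \<le> 4 / e * r"
            using x(2) cc(2) e unfolding dyn_le_iff[OF H] by (intro mult_left_mono) auto
          also have "\<dots> = 1 / (2 * real p)" using e p by (simp add: r_def)
          finally have "real p * \<bar>v x c - v z c\<bar> \<le> 1 / 2" using p by (simp add: field_simps)
          moreover have "\<bar>p * v z c - p * v x c\<bar> = real p * \<bar>v x c - v z c\<bar>"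
            by (simp add: abs_minus_commute right_diff_distrib[symmetric] abs_mult)
          ultimately show ?thesis by simp
        qed
        ultimately have "- (1/2) < p * v x c - real (t c) \<and> p * v x c - real (t c) < 3/2" by linarith
        then show "w \<in> (\<lambda>c. u c z) ` ?B" using c(1,2) by blast
      qed
      then have "card ((\<lambda>c. u c z) ` ?C \<inter> {0<..<1}) \<le> card ((\<lambda>c. u c z) ` ?B)"
        using N(1) HG(2) by (intro card_mono) auto
      also have "\<dots> \<le> card ?B" using N(1) HG(2) by (intro card_image_le) auto
      also have "\<dots> \<le> D" using near x(1) by blast
      finally show ?thesis .
    qed
    show "dyn H z z' < e" if z: "z \<in> topspace (subtopology Z (fib y))" "z' \<in> topspace (subtopology Z (fib y))"
      and eq: "\<And>c. c \<in> ?C \<Longrightarrow> u c z = u c z'" for z z'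
      unfolding dyn_less_iff[OF H]
    proof (rule ballI, rule ccontr)
      fix s assume s: "s \<in> H" "\<not> \<rho> (act s z) (act s z') < e"
      have "act s z \<in> topspace Z" "act s z' \<in> topspace Z" using s(1) HG(1) z act_closed by auto
      then obtain x where x: "x \<in> N" "bump e x (act s z) = 0" "bump e x (act s z') = 1" using N(3) s(2) by fastforce
      have "t (x, s) < p" using t x(1) s(1) by blast
      then have "u (x, s) z = 0" "u (x, s) z' = 1" using x by (auto simp: u_def v_def clip_def)
      then show False using eq[of "(x, s)"] x(1) s(1) by simp
    qed
  qed (use N(1) HG(2) in \<open>auto simp: u_def\<close>)
qed

text \<open>The resolution \<open>p\<close> is fixed before the entropy is used at the scale
  \<open>e / (8 * p)\<close>. With \<open>D + 1 > \<delta> * h\<close>, the constant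
  \<open>K\<close> makes \<open>exp K ^ (D + 1)\<close> exceed both the separation number, at most
  \<open>exp h\<close>, and the factor \<open>2 ^ (card N * h)\<close> from the choice of
  coordinates; \<open>p > 2 * exp K\<close> absorbs the remaining
  \<open>2 ^ (D + 1)\<close>.\<close>

theorem zero_entropy_imp_zero_mdim:
  assumes F: "folner_sequence G F" and zero: "\<And>e. e > 0 \<Longrightarrow> Ent F e = 0"
  shows "rel_mdim Z act Y \<pi> \<rho> F = 0"
proof (rule rel_mdim_zero[OF F])
  fix e :: real assume e: "e > 0"
  have Fn: "F n \<in> finite_subsets G" "0 < card (F n)" for n
    using F folner_finite_subsets[OF F, of n] by (auto simp: folner_sequence_def card_gt_0_iff)
  obtain N where N: "finite N" "N \<subseteq> topspace Z"
    "\<forall>z\<in>topspace Z. \<forall>z'\<in>topspace Z. e \<le> \<rho> z z' \<longrightarrow> (\<exists>x\<in>N. bump e x z = 0 \<and> bump e x z' = 1)"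
    using bump_separates[OF e] by (elim exE conjE)
  have "\<forall>\<^sub>F n in sequentially. real (Wd e (F n)) / real (card (F n)) < a" if a: "a > 0" for a
  proof -
    define \<delta> where "\<delta> = a / 2"
    have \<delta>: "\<delta> > 0" using a by (simp add: \<delta>_def)
    define K where "K = (1 + real (card N) * ln 2) / \<delta>"
    have K: "K > 0" using \<delta> by (simp add: K_def add_pos_nonneg)
    obtain p :: nat where p: "2 * exp K < real p" using reals_Archimedean2 by blast
    have p0: "p > 0" using p exp_gt_zero[of K] by (cases "p = 0") auto
    define r where "r = e / (8 * real p)"
    have "Ent F r = 0" using e p0 by (intro zero) (simp add: r_def)
    then have "limsup (\<lambda>n. ereal (ln (real (Sep r (F n))) / real (card (F n)))) < 1" unfolding Ent_def by simp
    then have "\<forall>\<^sub>F n in sequentially. ereal (ln (real (Sep r (F n))) / real (card (F n))) < 1" by (rule Limsup_lessD)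
    then show ?thesis
    proof eventually_elim
      case (elim n)
      let ?h = "real (card (F n))"
      define D where "D = nat \<lfloor>\<delta> * ?h\<rfloor>"
      have D: "real D \<le> \<delta> * ?h" "\<delta> * ?h < real (D + 1)"
        using \<delta> by (simp_all add: D_def) linarith+
      have "ln (real (Sep r (F n))) < ?h" using elim Fn(2)[of n] by (simp add: divide_less_eq one_ereal_def)
      then have sep: "real (Sep r (F n)) \<le> exp ?h"
      proof (cases "Sep r (F n) = 0")
        case False
        then have "real (Sep r (F n)) = exp (ln (real (Sep r (F n))))" by simp
        also have "\<dots> \<le> exp ?h" using \<open>ln (real (Sep r (F n))) < ?h\<close> by (simp only: exp_le_cancel_iff less_imp_le)
        finally show ?thesis .
      qed simp
      have pow2: "(2::real) ^ (card N * card (F n)) = exp (real (card N) * ?h * ln 2)"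
        by (simp add: powr_realpow[symmetric] powr_def)
      have "real (Sep r (F n)) * 2 ^ (card N * card (F n)) \<le> exp ?h * 2 ^ (card N * card (F n))"
        using sep by (rule mult_right_mono) simp
      also note pow2
      also have "exp ?h * exp (real (card N) * ?h * ln 2) = exp (K * (\<delta> * ?h))"
      proof -
        have "K * \<delta> = 1 + real (card N) * ln 2" using \<delta> by (simp add: K_def)
        then have "K * (\<delta> * ?h) = (1 + real (card N) * ln 2) * ?h" by (simp only: mult.assoc[symmetric])
        then show ?thesis by (simp add: exp_add[symmetric] algebra_simps)
      qed
      also have "\<dots> < exp (K * real (D + 1))" using D(2) K by simp
      also have "\<dots> = exp K ^ (D + 1)" by (subst mult.commute) (rule exp_of_nat_mult)
      finally have "real (Sep r (F n)) * 2 ^ (card N * card (F n)) * 2 ^ (D + 1) < exp K ^ (D + 1) * 2 ^ (D + 1)"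
        unfolding pow2 by (rule mult_strict_right_mono) simp
      also have "\<dots> = (2 * exp K) ^ (D + 1)" by (simp only: power_mult_distrib mult.commute)
      also have "\<dots> \<le> real p ^ (D + 1)" using p by (intro power_mono) auto
      finally have "Wd e (F n) \<le> D"
        unfolding r_def by (intro Wd_le_of_Sep[OF e N p0 Fn(1)])
      then have "real (Wd e (F n)) \<le> \<delta> * ?h" using D(1) by linarith
      then have "real (Wd e (F n)) / ?h \<le> \<delta>" using Fn(2)[of n] by (simp add: pos_divide_le_eq)
      moreover have "\<delta> < a" using a by (simp add: \<delta>_def)
      ultimately show ?case by (rule le_less_trans)
    qed
  qed
  then show "(\<lambda>n. real (Wd e (F n)) / real (card (F n))) \<longlonglongrightarrow> 0"
  proof (intro order_tendstoI)
    fix a :: real assume "a < 0"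
    moreover have "0 \<le> real (Wd e (F n)) / real (card (F n))" for n by simp
    ultimately show "\<forall>\<^sub>F n in sequentially. a < real (Wd e (F n)) / real (card (F n))"
      by (intro always_eventually allI) (rule less_le_trans)
  qed
qed

end

section \<open>Decoding patterns from samples\<close>

lemma sample_error_ge:
  fixes h :: "'s \<Rightarrow> 'e \<Rightarrow> real" and xs :: "'e list"
  assumes W: "finite W" "\<tau> \<subseteq> W" and ab: "a < b"
    and v: "\<And>s. s \<in> \<tau> \<Longrightarrow> v s \<le> a" "\<And>s. s \<in> W - \<tau> \<Longrightarrow> b \<le> v s"
  defines "\<sigma> \<equiv> {s\<in>W. (\<Sum>x\<leftarrow>xs. h s x) / real (length xs) < (a + b) / 2}"
  shows "real (card ((\<tau> - \<sigma>) \<union> (\<sigma> - \<tau>))) * ((b - a) / 2)\<^sup>2 \<le> sample_error W h v xs"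
proof -
  let ?D = "(\<tau> - \<sigma>) \<union> (\<sigma> - \<tau>)"
  let ?m = "\<lambda>s. (\<Sum>x\<leftarrow>xs. h s x) / real (length xs)"
  have sub: "?D \<subseteq> W" using W(2) by (auto simp: \<sigma>_def)
  have "((b - a) / 2)\<^sup>2 \<le> (?m s - v s)\<^sup>2" if s: "s \<in> ?D" for s
  proof -
    \<comment> \<open>The decoded pattern \<open>\<sigma>\<close> is wrong at \<open>s\<close>, so
      the empirical mean lies on the wrong side of the midpoint \<open>(a + b) / 2\<close>.\<close>
    have "(b - a) / 2 \<le> \<bar>?m s - v s\<bar>"
    proof (cases "s \<in> \<tau>")
      case True
      then have "s \<notin> \<sigma>" using s by blast
      then have "(a + b) / 2 \<le> ?m s" using True W(2) by (auto simp: \<sigma>_def)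
      moreover have "(a + b) / 2 \<le> x \<Longrightarrow> y \<le> a \<Longrightarrow> (b - a) / 2 \<le> x - y" for x y
        by (simp add: field_simps)
      ultimately have "(b - a) / 2 \<le> ?m s - v s" using v(1)[OF True] by blast
      then show ?thesis by linarith
    next
      case False
      then have "s \<in> \<sigma>" "s \<in> W - \<tau>" using s sub by auto
      then have "?m s < (a + b) / 2" "b \<le> v s" using v(2) by (auto simp: \<sigma>_def)
      then have "(b - a) / 2 \<le> - (?m s - v s)" by (simp add: field_simps)
      then show ?thesis by linarith
    qed
    then have "\<bar>(b - a) / 2\<bar> \<le> \<bar>?m s - v s\<bar>" using ab by simp
    then show ?thesis by (simp only: abs_le_square_iff)
  qed
  then have "(\<Sum>s\<in>?D. ((b - a) / 2)\<^sup>2) \<le> (\<Sum>s\<in>?D. (?m s - v s)\<^sup>2)" by (rule sum_mono)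
  also have "\<dots> \<le> (\<Sum>s\<in>W. (?m s - v s)\<^sup>2)" using W(1) sub by (intro sum_mono2) auto
  finally show ?thesis by (simp add: sample_error_def)
qed

text \<open>The sample length \<open>L\<close> is so large that a good sample decodes a pattern up
  to \<open>c * card W\<close> errors; it is therefore good for at most
  \<open>2 powr (card W / 2)\<close> patterns. By \<open>few_samples_suffice\<close>,
  \<open>m ^ L\<close> samples serve half of all patterns, so
  \<open>2 ^ card W \<le> 2 * m ^ L * 2 powr (card W / 2)\<close>. The condition
  \<open>4 \<le> card W\<close> absorbs the leading 2 and leaves
  \<open>\<kappa> = 1 / (4 * L)\<close>.\<close>

lemma independent_weights_bound:
  fixes a b :: real
  assumes ab: "a < b"
  shows "\<exists>\<kappa>>0. \<forall>(W::'s set) (E::'e set) (q::'s set \<Rightarrow> 'e \<Rightarrow> real) (key::'e \<Rightarrow> 'k) \<nu> m h.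
    finite W \<and> 4 \<le> card W \<and> finite E \<and>
    (\<forall>\<tau>\<in>Pow W. (\<forall>e\<in>E. 0 \<le> q \<tau> e) \<and> (\<Sum>e\<in>E. q \<tau> e) = 1 \<and> (\<forall>k. (\<Sum>e\<in>{e\<in>E. key e = k}. q \<tau> e) = \<nu> k) \<and>
      (\<forall>s\<in>\<tau>. (\<Sum>e\<in>E. q \<tau> e * h s e) \<le> a) \<and> (\<forall>s\<in>W-\<tau>. b \<le> (\<Sum>e\<in>E. q \<tau> e * h s e))) \<and>
    (\<forall>k. card {e\<in>E. key e = k} \<le> m) \<and> (\<forall>s\<in>W. \<forall>e\<in>E. 0 \<le> h s e \<and> h s e \<le> 1) \<longrightarrow>
    2 powr (\<kappa> * real (card W)) \<le> real m"
proof -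
  define \<eta> where "\<eta> = (b - a) / 2"
  have \<eta>: "\<eta> > 0" using ab by (simp add: \<eta>_def)
  obtain c where c: "c > 0" and few: "\<forall>A::'s set. finite A \<longrightarrow>
       real (card {W. W \<subseteq> A \<and> real (card W) \<le> c * real (card A)}) \<le> exp (ln 2 / 2 * real (card A))"
  proof -
    have "(0::real) < ln 2 / 2" by simp
    from few_small_subsets[OF this, where 'a = 's] that show thesis by blast
  qed
  obtain L :: nat where L: "2 / (c * \<eta>\<^sup>2) < real L" using reals_Archimedean2 by blast
  have "0 < 2 / (c * \<eta>\<^sup>2)" using c \<eta> by simp
  then have L0: "0 < real L" using L by linarith
  have main: "2 powr (1 / (4 * real L) * real (card W)) \<le> real m"
    if hyp: "finite W \<and> 4 \<le> card W \<and> finite E \<and>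
      (\<forall>\<tau>\<in>Pow W. (\<forall>e\<in>E. 0 \<le> q \<tau> e) \<and> (\<Sum>e\<in>E. q \<tau> e) = 1 \<and> (\<forall>k. (\<Sum>e\<in>{e\<in>E. key e = k}. q \<tau> e) = \<nu> k) \<and>
        (\<forall>s\<in>\<tau>. (\<Sum>e\<in>E. q \<tau> e * h s e) \<le> a) \<and> (\<forall>s\<in>W-\<tau>. b \<le> (\<Sum>e\<in>E. q \<tau> e * h s e))) \<and>
      (\<forall>k. card {e\<in>E. key e = k} \<le> m) \<and> (\<forall>s\<in>W. \<forall>e\<in>E. 0 \<le> h s e \<and> h s e \<le> 1)"
    for W :: "'s set" and E :: "'e set" and q and key :: "'e \<Rightarrow> 'k" and \<nu> m h
  proof -
    have W: "finite W" "4 \<le> card W" and E: "finite E"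
      and q: "\<forall>\<tau>\<in>Pow W. (\<forall>e\<in>E. 0 \<le> q \<tau> e) \<and> (\<Sum>e\<in>E. q \<tau> e) = 1 \<and> (\<forall>k. (\<Sum>e\<in>{e\<in>E. key e = k}. q \<tau> e) = \<nu> k) \<and>
        (\<forall>s\<in>\<tau>. (\<Sum>e\<in>E. q \<tau> e * h s e) \<le> a) \<and> (\<forall>s\<in>W-\<tau>. b \<le> (\<Sum>e\<in>E. q \<tau> e * h s e))"
      and m: "\<forall>k. card {e\<in>E. key e = k} \<le> m" and h: "\<forall>s\<in>W. \<forall>e\<in>E. 0 \<le> h s e \<and> h s e \<le> 1"
      by (rule hyp[THEN conjunct1], rule hyp[THEN conjunct2, THEN conjunct1],
        rule hyp[THEN conjunct2, THEN conjunct2, THEN conjunct1],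
        rule hyp[THEN conjunct2, THEN conjunct2, THEN conjunct2, THEN conjunct1],
        rule hyp[THEN conjunct2, THEN conjunct2, THEN conjunct2, THEN conjunct2, THEN conjunct1],
        rule hyp[THEN conjunct2, THEN conjunct2, THEN conjunct2, THEN conjunct2, THEN conjunct2])
    let ?w = "real (card W)"
    let ?v = "\<lambda>\<tau> s. \<Sum>e\<in>E. q \<tau> e * h s e"
    have "\<exists>V \<subseteq> tuples E L. card V \<le> m ^ L \<and>
      card (Pow W) \<le> 2 * card {\<tau>\<in>Pow W. \<exists>xs\<in>V. sample_error W h (?v \<tau>) xs \<le> 2 * card W / L}"
    proof (rule few_samples_suffice[where key = key and \<nu> = \<nu>])
      show "finite E" "finite (Pow W)" "finite W" "0 < L" using E W(1) L0 by simp_all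
      show "0 \<le> q \<tau> e" if "\<tau> \<in> Pow W" "e \<in> E" for \<tau> e using q that by blast
      show "(\<Sum>e\<in>E. q \<tau> e) = 1" if "\<tau> \<in> Pow W" for \<tau> using q that by blast
      show "(\<Sum>e\<in>{e\<in>E. key e = k}. q \<tau> e) = \<nu> k" if "\<tau> \<in> Pow W" for \<tau> k using q that by blast
      show "card {e\<in>E. key e = k} \<le> m" for k using m by blast
      show "0 \<le> h s e \<and> h s e \<le> 1" if "s \<in> W" "e \<in> E" for s e using h that by blast
    qed
    then obtain V where V: "V \<subseteq> tuples E L" "card V \<le> m ^ L"
      "card (Pow W) \<le> 2 * card {\<tau>\<in>Pow W. \<exists>xs\<in>V. sample_error W h (?v \<tau>) xs \<le> 2 * card W / L}" by blast
    have finV: "finite V" using V(1) finite_tuples[OF E] by (rule finite_subset)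
    have each: "real (card {\<tau>\<in>Pow W. sample_error W h (?v \<tau>) xs \<le> 2 * card W / L}) \<le> exp (ln 2 / 2 * ?w)" for xs
    proof -
      define \<sigma> where "\<sigma> = {s\<in>W. (\<Sum>x\<leftarrow>xs. h s x) / real (length xs) < (a + b) / 2}"
      let ?d = "\<lambda>\<tau>. (\<tau> - \<sigma>) \<union> (\<sigma> - \<tau>)"
      have "card {\<tau>\<in>Pow W. sample_error W h (?v \<tau>) xs \<le> 2 * card W / L}
          \<le> card {D. D \<subseteq> W \<and> real (card D) \<le> c * real (card W)}"
      proof (rule card_inj_on_le[of ?d])
        show "inj_on ?d {\<tau>\<in>Pow W. sample_error W h (?v \<tau>) xs \<le> 2 * card W / L}"
        proof (rule inj_onI)
          fix \<tau> \<tau>' assume eq: "?d \<tau> = ?d \<tau>'"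
          have "s \<in> \<tau> \<longleftrightarrow> s \<in> \<tau>'" for s
          proof -
            have "s \<in> ?d \<tau> \<longleftrightarrow> s \<in> ?d \<tau>'" by (simp only: eq)
            then show ?thesis by auto
          qed
          then show "\<tau> = \<tau>'" by blast
        qed
        show "?d ` {\<tau>\<in>Pow W. sample_error W h (?v \<tau>) xs \<le> 2 * card W / L}
            \<subseteq> {D. D \<subseteq> W \<and> real (card D) \<le> c * real (card W)}"
        proof (intro image_subsetI CollectI conjI)
          fix \<tau> assume \<tau>: "\<tau> \<in> {\<tau>\<in>Pow W. sample_error W h (?v \<tau>) xs \<le> 2 * card W / L}"
          then have \<tau>W: "\<tau> \<in> Pow W" by blast
          show "?d \<tau> \<subseteq> W" using \<tau>W by (auto simp: \<sigma>_def)
          have "real (card (?d \<tau>)) * ((b - a) / 2)\<^sup>2 \<le> sample_error W h (?v \<tau>) xs"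
            unfolding \<sigma>_def using q \<tau>W by (intro sample_error_ge W(1) ab) auto
          also have "\<dots> \<le> 2 * ?w / L" using \<tau> by simp
          finally have "real (card (?d \<tau>)) * \<eta>\<^sup>2 \<le> 2 * ?w / L" by (simp add: \<eta>_def)
          then have "real (card (?d \<tau>)) \<le> 2 * ?w / L / \<eta>\<^sup>2" using \<eta> by (subst pos_le_divide_eq) auto
          also have "\<dots> = (2 / (c * \<eta>\<^sup>2)) / L * (c * ?w)" using c \<eta> by (simp add: field_simps)
          also have "\<dots> \<le> 1 * (c * ?w)"
          proof (rule mult_right_mono)
            show "(2 / (c * \<eta>\<^sup>2)) / L \<le> 1" using L L0 by (simp only: divide_le_eq_1_pos less_imp_le)
          qed (use c in simp)
          finally show "real (card (?d \<tau>)) \<le> c * real (card W)" by simp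
        qed
        show "finite {D. D \<subseteq> W \<and> real (card D) \<le> c * real (card W)}" using W(1) by simp
      qed
      then have "real (card {\<tau>\<in>Pow W. sample_error W h (?v \<tau>) xs \<le> 2 * card W / L})
          \<le> real (card {D. D \<subseteq> W \<and> real (card D) \<le> c * real (card W)})" by (rule of_nat_mono)
      then show ?thesis using few W(1) by (meson order_trans)
    qed
    have "card {\<tau>\<in>Pow W. \<exists>xs\<in>V. sample_error W h (?v \<tau>) xs \<le> 2 * card W / L}
        \<le> (\<Sum>xs\<in>V. card {\<tau>\<in>Pow W. sample_error W h (?v \<tau>) xs \<le> 2 * card W / L})"
    proof -
      have "{\<tau>\<in>Pow W. \<exists>xs\<in>V. sample_error W h (?v \<tau>) xs \<le> 2 * card W / L}
          = (\<Union>xs\<in>V. {\<tau>\<in>Pow W. sample_error W h (?v \<tau>) xs \<le> 2 * card W / L})" by blast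
      then show ?thesis using card_UN_le[OF finV] by simp
    qed
    then have "real (card (Pow W)) \<le> 2 * (\<Sum>xs\<in>V. real (card {\<tau>\<in>Pow W. sample_error W h (?v \<tau>) xs \<le> 2 * card W / L}))"
      using V(3) unfolding of_nat_sum[symmetric] by linarith
    also have "(\<Sum>xs\<in>V. real (card {\<tau>\<in>Pow W. sample_error W h (?v \<tau>) xs \<le> 2 * card W / L})) \<le> real (card V) * exp (ln 2 / 2 * ?w)"
      using each by (rule sum_bounded_above)
    also have "\<dots> \<le> real (m ^ L) * exp (ln 2 / 2 * ?w)" using V(2) by (intro mult_right_mono of_nat_mono) auto
    finally have le: "real (card (Pow W)) \<le> 2 * (real (m ^ L) * exp (ln 2 / 2 * ?w))" by simp
    have "exp (ln 2 * ?w) = real (card (Pow W))" using W(1)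
      by (simp add: card_Pow powr_realpow[symmetric] powr_def mult.commute)
    also note le
    also have "2 * (real (m ^ L) * exp (ln 2 / 2 * ?w)) = exp (ln 2) * (real (m ^ L) * exp (ln 2 / 2 * ?w))" by simp
    also have "\<dots> \<le> exp (ln 2 / 4 * ?w) * (real (m ^ L) * exp (ln 2 / 2 * ?w))"
    proof (rule mult_right_mono)
      have "ln 2 * 4 \<le> ln 2 * ?w" using W(2) by (intro mult_left_mono) auto
      then have "ln 2 \<le> ln 2 / 4 * ?w" by simp
      then show "exp (ln 2) \<le> exp (ln 2 / 4 * ?w)" by (simp only: exp_le_cancel_iff)
    qed simp
    also have "\<dots> = real m ^ L * exp (ln 2 * 3 / 4 * ?w)" by (simp add: exp_add[symmetric])
    finally have "exp (ln 2 * ?w) / exp (ln 2 * 3 / 4 * ?w) \<le> real m ^ L" by (simp add: pos_divide_le_eq)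
    then have "exp (ln 2 * ?w / 4) \<le> real m ^ L" by (simp add: exp_diff[symmetric] mult.commute)
    also have "exp (ln 2 * ?w / 4) = exp (ln 2 * ?w / (4 * L)) ^ L"
      using L0 by (simp add: exp_of_nat_mult[symmetric])
    finally have "exp (ln 2 * ?w / (4 * L)) ^ L \<le> real m ^ L" .
    then have "exp (ln 2 * ?w / (4 * L)) \<le> real m"
      using L0 by (subst (asm) power_mono_iff) auto
    then show ?thesis by (simp add: powr_def mult.commute)
  qed
  show ?thesis
  proof (intro exI[of _ "1 / (4 * real L)"] conjI allI impI)
    show "0 < 1 / (4 * real L)" using L0 by simp
  qed (rule main)
qed

section \<open>The induced system\<close>

lemma (in factor_map) group_G: "group G"
  using dom.group_hom by (simp add: group_hom_def)

lemma (in G_system) continuous_act_single: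
  assumes "g \<in> carrier G"
  shows "continuous_map X X (act g)"
proof -
  have "continuous_map X (prod_topology (discrete_topology (carrier G)) X) (\<lambda>x. (g, x))"
    using assms by (simp add: continuous_map_pairwise o_def)
  from continuous_map_compose[OF this continuous_act] show ?thesis by (simp add: o_def)
qed

lemma (in G_system) act_mult:
  "g \<in> carrier G \<Longrightarrow> h \<in> carrier G \<Longrightarrow> x \<in> topspace X \<Longrightarrow> act (g \<otimes> h) x = act g (act h x)"
  by (rule composition_rule)

lemma distr_distr_borel:
  assumes "\<mu> \<in> borel_probs X" "continuous_map X Y f" "continuous_map Y Z g"
  shows "distr (distr \<mu> (borel_of Y) f) (borel_of Z) g = distr \<mu> (borel_of Z) (\<lambda>x. g (f x))"
  using continuous_map_measurable[OF assms(2)] continuous_map_measurable[OF assms(3)] borel_probs_measurable[OF assms(1)]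
  by (subst distr_distr) (auto simp: o_def)

lemma distr_cong_borel:
  assumes "\<mu> \<in> borel_probs X" "\<And>x. x \<in> topspace X \<Longrightarrow> f x = g x"
  shows "distr \<mu> N f = distr \<mu> N g"
  using assms borel_probsD(3)[OF assms(1)] by (intro distr_cong) auto

lemma distr_continuous_borel_probs:
  assumes "\<mu> \<in> borel_probs X" "continuous_map X Y f"
  shows "distr \<mu> (borel_of Y) f \<in> borel_probs Y"
  using borel_probsD(1)[OF assms(1)] continuous_map_measurable[OF assms(2)] borel_probs_measurable[OF assms(1)]
  by (intro distr_borel_probs) auto

locale induced_factor = factor_map G X act Y act' \<pi>
  for G :: "('g, 'm) monoid_scheme" (structure)
    and X :: "'a topology" and act :: "'g \<Rightarrow> 'a \<Rightarrow> 'a"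
    and Y :: "'b topology" and act' :: "'g \<Rightarrow> 'b \<Rightarrow> 'b" and \<pi> :: "'a \<Rightarrow> 'b" +
  fixes d :: "'a \<Rightarrow> 'a \<Rightarrow> real" and \<rho> :: "'a measure \<Rightarrow> 'a measure \<Rightarrow> real"
  assumes d: "compatible_metric X d" and \<rho>: "compatible_metric (prob_topology X) \<rho>"
begin

sublocale base: fibred_system G X d act Y act' \<pi>
proof (intro fibred_system.intro compact_metric.intro fibred_system_axioms.intro group_G d)
  show "compact_space X" by (rule dom.compact_X)
  show "continuous_map X X (act g)" if "g \<in> carrier G" for g by (rule dom.continuous_act_single[OF that])
  show "act (g \<otimes> h) z = act g (act h z)" if "g \<in> carrier G" "h \<in> carrier G" "z \<in> topspace X" for g h z
    using that by (rule dom.act_mult)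
  show "act' g y \<in> topspace Y" if "g \<in> carrier G" "y \<in> topspace Y" for g y
    using cod.continuous_act_single[OF that(1)] that(2) by (auto simp: continuous_map_def)
  show "\<pi> (act g z) = act' g (\<pi> z)" if "g \<in> carrier G" "z \<in> topspace X" for g z
    using that by (rule equivariant)
qed

lemma induced_action_apply:
  "\<mu> \<in> borel_probs X \<Longrightarrow> induced_action X act g \<mu> = distr \<mu> (borel_of X) (act g)"
  by (simp add: induced_action_def)

sublocale ind: fibred_system G "prob_topology X" \<rho> "induced_action X act" "prob_topology Y"
  "induced_action Y act'" "induced_map Y \<pi>"
proof (unfold_locales)
  show "compact_space (prob_topology X)" by (rule base.compact_prob_topology[OF \<rho>])
  show "compatible_metric (prob_topology X) \<rho>" by (rule \<rho>)
next
  fix g assume g: "g \<in> carrier G"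
  have gc: "continuous_map X X (act g)" by (rule base.act_continuous[OF g])
  show "continuous_map (prob_topology X) (prob_topology X) (induced_action X act g)"
  proof (rule continuous_map_into_prob_topology)
    show "induced_action X act g \<in> topspace (prob_topology X) \<rightarrow> borel_probs X"
      using distr_continuous_borel_probs[OF _ gc] by (auto simp: induced_action_apply)
    fix f assume f: "continuous_map X euclideanreal f"
    have fg: "continuous_map X euclideanreal (\<lambda>x. f (act g x))"
      using continuous_map_compose[OF gc f] by (simp add: o_def)
    show "continuous_map (prob_topology X) euclideanreal (\<lambda>\<mu>. integral\<^sup>L (induced_action X act g \<mu>) f)"
    proof (rule continuous_map_eq[OF continuous_integral[OF fg]])
      fix \<mu> assume "\<mu> \<in> topspace (prob_topology X)"
      then have \<mu>: "\<mu> \<in> borel_probs X" by simp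
      show "integral\<^sup>L \<mu> (\<lambda>x. f (act g x)) = integral\<^sup>L (induced_action X act g \<mu>) f"
        unfolding induced_action_apply[OF \<mu>]
        by (rule integral_distr_continuous[OF \<mu> continuous_map_measurable[OF gc] f, symmetric])
    qed
  qed
next
  fix g h \<mu> assume g: "g \<in> carrier G" and h: "h \<in> carrier G" and "\<mu> \<in> topspace (prob_topology X)"
  then have \<mu>: "\<mu> \<in> borel_probs X" by simp
  have c: "continuous_map X X (act g)" "continuous_map X X (act h)" using base.act_continuous g h by auto
  have "induced_action X act h \<mu> \<in> borel_probs X"
    using distr_continuous_borel_probs[OF \<mu> c(2)] by (simp add: induced_action_apply[OF \<mu>])
  then have "induced_action X act g (induced_action X act h \<mu>)
      = distr (distr \<mu> (borel_of X) (act h)) (borel_of X) (act g)"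
    by (simp add: induced_action_apply \<mu>)
  also have "\<dots> = distr \<mu> (borel_of X) (\<lambda>x. act g (act h x))" by (rule distr_distr_borel[OF \<mu> c(2,1)])
  also have "\<dots> = distr \<mu> (borel_of X) (act (g \<otimes> h))"
    by (rule distr_cong_borel[OF \<mu>]) (simp add: base.act_mult g h)
  finally show "induced_action X act (g \<otimes> h) \<mu> = induced_action X act g (induced_action X act h \<mu>)"
    by (simp add: induced_action_apply \<mu>)
next
  fix g \<nu> assume g: "g \<in> carrier G" and "\<nu> \<in> topspace (prob_topology Y)"
  then have \<nu>: "\<nu> \<in> borel_probs Y" by simp
  show "induced_action Y act' g \<nu> \<in> topspace (prob_topology Y)"
    using distr_continuous_borel_probs[OF \<nu> cod.continuous_act_single[OF g]] \<nu> by (simp add: induced_action_def)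
next
  fix g \<mu> assume g: "g \<in> carrier G" and "\<mu> \<in> topspace (prob_topology X)"
  then have \<mu>: "\<mu> \<in> borel_probs X" by simp
  have c: "continuous_map X X (act g)" "continuous_map Y Y (act' g)"
    using base.act_continuous[OF g] cod.continuous_act_single[OF g] by auto
  have "induced_map Y \<pi> (induced_action X act g \<mu>) = distr \<mu> (borel_of Y) (\<lambda>x. \<pi> (act g x))"
    unfolding induced_map_def induced_action_apply[OF \<mu>] by (rule distr_distr_borel[OF \<mu> c(1) continuous_factor])
  also have "\<dots> = distr \<mu> (borel_of Y) (\<lambda>x. act' g (\<pi> x))"
    by (rule distr_cong_borel[OF \<mu>]) (simp add: equivariant g)
  also have "\<dots> = distr (distr \<mu> (borel_of Y) \<pi>) (borel_of Y) (act' g)"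
    by (rule distr_distr_borel[OF \<mu> continuous_factor c(2), symmetric])
  finally show "induced_map Y \<pi> (induced_action X act g \<mu>) = induced_action Y act' g (induced_map Y \<pi> \<mu>)"
    using distr_continuous_borel_probs[OF \<mu> continuous_factor] by (simp add: induced_action_def induced_map_def)
qed

lemma integral_induced_action:
  assumes \<mu>: "\<mu> \<in> borel_probs X" and g: "g \<in> carrier G" and f: "continuous_map X euclideanreal f"
  shows "integral\<^sup>L (induced_action X act g \<mu>) f = integral\<^sup>L \<mu> (\<lambda>x. f (act g x))"
  unfolding induced_action_apply[OF \<mu>]
  by (rule integral_distr_continuous[OF \<mu> continuous_map_measurable[OF base.act_continuous[OF g]] f])

lemma Hausdorff_prob_topology: "Hausdorff_space (prob_topology X)"
  using ind.Hausdorff_space_mtopology unfolding ind.mtopology_eq .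

lemma Hausdorff_Y: "Hausdorff_space Y"
  using cod.metrizable_X by (rule metrizable_imp_Hausdorff_space)

definition return_measure :: "'a \<Rightarrow> 'a measure" where
  "return_measure x = return (borel_of X) x"

lemma return_props:
  assumes x: "x \<in> topspace X"
  shows "return_measure x \<in> borel_probs X"
    and "continuous_map X euclideanreal f \<Longrightarrow> integral\<^sup>L (return_measure x) f = f x"
    and "induced_map Y \<pi> (return_measure x) = return (borel_of Y) (\<pi> x)"
    and "g \<in> carrier G \<Longrightarrow> induced_action X act g (return_measure x) = return_measure (act g x)"
proof -
  show b: "return_measure x \<in> borel_probs X"
    using x by (simp add: borel_probs_def return_measure_def prob_space_return)
  show "integral\<^sup>L (return_measure x) f = f x" if "continuous_map X euclideanreal f"
    unfolding return_measure_def using x continuous_map_borel_measurable[OF that] by (intro integral_return) auto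
  show "induced_map Y \<pi> (return_measure x) = return (borel_of Y) (\<pi> x)"
    unfolding induced_map_def return_measure_def
    using x by (intro distr_return continuous_map_measurable[OF continuous_factor]) simp
  show "induced_action X act g (return_measure x) = return_measure (act g x)" if "g \<in> carrier G"
    unfolding induced_action_apply[OF b] unfolding return_measure_def
    using x by (intro distr_return continuous_map_measurable base.act_continuous that) simp
qed

theorem ind_density_imp_induced:
  assumes f: "continuous_map X euclideanreal f" and ind: "base.ind_density f a b c"
  shows "ind.ind_density (\<lambda>\<mu>. integral\<^sup>L \<mu> f) a b c"
  unfolding ind.ind_density_def
proof
  fix T assume "T \<in> finite_subsets G"
  then obtain y W where y: "y \<in> topspace Y" and W: "W \<in> base.indep f a b y" "W \<subseteq> T" "c * real (card T) \<le> real (card W)"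
    using ind unfolding base.ind_density_def by blast
  let ?\<nu> = "return (borel_of Y) y"
  have "W \<in> ind.indep (\<lambda>\<mu>. integral\<^sup>L \<mu> f) a b ?\<nu>"
    unfolding ind.indep_def indep_sets_def
  proof (intro CollectI conjI allI impI)
    show WG: "W \<subseteq> carrier G" using W(1) by (simp add: base.indep_def indep_sets_def)
    fix \<tau> assume \<tau>: "\<tau> \<subseteq> W"
    then obtain z where z: "z \<in> base.fib y" "\<forall>s\<in>\<tau>. f (act s z) \<le> a" "\<forall>s\<in>W-\<tau>. b \<le> f (act s z)"
      using W(1) unfolding base.indep_def indep_sets_def by blast
    have zX: "z \<in> topspace X" "\<pi> z = y" using z(1) by (auto simp: fibre_def)
    have "integral\<^sup>L (induced_action X act s (return_measure z)) f = f (act s z)" if "s \<in> carrier G" for s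
      using return_props(4)[OF zX(1) that] return_props(2)[OF base.act_closed[OF that zX(1)] f] by simp
    moreover have "return_measure z \<in> ind.fib ?\<nu>"
      using return_props(1,3)[OF zX(1)] zX(2) by (simp add: fibre_def)
    ultimately show "\<exists>\<mu>\<in>ind.fib ?\<nu>. (\<forall>s\<in>\<tau>. integral\<^sup>L (induced_action X act s \<mu>) f \<le> a) \<and>
        (\<forall>s\<in>W-\<tau>. b \<le> integral\<^sup>L (induced_action X act s \<mu>) f)"
      using z(2,3) WG \<tau> by (intro bexI[of _ "return_measure z"] conjI ballI) (auto simp: subset_iff)
  qed
  moreover have "?\<nu> \<in> topspace (prob_topology Y)"
    using y by (simp add: borel_probs_def prob_space_return)
  ultimately show "\<exists>\<nu>\<in>topspace (prob_topology Y). \<exists>W\<in>ind.indep (\<lambda>\<mu>. integral\<^sup>L \<mu> f) a b \<nu>.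
      W \<subseteq> T \<and> c * real (card T) \<le> real (card W)"
    using W(2,3) by blast
qed

end

section \<open>Finite Borel partitions adapted to the fibres\<close>

lemma (in prob_space) prob_finite_valued:
  assumes lab: "lab \<in> measurable M (count_space UNIV)" and E: "finite (A :: nat set)"
  shows "(\<Sum>n\<in>A. prob {x\<in>space M. lab x = n}) = prob {x\<in>space M. lab x \<in> A}"
proof -
  have sets: "{x\<in>space M. lab x = n} \<in> sets M" for n
    using measurable_sets[OF lab, of "{n}"] by (simp add: vimage_def Int_def conj_commute)
  have "(\<Sum>n\<in>A. prob {x\<in>space M. lab x = n}) = prob (\<Union>n\<in>A. {x\<in>space M. lab x = n})"
    using E sets by (intro finite_measure_finite_Union[symmetric]) (auto simp: disjoint_family_on_def)
  also have "(\<Union>n\<in>A. {x\<in>space M. lab x = n}) = {x\<in>space M. lab x \<in> A}" by auto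
  finally show ?thesis .
qed

lemma (in prob_space) expectation_finite_valued:
  fixes \<phi> :: "nat \<Rightarrow> real"
  assumes lab: "lab \<in> measurable M (count_space UNIV)" and E: "finite E" "\<And>x. x \<in> space M \<Longrightarrow> lab x \<in> E"
  shows "integrable M (\<lambda>x. \<phi> (lab x))"
    and "expectation (\<lambda>x. \<phi> (lab x)) = (\<Sum>n\<in>E. prob {x\<in>space M. lab x = n} * \<phi> n)"
proof -
  let ?A = "\<lambda>n. {x\<in>space M. lab x = n}"
  have sets: "?A n \<in> sets M" for n
    using measurable_sets[OF lab, of "{n}"] by (simp add: vimage_def Int_def conj_commute)
  have int: "integrable M (\<lambda>x. \<Sum>n\<in>E. indicator (?A n) x * \<phi> n)"
    using sets by (intro Bochner_Integration.integrable_sum integrable_mult_left integrable_real_indicator) (auto simp: emeasure_eq_measure)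
  have eq: "\<phi> (lab x) = (\<Sum>n\<in>E. indicator (?A n) x * \<phi> n)" if x: "x \<in> space M" for x
  proof -
    have "(\<Sum>n\<in>E. indicator (?A n) x * \<phi> n) = (\<Sum>n\<in>E. if n = lab x then \<phi> n else 0)"
      using x by (intro sum.cong refl) (auto simp: indicator_def)
    then show ?thesis using E x by simp
  qed
  show "integrable M (\<lambda>x. \<phi> (lab x))"
    using int by (rule Bochner_Integration.integrable_cong[THEN iffD2, rotated 2]) (simp_all add: eq)
  have "expectation (\<lambda>x. \<phi> (lab x)) = expectation (\<lambda>x. \<Sum>n\<in>E. indicator (?A n) x * \<phi> n)"
    by (intro Bochner_Integration.integral_cong refl eq)
  also have "\<dots> = (\<Sum>n\<in>E. expectation (\<lambda>x. indicator (?A n) x * \<phi> n))"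
    using sets by (intro Bochner_Integration.integral_sum integrable_mult_left integrable_real_indicator) (auto simp: emeasure_eq_measure)
  also have "\<dots> = (\<Sum>n\<in>E. prob (?A n) * \<phi> n)"
    using sets by (intro sum.cong refl) (simp add: Int_absorb1 subset_eq)
  finally show "expectation (\<lambda>x. \<phi> (lab x)) = (\<Sum>n\<in>E. prob {x\<in>space M. lab x = n} * \<phi> n)" .
qed

context induced_factor begin

text \<open>The factor map is closed, since \<open>X\<close> is compact and \<open>Y\<close> is
  Hausdorff; so the image of the complement of \<open>U\<close> is a closed set missing
  \<open>y\<close>.\<close>

lemma fibre_neighbourhood:
  assumes O: "openin X U" "base.fib y \<subseteq> U" and y: "y \<in> topspace Y"
  shows "\<exists>V. openin Y V \<and> y \<in> V \<and> (\<forall>y'\<in>V. base.fib y' \<subseteq> U)"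
proof -
  have "closed_map X Y \<pi>"
    using dom.compact_X continuous_factor Hausdorff_Y
    by (intro continuous_imp_closed_map_gen Hausdorff_imp_kc_space)
  moreover have "closedin X (topspace X - U)" using O(1) by blast
  ultimately have "closedin Y (\<pi> ` (topspace X - U))" by (simp add: closed_map_def)
  then have "openin Y (topspace Y - \<pi> ` (topspace X - U))" by blast
  moreover have "y \<in> topspace Y - \<pi> ` (topspace X - U)" using O(2) y by (auto simp: fibre_def)
  moreover have "base.fib y' \<subseteq> U" if "y' \<in> topspace Y - \<pi> ` (topspace X - U)" for y'
    using that by (auto simp: fibre_def)
  ultimately show ?thesis by blast
qed

lemma openin_dyn_ball:
  assumes H: "H \<in> finite_subsets G" and x: "x \<in> topspace X"
  shows "openin X {z\<in>topspace X. base.dyn H x z < e}"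
proof -
  have HG: "H \<subseteq> carrier G" "finite H" using H by (auto simp: finite_subsets_def)
  have "openin X {z\<in>topspace X. d (act s x) (act s z) \<in> {..<e}}" if s: "s \<in> H" for s
  proof (rule openin_continuous_map_preimage)
    have sG: "s \<in> carrier G" using s HG by blast
    show "continuous_map X euclideanreal (\<lambda>z. d (act s x) (act s z))"
      using continuous_map_compose[OF base.act_continuous[OF sG] base.continuous_dist_point[OF base.act_closed[OF sG x]]]
      by (simp add: o_def)
  qed simp
  then have "openin X ((\<Inter>s\<in>H. {z\<in>topspace X. d (act s x) (act s z) \<in> {..<e}}) \<inter> topspace X)"
    by (rule openin_INT[OF HG(2)])
  moreover have "(\<Inter>s\<in>H. {z\<in>topspace X. d (act s x) (act s z) \<in> {..<e}}) \<inter> topspace X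
      = {z\<in>topspace X. base.dyn H x z < e}"
    using base.dyn_less_iff[OF H] by auto
  ultimately show ?thesis by simp
qed

text \<open>
  The level sets of \<open>lab\<close> and \<open>kY\<close> are Borel partitions of \<open>X\<close> and \<open>Y\<close>. The neighbourhood of a fibre that is
  covered by the balls of a spanning set of the fibre contains the preimage of an open set.
\<close>

lemma fibre_atoms:
  assumes H: "H \<in> finite_subsets G" and e: "0 < e" "e < e0"
  shows "\<exists>(E :: nat set) (key :: nat \<Rightarrow> nat) pt lab kY. finite E \<and>
    lab \<in> measurable (borel_of X) (count_space UNIV) \<and> kY \<in> measurable (borel_of Y) (count_space UNIV) \<and>
    (\<forall>n\<in>E. pt n \<in> topspace X) \<and>
    (\<forall>x\<in>topspace X. lab x \<in> E \<and> key (lab x) = kY (\<pi> x) \<and> base.dyn H (pt (lab x)) x < e0) \<and>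
    (\<forall>k. card {n\<in>E. key n = k} \<le> base.Sep e H)"
proof -
  have "\<forall>y\<in>topspace Y. \<exists>S. S \<subseteq> base.fib y \<and> finite S \<and> card S \<le> base.Sep e H \<and>
      (\<forall>z\<in>base.fib y. \<exists>x\<in>S. base.dyn H x z \<le> e)"
    using base.spanning_set[OF H e(1)] by blast
  from bchoice[OF this] obtain S where S: "\<forall>y\<in>topspace Y. S y \<subseteq> base.fib y \<and> finite (S y) \<and>
      card (S y) \<le> base.Sep e H \<and> (\<forall>z\<in>base.fib y. \<exists>x\<in>S y. base.dyn H x z \<le> e)" by (elim exE)
  define U where "U y = (\<Union>x\<in>S y. {z\<in>topspace X. base.dyn H x z < e0})" for y
  have SX: "x \<in> topspace X" if "y \<in> topspace Y" "x \<in> S y" for x y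
    using S that base.fib_subset by blast
  have U: "openin X (U y) \<and> base.fib y \<subseteq> U y" if y: "y \<in> topspace Y" for y
  proof
    show "openin X (U y)" unfolding U_def using SX[OF y] by (intro openin_Union) (auto intro: openin_dyn_ball[OF H])
    show "base.fib y \<subseteq> U y"
    proof
      fix z assume z: "z \<in> base.fib y"
      then obtain x where "x \<in> S y" "base.dyn H x z \<le> e" using S y by blast
      moreover from this have "base.dyn H x z < e0" using e(2) by linarith
      moreover have "z \<in> topspace X" using z base.fib_subset by blast
      ultimately show "z \<in> U y" unfolding U_def by blast
    qed
  qed
  have "\<forall>y\<in>topspace Y. \<exists>V. openin Y V \<and> y \<in> V \<and> (\<forall>y'\<in>V. base.fib y' \<subseteq> U y)"
    using fibre_neighbourhood U by blast
  from bchoice[OF this] obtain V where V: "\<forall>y\<in>topspace Y. openin Y (V y) \<and> y \<in> V y \<and> (\<forall>y'\<in>V y. base.fib y' \<subseteq> U y)"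
    by (elim exE)
  have "\<exists>J. finite J \<and> J \<subseteq> topspace Y \<and> topspace Y \<subseteq> (\<Union>y\<in>J. V y)"
  proof -
    have op: "\<forall>W\<in>V ` topspace Y. openin Y W" using V by auto
    moreover have cov: "topspace Y \<subseteq> \<Union> (V ` topspace Y)" using V by auto
    ultimately obtain \<F> where \<F>: "finite \<F>" "\<F> \<subseteq> V ` topspace Y" "topspace Y \<subseteq> \<Union>\<F>"
      using cod.compact_X unfolding compact_space_alt by meson
    obtain J where "J \<subseteq> topspace Y" "finite J" "\<F> = V ` J" using finite_subset_image[OF \<F>(1,2)] by blast
    then show ?thesis using \<F>(3) by blast
  qed
  then obtain J where J: "finite J" "J \<subseteq> topspace Y" "topspace Y \<subseteq> (\<Union>y\<in>J. V y)" by blast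
  obtain j where j: "bij_betw j {..<card J} J"
    using ex_bij_betw_nat_finite[OF J(1)] by (auto simp: atLeast0LessThan)
  have jJ: "j i \<in> topspace Y" if "i < card J" for i using j J(2) that by (auto simp: bij_betw_def)
  \<comment> \<open>Taking the least index turns the finite open cover into a Borel partition;
    \<open>lab\<close> does the same on \<open>X\<close>.\<close>
  define kY where "kY y = (LEAST i. i < card J \<and> y \<in> V (j i))" for y
  have kY: "kY y < card J \<and> y \<in> V (j (kY y))" if y: "y \<in> topspace Y" for y
  proof -
    obtain y0 where "y0 \<in> J" "y \<in> V y0" using J(3) y by blast
    moreover from this have "y0 \<in> j ` {..<card J}" using j by (simp add: bij_betw_def)
    ultimately obtain i where "i < card J" "y \<in> V (j i)" by auto
    then show ?thesis unfolding kY_def by (intro LeastI[of "\<lambda>i. i < card J \<and> y \<in> V (j i)" i]) simp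
  qed
  have kY_meas: "kY \<in> measurable (borel_of Y) (count_space UNIV)"
    unfolding kY_def
  proof (rule measurable_Least)
    show "(\<lambda>y. i < card J \<and> y \<in> V (j i)) \<in> measurable (borel_of Y) (count_space UNIV)" for i
    proof (cases "i < card J")
      case True
      then have "openin Y (V (j i))" using V jJ by blast
      moreover from this have "{y\<in>space (borel_of Y). y \<in> V (j i)} = V (j i)" using openin_subset by auto
      ultimately have "{y\<in>space (borel_of Y). y \<in> V (j i)} \<in> sets (borel_of Y)" using openin_borel_of by metis
      then show ?thesis using True by (simp add: pred_def)
    qed simp
  qed
  \<comment> \<open>Spanning points are tagged with the index of their set in \<open>Y\<close>, so
    that the label of \<open>x\<close> determines \<open>kY (\<pi> x)\<close> even when a point
    occurs for several indices.\<close>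
  define E0 where "E0 = (SIGMA i:{..<card J}. S (j i))"
  have finE0: "finite E0" unfolding E0_def using S jJ by (intro finite_SigmaI) auto
  obtain g where g: "bij_betw g {..<card E0} E0"
    using ex_bij_betw_nat_finite[OF finE0] by (auto simp: atLeast0LessThan)
  have gE: "g n \<in> E0" if "n < card E0" for n using g that by (auto simp: bij_betw_def)
  define lab where "lab x = (LEAST n. n < card E0 \<and> fst (g n) = kY (\<pi> x) \<and> base.dyn H (snd (g n)) x < e0)" for x
  have lab: "lab x < card E0 \<and> fst (g (lab x)) = kY (\<pi> x) \<and> base.dyn H (snd (g (lab x))) x < e0"
    if x: "x \<in> topspace X" for x
  proof -
    have \<pi>x: "\<pi> x \<in> topspace Y" using x surj_factor by blast
    let ?k = "kY (\<pi> x)"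
    have k: "?k < card J" "\<pi> x \<in> V (j ?k)" using kY[OF \<pi>x] by auto
    have "x \<in> base.fib (\<pi> x)" using x by (simp add: fibre_def)
    then have "x \<in> U (j ?k)" using V jJ[OF k(1)] k(2) by blast
    then obtain z where z: "z \<in> S (j ?k)" "base.dyn H z x < e0" by (auto simp: U_def)
    have "(?k, z) \<in> E0" using k(1) z(1) by (simp add: E0_def)
    then have "(?k, z) \<in> g ` {..<card E0}" using g by (simp add: bij_betw_def)
    then obtain n where "n < card E0" "g n = (?k, z)" by auto
    then show ?thesis unfolding lab_def
      using z(2) by (intro LeastI[of "\<lambda>n. n < card E0 \<and> fst (g n) = kY (\<pi> x) \<and> base.dyn H (snd (g n)) x < e0" n]) simp
  qed
  have pt: "snd (g n) \<in> topspace X" if "n < card E0" for n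
  proof -
    have "fst (g n) < card J" "snd (g n) \<in> S (j (fst (g n)))" using gE[OF that] by (auto simp: E0_def)
    then show ?thesis using SX[OF jJ] by blast
  qed
  have lab_meas: "lab \<in> measurable (borel_of X) (count_space UNIV)"
    unfolding lab_def
  proof (rule measurable_Least)
    show "(\<lambda>x. n < card E0 \<and> fst (g n) = kY (\<pi> x) \<and> base.dyn H (snd (g n)) x < e0) \<in> measurable (borel_of X) (count_space UNIV)" for n
    proof (cases "n < card E0")
      case True
      have "(\<lambda>x. kY (\<pi> x)) \<in> measurable (borel_of X) (count_space UNIV)"
        using measurable_compose[OF continuous_map_measurable[OF continuous_factor] kY_meas] .
      from measurable_sets[OF this, of "{fst (g n)}"]
      have 1: "{x\<in>space (borel_of X). fst (g n) = kY (\<pi> x)} \<in> sets (borel_of X)"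
        by (simp add: vimage_def Int_def conj_commute eq_commute)
      have "{x\<in>space (borel_of X). base.dyn H (snd (g n)) x < e0} \<in> sets (borel_of X)"
        using openin_borel_of[OF openin_dyn_ball[OF H pt[OF True], of e0]] by simp
      from sets.Int[OF 1 this] have "{x\<in>space (borel_of X). fst (g n) = kY (\<pi> x) \<and> base.dyn H (snd (g n)) x < e0} \<in> sets (borel_of X)"
        by (simp add: Int_def conj_ac)
      then show ?thesis using True by (simp add: pred_def)
    qed simp
  qed
  have cardk: "card {n\<in>{..<card E0}. fst (g n) = k} \<le> base.Sep e H" for k
  proof (cases "k < card J")
    case True
    have "card {n\<in>{..<card E0}. fst (g n) = k} \<le> card ({k} \<times> S (j k))"
    proof (rule card_inj_on_le[of g])
      show "inj_on g {n\<in>{..<card E0}. fst (g n) = k}" using g by (auto simp: bij_betw_def intro: inj_on_subset)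
      show "g ` {n\<in>{..<card E0}. fst (g n) = k} \<subseteq> {k} \<times> S (j k)" using gE by (fastforce simp: E0_def)
      show "finite ({k} \<times> S (j k))" using S jJ[OF True] by simp
    qed
    also have "\<dots> \<le> base.Sep e H" using S jJ[OF True] by (simp add: card_cartesian_product)
    finally show ?thesis .
  next
    case False
    then have "{n\<in>{..<card E0}. fst (g n) = k} = {}" using gE by (fastforce simp: E0_def)
    then show ?thesis by (simp only: card.empty)
  qed
  show ?thesis
    by (rule exI[of _ "{..<card E0}"], rule exI[of _ "\<lambda>n. fst (g n)"], rule exI[of _ "\<lambda>n. snd (g n)"],
      rule exI[of _ lab], rule exI[of _ kY], intro conjI ballI allI lab_meas kY_meas cardk)
      (use pt lab in auto)
qed

text \<open>The measures realising the patterns become weights on the atoms of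
  \<open>fibre_atoms\<close>. Replacing \<open>f\<close> by its value at the atom's point costs at
  most \<open>\<eta> = (b - a) / 4\<close>, so half of the gap remains. The measures have the same
  image \<open>\<nu>\<close>, hence the same key marginals, and at most \<open>Sep e H\<close> atoms
  share a key; this is the \<open>m\<close> of the sampling bound. The bound \<open>n0\<close>
  provides the four elements of \<open>W\<close> required there.\<close>

theorem induced_ind_density_imp_Sep_ge:
  assumes f: "continuous_map X euclideanreal f" and range: "\<And>x. x \<in> topspace X \<Longrightarrow> 0 \<le> f x \<and> f x \<le> 1"
    and ab: "a < b" and c: "c > 0" and ind: "ind.ind_density (\<lambda>\<mu>. integral\<^sup>L \<mu> f) a b c"
  shows "\<exists>e>0. \<exists>\<kappa>>0. \<exists>n0. \<forall>H\<in>finite_subsets G. n0 \<le> card H \<longrightarrow> 2 powr (\<kappa> * real (card H)) \<le> real (base.Sep e H)"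
proof -
  define \<eta> where "\<eta> = (b - a) / 4"
  have \<eta>: "\<eta> > 0" using ab by (simp add: \<eta>_def)
  have ab': "a + \<eta> < b - \<eta>" using ab by (simp add: \<eta>_def field_simps)
  obtain e0 where e0: "e0 > 0" "\<forall>x\<in>topspace X. \<forall>y\<in>topspace X. d x y < e0 \<longrightarrow> \<bar>f x - f y\<bar> < \<eta>"
    using base.uniformly_continuous[OF f \<eta>] by blast
  define e where "e = e0 / 2"
  have e: "0 < e" "e < e0" using e0(1) by (auto simp: e_def)
  obtain \<kappa> where \<kappa>: "\<kappa> > 0" and bound: "\<forall>(W::'g set) (E::nat set) (q::'g set \<Rightarrow> nat \<Rightarrow> real) (key::nat \<Rightarrow> nat) \<nu> m h.
    finite W \<and> 4 \<le> card W \<and> finite E \<and>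
    (\<forall>\<tau>\<in>Pow W. (\<forall>e\<in>E. 0 \<le> q \<tau> e) \<and> (\<Sum>e\<in>E. q \<tau> e) = 1 \<and> (\<forall>k. (\<Sum>e\<in>{e\<in>E. key e = k}. q \<tau> e) = \<nu> k) \<and>
      (\<forall>s\<in>\<tau>. (\<Sum>e\<in>E. q \<tau> e * h s e) \<le> a + \<eta>) \<and> (\<forall>s\<in>W-\<tau>. b - \<eta> \<le> (\<Sum>e\<in>E. q \<tau> e * h s e))) \<and>
    (\<forall>k. card {e\<in>E. key e = k} \<le> m) \<and> (\<forall>s\<in>W. \<forall>e\<in>E. 0 \<le> h s e \<and> h s e \<le> 1) \<longrightarrow>
    2 powr (\<kappa> * real (card W)) \<le> real m"
    using independent_weights_bound[OF ab'] by (elim exE conjE)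
  have "2 powr (\<kappa> * c * real (card H)) \<le> real (base.Sep e H)"
    if H: "H \<in> finite_subsets G" and big: "nat \<lceil>4 / c\<rceil> \<le> card H" for H
  proof -
    have HG: "H \<subseteq> carrier G" "finite H" using H by (auto simp: finite_subsets_def)
    obtain \<nu> W where W: "W \<in> ind.indep (\<lambda>\<mu>. integral\<^sup>L \<mu> f) a b \<nu>" "W \<subseteq> H" "c * real (card H) \<le> real (card W)"
      using ind H unfolding ind.ind_density_def by blast
    have finW: "finite W" using W(2) HG(2) by (rule finite_subset)
    have W4: "4 \<le> card W"
    proof -
      have "4 / c \<le> real (card H)" using big by linarith
      then have "4 \<le> c * real (card H)" using c by (simp add: pos_divide_le_eq mult.commute)
      then show ?thesis using W(3) by linarith
    qed
    have "\<forall>\<tau>\<in>Pow W. \<exists>\<mu>. \<mu> \<in> ind.fib \<nu> \<and> (\<forall>s\<in>\<tau>. integral\<^sup>L (induced_action X act s \<mu>) f \<le> a) \<and>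
        (\<forall>s\<in>W-\<tau>. b \<le> integral\<^sup>L (induced_action X act s \<mu>) f)"
      using W(1) unfolding ind.indep_def indep_sets_def by blast
    from bchoice[OF this] obtain \<mu> where \<mu>: "\<forall>\<tau>\<in>Pow W. \<mu> \<tau> \<in> ind.fib \<nu> \<and>
        (\<forall>s\<in>\<tau>. integral\<^sup>L (induced_action X act s (\<mu> \<tau>)) f \<le> a) \<and>
        (\<forall>s\<in>W-\<tau>. b \<le> integral\<^sup>L (induced_action X act s (\<mu> \<tau>)) f)" by (elim exE)
    obtain E key pt lab kY where atoms: "finite (E :: nat set)"
        "lab \<in> measurable (borel_of X) (count_space UNIV)" "kY \<in> measurable (borel_of Y) (count_space UNIV)"
        "\<forall>n\<in>E. pt n \<in> topspace X"
        "\<forall>x\<in>topspace X. lab x \<in> E \<and> key (lab x) = (kY (\<pi> x) :: nat) \<and> base.dyn H (pt (lab x)) x < e0"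
        "\<forall>k. card {n\<in>E. key n = k} \<le> base.Sep e H"
      using fibre_atoms[OF H e] by (elim exE conjE)
    note E = atoms(1) and lab_meas = atoms(2) and kY_meas = atoms(3)
    have pt: "\<And>n. n \<in> E \<Longrightarrow> pt n \<in> topspace X" using atoms(4) by blast
    have lab: "\<And>x. x \<in> topspace X \<Longrightarrow> lab x \<in> E \<and> key (lab x) = kY (\<pi> x) \<and> base.dyn H (pt (lab x)) x < e0"
      using atoms(5) by blast
    have card_key: "\<And>k. card {n\<in>E. key n = k} \<le> base.Sep e H" using atoms(6) by blast
    define q where "q \<tau> n = measure (\<mu> \<tau>) {x\<in>topspace X. lab x = n}" for \<tau> n
    define h where "h s n = f (act s (pt n))" for s n
    have each: "(\<forall>n\<in>E. 0 \<le> q \<tau> n) \<and> (\<Sum>n\<in>E. q \<tau> n) = 1 \<and>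
        (\<forall>k. (\<Sum>n\<in>{n\<in>E. key n = k}. q \<tau> n) = measure \<nu> {y\<in>topspace Y. kY y = k}) \<and>
        (\<forall>s\<in>\<tau>. (\<Sum>n\<in>E. q \<tau> n * h s n) \<le> a + \<eta>) \<and> (\<forall>s\<in>W-\<tau>. b - \<eta> \<le> (\<Sum>n\<in>E. q \<tau> n * h s n))"
      if \<tau>: "\<tau> \<in> Pow W" for \<tau>
    proof -
      have M: "\<mu> \<tau> \<in> borel_probs X" and \<nu>: "distr (\<mu> \<tau>) (borel_of Y) \<pi> = \<nu>"
        using \<mu> \<tau> by (auto simp: fibre_def induced_map_def)
      interpret M: prob_space "\<mu> \<tau>" using borel_probsD(1)[OF M] .
      have sp: "space (\<mu> \<tau>) = topspace X" using borel_probsD(3)[OF M] .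
      have lm: "lab \<in> measurable (\<mu> \<tau>) (count_space UNIV)" using lab_meas borel_probs_measurable[OF M] by blast
      have 1: "(\<Sum>n\<in>A. q \<tau> n) = measure (\<mu> \<tau>) {x\<in>topspace X. lab x \<in> A}" if "finite A" for A
        using M.prob_finite_valued[OF lm that] by (simp add: q_def sp)
      have "{x\<in>topspace X. lab x \<in> E} = space (\<mu> \<tau>)" using lab sp by auto
      then have sum1: "(\<Sum>n\<in>E. q \<tau> n) = 1" using 1[OF E] M.prob_space by simp
      have marg: "(\<Sum>n\<in>{n\<in>E. key n = k}. q \<tau> n) = measure \<nu> {y\<in>topspace Y. kY y = k}" for k
      proof -
        have "(\<Sum>n\<in>{n\<in>E. key n = k}. q \<tau> n) = measure (\<mu> \<tau>) {x\<in>topspace X. lab x \<in> {n\<in>E. key n = k}}"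
          using E by (intro 1) auto
        also have "{x\<in>topspace X. lab x \<in> {n\<in>E. key n = k}} = \<pi> -` {y\<in>topspace Y. kY y = k} \<inter> space (\<mu> \<tau>)"
          using lab surj_factor by (auto simp: sp)
        also have "measure (\<mu> \<tau>) \<dots> = measure \<nu> {y\<in>topspace Y. kY y = k}"
        proof -
          have "{y\<in>topspace Y. kY y = k} \<in> sets (borel_of Y)"
            using measurable_sets[OF kY_meas, of "{k}"] by (simp add: vimage_def Int_def conj_commute)
          moreover have "\<pi> \<in> measurable (\<mu> \<tau>) (borel_of Y)"
            using continuous_map_measurable[OF continuous_factor] borel_probs_measurable[OF M] by blast
          ultimately show ?thesis unfolding \<nu>[symmetric] by (simp add: measure_distr)
        qed
        finally show ?thesis .
      qed
      have close: "\<bar>(\<Sum>n\<in>E. q \<tau> n * h s n) - integral\<^sup>L (induced_action X act s (\<mu> \<tau>)) f\<bar> \<le> \<eta>" if s: "s \<in> W" for s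
      proof -
        have sH: "s \<in> H" "s \<in> carrier G" using s W(2) HG by auto
        have fs: "continuous_map X euclideanreal (\<lambda>x. f (act s x))"
          using continuous_map_compose[OF base.act_continuous[OF sH(2)] f] by (simp add: o_def)
        have sum: "(\<Sum>n\<in>E. q \<tau> n * h s n) = integral\<^sup>L (\<mu> \<tau>) (\<lambda>x. h s (lab x))" and ih: "integrable (\<mu> \<tau>) (\<lambda>x. h s (lab x))"
          using M.expectation_finite_valued[OF lm E, of "h s"] lab by (auto simp: q_def sp)
        have int: "integral\<^sup>L (induced_action X act s (\<mu> \<tau>)) f = integral\<^sup>L (\<mu> \<tau>) (\<lambda>x. f (act s x))"
          by (rule integral_induced_action[OF M sH(2) f])
        have ig: "integrable (\<mu> \<tau>) (\<lambda>x. f (act s x))" by (rule base.integrable_continuous[OF M fs])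
        have pw: "\<bar>h s (lab x) - f (act s x)\<bar> \<le> \<eta>" if x: "x \<in> space (\<mu> \<tau>)" for x
        proof -
          have xX: "x \<in> topspace X" using x sp by simp
          have "d (act s (pt (lab x))) (act s x) < e0" using lab[OF xX] base.dyn_less_iff[OF H] sH(1) by blast
          moreover have "act s (pt (lab x)) \<in> topspace X" "act s x \<in> topspace X"
            using lab[OF xX] pt base.act_closed[OF sH(2)] xX by auto
          ultimately show ?thesis using e0(2) unfolding h_def by (meson less_imp_le)
        qed
        have "\<bar>integral\<^sup>L (\<mu> \<tau>) (\<lambda>x. h s (lab x) - f (act s x))\<bar> \<le> integral\<^sup>L (\<mu> \<tau>) (\<lambda>x. \<bar>h s (lab x) - f (act s x)\<bar>)"
          by (rule integral_abs_bound)
        also have "\<dots> \<le> integral\<^sup>L (\<mu> \<tau>) (\<lambda>x. \<eta>)"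
          using ih ig pw by (intro integral_mono integrable_abs Bochner_Integration.integrable_diff) auto
        also have "\<dots> = \<eta>" by (simp add: M.prob_space)
        finally show ?thesis unfolding sum int using ih ig by simp
      qed
      have \<tau>W: "\<tau> \<subseteq> W" using \<tau> by blast
      have "(\<Sum>n\<in>E. q \<tau> n * h s n) \<le> a + \<eta>" if "s \<in> \<tau>" for s
      proof -
        have "integral\<^sup>L (induced_action X act s (\<mu> \<tau>)) f \<le> a" using \<mu> \<tau> that by blast
        then show ?thesis using close[of s] that \<tau>W by (auto simp: abs_le_iff)
      qed
      moreover have "b - \<eta> \<le> (\<Sum>n\<in>E. q \<tau> n * h s n)" if "s \<in> W - \<tau>" for s
      proof -
        have "b \<le> integral\<^sup>L (induced_action X act s (\<mu> \<tau>)) f" using \<mu> \<tau> that by blast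
        then show ?thesis using close[of s] that by (auto simp: abs_le_iff)
      qed
      ultimately show ?thesis using sum1 marg by (auto simp: q_def)
    qed
    have hr: "\<forall>s\<in>W. \<forall>n\<in>E. 0 \<le> h s n \<and> h s n \<le> 1"
    proof (intro ballI)
      fix s n assume "s \<in> W" "n \<in> E"
      then have "act s (pt n) \<in> topspace X" using W(2) HG(1) pt base.act_closed by blast
      then show "0 \<le> h s n \<and> h s n \<le> 1" using range by (simp add: h_def)
    qed
    have "2 powr (\<kappa> * real (card W)) \<le> real (base.Sep e H)"
      by (rule bound[rule_format, of W E q key "\<lambda>k. measure \<nu> {y\<in>topspace Y. kY y = k}" h "base.Sep e H"])
        (intro conjI finW W4 E ballI[OF each] allI card_key hr)
    moreover have "\<kappa> * c * real (card H) \<le> \<kappa> * real (card W)"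
      using W(3) \<kappa> by (simp add: mult.assoc)
    then have "2 powr (\<kappa> * c * real (card H)) \<le> 2 powr (\<kappa> * real (card W))" by (intro powr_mono) auto
    ultimately show ?thesis by linarith
  qed
  then show ?thesis using e(1) \<kappa> c
    by (intro exI[of _ e] exI[of _ "\<kappa> * c"] conjI exI[of _ "nat \<lceil>4 / c\<rceil>"] ballI impI) auto
qed

end

text \<open>For a maximal disjoint family, every \<open>x\<close> in \<open>D\<close> satisfies
  \<open>t \<otimes> x = t' \<otimes> c\<close> for some centre \<open>c\<close>, and each
  \<open>c\<close> arises from at most as many \<open>x\<close> as there are pairs \<open>t\<close>,
  \<open>t'\<close>.\<close>

lemma (in group) disjoint_translates:
  assumes D: "D \<subseteq> carrier G" "finite D" and T: "T \<subseteq> carrier G" "finite T" "T \<noteq> {}"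
  shows "\<exists>C\<subseteq>D. (\<forall>x\<in>C. \<forall>y\<in>C. x \<noteq> y \<longrightarrow> rtrans T x \<inter> rtrans T y = {}) \<and> card D \<le> card C * (card T)\<^sup>2"
proof -
  define \<F> where "\<F> = {C. C \<subseteq> D \<and> (\<forall>x\<in>C. \<forall>y\<in>C. x \<noteq> y \<longrightarrow> rtrans T x \<inter> rtrans T y = {})}"
  have "finite \<F>" using D by (intro finite_subset[of \<F> "Pow D"]) (auto simp: \<F>_def)
  moreover have "{} \<in> \<F>" by (simp add: \<F>_def)
  ultimately obtain C where C: "C \<in> \<F>" "\<forall>C'\<in>\<F>. C \<subseteq> C' \<longrightarrow> C = C'"
    using finite_has_maximal2[of \<F> "{}"] by auto
  have CD: "C \<subseteq> D" and dis: "\<forall>x\<in>C. \<forall>y\<in>C. x \<noteq> y \<longrightarrow> rtrans T x \<inter> rtrans T y = {}" using C(1) by (auto simp: \<F>_def)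
  have meet: "\<exists>c\<in>C. rtrans T x \<inter> rtrans T c \<noteq> {}" if x: "x \<in> D" for x
  proof (rule ccontr)
    assume neg: "\<not> ?thesis"
    have "rtrans T x \<noteq> {}" using T(3) by (simp add: rtrans_def)
    then have "x \<notin> C" using neg by auto
    have "insert x C \<in> \<F>" using neg CD dis x unfolding \<F>_def by (auto simp: Int_commute)
    then show False using C(2) \<open>x \<notin> C\<close> by blast
  qed
  have "D \<subseteq> (\<lambda>(c, t, t'). inv t \<otimes> (t' \<otimes> c)) ` (C \<times> T \<times> T)"
  proof
    fix x assume x: "x \<in> D"
    then obtain c w where c: "c \<in> C" "w \<in> rtrans T x" "w \<in> rtrans T c" using meet by blast
    then obtain t t' where t: "t \<in> T" "t' \<in> T" "w = t \<otimes> x" "w = t' \<otimes> c" by (auto simp: rtrans_def)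
    have G: "x \<in> carrier G" "t \<in> carrier G" "t' \<in> carrier G" "c \<in> carrier G" using x D t T c CD by auto
    have "x = inv t \<otimes> (t' \<otimes> c)" using t(3,4) G by (metis inv_solve_left m_closed)
    then show "x \<in> (\<lambda>(c, t, t'). inv t \<otimes> (t' \<otimes> c)) ` (C \<times> T \<times> T)" using c(1) t(1,2) by force
  qed
  then have "card D \<le> card ((\<lambda>(c, t, t'). inv t \<otimes> (t' \<otimes> c)) ` (C \<times> T \<times> T))"
    using T(2) CD D(2) by (intro card_mono) (auto intro: finite_subset)
  also have "\<dots> \<le> card (C \<times> T \<times> T)" using T(2) CD D(2) by (intro card_image_le) (auto intro: finite_subset)
  finally show ?thesis using CD dis by (auto simp: card_cartesian_product power2_eq_square)
qed

text \<open>The convex combination of Dirac measures at the points \<open>x i\<close>, as the image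
  of a measure on the indices, so that points may coincide.\<close>

definition mix :: "'a topology \<Rightarrow> 'i set \<Rightarrow> ('i \<Rightarrow> 'a) \<Rightarrow> ('i \<Rightarrow> real) \<Rightarrow> 'a measure" where
  "mix X I x w = distr (point_measure I (\<lambda>i. ennreal (w i))) (borel_of X) x"

context
  fixes X :: "'a topology" and I :: "'i set" and x :: "'i \<Rightarrow> 'a" and w :: "'i \<Rightarrow> real"
  assumes I: "finite I" and x: "\<And>i. i \<in> I \<Longrightarrow> x i \<in> topspace X"
    and w: "\<And>i. i \<in> I \<Longrightarrow> 0 \<le> w i" "(\<Sum>i\<in>I. w i) = 1"
begin

lemma prob_space_weights: "prob_space (point_measure I (\<lambda>i. ennreal (w i)))"
  using I w by (intro prob_space_point_measure) (simp_all add: sum_ennreal)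

lemma measurable_weights: "x \<in> measurable (point_measure I (\<lambda>i. ennreal (w i))) (borel_of X)"
  using x by (auto simp: measurable_def space_point_measure sets_point_measure)

lemma mix_borel_probs: "mix X I x w \<in> borel_probs X"
  unfolding mix_def using prob_space_weights measurable_weights by (rule distr_borel_probs)

lemma integral_mix:
  assumes f: "continuous_map X euclideanreal f"
  shows "integral\<^sup>L (mix X I x w) f = (\<Sum>i\<in>I. w i * f (x i))"
proof -
  have "integral\<^sup>L (mix X I x w) f = integral\<^sup>L (point_measure I (\<lambda>i. ennreal (w i))) (\<lambda>i. f (x i))"
    unfolding mix_def by (rule integral_distr[OF measurable_weights continuous_map_borel_measurable[OF f]])
  also have "\<dots> = (\<Sum>i\<in>I. w i * f (x i))" using I w(1) by (subst lebesgue_integral_point_measure_finite) auto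
  finally show ?thesis .
qed

lemma distr_mix_const:
  assumes \<pi>: "continuous_map X Y \<pi>" and y: "\<And>i. i \<in> I \<Longrightarrow> \<pi> (x i) = y" "y \<in> topspace Y"
  shows "distr (mix X I x w) (borel_of Y) \<pi> = return (borel_of Y) y"
proof -
  let ?P = "point_measure I (\<lambda>i. ennreal (w i))"
  have "distr (mix X I x w) (borel_of Y) \<pi> = distr ?P (borel_of Y) (\<lambda>i. \<pi> (x i))"
    unfolding mix_def using measurable_weights continuous_map_measurable[OF \<pi>] by (subst distr_distr) (auto simp: o_def)
  also have "\<dots> = distr ?P (borel_of Y) (\<lambda>i. y)" using y(1) by (intro distr_cong) (auto simp: space_point_measure)
  also have "\<dots> = return (borel_of Y) y" using y(2) by (intro prob_space.distr_const prob_space_weights) simp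
  finally show ?thesis .
qed

end

text \<open>Marginal of a product measure: the indicator is moved into the factor at
  \<open>c\<close>, after which the sum of products is a product of sums whose other factors are
  1.\<close>

lemma prod_indicator_marginal:
  fixes p :: "'c \<Rightarrow> 't \<Rightarrow> real"
  assumes C: "finite C" and T: "\<And>c. c \<in> C \<Longrightarrow> finite (T c)" and sum: "\<And>c. c \<in> C \<Longrightarrow> (\<Sum>\<tau>\<in>T c. p c \<tau>) = 1"
    and c: "c \<in> C" "\<tau> \<in> T c"
  shows "(\<Sum>\<sigma>\<in>PiE C T. (\<Prod>b\<in>C. p b (\<sigma> b)) * (if \<sigma> c = \<tau> then 1 else 0)) = p c \<tau>"
proof -
  let ?f = "\<lambda>b \<tau>'. p b \<tau>' * (if b = c \<and> \<tau>' \<noteq> \<tau> then 0 else 1)"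
  have "(\<Sum>\<sigma>\<in>PiE C T. (\<Prod>b\<in>C. p b (\<sigma> b)) * (if \<sigma> c = \<tau> then 1 else 0)) = (\<Sum>\<sigma>\<in>PiE C T. \<Prod>b\<in>C. ?f b (\<sigma> b))"
  proof (rule sum.cong[OF refl])
    fix \<sigma>
    have "(\<Prod>b\<in>C. if b = c \<and> \<sigma> b \<noteq> \<tau> then 0 else 1::real) = (if \<sigma> c = \<tau> then 1 else 0)"
    proof (cases "\<sigma> c = \<tau>")
      case True
      then show ?thesis by (intro trans[OF prod.neutral]) auto
    next
      case False
      then have "\<exists>b\<in>C. (if b = c \<and> \<sigma> b \<noteq> \<tau> then 0 else 1::real) = 0" using c(1) by (intro bexI[of _ c]) auto
      then have "(\<Prod>b\<in>C. if b = c \<and> \<sigma> b \<noteq> \<tau> then 0 else 1::real) = 0" using C by (rule prod_zero[rotated])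
      then show ?thesis using False by (simp only: if_False)
    qed
    then show "(\<Prod>b\<in>C. p b (\<sigma> b)) * (if \<sigma> c = \<tau> then 1 else 0) = (\<Prod>b\<in>C. ?f b (\<sigma> b))"
      by (simp only: prod.distrib)
  qed
  also have "\<dots> = (\<Prod>b\<in>C. \<Sum>\<tau>'\<in>T b. ?f b \<tau>')" by (rule prod_sum_PiE[symmetric, OF C]) (use T in auto)
  also have "\<dots> = (\<Prod>b\<in>C. if b = c then p c \<tau> else 1)"
  proof (rule prod.cong[OF refl])
    fix b assume b: "b \<in> C"
    show "(\<Sum>\<tau>'\<in>T b. ?f b \<tau>') = (if b = c then p c \<tau> else 1)"
    proof (cases "b = c")
      case True
      have "(\<Sum>\<tau>'\<in>T c. ?f c \<tau>') = (\<Sum>\<tau>'\<in>T c. if \<tau>' = \<tau> then p c \<tau>' else 0)" by (intro sum.cong refl) auto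
      then show ?thesis using True T[OF c(1)] c(2) by simp
    next
      case False
      then show ?thesis using sum[OF b] by simp
    qed
  qed
  also have "\<dots> = p c \<tau>" using C c(1) by simp
  finally show ?thesis .
qed

section \<open>Cubes of measures inside one fibre\<close>

context induced_factor begin

text \<open>
  Disjoint blocks \<open>T\<^sub>x x\<close> of \<open>L\<close> points inside an independent set carry independent product measures \<open>\<Otimes> p\<^sub>x\<close> on the patterns in \<open>{low, high}\<^sup>L\<close>;
  the \<open>|C| (2\<^sup>L - 1)\<close> parameters of these measures are read off by the finitely many test functions
  \<open>pat T' \<tau>\<close>, so that they form a cube that is not squeezed by \<open>\<rho>\<close>.
\<close>

definition pat :: "('a \<Rightarrow> real) \<Rightarrow> 'g set \<Rightarrow> 'g set \<Rightarrow> 'a \<Rightarrow> real" where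
  "pat \<alpha> T' \<tau> x = (\<Prod>t\<in>\<tau>. 1 - \<alpha> (act t x)) * (\<Prod>t\<in>T'-\<tau>. \<alpha> (act t x))"

lemma continuous_pat:
  assumes \<alpha>: "continuous_map X euclideanreal \<alpha>" and T': "T' \<subseteq> carrier G" "finite T'" "\<tau> \<subseteq> T'"
  shows "continuous_map X euclideanreal (pat \<alpha> T' \<tau>)"
proof -
  have "continuous_map X euclideanreal (\<lambda>x. \<alpha> (act t x))" if "t \<in> T'" for t
    using continuous_map_compose[OF base.act_continuous \<alpha>, of t] that T'(1) by (auto simp: o_def)
  moreover have "finite \<tau>" using T' finite_subset by blast
  ultimately show ?thesis unfolding pat_def using T'
    by (intro continuous_map_real_mult continuous_map_prod continuous_map_diff) auto
qed

lemma pat_eq: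
  assumes T': "finite T'" "\<tau> \<subseteq> T'" "\<sigma> \<subseteq> T'"
    and lo: "\<And>t. t \<in> \<sigma> \<Longrightarrow> \<alpha> (act t x) = 0" and hi: "\<And>t. t \<in> T' - \<sigma> \<Longrightarrow> \<alpha> (act t x) = 1"
  shows "pat \<alpha> T' \<tau> x = (if \<sigma> = \<tau> then 1 else 0)"
proof (cases "\<sigma> = \<tau>")
  case True
  then show ?thesis using lo hi by (simp add: pat_def)
next
  case False
  then consider t where "t \<in> \<sigma>" "t \<notin> \<tau>" | t where "t \<in> \<tau>" "t \<notin> \<sigma>" by blast
  then have "pat \<alpha> T' \<tau> x = 0"
  proof cases
    case 1
    then have "(\<Prod>t\<in>T'-\<tau>. \<alpha> (act t x)) = 0"
      using T' lo by (intro prod_zero bexI[of _ t]) auto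
    then show ?thesis by (simp add: pat_def)
  next
    case 2
    then have "(\<Prod>t\<in>\<tau>. 1 - \<alpha> (act t x)) = 0"
      using T' hi by (intro prod_zero bexI[of _ t]) (auto intro: finite_subset)
    then show ?thesis by (simp add: pat_def)
  qed
  then show ?thesis using False by simp
qed

text \<open>If the width were smaller than the dimension of the cube, the Lebesgue theorem would
  give two parameters on opposite faces whose measures are \<open>e\<close>-close along
  \<open>H\<close>. The direction of the faces is a pair of a block \<open>c\<close> and a nonempty
  pattern \<open>\<tau>\<close>; as \<open>c\<close> lies in \<open>H\<close>, the translates by
  \<open>c\<close> are close too, but the test function for \<open>\<tau>\<close> has integrals 0
  and \<open>1 / 2 ^ L\<close> on them.\<close>

lemma Wd_ge_blocks:
  assumes \<alpha>: "continuous_map X euclideanreal \<alpha>" and H: "H \<in> finite_subsets G" and y: "y \<in> topspace Y"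
    and C: "C \<subseteq> H" and T: "\<And>c. c \<in> C \<Longrightarrow> Tc c \<subseteq> carrier G \<and> finite (Tc c) \<and> card (Tc c) = L"
    and point: "\<And>\<sigma>. \<sigma> \<in> PiE C (\<lambda>c. Pow (Tc c)) \<Longrightarrow> \<exists>z\<in>base.fib y. \<forall>c\<in>C. (\<forall>t\<in>\<sigma> c. \<alpha> (act t (act c z)) = 0) \<and>
      (\<forall>t\<in>Tc c - \<sigma> c. \<alpha> (act t (act c z)) = 1)"
    and e: "e > 0"
    and close: "\<And>c \<tau> \<mu> \<mu>'. \<lbrakk>c \<in> C; \<tau> \<subseteq> Tc c; \<mu> \<in> borel_probs X; \<mu>' \<in> borel_probs X; \<rho> \<mu> \<mu>' < e\<rbrakk> \<Longrightarrow>
      \<bar>integral\<^sup>L \<mu> (pat \<alpha> (Tc c) \<tau>) - integral\<^sup>L \<mu>' (pat \<alpha> (Tc c) \<tau>)\<bar> < 1 / 2 ^ L"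
  shows "card C * (2 ^ L - 1) \<le> ind.Wd e H"
proof (rule ccontr)
  assume neg: "\<not> ?thesis"
  have HG: "H \<subseteq> carrier G" "finite H" using H by (auto simp: finite_subsets_def)
  have finC: "finite C" using C HG(2) by (rule finite_subset)
  define \<nu> where "\<nu> = return (borel_of Y) y"
  have \<nu>: "\<nu> \<in> topspace (prob_topology Y)" using y by (simp add: \<nu>_def borel_probs_def prob_space_return)
  let ?Z = "subtopology (prob_topology X) (ind.fib \<nu>)"
  obtain D where D: "D \<le> ind.Wd e H" "small_width ?Z (ind.dyn H) e D"
    using ind.small_width_Wd[OF H e \<nu>] by blast
  obtain M :: nat and u where u: "\<forall>c<M. continuous_map ?Z euclideanreal (u c)"
     "\<forall>z\<in>topspace ?Z. \<forall>c<M. 0 \<le> u c z \<and> u c z \<le> 1"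
     "\<forall>z\<in>topspace ?Z. card ((\<lambda>c. u c z) ` {..<M} \<inter> {0<..<1}) \<le> D"
     "\<forall>z\<in>topspace ?Z. \<forall>z'\<in>topspace ?Z. (\<forall>c<M. u c z = u c z') \<longrightarrow> ind.dyn H z z' < e"
    using D(2) unfolding small_width_def by (elim exE conjE)
  define J where "J = (SIGMA c:C. Pow (Tc c) - {{}})"
  define n where "n = card C * (2 ^ L - 1)"
  have finJ: "finite J" unfolding J_def using finC T by (intro finite_SigmaI) auto
  have cardJ: "card J = n"
  proof -
    have "card (Pow (Tc c) - {{}}) = 2 ^ L - 1" if "c \<in> C" for c using T[OF that] by (simp add: card_Pow)
    then show ?thesis unfolding J_def n_def using finC T by (subst card_SigmaI) auto
  qed
  obtain \<beta> where \<beta>: "bij_betw \<beta> J {..<n}"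
    using ex_bij_betw_finite_nat[OF finJ] by (auto simp: cardJ atLeast0LessThan)
  have \<beta>n: "\<beta> (c, \<tau>) < n" if "c \<in> C" "\<tau> \<subseteq> Tc c" "\<tau> \<noteq> {}" for c \<tau>
    using \<beta> that by (auto simp: bij_betw_def J_def)
  \<comment> \<open>Each nonempty pattern receives mass at most \<open>1 / 2 ^ L\<close>, and the
    empty pattern takes the rest, which stays nonnegative; so \<open>2 ^ L - 1\<close> parameters of
    a block vary freely in \<open>[0, 1]\<close>.\<close>
  define p where "p \<theta> c \<tau> = (if \<tau> = {} then 1 - (\<Sum>\<tau>'\<in>Pow (Tc c) - {{}}. \<theta> (\<beta> (c, \<tau>')) / 2 ^ L)
      else \<theta> (\<beta> (c, \<tau>)) / 2 ^ L)" for \<theta> :: "nat \<Rightarrow> real" and c \<tau>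
  have psum: "(\<Sum>\<tau>\<in>Pow (Tc c). p \<theta> c \<tau>) = 1" if c: "c \<in> C" for \<theta> c
  proof -
    have fin: "finite (Pow (Tc c))" using T[OF c] by simp
    have "(\<Sum>\<tau>\<in>Pow (Tc c). p \<theta> c \<tau>) = p \<theta> c {} + (\<Sum>\<tau>\<in>Pow (Tc c) - {{}}. p \<theta> c \<tau>)"
      by (rule sum.remove[OF fin]) simp
    also have "(\<Sum>\<tau>\<in>Pow (Tc c) - {{}}. p \<theta> c \<tau>) = (\<Sum>\<tau>\<in>Pow (Tc c) - {{}}. \<theta> (\<beta> (c, \<tau>)) / 2 ^ L)"
      by (intro sum.cong refl) (simp add: p_def)
    finally show ?thesis by (simp add: p_def)
  qed
  have \<theta>01: "0 \<le> \<theta> i \<and> \<theta> i \<le> 1" if "\<theta> \<in> cube n" for \<theta> i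
    using that by (auto simp: cube_def split: if_splits)
  have pnn: "0 \<le> p \<theta> c \<tau>" if \<theta>: "\<theta> \<in> cube n" and c: "c \<in> C" for \<theta> c \<tau>
  proof (cases "\<tau> = {}")
    case True
    have "(\<Sum>\<tau>'\<in>Pow (Tc c) - {{}}. \<theta> (\<beta> (c, \<tau>')) / 2 ^ L) \<le> (\<Sum>\<tau>'\<in>Pow (Tc c) - {{}}. 1 / 2 ^ L)"
      using \<theta>01[OF \<theta>] by (intro sum_mono divide_right_mono) auto
    also have "\<dots> = real (2 ^ L - 1) / 2 ^ L" using T[OF c] by (simp add: card_Pow)
    also have "\<dots> \<le> 1" by (simp add: divide_le_eq of_nat_diff)
    finally show ?thesis using True by (simp add: p_def)
  next
    case False
    then show ?thesis using \<theta>01[OF \<theta>] by (simp add: p_def)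
  qed
  have pcont: "continuous_on (cube n) (\<lambda>\<theta>. p \<theta> c \<tau>)" for c \<tau>
    unfolding p_def by (cases "\<tau> = {}") (auto intro!: continuous_intros continuous_on_coord)
  define \<Phi> where "\<Phi> = PiE C (\<lambda>c. Pow (Tc c))"
  have fin\<Phi>: "finite \<Phi>" unfolding \<Phi>_def using finC T by (intro finite_PiE) auto
  have "\<forall>\<sigma>\<in>\<Phi>. \<exists>z. z \<in> base.fib y \<and> (\<forall>c\<in>C. (\<forall>t\<in>\<sigma> c. \<alpha> (act t (act c z)) = 0) \<and>
      (\<forall>t\<in>Tc c - \<sigma> c. \<alpha> (act t (act c z)) = 1))"
    using point unfolding \<Phi>_def by blast
  from bchoice[OF this] obtain x where x: "\<forall>\<sigma>\<in>\<Phi>. x \<sigma> \<in> base.fib y \<and> (\<forall>c\<in>C. (\<forall>t\<in>\<sigma> c. \<alpha> (act t (act c (x \<sigma>))) = 0) \<and>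
      (\<forall>t\<in>Tc c - \<sigma> c. \<alpha> (act t (act c (x \<sigma>))) = 1))" by (elim exE)
  have xX: "x \<sigma> \<in> topspace X" and \<pi>x: "\<pi> (x \<sigma>) = y" if "\<sigma> \<in> \<Phi>" for \<sigma>
    using x that by (auto simp: fibre_def)
  define w where "w \<theta> \<sigma> = (\<Prod>c\<in>C. p \<theta> c (\<sigma> c))" for \<theta> \<sigma>
  have wnn: "0 \<le> w \<theta> \<sigma>" if "\<theta> \<in> cube n" for \<theta> \<sigma> unfolding w_def using pnn[OF that] by (intro prod_nonneg) auto
  have wsum: "(\<Sum>\<sigma>\<in>\<Phi>. w \<theta> \<sigma>) = 1" for \<theta>
  proof -
    have "(\<Sum>\<sigma>\<in>\<Phi>. w \<theta> \<sigma>) = (\<Prod>c\<in>C. \<Sum>\<tau>\<in>Pow (Tc c). p \<theta> c \<tau>)"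
      unfolding w_def \<Phi>_def by (rule prod_sum_PiE[symmetric, OF finC]) (use T in auto)
    then show ?thesis using psum by simp
  qed
  define \<mu> where "\<mu> \<theta> = mix X \<Phi> x (w \<theta>)" for \<theta>
  have \<mu>b: "\<mu> \<theta> \<in> borel_probs X" if "\<theta> \<in> cube n" for \<theta>
    unfolding \<mu>_def by (rule mix_borel_probs[OF fin\<Phi> xX wnn[OF that] wsum])
  have \<mu>int: "integral\<^sup>L (\<mu> \<theta>) f = (\<Sum>\<sigma>\<in>\<Phi>. w \<theta> \<sigma> * f (x \<sigma>))" if "\<theta> \<in> cube n" "continuous_map X euclideanreal f" for \<theta> f
    unfolding \<mu>_def by (rule integral_mix[OF fin\<Phi> xX wnn[OF that(1)] wsum that(2)])
  have "induced_map Y \<pi> (\<mu> \<theta>) = \<nu>" if "\<theta> \<in> cube n" for \<theta>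
    unfolding induced_map_def \<mu>_def \<nu>_def
    by (rule distr_mix_const[OF fin\<Phi> xX wnn[OF that] wsum continuous_factor \<pi>x y])
  then have \<mu>Z: "\<mu> \<theta> \<in> topspace ?Z" if "\<theta> \<in> cube n" for \<theta>
    using \<mu>b that by (simp add: fibre_def)
  have \<mu>cont: "continuous_map (top_of_set (cube n)) ?Z \<mu>"
    unfolding continuous_map_in_subtopology
  proof
    show "continuous_map (top_of_set (cube n)) (prob_topology X) \<mu>"
    proof (rule continuous_map_into_prob_topology)
      show "\<mu> \<in> topspace (top_of_set (cube n)) \<rightarrow> borel_probs X" using \<mu>b by auto
      fix f assume f: "continuous_map X euclideanreal f"
      have "continuous_on (cube n) (\<lambda>\<theta>. \<Sum>\<sigma>\<in>\<Phi>. w \<theta> \<sigma> * f (x \<sigma>))"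
        unfolding w_def by (intro continuous_on_sum continuous_on_mult continuous_on_prod pcont continuous_on_const)
      then have "continuous_on (cube n) (\<lambda>\<theta>. integral\<^sup>L (\<mu> \<theta>) f)"
        using \<mu>int[OF _ f] by (simp cong: continuous_on_cong)
      then show "continuous_map (top_of_set (cube n)) euclideanreal (\<lambda>\<theta>. integral\<^sup>L (\<mu> \<theta>) f)" by simp
    qed
    show "\<mu> \<in> topspace (top_of_set (cube n)) \<rightarrow> ind.fib \<nu>" using \<mu>Z by auto
  qed
  have "D < n" using neg D(1) by (simp add: n_def)
  have "\<exists>\<theta>\<in>cube n. \<exists>\<theta>'\<in>cube n. \<exists>i<n. \<theta> i = 0 \<and> \<theta>' i = 1 \<and> (\<forall>c\<in>{..<M}. u c (\<mu> \<theta>) = u c (\<mu> \<theta>'))"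
  proof (rule cube_not_small_width[OF _ \<open>D < n\<close>])
    show "continuous_on (cube n) (\<lambda>\<theta>. u c (\<mu> \<theta>))" if "c \<in> {..<M}" for c
      using continuous_map_compose[OF \<mu>cont, of euclideanreal "u c"] u(1) that by (simp add: o_def)
    show "card ((\<lambda>c. u c (\<mu> \<theta>)) ` {..<M} \<inter> {0<..<1}) \<le> D" if "\<theta> \<in> cube n" for \<theta>
      using u(3) \<mu>Z[OF that] by blast
    show "0 \<le> u c (\<mu> \<theta>) \<and> u c (\<mu> \<theta>) \<le> 1" if "c \<in> {..<M}" "\<theta> \<in> cube n" for c \<theta>
      using u(2) \<mu>Z[OF that(2)] that(1) by blast
  qed simp
  then obtain \<theta> \<theta>' i where \<theta>: "\<theta> \<in> cube n" "\<theta>' \<in> cube n" "i < n" "\<theta> i = 0" "\<theta>' i = 1"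
    and eq: "\<forall>c\<in>{..<M}. u c (\<mu> \<theta>) = u c (\<mu> \<theta>')" by blast
  have less: "ind.dyn H (\<mu> \<theta>) (\<mu> \<theta>') < e" using u(4) \<mu>Z[OF \<theta>(1)] \<mu>Z[OF \<theta>(2)] eq by blast
  have "i \<in> \<beta> ` J" using \<beta> \<theta>(3) by (simp add: bij_betw_def)
  then obtain c \<tau> where c\<tau>: "c \<in> C" "\<tau> \<subseteq> Tc c" "\<tau> \<noteq> {}" "i = \<beta> (c, \<tau>)" by (auto simp: J_def)
  have cH: "c \<in> H" "c \<in> carrier G" using c\<tau>(1) C HG by auto
  have patc: "continuous_map X euclideanreal (pat \<alpha> (Tc c) \<tau>)" using T[OF c\<tau>(1)] c\<tau>(2) by (intro continuous_pat \<alpha>) auto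
  have val: "integral\<^sup>L (induced_action X act c (\<mu> \<phi>)) (pat \<alpha> (Tc c) \<tau>) = p \<phi> c \<tau>" if \<phi>: "\<phi> \<in> cube n" for \<phi>
  proof -
    have pc: "continuous_map X euclideanreal (\<lambda>z. pat \<alpha> (Tc c) \<tau> (act c z))"
      using continuous_map_compose[OF base.act_continuous[OF cH(2)] patc] by (simp add: o_def)
    have "integral\<^sup>L (induced_action X act c (\<mu> \<phi>)) (pat \<alpha> (Tc c) \<tau>) = (\<Sum>\<sigma>\<in>\<Phi>. w \<phi> \<sigma> * pat \<alpha> (Tc c) \<tau> (act c (x \<sigma>)))"
      unfolding integral_induced_action[OF \<mu>b[OF \<phi>] cH(2) patc] by (rule \<mu>int[OF \<phi> pc])
    also have "\<dots> = (\<Sum>\<sigma>\<in>\<Phi>. w \<phi> \<sigma> * (if \<sigma> c = \<tau> then 1 else 0))"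
    proof (rule sum.cong[OF refl])
      fix \<sigma> assume \<sigma>: "\<sigma> \<in> \<Phi>"
      have "\<sigma> c \<subseteq> Tc c" using \<sigma> c\<tau>(1) by (auto simp: \<Phi>_def PiE_iff)
      then have "pat \<alpha> (Tc c) \<tau> (act c (x \<sigma>)) = (if \<sigma> c = \<tau> then 1 else 0)"
        using T[OF c\<tau>(1)] c\<tau>(1,2) x \<sigma> by (intro pat_eq) auto
      then show "w \<phi> \<sigma> * pat \<alpha> (Tc c) \<tau> (act c (x \<sigma>)) = w \<phi> \<sigma> * (if \<sigma> c = \<tau> then 1 else 0)" by simp
    qed
    also have "\<dots> = p \<phi> c \<tau>"
      unfolding w_def \<Phi>_def
    proof (rule prod_indicator_marginal[OF finC _ psum c\<tau>(1)])
      show "finite (Pow (Tc b))" if "b \<in> C" for b using T[OF that] by simp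
    qed (use c\<tau>(2) in auto)
    finally show ?thesis .
  qed
  have "\<rho> (induced_action X act c (\<mu> \<theta>)) (induced_action X act c (\<mu> \<theta>')) < e"
    using less cH(1) unfolding ind.dyn_less_iff[OF H] by blast
  moreover have "induced_action X act c (\<mu> \<phi>) \<in> borel_probs X" if "\<phi> \<in> cube n" for \<phi>
    using ind.act_closed[OF cH(2), of "\<mu> \<phi>"] \<mu>b[OF that] by simp
  ultimately have "\<bar>p \<theta> c \<tau> - p \<theta>' c \<tau>\<bar> < 1 / 2 ^ L"
    using close[OF c\<tau>(1,2)] \<theta>(1,2) val by metis
  moreover have "p \<theta> c \<tau> = 0" "p \<theta>' c \<tau> = 1 / 2 ^ L" using c\<tau>(3,4) \<theta>(4,5) by (simp_all add: p_def)
  ultimately show False by simp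
qed

end

text \<open>For tiles of \<open>k\<close> elements a block contributes about
  \<open>2 powr (c * k / 4)\<close> dimensions, whereas making the blocks disjoint costs a factor
  \<open>k ^ 2\<close> in their number; the 4 comes from \<open>blocks_exist\<close>.\<close>

lemma exponential_beats_square:
  assumes c: "c > (0::real)"
  shows "\<exists>k::nat. k > 0 \<and> R * (4 * real k ^ 2) \<le> c * (2 powr (c * real k / 4) - 1)"
proof -
  have "eventually (\<lambda>k::nat. R * (4 * real k ^ 2) \<le> c * (2 powr (c * real k / 4) - 1)) at_top"
    using c by real_asymp
  then have "eventually (\<lambda>k::nat. k > 0 \<and> R * (4 * real k ^ 2) \<le> c * (2 powr (c * real k / 4) - 1)) at_top"
    using eventually_gt_at_top[of "0::nat"] by eventually_elim simp
  from eventually_happens'[OF sequentially_bot this] show ?thesis .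
qed

section \<open>Independence and infinite mean dimension\<close>

context induced_factor begin

text \<open>On average a point \<open>x\<close> of \<open>F n\<close> has at least
  \<open>c / 2 * card T\<close> hits. Points with fewer than \<open>c / 4 * card T\<close> account
  for at most half of this, so the others form a proportion at least \<open>c / 4\<close> of
  \<open>F n\<close>; thinning them to disjoint translates loses the factor
  \<open>(card T)\<^sup>2\<close>.\<close>

lemma blocks_exist:
  assumes F: "folner_sequence G F" and T: "T \<subseteq> carrier G" "finite T" "T \<noteq> {}" and c: "c > 0"
  shows "\<forall>\<^sub>F n in sequentially. \<forall>W\<subseteq>F n. c * real (card (F n)) \<le> real (card W) \<longrightarrow>
    (\<exists>C\<subseteq>F n. (\<forall>x\<in>C. \<forall>y\<in>C. x \<noteq> y \<longrightarrow> base.rtrans T x \<inter> base.rtrans T y = {}) \<and>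
      (\<forall>x\<in>C. c / 4 * real (card T) \<le> real (card {t\<in>T. t \<otimes> x \<in> W})) \<and>
      c * real (card (F n)) \<le> 4 * real (card C) * (real (card T))\<^sup>2)"
proof -
  have "\<forall>\<^sub>F n in sequentially. \<forall>k\<in>T. real (card {a\<in>F n. inv k \<otimes> a \<notin> F n}) \<le> c / 2 * real (card (F n))"
    using T c by (intro eventually_ball_finite ballI base.folner_translate[OF F]) auto
  then show ?thesis
  proof (eventually_elim, intro allI impI)
    fix n W assume inv: "\<forall>k\<in>T. real (card {a\<in>F n. inv k \<otimes> a \<notin> F n}) \<le> c / 2 * real (card (F n))"
      and W: "W \<subseteq> F n" "c * real (card (F n)) \<le> real (card W)"
    have Fn: "F n \<subseteq> carrier G" "finite (F n)" "F n \<noteq> {}" using base.folner_finite_subsets[OF F, of n] by auto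
    let ?hit = "\<lambda>x. real (card {t\<in>T. t \<otimes> x \<in> W})"
    define D where "D = {x\<in>F n. c / 4 * real (card T) \<le> ?hit x}"
    have k: "real (card T) > 0" using T by (simp add: card_gt_0_iff)
    have hit: "?hit x \<le> real (card T)" for x using T(2) by (intro of_nat_mono card_mono) auto
    have "(c - c / 2) * real (card (F n)) * real (card T) \<le> (\<Sum>x\<in>F n. ?hit x)"
      by (rule base.sum_hits_ge[OF Fn(1,2) T(1,2) W(1)]) (use inv W(2) in auto)
    also have "\<dots> \<le> (\<Sum>x\<in>F n. c / 4 * real (card T) + (if x \<in> D then real (card T) else 0))"
      using hit c by (intro sum_mono) (auto simp: D_def not_le intro: less_imp_le add_increasing)
    also have "\<dots> = c / 4 * real (card T) * real (card (F n)) + real (card D) * real (card T)"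
    proof -
      have "(\<Sum>x\<in>F n. if x \<in> D then real (card T) else 0) = real (card D) * real (card T)"
        using Fn(2) by (subst sum.inter_restrict[symmetric]) (auto simp: D_def Int_def conj_ac)
      then show ?thesis by (simp add: sum.distrib)
    qed
    finally have "c / 4 * real (card (F n)) * real (card T) \<le> real (card D) * real (card T)" by (simp add: algebra_simps)
    then have cD: "c / 4 * real (card (F n)) \<le> real (card D)" using k by simp
    have DG: "D \<subseteq> carrier G" "finite D" using Fn by (auto simp: D_def)
    obtain C where C: "C \<subseteq> D" "\<forall>x\<in>C. \<forall>y\<in>C. x \<noteq> y \<longrightarrow> base.rtrans T x \<inter> base.rtrans T y = {}"
      "card D \<le> card C * (card T)\<^sup>2"
      using base.disjoint_translates[OF DG T] by blast
    have "real (card D) \<le> real (card C) * (real (card T))\<^sup>2"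
      using C(3) by (metis of_nat_le_iff of_nat_mult of_nat_power)
    then have "c * real (card (F n)) \<le> 4 * real (card C) * (real (card T))\<^sup>2" using cD by linarith
    then show "\<exists>C\<subseteq>F n. (\<forall>x\<in>C. \<forall>y\<in>C. x \<noteq> y \<longrightarrow> base.rtrans T x \<inter> base.rtrans T y = {}) \<and>
      (\<forall>x\<in>C. c / 4 * real (card T) \<le> ?hit x) \<and> c * real (card (F n)) \<le> 4 * real (card C) * (real (card T))\<^sup>2"
      using C(1,2) by (intro exI[of _ C]) (auto simp: D_def)
  qed
qed

text \<open>Disjointness of the translates means that \<open>t \<otimes> c\<close> determines both
  \<open>c\<close> and \<open>t\<close>, so patterns prescribed separately on the blocks combine to
  one subset of \<open>W\<close> without conflict.\<close>

lemma block_points: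
  assumes W: "W \<in> base.indep g a b y" and T: "T \<subseteq> carrier G" and C: "C \<subseteq> carrier G"
    and dis: "\<forall>x\<in>C. \<forall>y\<in>C. x \<noteq> y \<longrightarrow> base.rtrans T x \<inter> base.rtrans T y = {}"
    and Tc: "\<And>c. c \<in> C \<Longrightarrow> Tc c \<subseteq> {t\<in>T. t \<otimes> c \<in> W}"
    and \<sigma>: "\<And>c. c \<in> C \<Longrightarrow> \<sigma> c \<subseteq> Tc c"
  shows "\<exists>z\<in>base.fib y. \<forall>c\<in>C. (\<forall>t\<in>\<sigma> c. g (act t (act c z)) \<le> a) \<and> (\<forall>t\<in>Tc c - \<sigma> c. b \<le> g (act t (act c z)))"
proof -
  define \<tau> where "\<tau> = (\<Union>c\<in>C. (\<lambda>t. t \<otimes> c) ` \<sigma> c)"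
  have "\<tau> \<subseteq> W" using Tc \<sigma> by (fastforce simp: \<tau>_def)
  then obtain z where z: "z \<in> base.fib y" "\<forall>s\<in>\<tau>. g (act s z) \<le> a" "\<forall>s\<in>W-\<tau>. b \<le> g (act s z)"
    using W unfolding base.indep_def indep_sets_def by blast
  have zX: "z \<in> topspace X" using z(1) by (simp add: fibre_def)
  have am: "act t (act c z) = act (t \<otimes> c) z" if tc: "t \<in> Tc c" "c \<in> C" for t c
  proof -
    have "t \<in> carrier G" "c \<in> carrier G" using Tc[OF tc(2)] tc T C by auto
    then show ?thesis using base.act_mult[of t c z] zX by simp
  qed
  have "t \<otimes> c \<in> W - \<tau>" if t: "c \<in> C" "t \<in> Tc c - \<sigma> c" for t c
  proof -
    have "t \<otimes> c \<noteq> t' \<otimes> c'" if t': "c' \<in> C" "t' \<in> \<sigma> c'" for t' c'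
    proof
      assume eq: "t \<otimes> c = t' \<otimes> c'"
      have tT: "t \<in> T" "t' \<in> T" using t t' Tc \<sigma> by blast+
      have "t \<otimes> c \<in> base.rtrans T c" "t \<otimes> c \<in> base.rtrans T c'"
        unfolding base.rtrans_def using imageI[OF tT(1), of "\<lambda>a. a \<otimes> c"] imageI[OF tT(2), of "\<lambda>a. a \<otimes> c'"]
        by (simp_all only: eq)
      then have "c = c'" using dis t(1) t'(1) by blast
      then have "t = t'" using eq base.right_cancel[of c t t'] tT T C t(1) by auto
      then show False using \<open>c = c'\<close> t t' by blast
    qed
    then show ?thesis using t Tc by (auto simp: \<tau>_def)
  qed
  then have "\<forall>c\<in>C. (\<forall>t\<in>\<sigma> c. g (act t (act c z)) \<le> a) \<and> (\<forall>t\<in>Tc c - \<sigma> c. b \<le> g (act t (act c z)))"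
    using z(2,3) am \<sigma> by (fastforce simp: \<tau>_def)
  then show ?thesis using z(1) by blast
qed

text \<open>The order of the choices matters: \<open>R\<close> fixes \<open>k\<close>, then
  \<open>T\<close> and \<open>L\<close>, and only then \<open>e0\<close>. The sets
  \<open>Tc x\<close> vary with the block and with \<open>n\<close> but are subsets of the one set
  \<open>T\<close>, so finitely many test functions suffice and \<open>e0\<close> does not depend on
  \<open>n\<close>.\<close>

theorem ind_density_imp_infinite_mdim:
  assumes F: "folner_sequence G F" and inf: "infinite (carrier G)"
    and g: "continuous_map X euclideanreal g" and ab: "a < b" and c: "c > 0" and ind: "base.ind_density g a b c"
  shows "rel_mdim (prob_topology X) (induced_action X act) (prob_topology Y) (induced_map Y \<pi>) \<rho> F = \<infinity>"
proof (rule ind.rel_mdim_infinite[OF F])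
  fix R :: real
  obtain k :: nat where k: "k > 0" "R * (4 * real k ^ 2) \<le> c * (2 powr (c * real k / 4) - 1)"
    using exponential_beats_square[OF c] by blast
  obtain T where T: "T \<subseteq> carrier G" "finite T" "card T = k"
    using infinite_arbitrarily_large[OF inf] by blast
  have Tne: "T \<noteq> {}" using T(3) k(1) by auto
  define L where "L = nat \<lceil>c * real k / 4\<rceil>"
  have L: "c * real k / 4 \<le> real L" unfolding L_def by (rule real_nat_ceiling_ge)
  \<comment> \<open>Clipping makes the two alternatives exact values 0 and 1, so that the products
    \<open>pat\<close> are exact indicators of patterns at the chosen points.\<close>
  define \<alpha> where "\<alpha> x = clip ((g x - a) / (b - a))" for x
  have \<alpha>: "continuous_map X euclideanreal \<alpha>"
    unfolding \<alpha>_def using g by (intro continuous_map_clip continuous_map_real_divide continuous_map_diff) (use ab in auto)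
  have \<alpha>0: "\<alpha> x = 0" if "g x \<le> a" for x
  proof -
    have "(g x - a) / (b - a) \<le> 0" using that ab by (intro divide_nonpos_pos) auto
    then show ?thesis by (simp add: \<alpha>_def clip_def)
  qed
  have \<alpha>1: "\<alpha> x = 1" if "b \<le> g x" for x
    using that ab by (simp add: \<alpha>_def clip_def)
  define \<P> where "\<P> = (\<lambda>(T', \<tau>). (\<lambda>\<mu>. integral\<^sup>L \<mu> (pat \<alpha> T' \<tau>))) ` (SIGMA T':Pow T. Pow T')"
  have "finite \<P>" unfolding \<P>_def using T(2) by (intro finite_imageI finite_SigmaI) (auto intro: finite_subset)
  moreover have "continuous_map (prob_topology X) euclideanreal f" if fP: "f \<in> \<P>" for f
  proof -
    obtain T' \<tau> where "T' \<subseteq> T" "\<tau> \<subseteq> T'" "f = (\<lambda>\<mu>. integral\<^sup>L \<mu> (pat \<alpha> T' \<tau>))" using fP by (auto simp: \<P>_def)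
    moreover from this have "continuous_map X euclideanreal (pat \<alpha> T' \<tau>)"
      using T by (intro continuous_pat \<alpha>) (auto intro: finite_subset)
    ultimately show ?thesis by (simp add: continuous_integral)
  qed
  ultimately obtain e0 where e0: "e0 > 0" and close: "\<forall>f\<in>\<P>. \<forall>\<mu>\<in>topspace (prob_topology X). \<forall>\<mu>'\<in>topspace (prob_topology X).
      \<rho> \<mu> \<mu>' < e0 \<longrightarrow> \<bar>f \<mu> - f \<mu>'\<bar> < 1 / 2 ^ L"
    using ind.uniformly_continuous_finite[of \<P> "1 / 2 ^ L"] by auto
  show "\<exists>e0>0. \<forall>e. 0 < e \<and> e < e0 \<longrightarrow> (\<forall>\<^sub>F n in sequentially. R * real (card (F n)) \<le> real (ind.Wd e (F n)))"
  proof (intro exI[of _ e0] conjI e0 allI impI)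
    fix e assume "0 < e \<and> e < e0"
    then have e: "0 < e" "e < e0" by auto
    show "\<forall>\<^sub>F n in sequentially. R * real (card (F n)) \<le> real (ind.Wd e (F n))"
      using blocks_exist[OF F T(1,2) Tne c]
    proof eventually_elim
      case (elim n)
      have FnG: "F n \<in> finite_subsets G" using F by (simp add: folner_sequence_def)
      have Fn: "F n \<subseteq> carrier G" "finite (F n)" using FnG by (auto simp: finite_subsets_def)
      obtain y W where y: "y \<in> topspace Y" and W: "W \<in> base.indep g a b y" "W \<subseteq> F n" "c * real (card (F n)) \<le> real (card W)"
        using ind FnG unfolding base.ind_density_def by blast
      obtain C where C: "C \<subseteq> F n" and dis: "\<forall>x\<in>C. \<forall>y\<in>C. x \<noteq> y \<longrightarrow> base.rtrans T x \<inter> base.rtrans T y = {}"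
        and hits: "\<forall>x\<in>C. c / 4 * real (card T) \<le> real (card {t\<in>T. t \<otimes> x \<in> W})"
        and cC: "c * real (card (F n)) \<le> 4 * real (card C) * (real (card T))\<^sup>2"
        using elim[rule_format, OF W(2,3)] by (elim exE conjE)
      have "\<forall>x\<in>C. \<exists>S. S \<subseteq> {t\<in>T. t \<otimes> x \<in> W} \<and> card S = L"
      proof
        fix x assume "x \<in> C"
        then have "c * real k / 4 \<le> real (card {t\<in>T. t \<otimes> x \<in> W})" using hits T(3) by auto
        then have "L \<le> card {t\<in>T. t \<otimes> x \<in> W}" unfolding L_def by linarith
        then show "\<exists>S. S \<subseteq> {t\<in>T. t \<otimes> x \<in> W} \<and> card S = L" by (meson obtain_subset_with_card_n)
      qed
      from bchoice[OF this] obtain Tc where Tc: "\<forall>x\<in>C. Tc x \<subseteq> {t\<in>T. t \<otimes> x \<in> W} \<and> card (Tc x) = L" by (elim exE)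
      have TcT: "Tc x \<subseteq> T" if "x \<in> C" for x using Tc that by blast
      have "card C * (2 ^ L - 1) \<le> ind.Wd e (F n)"
      proof (rule Wd_ge_blocks[OF \<alpha> FnG y C, of Tc])
        show "Tc x \<subseteq> carrier G \<and> finite (Tc x) \<and> card (Tc x) = L" if "x \<in> C" for x
          using TcT[OF that] Tc that T(1,2) finite_subset by blast
        show "\<exists>z\<in>base.fib y. \<forall>x\<in>C. (\<forall>t\<in>\<sigma> x. \<alpha> (act t (act x z)) = 0) \<and> (\<forall>t\<in>Tc x - \<sigma> x. \<alpha> (act t (act x z)) = 1)"
          if \<sigma>: "\<sigma> \<in> PiE C (\<lambda>x. Pow (Tc x))" for \<sigma>
        proof -
          have "\<exists>z\<in>base.fib y. \<forall>x\<in>C. (\<forall>t\<in>\<sigma> x. g (act t (act x z)) \<le> a) \<and> (\<forall>t\<in>Tc x - \<sigma> x. b \<le> g (act t (act x z)))"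
            using C Fn(1) Tc \<sigma> by (intro block_points[OF W(1) T(1) _ dis]) (auto simp: PiE_iff)
          then show ?thesis using \<alpha>0 \<alpha>1 by meson
        qed
        show "0 < e" by (rule e(1))
        show "\<bar>integral\<^sup>L \<mu> (pat \<alpha> (Tc x) \<tau>) - integral\<^sup>L \<mu>' (pat \<alpha> (Tc x) \<tau>)\<bar> < 1 / 2 ^ L"
          if "x \<in> C" "\<tau> \<subseteq> Tc x" "\<mu> \<in> borel_probs X" "\<mu>' \<in> borel_probs X" "\<rho> \<mu> \<mu>' < e" for x \<tau> \<mu> \<mu>'
        proof -
          have "(\<lambda>\<mu>. integral\<^sup>L \<mu> (pat \<alpha> (Tc x) \<tau>)) \<in> \<P>"
            unfolding \<P>_def using TcT[OF that(1)] that(2) by (intro image_eqI[of _ _ "(Tc x, \<tau>)"]) auto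
          from close[rule_format, OF this, of \<mu> \<mu>'] show ?thesis using that(3-5) e(2) by simp
        qed
      qed
      then have Wd: "real (card C) * (2 ^ L - 1) \<le> real (ind.Wd e (F n))"
      proof -
        have "real (card C) * (2 ^ L - 1) = real (card C * (2 ^ L - 1))" by (simp add: of_nat_diff)
        also have "\<dots> \<le> real (ind.Wd e (F n))" using \<open>card C * (2 ^ L - 1) \<le> ind.Wd e (F n)\<close> by (rule of_nat_mono)
        finally show ?thesis .
      qed
      have k2: "0 < 4 * real k ^ 2" using k(1) by simp
      have "R * (4 * real k ^ 2) * real (card (F n)) \<le> c * (2 powr (c * real k / 4) - 1) * real (card (F n))"
        using k(2) by (rule mult_right_mono) simp
      also have "\<dots> \<le> c * (2 ^ L - 1) * real (card (F n))"
      proof -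
        have "2 powr (c * real k / 4) \<le> 2 powr real L" using L by (intro powr_mono) auto
        then have "2 powr (c * real k / 4) \<le> 2 ^ L" by (simp add: powr_realpow)
        then show ?thesis using c by (intro mult_right_mono mult_left_mono) auto
      qed
      also have "\<dots> = (2 ^ L - 1) * (c * real (card (F n)))" by simp
      also have "\<dots> \<le> (2 ^ L - 1) * (4 * real (card C) * (real k)\<^sup>2)"
        using cC T(3) by (intro mult_left_mono) auto
      also have "\<dots> = 4 * real k ^ 2 * (real (card C) * (2 ^ L - 1))" by simp
      also have "\<dots> \<le> 4 * real k ^ 2 * real (ind.Wd e (F n))" using Wd by (intro mult_left_mono) auto
      finally have "4 * real k ^ 2 * (R * real (card (F n))) \<le> 4 * real k ^ 2 * real (ind.Wd e (F n))" by (simp add: mult_ac)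
      then show ?case using k2 mult_le_cancel_left_pos by blast
    qed
  qed
qed

text \<open>The range \<open>[0, 1]\<close> is the one required by the sampling bound.\<close>

definition test_functions :: "('a \<Rightarrow> real) set" where
  "test_functions = {f. continuous_map X euclideanreal f \<and> (\<forall>x\<in>topspace X. 0 \<le> f x \<and> f x \<le> 1)}"

lemma test_functions_separate:
  assumes "x \<in> topspace X" "y \<in> topspace X" "x \<noteq> y"
  shows "\<exists>f\<in>test_functions. f x \<noteq> f y"
proof -
  have pos: "d x y > 0" using assms by simp
  have "base.bump (d x y) x \<in> test_functions"
    using base.continuous_bump[OF assms(1)] base.bump_bounds by (simp add: test_functions_def)
  moreover have "base.bump (d x y) x x = 0" "base.bump (d x y) x y = 1"
    using pos assms by (simp_all add: base.bump_def clip_def)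
  ultimately show ?thesis by (intro bexI[of _ "base.bump (d x y) x"]) auto
qed

text \<open>An affine change of values brings a separating function into \<open>[0, 1]\<close>; it
  acts on integrals by the same affine map, because the measures have mass 1.\<close>

lemma test_integrals_separate:
  assumes \<mu>: "\<mu> \<in> borel_probs X" and \<nu>: "\<nu> \<in> borel_probs X" and ne: "\<mu> \<noteq> \<nu>"
  shows "\<exists>f\<in>test_functions. integral\<^sup>L \<mu> f \<noteq> integral\<^sup>L \<nu> f"
proof -
  obtain f where f: "continuous_map X euclideanreal f" "integral\<^sup>L \<mu> f \<noteq> integral\<^sup>L \<nu> f"
    using integrals_separate[OF Hausdorff_prob_topology \<mu> \<nu> ne] by blast
  obtain B where B: "B > 0" "\<forall>x\<in>topspace X. \<bar>f x\<bar> \<le> B" using base.bounded_continuous[OF f(1)] by blast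
  define h where "h x = (f x + B) / (2 * B)" for x
  have hc: "continuous_map X euclideanreal h"
    unfolding h_def using f(1) B(1) by (intro continuous_map_real_divide continuous_map_add) auto
  have "0 \<le> h x \<and> h x \<le> 1" if "x \<in> topspace X" for x
  proof -
    have "- B \<le> f x" "f x \<le> B" using B(2) that by (auto simp: abs_le_iff minus_le_iff)
    then show ?thesis using B(1) by (simp add: h_def)
  qed
  then have "h \<in> test_functions" using hc by (simp add: test_functions_def)
  moreover have "integral\<^sup>L \<kappa> h = (integral\<^sup>L \<kappa> f + B) / (2 * B)" if \<kappa>: "\<kappa> \<in> borel_probs X" for \<kappa>
  proof -
    interpret prob_space \<kappa> using borel_probsD(1)[OF \<kappa>] .
    show ?thesis unfolding h_def using base.integrable_continuous[OF \<kappa> f(1)] by (simp add: prob_space)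
  qed
  then have "integral\<^sup>L \<mu> h \<noteq> integral\<^sup>L \<nu> h" using f(2) \<mu> \<nu> B(1) by simp
  ultimately show ?thesis by blast
qed

section \<open>The equivalences\<close>

abbreviation entropy :: "(nat \<Rightarrow> 'g set) \<Rightarrow> ereal" where
  "entropy F \<equiv> rel_entropy X act Y \<pi> d F"

abbreviation induced_entropy :: "(nat \<Rightarrow> 'g set) \<Rightarrow> ereal" where
  "induced_entropy F \<equiv> rel_entropy (prob_topology X) (induced_action X act) (prob_topology Y) (induced_map Y \<pi>) \<rho> F"

lemma entropy_pos_imp_ind_density:
  assumes F: "folner_sequence G F" and pos: "0 < entropy F"
  shows "\<exists>f\<in>test_functions. \<exists>a b c. a < b \<and> c > 0 \<and> base.ind_density f a b c"
proof -
  have Fn: "F n \<in> finite_subsets G" for n using F by (simp add: folner_sequence_def)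
  obtain e where "e > 0" "0 < base.Ent F e" using pos base.rel_entropy_pos_iff[of F] Fn by blast
  then show ?thesis
    by (intro base.positive_entropy_imp_ind_density[OF F _ test_functions_separate]) (auto simp: test_functions_def)
qed

lemma ind_density_imp_induced_entropy_pos:
  assumes F: "folner_sequence G F" and f: "f \<in> test_functions" and ab: "a < b" and c: "c > 0" and ind: "base.ind_density f a b c"
  shows "0 < induced_entropy F"
proof -
  have Fn: "F n \<in> finite_subsets G" for n using F by (simp add: folner_sequence_def)
  have fc: "continuous_map X euclideanreal f" using f by (simp add: test_functions_def)
  obtain e where e: "e > 0" "\<And>H. H \<in> finite_subsets G \<Longrightarrow> 2 powr (c * real (card H)) \<le> real (ind.Sep e H)"
    using ind.ind_density_imp_Sep_ge[OF continuous_integral[OF fc] ab ind_density_imp_induced[OF fc ind]] by metis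
  have "0 < ind.Ent F e"
    using e(2) Fn by (intro ind.Ent_pos_of_exponential[OF Fn c] always_eventually) auto
  then show ?thesis using e(1) ind.rel_entropy_pos_iff[of F] Fn by blast
qed

text \<open>Independence density obtained along \<open>F'\<close> concerns all finite sets and can
  be evaluated along \<open>F\<close>. Since the group is infinite, the sets \<open>F n\<close>
  eventually exceed the size \<open>n0\<close> from which the exponential bound holds.\<close>

lemma induced_entropy_pos_imp_entropy_pos:
  assumes F: "folner_sequence G F" and F': "folner_sequence G F'" and inf: "infinite (carrier G)"
    and pos: "0 < induced_entropy F'"
  shows "0 < entropy F"
proof -
  have Fn: "F n \<in> finite_subsets G" "F' n \<in> finite_subsets G" for n using F F' by (auto simp: folner_sequence_def)
  obtain e where e: "e > 0" "0 < ind.Ent F' e" using pos ind.rel_entropy_pos_iff[of F'] Fn by blast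
  let ?\<G> = "(\<lambda>f \<mu>. integral\<^sup>L \<mu> f) ` test_functions"
  have "\<exists>g\<in>?\<G>. \<exists>a b c. a < b \<and> c > 0 \<and> ind.ind_density g a b c"
  proof (rule ind.positive_entropy_imp_ind_density[OF F' _ _ e])
    show "continuous_map (prob_topology X) euclideanreal g" if "g \<in> ?\<G>" for g
      using that continuous_integral by (auto simp: test_functions_def)
    show "\<exists>g\<in>?\<G>. g \<mu> \<noteq> g \<nu>" if "\<mu> \<in> topspace (prob_topology X)" "\<nu> \<in> topspace (prob_topology X)" "\<mu> \<noteq> \<nu>" for \<mu> \<nu>
      using test_integrals_separate[of \<mu> \<nu>] that by auto
  qed
  then obtain f a b c where f: "f \<in> test_functions" and abc: "a < b" "c > 0" "ind.ind_density (\<lambda>\<mu>. integral\<^sup>L \<mu> f) a b c" by blast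
  obtain e \<kappa> n0 where e: "e > 0" "\<kappa> > 0"
    and ge: "\<forall>H\<in>finite_subsets G. n0 \<le> card H \<longrightarrow> 2 powr (\<kappa> * real (card H)) \<le> real (base.Sep e H)"
    using induced_ind_density_imp_Sep_ge[OF _ _ abc] f unfolding test_functions_def by blast
  have "\<forall>\<^sub>F n in sequentially. n0 \<le> card (F n)" by (rule base.folner_card_at_top[OF F inf])
  then have "\<forall>\<^sub>F n in sequentially. 2 powr (\<kappa> * real (card (F n))) \<le> real (base.Sep e (F n))"
    by eventually_elim (use ge Fn in blast)
  then have "0 < base.Ent F e" using Fn e(2) by (intro base.Ent_pos_of_exponential) auto
  then show ?thesis using e(1) base.rel_entropy_pos_iff[of F] Fn by blast
qed

end

theorem theorem1p1:
  fixes G :: "('g, 'm) monoid_scheme"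
    and X :: "'a topology" and act :: "'g \<Rightarrow> 'a \<Rightarrow> 'a"
    and Y :: "'b topology" and act' :: "'g \<Rightarrow> 'b \<Rightarrow> 'b"
    and \<pi> :: "'a \<Rightarrow> 'b"
    and d :: "'a \<Rightarrow> 'a \<Rightarrow> real" and \<rho> :: "'a measure \<Rightarrow> 'a measure \<Rightarrow> real"
    and F F' :: "nat \<Rightarrow> 'g set"
  assumes "group G" and "countable (carrier G)" and "infinite (carrier G)" and "amenable G"
    and "factor_map G X act Y act' \<pi>"
    and "folner_sequence G F" and "folner_sequence G F'"
    and "compatible_metric X d" and "compatible_metric (prob_topology X) \<rho>"
  shows "(rel_entropy X act Y \<pi> d F = 0 \<longleftrightarrow>
         rel_entropy (prob_topology X) (induced_action X act)
           (prob_topology Y) (induced_map Y \<pi>) \<rho> F' = 0) \<and>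
         (rel_entropy X act Y \<pi> d F > 0 \<longleftrightarrow>
         rel_mdim (prob_topology X) (induced_action X act)
           (prob_topology Y) (induced_map Y \<pi>) \<rho> F' = \<infinity>)"
proof -
  interpret induced_factor G X act Y act' \<pi> d \<rho>
    using assms(5,8,9) by (simp add: induced_factor_def induced_factor_axioms_def)
  have Fn: "F n \<in> finite_subsets G" "F' n \<in> finite_subsets G" for n
    using assms(6,7) by (auto simp: folner_sequence_def)
  have nn: "0 \<le> entropy F" "0 \<le> induced_entropy F'"
    using base.rel_entropy_nonneg[of F] ind.rel_entropy_nonneg[of F'] Fn by auto
  have pos: "0 < induced_entropy F' \<and>
      rel_mdim (prob_topology X) (induced_action X act) (prob_topology Y) (induced_map Y \<pi>) \<rho> F' = \<infinity>"
    if "0 < entropy F"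
  proof -
    obtain f a b c where f: "f \<in> test_functions" "a < b" "c > 0" "base.ind_density f a b c"
      using entropy_pos_imp_ind_density[OF assms(6) \<open>0 < entropy F\<close>] by blast
    then have "continuous_map X euclideanreal f" by (simp add: test_functions_def)
    then show ?thesis
      using ind_density_imp_induced_entropy_pos[OF assms(7) f]
        ind_density_imp_infinite_mdim[OF assms(7,3) _ f(2-4)] by blast
  qed
  have zero: "rel_mdim (prob_topology X) (induced_action X act) (prob_topology Y) (induced_map Y \<pi>) \<rho> F' = 0"
    if "\<not> 0 < induced_entropy F'"
  proof (rule ind.zero_entropy_imp_zero_mdim[OF assms(7)])
    fix e :: real assume "e > 0"
    then have "\<not> 0 < ind.Ent F' e" using that ind.rel_entropy_pos_iff[of F'] Fn by blast
    then show "ind.Ent F' e = 0" using ind.Ent_nonneg[of F' e] by simp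
  qed
  \<comment> \<open>Together with \<open>pos\<close> and \<open>zero\<close> this leaves only 0 and
    infinity as values of the mean dimension, which gives the converse implication in (ii).\<close>
  have lift: "0 < entropy F" if "0 < induced_entropy F'"
    using induced_entropy_pos_imp_entropy_pos[OF assms(6,7,3) that] .
  show ?thesis
  proof (intro conjI)
    show "entropy F = 0 \<longleftrightarrow> induced_entropy F' = 0"
      using nn pos lift by (metis order_le_less less_irrefl)
    show "0 < entropy F \<longleftrightarrow>
        rel_mdim (prob_topology X) (induced_action X act) (prob_topology Y) (induced_map Y \<pi>) \<rho> F' = \<infinity>"
      using pos lift zero by (metis PInfty_neq_ereal(1) zero_ereal_def)
  qed
qed

end
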